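(* Let $P$ be a planar, symmetric or cyclic operad (in sets) endowed with a nice grading $\psi$. Consider on the twisted arrow category $\mathrm{Tw}(P)$ the degree map that sends an object $p$ (an operation of $P$) to $\psi(p)$. With this choice of the degree map, the pair $(R_-,R_+)$ is a generalized Reedy structure for $\mathrm{Tw}(P)$ if and only if all operations of $P$ of grading $0$ have arity $1$ and the category $P(\psi=0)$ of these operations is a groupoid.
   Context: Symmetric and planar operads are coloured operads in sets with identity operations (planar: no symmetric group actions). Cyclic operads are single-coloured: symmetric operads $P$ whose $S_n$-action on $P(n)$ extends compatibly to an $S_{n+1}$-action; an element of $P(n)$ has arity $n$ and legs $0,\dots,n$ ($0$ is the output), and any leg of one element can be glued to any leg of another, provided the result has at least one leg. **Twisted arrow category, symmetric case** ($P$ is $C$-coloured). Objects: operations of $P$. A morphism with source $p\in P(c_1,\dots,c_n;c_0)$ is (uniquely, this is its canonical representative) a tuple $f=(q_0;q_1,\dots,q_n;\lambda)$, where $q_0\in P$ has arity $m_0\ge 1$ and first input colour $c_0$, $q_i\in P$ ($1\le i\le n$) has arity $m_i\ge 0$ and output colour $c_i$, and $\lambda$ is a bijection from the set of leaves $\{(i,k):1\le i\le n,1\le k\le m_i\}\cup\{(0,k):2\le k\le m_0\}$ onto $\{1,\dots,N\}$ with $k\mapsto\lambda(i,k)$ increasing for each fixed $i$. The target is the operation $t$ with $t(x_1,\dots,x_N)=q_0\bigl(p(q_1(x_{\lambda(1,1)},\dots,x_{\lambda(1,m_1)}),\dots,q_n(x_{\lambda(n,1)},\dots)),x_{\lambda(0,2)},\dots,x_{\lambda(0,m_0)}\bigr)$.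 So $f$ is a tree with source vertex $p$, lower vertex $q_0$ (its first input attached to the root of $p$), upper vertices $q_1,\dots,q_n$; $q_0,\dots,q_n$ are the non-source vertices. The planar order of leaves is $(1,1),\dots,(1,m_1),(2,1),\dots,(n,m_n),(0,2),\dots,(0,m_0)$; the permutation on leaves is trivial if $\lambda$ numbers leaves in planar order. The composite of $f:p\to t$ with $g=(r_0;r_1,\dots,r_N;\mu):t\to u$ has upper vertices $q_i(r_{\lambda(i,1)},\dots,r_{\lambda(i,m_i)})$ and lower vertex $r_0\circ_1 q_0(\mathrm{id},r_{\lambda(0,2)},\dots,r_{\lambda(0,m_0)})$, with leaves numbered by $\mu$, and with inputs of each vertex (other than the first input of the lower one) then permuted so that the numbers increase. **Planar case.** The same, but a morphism from $p$ is a tuple $(q_0,i;q_1,\dots,q_n)$, where the $i$-th input of $q_0$ has colour $c_0$, with target $q_0\circ_i p(q_1,\dots,q_n)$; there is no numbering (the permutation on leaves is trivial). **Cyclic case.** Objects: elements of all $P(n)$, $n\geq 0$. A morphism from $p\in P(n)$ is a tuple $(q_0,\dots,q_n;\lambda)$ with $q_j\in P(m_j)$, $\sum_j m_j\geq 1$, and $\lambda$ a bijection from $\{(j,k):0\le j\le n,1\le k\le m_j\}$ onto $\{0,\dots,N\}$ increasing in $k$ for each $j$; its target is obtained by gluing leg $0$ of $q_j$ to leg $j$ of $p$ for all $j$ and numbering the remaining legs by $\lambda$. Composition is by gluing, and all $q_j$ are the non-source vertices. The permutation on leaves is trivial if $\lambda$ is order-preserving for the lexicographic order. **Grading.** A grading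 $\psi$ assigns to each operation an integer with $\psi(p\circ_i q)=\psi(p)+\psi(q)$, $\psi(\mathrm{id}_c)=0$, $\psi(p^\sigma)=\psi(p)$. It is nice if $\psi(p)\ge -1$ for all $p$, operations of grading $-1$ have arity $0$, and units of binary operations (arity $0$ operations $e$ such that $m\circ_1 e$ or $m\circ_2 e$ is an identity for some binary $m$) have grading $-1$. If all operations of grading $0$ are unary, $P(\psi=0)$ is the category whose objects are colours and whose morphisms are the operations of grading $0$. **The classes.** $R_{\psi=-1}$: morphisms of $\mathrm{Tw}(P)$ whose canonical representative has trivial permutation on leaves and whose non-source vertices are identities or operations of grading $-1$. $R_{\psi\ge0}$: morphisms all of whose non-source vertices have grading $\ge 0$. With $I$ the class of all isomorphisms, $R_-=I\circ R_{\psi=-1}$ and $R_+=R_{\psi\geq 0}\circ I=R_{\psi\ge 0}$. **Generalized Reedy structure** on a category $\mathcal C$: subcategories $R_-,R_+$ and a degree map from objects to an ordinal (here $\{-1,0,1,\dots\}\cong\omega$) such that (1) $(R_-,R_+)$ is an orthogonal factorization system (both contain all isomorphisms; each morphism factors as $r\circ l$ with $l\in R_-$, $r\in R_+$, uniquely up to unique isomorphism of factorizations); (2) non-isomorphisms in $R_-$ decrease degree; (3) non-isomorphisms in $R_+$ increase degree; (4) isomorphisms preserve degree; (5) if $f\in R_-$, $\theta$ is an isomorphism and $\theta\circ f=f$, then $\theta=\mathrm{id}$. *)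

theory Defs
  imports "HOL-Combinatorics.Multiset_Permutations"
begin

section \<open>Categories and generalized Reedy structures\<close>

record ('o, 'a) cat =
  Obj :: "'o set"
  Arr :: "'a set"
  Dom :: "'a \<Rightarrow> 'o"
  Cod :: "'a \<Rightarrow> 'o"
  Id :: "'o \<Rightarrow> 'a"
  Comp :: "'a \<Rightarrow> 'a \<Rightarrow> 'a"  \<comment> \<open>\<open>Comp C g f\<close> is g after f\<close>

locale category =
  fixes C :: "('o, 'a) cat"
  assumes dom_obj: "f \<in> Arr C \<Longrightarrow> Dom C f \<in> Obj C"
    and cod_obj: "f \<in> Arr C \<Longrightarrow> Cod C f \<in> Obj C"
    and id_arr: "a \<in> Obj C \<Longrightarrow> Id C a \<in> Arr C"
    and id_dom: "a \<in> Obj C \<Longrightarrow> Dom C (Id C a) = a"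
    and id_cod: "a \<in> Obj C \<Longrightarrow> Cod C (Id C a) = a"
    and comp_arr: "\<lbrakk>f \<in> Arr C; g \<in> Arr C; Cod C f = Dom C g\<rbrakk> \<Longrightarrow> Comp C g f \<in> Arr C"
    and comp_dom: "\<lbrakk>f \<in> Arr C; g \<in> Arr C; Cod C f = Dom C g\<rbrakk> \<Longrightarrow> Dom C (Comp C g f) = Dom C f"
    and comp_cod: "\<lbrakk>f \<in> Arr C; g \<in> Arr C; Cod C f = Dom C g\<rbrakk> \<Longrightarrow> Cod C (Comp C g f) = Cod C g"
    and comp_id_right: "f \<in> Arr C \<Longrightarrow> Comp C f (Id C (Dom C f)) = f"
    and comp_id_left: "f \<in> Arr C \<Longrightarrow> Comp C (Id C (Cod C f)) f = f"
    and comp_assoc: "\<lbrakk>f \<in> Arr C; g \<in> Arr C; h \<in> Arr C; Cod C f = Dom C g; Cod C g = Dom C h\<rbrakk>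
      \<Longrightarrow> Comp C h (Comp C g f) = Comp C (Comp C h g) f"

definition isos :: "('o, 'a) cat \<Rightarrow> 'a set" where
  "isos C = {f \<in> Arr C. \<exists>g\<in>Arr C. Dom C g = Cod C f \<and> Cod C g = Dom C f \<and>
     Comp C g f = Id C (Dom C f) \<and> Comp C f g = Id C (Cod C f)}"

definition groupoid :: "('o, 'a) cat \<Rightarrow> bool" where
  "groupoid C \<longleftrightarrow> category C \<and> isos C = Arr C"

definition subcategory :: "('o, 'a) cat \<Rightarrow> 'a set \<Rightarrow> bool" where
  "subcategory C S \<longleftrightarrow> S \<subseteq> Arr C \<and>
     (\<forall>f\<in>S. Id C (Dom C f) \<in> S \<and> Id C (Cod C f) \<in> S) \<and>
     (\<forall>f\<in>S. \<forall>g\<in>S. Cod C f = Dom C g \<longrightarrow> Comp C g f \<in> S)"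

definition comp_class :: "('o, 'a) cat \<Rightarrow> 'a set \<Rightarrow> 'a set \<Rightarrow> 'a set" where
  "comp_class C A B = {Comp C a b | a b. a \<in> A \<and> b \<in> B \<and> Cod C b = Dom C a}"

definition factorizes :: "('o, 'a) cat \<Rightarrow> 'a set \<Rightarrow> 'a set \<Rightarrow> 'a \<Rightarrow> 'a \<Rightarrow> 'a \<Rightarrow> bool" where
  "factorizes C L R f l r \<longleftrightarrow> l \<in> L \<and> r \<in> R \<and> Cod C l = Dom C r \<and> Comp C r l = f"

definition orthogonal_factorization_system :: "('o, 'a) cat \<Rightarrow> 'a set \<Rightarrow> 'a set \<Rightarrow> bool" where
  "orthogonal_factorization_system C L R \<longleftrightarrow>
     isos C \<subseteq> L \<and> isos C \<subseteq> R \<and>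
     (\<forall>f\<in>Arr C. \<exists>l r. factorizes C L R f l r) \<and>
     (\<forall>f l r l' r'. f \<in> Arr C \<and> factorizes C L R f l r \<and> factorizes C L R f l' r' \<longrightarrow>
        (\<exists>!\<theta>. \<theta> \<in> isos C \<and> Dom C \<theta> = Cod C l \<and> Cod C \<theta> = Cod C l' \<and>
              Comp C \<theta> l = l' \<and> Comp C r' \<theta> = r))"

text \<open>The ordinal in which degrees live is given by a well-ordered set \<open>D\<close>.\<close>

definition generalized_reedy ::
  "('o, 'a) cat \<Rightarrow> 'd::linorder set \<Rightarrow> ('o \<Rightarrow> 'd) \<Rightarrow> 'a set \<Rightarrow> 'a set \<Rightarrow> bool" where
  "generalized_reedy C D deg L R \<longleftrightarrow>
     category C \<and> subcategory C L \<and> subcategory C R \<and>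
     wfp_on D (<) \<and> (\<forall>a\<in>Obj C. deg a \<in> D) \<and>
     orthogonal_factorization_system C L R \<and>
     (\<forall>f\<in>L - isos C. deg (Cod C f) < deg (Dom C f)) \<and>
     (\<forall>f\<in>R - isos C. deg (Dom C f) < deg (Cod C f)) \<and>
     (\<forall>f\<in>isos C. deg (Dom C f) = deg (Cod C f)) \<and>
     (\<forall>f\<in>L. \<forall>\<theta>\<in>isos C. Dom C \<theta> = Cod C f \<and> Comp C \<theta> f = f \<longrightarrow> \<theta> = Id C (Cod C f))"


section \<open>Operads\<close>

record ('c, 'o) operad =
  colours :: "'c set"
  opers :: "'o set"
  ins :: "'o \<Rightarrow> 'c list"
  out :: "'o \<Rightarrow> 'c"
  ident :: "'c \<Rightarrow> 'o"
  gcomp :: "'o \<Rightarrow> 'o list \<Rightarrow> 'o"  \<comment> \<open>simultaneous composition \<open>p(q\<^sub>1,\<dots>,q\<^sub>n)\<close>\<close>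

abbreviation arity :: "('c, 'o, 'x) operad_scheme \<Rightarrow> 'o \<Rightarrow> nat" where
  "arity P p \<equiv> length (ins P p)"

definition composable :: "('c, 'o, 'x) operad_scheme \<Rightarrow> 'o \<Rightarrow> 'o list \<Rightarrow> bool" where
  "composable P p qs \<longleftrightarrow> p \<in> opers P \<and> set qs \<subseteq> opers P \<and> map (out P) qs = ins P p"

text \<open>Inputs are numbered from 0 here, so \<open>pcomp P p i q\<close> is the partial composition usually
  written with index \<open>i + 1\<close>.\<close>

definition pcomp :: "('c, 'o, 'x) operad_scheme \<Rightarrow> 'o \<Rightarrow> nat \<Rightarrow> 'o \<Rightarrow> 'o" where
  "pcomp P p i q = gcomp P p ((map (ident P) (ins P p))[i := q])"

definition pcomposable :: "('c, 'o, 'x) operad_scheme \<Rightarrow> 'o \<Rightarrow> nat \<Rightarrow> 'o \<Rightarrow> bool" where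
  "pcomposable P p i q \<longleftrightarrow>
     p \<in> opers P \<and> q \<in> opers P \<and> i < arity P p \<and> out P q = ins P p ! i"

locale planar_operad =
  fixes P :: "('c, 'o, 'x) operad_scheme"
  assumes ins_colours: "p \<in> opers P \<Longrightarrow> set (ins P p) \<subseteq> colours P"
    and out_colours: "p \<in> opers P \<Longrightarrow> out P p \<in> colours P"
    and ident_opers: "c \<in> colours P \<Longrightarrow> ident P c \<in> opers P"
    and ident_ins: "c \<in> colours P \<Longrightarrow> ins P (ident P c) = [c]"
    and ident_out: "c \<in> colours P \<Longrightarrow> out P (ident P c) = c"
    and gcomp_opers: "composable P p qs \<Longrightarrow> gcomp P p qs \<in> opers P"
    and gcomp_ins: "composable P p qs \<Longrightarrow> ins P (gcomp P p qs) = concat (map (ins P) qs)"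
    and gcomp_out: "composable P p qs \<Longrightarrow> out P (gcomp P p qs) = out P p"
    and gcomp_ident_right: "p \<in> opers P \<Longrightarrow> gcomp P p (map (ident P) (ins P p)) = p"
    and gcomp_ident_left: "p \<in> opers P \<Longrightarrow> gcomp P (ident P (out P p)) [p] = p"
    and gcomp_assoc: "\<lbrakk>composable P p qs; list_all2 (composable P) qs rss\<rbrakk> \<Longrightarrow>
      gcomp P (gcomp P p qs) (concat rss) = gcomp P p (map2 (gcomp P) qs rss)"

fun chop :: "nat list \<Rightarrow> 'a list \<Rightarrow> 'a list list" where
  "chop [] xs = []"
| "chop (n # ns) xs = take n xs # chop ns (drop n xs)"

text \<open>Permutations are written in one-line notation, as lists
  \<open>s \<in> permutations_of_set {..<n}\<close>. Here \<open>act P s p\<close> is the operation \<open>t\<close> with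
  \<open>t(x\<^sub>0,\<dots>,x\<^sub>n\<^sub>-\<^sub>1) = p(x\<^bsub>s!0\<^esub>,\<dots>,x\<^bsub>s!(n-1)\<^esub>)\<close>; that is, input \<open>k\<close> of \<open>p\<close> becomes input \<open>s ! k\<close>
  of \<open>t\<close>. This is a left action.\<close>

record ('c, 'o) sym_operad = "('c, 'o) operad" +
  act :: "nat list \<Rightarrow> 'o \<Rightarrow> 'o"

text \<open>\<open>input_blocks P qs ! j\<close> lists the input positions of \<open>p(q\<^sub>0,\<dots>,q\<^sub>n\<^sub>-\<^sub>1)\<close> coming from \<open>q\<^sub>j\<close>.\<close>

definition input_blocks :: "('c, 'o, 'x) operad_scheme \<Rightarrow> 'o list \<Rightarrow> nat list list" where
  "input_blocks P qs = chop (map (arity P) qs) [0..<sum_list (map (arity P) qs)]"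

locale symmetric_operad = planar_operad P
  for P :: "('c, 'o, 'x) sym_operad_scheme" +
  assumes act_opers: "\<lbrakk>p \<in> opers P; s \<in> permutations_of_set {..<arity P p}\<rbrakk> \<Longrightarrow> act P s p \<in> opers P"
    and act_arity: "\<lbrakk>p \<in> opers P; s \<in> permutations_of_set {..<arity P p}\<rbrakk>
      \<Longrightarrow> arity P (act P s p) = arity P p"
    and act_ins: "\<lbrakk>p \<in> opers P; s \<in> permutations_of_set {..<arity P p}; k < arity P p\<rbrakk>
      \<Longrightarrow> ins P (act P s p) ! (s ! k) = ins P p ! k"
    and act_out: "\<lbrakk>p \<in> opers P; s \<in> permutations_of_set {..<arity P p}\<rbrakk>
      \<Longrightarrow> out P (act P s p) = out P p"
    and act_id: "p \<in> opers P \<Longrightarrow> act P [0..<arity P p] p = p"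
    and act_act: "\<lbrakk>p \<in> opers P; s \<in> permutations_of_set {..<arity P p};
        t \<in> permutations_of_set {..<arity P p}\<rbrakk>
      \<Longrightarrow> act P t (act P s p) = act P (map ((!) t) s) p"
    and equivariant_outer: "\<lbrakk>p \<in> opers P; s \<in> permutations_of_set {..<arity P p};
        composable P (act P s p) qs\<rbrakk>
      \<Longrightarrow> gcomp P (act P s p) qs =
          act P (concat (map ((!) (input_blocks P qs)) s)) (gcomp P p (map ((!) qs) s))"
    and equivariant_inner: "\<lbrakk>composable P p qs;
        list_all2 (\<lambda>q s. s \<in> permutations_of_set {..<arity P q}) qs ss\<rbrakk>
      \<Longrightarrow> gcomp P p (map2 (act P) ss qs) =
          act P (concat (map2 (\<lambda>B s. map ((!) B) s) (input_blocks P qs) ss)) (gcomp P p qs)"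

text \<open>An element of arity \<open>n\<close> of a cyclic operad has legs \<open>0,\<dots>,n\<close>, leg 0 being the output and
  leg \<open>k + 1\<close> being input \<open>k\<close>. Permutations of the legs are again in one-line notation:
  leg \<open>k\<close> of \<open>p\<close> becomes leg \<open>s ! k\<close> of \<open>cact P s p\<close>.\<close>

record 'o cyc_operad = "(unit, 'o) sym_operad" +
  cact :: "nat list \<Rightarrow> 'o \<Rightarrow> 'o"

text \<open>The cyclic rotation: legs \<open>1,\<dots>,n,0\<close> of \<open>p\<close> become legs \<open>0,\<dots>,n\<close>.\<close>

definition rot :: "('o, 'x) cyc_operad_scheme \<Rightarrow> 'o \<Rightarrow> 'o" where
  "rot P p = cact P (arity P p # [0..<arity P p]) p"

text \<open>The last three axioms are the usual compatibility of the rotation with the identity and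
  with partial compositions. For \<open>q\<close> of arity 0, the rotation of the composition at the first
  input is determined by equivariance and \<open>rot_pcomp\<close>.\<close>

locale cyclic_operad = symmetric_operad P
  for P :: "('o, 'x) cyc_operad_scheme" +
  assumes single_colour: "colours P = {()}"
    and cact_opers: "\<lbrakk>p \<in> opers P; s \<in> permutations_of_set {..arity P p}\<rbrakk> \<Longrightarrow> cact P s p \<in> opers P"
    and cact_arity: "\<lbrakk>p \<in> opers P; s \<in> permutations_of_set {..arity P p}\<rbrakk>
      \<Longrightarrow> arity P (cact P s p) = arity P p"
    and cact_id: "p \<in> opers P \<Longrightarrow> cact P [0..<Suc (arity P p)] p = p"
    and cact_cact: "\<lbrakk>p \<in> opers P; s \<in> permutations_of_set {..arity P p};
        t \<in> permutations_of_set {..arity P p}\<rbrakk>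
      \<Longrightarrow> cact P t (cact P s p) = cact P (map ((!) t) s) p"
    and cact_extends: "\<lbrakk>p \<in> opers P; s \<in> permutations_of_set {..<arity P p}\<rbrakk>
      \<Longrightarrow> cact P (0 # map Suc s) p = act P s p"
    and rot_ident: "rot P (ident P ()) = ident P ()"
    and rot_pcomp: "\<lbrakk>p \<in> opers P; q \<in> opers P; 1 \<le> i; i < arity P p\<rbrakk>
      \<Longrightarrow> rot P (pcomp P p i q) = pcomp P (rot P p) (i - 1) q"
    and rot_pcomp_first: "\<lbrakk>p \<in> opers P; q \<in> opers P; 1 \<le> arity P p; 1 \<le> arity P q\<rbrakk>
      \<Longrightarrow> rot P (pcomp P p 0 q) = pcomp P (rot P q) (arity P q - 1) (rot P p)"


section \<open>Gradings\<close>

definition planar_grading :: "('c, 'o, 'x) operad_scheme \<Rightarrow> ('o \<Rightarrow> int) \<Rightarrow> bool" where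
  "planar_grading P \<psi> \<longleftrightarrow>
     (\<forall>p i q. pcomposable P p i q \<longrightarrow> \<psi> (pcomp P p i q) = \<psi> p + \<psi> q) \<and>
     (\<forall>c\<in>colours P. \<psi> (ident P c) = 0)"

definition symmetric_grading :: "('c, 'o, 'x) sym_operad_scheme \<Rightarrow> ('o \<Rightarrow> int) \<Rightarrow> bool" where
  "symmetric_grading P \<psi> \<longleftrightarrow> planar_grading P \<psi> \<and>
     (\<forall>p\<in>opers P. \<forall>s\<in>permutations_of_set {..<arity P p}. \<psi> (act P s p) = \<psi> p)"

definition cyclic_grading :: "('o, 'x) cyc_operad_scheme \<Rightarrow> ('o \<Rightarrow> int) \<Rightarrow> bool" where
  "cyclic_grading P \<psi> \<longleftrightarrow> planar_grading P \<psi> \<and>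
     (\<forall>p\<in>opers P. \<forall>s\<in>permutations_of_set {..arity P p}. \<psi> (cact P s p) = \<psi> p)"

definition is_unit_op :: "('c, 'o, 'x) operad_scheme \<Rightarrow> 'o \<Rightarrow> bool" where
  "is_unit_op P e \<longleftrightarrow> e \<in> opers P \<and> arity P e = 0 \<and>
     (\<exists>m\<in>opers P. arity P m = 2 \<and>
        (\<exists>i<2. pcomposable P m i e \<and> pcomp P m i e \<in> ident P ` colours P))"

definition nice :: "('c, 'o, 'x) operad_scheme \<Rightarrow> ('o \<Rightarrow> int) \<Rightarrow> bool" where
  "nice P \<psi> \<longleftrightarrow>
     (\<forall>p\<in>opers P. \<psi> p \<ge> - 1) \<and>
     (\<forall>p\<in>opers P. \<psi> p = - 1 \<longrightarrow> arity P p = 0) \<and>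
     (\<forall>e. is_unit_op P e \<longrightarrow> \<psi> e = - 1)"

text \<open>Meaningful only if all operations of grading 0 are unary.\<close>

definition grade0_cat :: "('c, 'o, 'x) operad_scheme \<Rightarrow> ('o \<Rightarrow> int) \<Rightarrow> ('c, 'o) cat" where
  "grade0_cat P \<psi> = \<lparr>Obj = colours P, Arr = {p \<in> opers P. \<psi> p = 0},
     Dom = (\<lambda>p. hd (ins P p)), Cod = out P, Id = ident P, Comp = (\<lambda>p q. gcomp P p [q])\<rparr>"


section \<open>Twisted arrow categories\<close>

subsection \<open>Planar case\<close>

text \<open>\<open>PTree p q\<^sub>0 i [q\<^sub>1,\<dots>,q\<^sub>n]\<close>, where \<open>i\<close> counts from 0.\<close>

datatype 'o ptree = PTree (psource: 'o) (plower: 'o) (ppos: nat) (pupper: "'o list")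

definition ptree_arrow :: "('c, 'o, 'x) operad_scheme \<Rightarrow> 'o ptree \<Rightarrow> bool" where
  "ptree_arrow P f \<longleftrightarrow> composable P (psource f) (pupper f) \<and>
     pcomposable P (plower f) (ppos f) (psource f)"

definition ptarget :: "('c, 'o, 'x) operad_scheme \<Rightarrow> 'o ptree \<Rightarrow> 'o" where
  "ptarget P f = pcomp P (plower f) (ppos f) (gcomp P (psource f) (pupper f))"

definition pid :: "('c, 'o, 'x) operad_scheme \<Rightarrow> 'o \<Rightarrow> 'o ptree" where
  "pid P p = PTree p (ident P (out P p)) 0 (map (ident P) (ins P p))"

text \<open>In \<open>ptcomp P g f\<close>, the upper vertices of \<open>g\<close> are split into those above the inputs of the
  lower vertex of \<open>f\<close> to the left of the source, those above the upper vertices of \<open>f\<close>, and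
  those above the inputs of the lower vertex of \<open>f\<close> to the right of the source.\<close>

definition ptcomp :: "('c, 'o, 'x) operad_scheme \<Rightarrow> 'o ptree \<Rightarrow> 'o ptree \<Rightarrow> 'o ptree" where
  "ptcomp P g f =
     (let m = sum_list (map (arity P) (pupper f));
          left = take (ppos f) (pupper g);
          mid = take m (drop (ppos f) (pupper g));
          right = drop (ppos f + m) (pupper g)
      in PTree (psource f)
           (pcomp P (plower g) (ppos g)
              (gcomp P (plower f) (left @ [ident P (out P (psource f))] @ right)))
           (ppos g + sum_list (map (arity P) left))
           (map2 (gcomp P) (pupper f) (chop (map (arity P) (pupper f)) mid)))"

definition planar_Tw :: "('c, 'o, 'x) operad_scheme \<Rightarrow> ('o, 'o ptree) cat" where
  "planar_Tw P = \<lparr>Obj = opers P, Arr = {f. ptree_arrow P f},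
     Dom = psource, Cod = ptarget P, Id = pid P, Comp = ptcomp P\<rparr>"

definition pvertices :: "'o ptree \<Rightarrow> 'o set" where
  "pvertices f = insert (plower f) (set (pupper f))"

subsection \<open>Symmetric case\<close>

text \<open>\<open>STree p q\<^sub>0 [q\<^sub>1,\<dots>,q\<^sub>n] l\<^sub>0 [l\<^sub>1,\<dots>,l\<^sub>n]\<close>: the bijection \<open>\<lambda>\<close> is given by the lists of its values,
  \<open>l\<^sub>i = [\<lambda>(i,1),\<dots>,\<lambda>(i,m\<^sub>i)]\<close> for \<open>1 \<le> i \<le> n\<close> and \<open>l\<^sub>0 = [\<lambda>(0,2),\<dots>,\<lambda>(0,m\<^sub>0)]\<close>. Its values are numbered
  from 0, as the inputs of an operation are.\<close>

datatype 'o stree = STree (ssource: 'o) (slower: 'o) (supper: "'o list")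
  (slower_labels: "nat list") (supper_labels: "nat list list")

definition sleaves :: "'o stree \<Rightarrow> nat list" where
  "sleaves f = concat (supper_labels f) @ slower_labels f"

definition stree_arrow :: "('c, 'o, 'x) sym_operad_scheme \<Rightarrow> 'o stree \<Rightarrow> bool" where
  "stree_arrow P f \<longleftrightarrow>
     composable P (ssource f) (supper f) \<and> pcomposable P (slower f) 0 (ssource f) \<and>
     map length (supper_labels f) = map (arity P) (supper f) \<and>
     Suc (length (slower_labels f)) = arity P (slower f) \<and>
     sleaves f \<in> permutations_of_set {..<length (sleaves f)} \<and>
     (\<forall>l \<in> insert (slower_labels f) (set (supper_labels f)). sorted l)"

definition starget :: "('c, 'o, 'x) sym_operad_scheme \<Rightarrow> 'o stree \<Rightarrow> 'o" where
  "starget P f = act P (sleaves f) (pcomp P (slower f) 0 (gcomp P (ssource f) (supper f)))"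

definition sid :: "('c, 'o, 'x) sym_operad_scheme \<Rightarrow> 'o \<Rightarrow> 'o stree" where
  "sid P p = STree p (ident P (out P p)) (map (ident P) (ins P p)) [] (map (\<lambda>k. [k]) [0..<arity P p])"

text \<open>If the inputs of an operation \<open>q\<close> are labelled by the distinct numbers \<open>ls\<close>, then
  \<open>act P (ranks ls) q\<close> is \<open>q\<close> with its inputs permuted so that the labels become \<open>sort ls\<close>.\<close>

definition ranks :: "nat list \<Rightarrow> nat list" where
  "ranks ls = map (\<lambda>x. card {y \<in> set ls. y < x}) ls"

definition stcomp :: "('c, 'o, 'x) sym_operad_scheme \<Rightarrow> 'o stree \<Rightarrow> 'o stree \<Rightarrow> 'o stree" where
  "stcomp P g f =
     (let above = (\<lambda>ls. map ((!) (supper g)) ls);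
          labels = (\<lambda>ls. concat (map ((!) (supper_labels g)) ls));
          low_labels = labels (slower_labels f) @ slower_labels g;
          low = pcomp P (slower g) 0
                  (gcomp P (slower f) (ident P (out P (ssource f)) # above (slower_labels f)))
      in STree (ssource f)
           (act P (0 # map Suc (ranks low_labels)) low)
           (map2 (\<lambda>q ls. act P (ranks (labels ls)) (gcomp P q (above ls))) (supper f) (supper_labels f))
           (sort low_labels)
           (map (\<lambda>ls. sort (labels ls)) (supper_labels f)))"

definition symmetric_Tw :: "('c, 'o, 'x) sym_operad_scheme \<Rightarrow> ('o, 'o stree) cat" where
  "symmetric_Tw P = \<lparr>Obj = opers P, Arr = {f. stree_arrow P f},
     Dom = ssource, Cod = starget P, Id = sid P, Comp = stcomp P\<rparr>"

definition svertices :: "'o stree \<Rightarrow> 'o set" where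
  "svertices f = insert (slower f) (set (supper f))"

definition strivial :: "'o stree \<Rightarrow> bool" where
  "strivial f \<longleftrightarrow> sleaves f = [0..<length (sleaves f)]"

subsection \<open>Cyclic case\<close>

text \<open>\<open>CTree p [q\<^sub>0,\<dots>,q\<^sub>n] [l\<^sub>0,\<dots>,l\<^sub>n]\<close> with \<open>l\<^sub>j = [\<lambda>(j,1),\<dots>,\<lambda>(j,m\<^sub>j)]\<close>; the values of \<open>\<lambda>\<close> are legs of the
  target, numbered from 0.\<close>

datatype 'o ctree = CTree (csource: 'o) (cverts: "'o list") (clabels: "nat list list")

definition cleaves :: "'o ctree \<Rightarrow> nat list" where
  "cleaves f = concat (clabels f)"

definition ctree_arrow :: "('o, 'x) cyc_operad_scheme \<Rightarrow> 'o ctree \<Rightarrow> bool" where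
  "ctree_arrow P f \<longleftrightarrow>
     csource f \<in> opers P \<and> set (cverts f) \<subseteq> opers P \<and>
     length (cverts f) = Suc (arity P (csource f)) \<and>
     map length (clabels f) = map (arity P) (cverts f) \<and>
     sum_list (map (arity P) (cverts f)) \<ge> 1 \<and>
     cleaves f \<in> permutations_of_set {..<length (cleaves f)} \<and>
     (\<forall>l \<in> set (clabels f). sorted l)"

text \<open>\<open>glue_root P s q\<close> glues leg 0 of \<open>q\<close> to leg 0 of \<open>s\<close>. If \<open>q\<close> has arity \<open>m\<close> and \<open>s\<close> has arity \<open>n\<close>,
  then the legs of the result, in order, are the legs \<open>1,\<dots>,m\<close> of \<open>q\<close> followed by the legs
  \<open>1,\<dots>,n\<close> of \<open>s\<close>. The two formulas are needed because leg 0 of the result has to be a leg of \<open>q\<close>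
  if \<open>m \<ge> 1\<close> and a leg of \<open>s\<close> otherwise. Not meaningful if \<open>m = n = 0\<close>.\<close>

definition glue_root :: "('o, 'x) cyc_operad_scheme \<Rightarrow> 'o \<Rightarrow> 'o \<Rightarrow> 'o" where
  "glue_root P s q =
     (if arity P q \<ge> 1 then pcomp P (rot P q) (arity P q - 1) s
      else pcomp P (rot P s) (arity P s - 1) q)"

definition ctarget :: "('o, 'x) cyc_operad_scheme \<Rightarrow> 'o ctree \<Rightarrow> 'o" where
  "ctarget P f =
     cact P (cleaves f) (glue_root P (gcomp P (csource f) (tl (cverts f))) (hd (cverts f)))"

definition cid :: "('o, 'x) cyc_operad_scheme \<Rightarrow> 'o \<Rightarrow> 'o ctree" where
  "cid P p = CTree p (replicate (Suc (arity P p)) (ident P ())) (map (\<lambda>k. [k]) [0..<Suc (arity P p)])"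

text \<open>Leg 0 of each vertex of the composite is leg 0 of the corresponding vertex of \<open>f\<close>, so vertices
  are composed with the ordinary operadic composition.\<close>

definition ctcomp :: "('o, 'x) cyc_operad_scheme \<Rightarrow> 'o ctree \<Rightarrow> 'o ctree \<Rightarrow> 'o ctree" where
  "ctcomp P g f =
     (let above = (\<lambda>ls. map ((!) (cverts g)) ls);
          labels = (\<lambda>ls. concat (map ((!) (clabels g)) ls))
      in CTree (csource f)
           (map2 (\<lambda>q ls. act P (ranks (labels ls)) (gcomp P q (above ls))) (cverts f) (clabels f))
           (map (\<lambda>ls. sort (labels ls)) (clabels f)))"

definition cyclic_Tw :: "('o, 'x) cyc_operad_scheme \<Rightarrow> ('o, 'o ctree) cat" where
  "cyclic_Tw P = \<lparr>Obj = opers P, Arr = {f. ctree_arrow P f},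
     Dom = csource, Cod = ctarget P, Id = cid P, Comp = ctcomp P\<rparr>"

definition cvertices :: "'o ctree \<Rightarrow> 'o set" where
  "cvertices f = set (cverts f)"

definition ctrivial :: "'o ctree \<Rightarrow> bool" where
  "ctrivial f \<longleftrightarrow> cleaves f = [0..<length (cleaves f)]"


section \<open>The classes of morphisms\<close>

text \<open>Here \<open>T\<close> is the twisted arrow category of \<open>P\<close>, \<open>vs\<close> gives the set of non-source vertices of a
  morphism, and \<open>triv\<close> says that its permutation on leaves is trivial.\<close>

definition R_eq_minus1 ::
  "('c, 'o, 'x) operad_scheme \<Rightarrow> ('o \<Rightarrow> int) \<Rightarrow> ('o, 'a) cat \<Rightarrow> ('a \<Rightarrow> 'o set) \<Rightarrow> ('a \<Rightarrow> bool) \<Rightarrow> 'a set" where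
  "R_eq_minus1 P \<psi> T vs triv =
     {f \<in> Arr T. triv f \<and> (\<forall>q\<in>vs f. q \<in> ident P ` colours P \<or> \<psi> q = - 1)}"

definition R_ge_0 :: "('o \<Rightarrow> int) \<Rightarrow> ('o, 'a) cat \<Rightarrow> ('a \<Rightarrow> 'o set) \<Rightarrow> 'a set" where
  "R_ge_0 \<psi> T vs = {f \<in> Arr T. \<forall>q\<in>vs f. \<psi> q \<ge> 0}"

definition R_minus ::
  "('c, 'o, 'x) operad_scheme \<Rightarrow> ('o \<Rightarrow> int) \<Rightarrow> ('o, 'a) cat \<Rightarrow> ('a \<Rightarrow> 'o set) \<Rightarrow> ('a \<Rightarrow> bool) \<Rightarrow> 'a set" where
  "R_minus P \<psi> T vs triv = comp_class T (isos T) (R_eq_minus1 P \<psi> T vs triv)"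

definition R_plus :: "('o \<Rightarrow> int) \<Rightarrow> ('o, 'a) cat \<Rightarrow> ('a \<Rightarrow> 'o set) \<Rightarrow> 'a set" where
  "R_plus \<psi> T vs = comp_class T (R_ge_0 \<psi> T vs) (isos T)"

end

theory Submission
  imports Defs
begin

text \<open>The degree of the target of a morphism is the degree of its source plus the gradings of its
  non-source vertices. Vertices of grading \<open>-1\<close> are leafless, so attaching them first factors
  every morphism as a morphism of \<open>R\<^bsub>\<psi>=-1\<^esub>\<close> followed by one of \<open>R\<^bsub>\<psi>\<ge>0\<^esub>\<close>; the first factor is
  epi and can be read off from the composite. A morphism is an isomorphism iff all its non-source
  vertices are invertible, and \<open>P(\<psi>=0)\<close> is a groupoid of unary operations iff every operation of
  grading 0 is invertible, in which case the isomorphisms are the morphisms all of whose non-source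
  vertices have grading 0. Conversely, an operation \<open>p\<close> of grading 0 is a vertex of a morphism
  from an identity to \<open>p\<close> that lies in \<open>R\<^sub>+\<close> and does not increase the degree, so it has to be an
  isomorphism and \<open>p\<close> is invertible.\<close>

section \<open>Factorizations determined by graded vertices\<close>

text \<open>An isomorphism might a priori contain vertices that cancel, such as a binary operation
  and a unit of it. Counting leaves excludes this: an upper (in the cyclic case, any) vertex
  together with the vertices of the inverse above it forms an identity, so it is not nullary. Once
  this is known for a morphism and its inverse, no vertex of the composite can contain more than one
  vertex from each, and inverses of the vertices can be read off.

  Planar trees compose by concatenating lists. Symmetric and cyclic trees have leaf numbers, and
  each vertex of a composite is put into canonical form by sorting them, which obscures
  associativity. Vertices are therefore treated as operations with labelled legs. Substitution of
  these is associative before sorting and respects simultaneous permutations of legs and labels; the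
  sorted form is independent of the representative because labels are distinct.

  The cyclic axioms speak only of permutations of legs and of rotated partial compositions. That
  gluing at all legs, the output included, respects every permutation of legs is derived by moving
  the output past one leg at a time.\<close>

lemma wfp_on_int_atLeast: "wfp_on {k::int..} (<)"
  unfolding wfp_on_def
proof (rule allI, rule impI, rule ballI)
  fix P and x :: int assume h: "\<forall>x\<in>{k..}. (\<forall>y\<in>{k..}. y < x \<longrightarrow> P y) \<longrightarrow> P x" and "x \<in> {k..}"
  then show "P x"
  proof (induction "nat (x - k)" arbitrary: x rule: less_induct)
    case less
    have "P y" if "y \<in> {k..}" "y < x" for y
    proof (rule less.hyps)
      show "nat (y - k) < nat (x - k)" "y \<in> {k..}" using that by auto
    qed (rule less.prems(1))
    then have "\<forall>y\<in>{k..}. y < x \<longrightarrow> P y" by blast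
    with bspec[OF less.prems] show ?case by (rule mp)
  qed
qed

lemma sum_list_pos:
  fixes xs :: "int list"
  assumes "\<forall>x\<in>set xs. 0 \<le> x" "\<exists>x\<in>set xs. x \<noteq> 0"
  shows "0 < sum_list xs"
  using assms
proof (induction xs)
  case (Cons x xs)
  then have "0 \<le> sum_list xs" by (auto intro: sum_list_nonneg)
  with Cons show ?case by (cases "x = 0") auto
qed simp

lemma sum_list_neg:
  fixes xs :: "int list"
  assumes "\<forall>x\<in>set xs. x \<le> 0" "\<exists>x\<in>set xs. x \<noteq> 0"
  shows "sum_list xs < 0"
  using sum_list_pos[of "map uminus xs"] assms uminus_sum_list_map[of "\<lambda>x. x" xs]
  by (simp add: comp_def)

section \<open>Isomorphisms in a category\<close>

context category
begin

lemma isos_arr: "f \<in> isos C \<Longrightarrow> f \<in> Arr C"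
  by (simp add: isos_def)

lemma id_iso: "a \<in> Obj C \<Longrightarrow> Id C a \<in> isos C"
  unfolding isos_def
  using id_arr id_dom id_cod comp_id_left comp_id_right by force

lemma isosE:
  assumes "f \<in> isos C"
  obtains g where "g \<in> isos C" "Dom C g = Cod C f" "Cod C g = Dom C f"
    "Comp C g f = Id C (Dom C f)" "Comp C f g = Id C (Cod C f)"
  using assms unfolding isos_def by fastforce

lemma iso_cancel_right:
  assumes f: "f \<in> isos C" and gh: "g \<in> Arr C" "h \<in> Arr C" "Dom C g = Cod C f" "Dom C h = Cod C f"
    and eq: "Comp C g f = Comp C h f"
  shows "g = h"
proof -
  obtain f' where f': "f' \<in> isos C" "Dom C f' = Cod C f" "Cod C f' = Dom C f"
    "Comp C f' f = Id C (Dom C f)" "Comp C f f' = Id C (Cod C f)"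
    using f by (rule isosE)
  have "Comp C (Comp C k f) f' = k" if "k \<in> Arr C" "Dom C k = Cod C f" for k
    using comp_assoc[of f' f k] f' isos_arr[OF f] isos_arr[OF f'(1)] that comp_id_right[of k] by simp
  then show ?thesis using gh eq by metis
qed

end

text \<open>If \<open>g\<close> is a left inverse of \<open>f\<close> and \<open>h\<close> one of
  \<open>g\<close>, then \<open>h = h g f = f\<close>, so \<open>g\<close> is a two-sided inverse.
  For a class closed under taking left inverses only one of the two composites has to be
  computed.\<close>

lemma (in category) isos_if_left_inverses:
  assumes E: "E \<subseteq> Arr C"
    and inv: "\<And>f. f \<in> E \<Longrightarrow> \<exists>g\<in>E. Dom C g = Cod C f \<and> Comp C g f = Id C (Dom C f)"
  shows "E \<subseteq> isos C"
proof
  fix f assume f: "f \<in> E"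
  obtain g where g: "g \<in> E" "Dom C g = Cod C f" "Comp C g f = Id C (Dom C f)" using inv f by blast
  obtain h where h: "h \<in> E" "Dom C h = Cod C g" "Comp C h g = Id C (Dom C g)" using inv g(1) by blast
  have arr: "f \<in> Arr C" "g \<in> Arr C" "h \<in> Arr C" using E f g h by auto
  have cg: "Cod C g = Dom C f"
    using comp_cod[OF arr(1,2)] g id_cod[OF dom_obj[OF arr(1)]] by simp
  have "h = Comp C h (Comp C g f)" using g(3) comp_id_right[OF arr(3)] h(2) cg by simp
  also have "\<dots> = Comp C (Comp C h g) f" by (rule comp_assoc) (use arr g h in auto)
  also have "\<dots> = f" using h(3) g(2) comp_id_left[OF arr(1)] by simp
  finally show "f \<in> isos C" unfolding isos_def using arr g h cg by auto
qed

lemma (in category) comp_class_id: "R \<subseteq> Arr C \<Longrightarrow> R \<subseteq> comp_class C R (isos C)"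
proof
  fix f assume "R \<subseteq> Arr C" "f \<in> R"
  then have "f \<in> R" "f = Comp C f (Id C (Dom C f))" "Id C (Dom C f) \<in> isos C"
    "Cod C (Id C (Dom C f)) = Dom C f"
    using comp_id_right id_iso dom_obj id_cod by auto
  then show "f \<in> comp_class C R (isos C)" unfolding comp_class_def by blast
qed

text \<open>An abstract form of the twisted arrow categories: \<open>vl f\<close> lists the non-source vertices of
  \<open>f\<close>, and \<open>L0\<close> plays the role of \<open>R\<^bsub>\<psi>=-1\<^esub>\<close>. As every element of \<open>L0\<close> is epi and determined by
  any composite with an element of \<open>R\<^bsub>\<psi>\<ge>0\<^esub>\<close>, factorizations are compared through \<open>L0\<close>.\<close>

locale graded_vertices = category C for C :: "('o, 'a) cat" +
  fixes \<psi> :: "'o \<Rightarrow> int" and vl :: "'a \<Rightarrow> 'o list" and L0 :: "'a set"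
  assumes iso_iff: "f \<in> Arr C \<Longrightarrow> f \<in> isos C \<longleftrightarrow> (\<forall>v\<in>set (vl f). \<psi> v = 0)"
    and degree: "f \<in> Arr C \<Longrightarrow> \<psi> (Cod C f) = \<psi> (Dom C f) + sum_list (map \<psi> (vl f))"
    and degree_ge: "a \<in> Obj C \<Longrightarrow> - 1 \<le> \<psi> a"
    and comp_vertex: "\<lbrakk>f \<in> Arr C; g \<in> Arr C; Cod C f = Dom C g; v \<in> set (vl (Comp C g f))\<rbrakk>
      \<Longrightarrow> \<exists>us. set us \<subseteq> set (vl f) \<union> set (vl g) \<and> \<psi> v = sum_list (map \<psi> us)"
    and L0_arr: "l \<in> L0 \<Longrightarrow> l \<in> Arr C"
    and L0_nonpos: "l \<in> L0 \<Longrightarrow> v \<in> set (vl l) \<Longrightarrow> \<psi> v \<le> 0"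
    and L0_factor: "f \<in> Arr C \<Longrightarrow> \<exists>l\<in>L0. \<exists>r\<in>Arr C. Cod C l = Dom C r \<and> Comp C r l = f \<and>
      set (vl r) \<subseteq> {v \<in> set (vl f). 0 \<le> \<psi> v}"
    and L0_epi: "\<lbrakk>l \<in> L0; g \<in> Arr C; h \<in> Arr C; Dom C g = Cod C l; Dom C h = Cod C l;
      Comp C g l = Comp C h l\<rbrakk> \<Longrightarrow> g = h"
    and L0_unique: "\<lbrakk>l \<in> L0; l' \<in> L0; g \<in> Arr C; h \<in> Arr C; Dom C g = Cod C l; Dom C h = Cod C l';
      Comp C g l = Comp C h l'; \<forall>v\<in>set (vl g) \<union> set (vl h). 0 \<le> \<psi> v\<rbrakk> \<Longrightarrow> l = l'"
begin

section \<open>The Reedy structure of a category with graded vertices\<close>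

definition "Neg = {f \<in> Arr C. \<forall>v\<in>set (vl f). \<psi> v \<le> 0}"
definition "Pos = {f \<in> Arr C. \<forall>v\<in>set (vl f). 0 \<le> \<psi> v}"

lemma iso_vertex: "f \<in> isos C \<Longrightarrow> v \<in> set (vl f) \<Longrightarrow> \<psi> v = 0"
  using iso_iff[OF isos_arr] by blast

lemma isos_Neg: "isos C \<subseteq> Neg" and isos_Pos: "isos C \<subseteq> Pos"
  by (auto simp: Neg_def Pos_def isos_arr iso_vertex)

lemma comp_Neg:
  assumes "f \<in> Neg" "g \<in> Neg" "Cod C f = Dom C g"
  shows "Comp C g f \<in> Neg"
proof -
  have "\<psi> v \<le> 0" if v: "v \<in> set (vl (Comp C g f))" for v
  proof -
    obtain us where us: "set us \<subseteq> set (vl f) \<union> set (vl g)" "\<psi> v = sum_list (map \<psi> us)"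
      using comp_vertex[of f g v] assms v by (auto simp: Neg_def)
    have "\<forall>u\<in>set us. \<psi> u \<le> 0" using us(1) assms by (auto simp: Neg_def)
    then show ?thesis unfolding us(2) by (auto intro!: sum_list_nonpos)
  qed
  then show ?thesis using assms comp_arr by (auto simp: Neg_def)
qed

lemma comp_Pos:
  assumes "f \<in> Pos" "g \<in> Pos" "Cod C f = Dom C g"
  shows "Comp C g f \<in> Pos"
proof -
  have "0 \<le> \<psi> v" if v: "v \<in> set (vl (Comp C g f))" for v
  proof -
    obtain us where us: "set us \<subseteq> set (vl f) \<union> set (vl g)" "\<psi> v = sum_list (map \<psi> us)"
      using comp_vertex[of f g v] assms v by (auto simp: Pos_def)
    have "\<forall>u\<in>set us. 0 \<le> \<psi> u" using us(1) assms by (auto simp: Pos_def)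
    then show ?thesis unfolding us(2) by (auto intro!: sum_list_nonneg)
  qed
  then show ?thesis using assms comp_arr by (auto simp: Pos_def)
qed

text \<open>The right factor keeps only vertices of \<open>f\<close> whose grading is nonnegative.
  As all gradings in \<open>f\<close> are nonpositive, these have grading 0, and
  \<open>iso_iff\<close> makes that factor an isomorphism.\<close>

lemma Neg_decomp:
  assumes "f \<in> Neg"
  obtains l \<theta> where "l \<in> L0" "\<theta> \<in> isos C" "Cod C l = Dom C \<theta>" "Comp C \<theta> l = f"
proof -
  from assms obtain l r where lr: "l \<in> L0" "r \<in> Arr C" "Cod C l = Dom C r" "Comp C r l = f"
    "set (vl r) \<subseteq> {v \<in> set (vl f). 0 \<le> \<psi> v}"
    using L0_factor[of f] by (auto simp: Neg_def)
  then have "r \<in> isos C" using iso_iff[of r] assms by (force simp: Neg_def)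
  then show ?thesis using that lr by blast
qed

lemma L0_Neg: "L0 \<subseteq> Neg"
  using L0_arr L0_nonpos by (auto simp: Neg_def)

text \<open>A description of \<open>R_-\<close> by gradings alone. Closure under composition is
  clear from it, because the grading of a vertex of a composite is a sum of gradings of vertices,
  while it is not clear from the product form on the left.\<close>

lemma Neg_eq: "comp_class C (isos C) L0 = Neg"
proof
  show "comp_class C (isos C) L0 \<subseteq> Neg"
    unfolding comp_class_def using comp_Neg L0_Neg isos_Neg by blast
  show "Neg \<subseteq> comp_class C (isos C) L0"
    unfolding comp_class_def using Neg_decomp by blast
qed

lemma Pos_eq: "comp_class C Pos (isos C) = Pos"
proof
  show "comp_class C Pos (isos C) \<subseteq> Pos"
    unfolding comp_class_def using comp_Pos isos_Pos by blast
  show "Pos \<subseteq> comp_class C Pos (isos C)"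
    by (rule comp_class_id) (auto simp: Pos_def)
qed

lemma subcategory_Neg: "subcategory C Neg"
proof -
  have "Neg \<subseteq> Arr C" by (auto simp: Neg_def)
  moreover have "Id C a \<in> Neg" if "a \<in> Obj C" for a using id_iso[OF that] isos_Neg by blast
  ultimately show ?thesis
    unfolding subcategory_def using comp_Neg dom_obj cod_obj by blast
qed

lemma subcategory_Pos: "subcategory C Pos"
proof -
  have "Pos \<subseteq> Arr C" by (auto simp: Pos_def)
  moreover have "Id C a \<in> Pos" if "a \<in> Obj C" for a using id_iso[OF that] isos_Pos by blast
  ultimately show ?thesis
    unfolding subcategory_def using comp_Pos dom_obj cod_obj by blast
qed

text \<open>Write \<open>l\<close> and \<open>l'\<close> as an element of \<open>L0\<close> followed
  by isomorphisms \<open>\<alpha>\<close> and \<open>\<alpha>'\<close>. By \<open>L0_unique\<close>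
  the two elements of \<open>L0\<close> agree, and since they are epi the comparison can only be
  \<open>\<alpha>'\<close> after the inverse of \<open>\<alpha>\<close>.\<close>

lemma factorization_unique:
  assumes l: "l \<in> Neg" "r \<in> Pos" "Cod C l = Dom C r" 
    and l': "l' \<in> Neg" "r' \<in> Pos" "Cod C l' = Dom C r'"
    and eq: "Comp C r l = Comp C r' l'"
  shows "\<exists>!\<theta>. \<theta> \<in> isos C \<and> Dom C \<theta> = Cod C l \<and> Cod C \<theta> = Cod C l' \<and> Comp C \<theta> l = l' \<and> Comp C r' \<theta> = r"
proof -
  obtain k \<alpha> where k: "k \<in> L0" "\<alpha> \<in> isos C" "Cod C k = Dom C \<alpha>" "Comp C \<alpha> k = l"
    using l(1) by (rule Neg_decomp)
  obtain k' \<alpha>' where k': "k' \<in> L0" "\<alpha>' \<in> isos C" "Cod C k' = Dom C \<alpha>'" "Comp C \<alpha>' k' = l'"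
    using l'(1) by (rule Neg_decomp)
  note arr = isos_arr[OF k(2)] isos_arr[OF k'(2)] L0_arr[OF k(1)] L0_arr[OF k'(1)]
  have arrs: "l \<in> Arr C" "r \<in> Arr C" "l' \<in> Arr C" "r' \<in> Arr C"
    using l l' by (auto simp: Neg_def Pos_def)
  have cod: "Cod C \<alpha> = Cod C l" "Cod C \<alpha>' = Cod C l'"
    using comp_cod k k' arr by force+
  have P: "Comp C r \<alpha> \<in> Pos" "Comp C r' \<alpha>' \<in> Pos"
    using comp_Pos isos_Pos k(2) k'(2) l l' cod by auto
  have e: "Comp C (Comp C r \<alpha>) k = Comp C (Comp C r' \<alpha>') k'"
    using comp_assoc[of k \<alpha> r] comp_assoc[of k' \<alpha>' r'] arr arrs k k' cod l l' eq by simp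
  have d: "Dom C (Comp C r \<alpha>) = Cod C k" "Dom C (Comp C r' \<alpha>') = Cod C k'"
    using comp_dom arr arrs k k' cod l l' by auto
  have kk: "k = k'"
    using L0_unique[OF k(1) k'(1) _ _ d e] P by (auto simp: Pos_def)
  have rr: "Comp C r \<alpha> = Comp C r' \<alpha>'"
    using L0_epi[OF k(1) _ _ d(1) _ ] e P d kk by (auto simp: Pos_def)
  obtain \<beta> where \<beta>: "\<beta> \<in> isos C" "Dom C \<beta> = Cod C \<alpha>" "Cod C \<beta> = Dom C \<alpha>"
    "Comp C \<beta> \<alpha> = Id C (Dom C \<alpha>)" "Comp C \<alpha> \<beta> = Id C (Cod C \<alpha>)"
    using k(2) by (rule isosE)
  note \<beta>a = isos_arr[OF \<beta>(1)]
  have dd: "Dom C \<alpha> = Dom C \<alpha>'" using k k' kk by simp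
  define \<theta> where "\<theta> = Comp C \<alpha>' \<beta>"
  have \<theta>a: "\<theta> \<in> Arr C" "Dom C \<theta> = Cod C l" "Cod C \<theta> = Cod C l'"
    unfolding \<theta>_def using comp_arr comp_dom comp_cod \<beta> \<beta>a arr cod dd by auto
  \<comment> \<open>By \<open>iso_iff\<close> the isomorphisms are exactly
    \<open>Neg \<inter> Pos\<close>, and both classes are closed under composition.\<close>
  have \<theta>i: "\<theta> \<in> isos C"
  proof -
    have "\<beta> \<in> Neg \<inter> Pos" "\<alpha>' \<in> Neg \<inter> Pos" using \<beta>(1) k'(2) isos_Neg isos_Pos by auto
    then have "\<theta> \<in> Neg \<inter> Pos"
      unfolding \<theta>_def using comp_Neg comp_Pos \<beta> dd by auto
    then have "\<forall>v\<in>set (vl \<theta>). \<psi> v = 0" by (auto simp: Neg_def Pos_def intro: antisym)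
    then show ?thesis using iso_iff \<theta>a by blast
  qed
  have \<theta>\<alpha>: "Comp C \<theta> \<alpha> = \<alpha>'"
    unfolding \<theta>_def using comp_assoc[of \<alpha> \<beta> \<alpha>'] \<beta> \<beta>a arr dd comp_id_right[of \<alpha>'] by simp
  have \<theta>l: "Comp C \<theta> l = l'"
    using comp_assoc[of k \<alpha> \<theta>] \<theta>\<alpha> k k' kk arr \<theta>a cod by simp
  have r\<theta>: "Comp C r' \<theta> = r"
    unfolding \<theta>_def
    using comp_assoc[of \<beta> \<alpha>' r'] comp_assoc[of \<beta> \<alpha> r] rr \<beta> \<beta>a arr arrs dd cod l l' comp_id_right[of r]
    by simp
  show ?thesis
  proof (rule ex1I[of _ \<theta>])
    fix \<eta> assume h: "\<eta> \<in> isos C \<and> Dom C \<eta> = Cod C l \<and> Cod C \<eta> = Cod C l' \<and> Comp C \<eta> l = l' \<and> Comp C r' \<eta> = r"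
    note \<eta>a = isos_arr[OF conjunct1[OF h]]
    have "Comp C (Comp C \<eta> \<alpha>) k = Comp C (Comp C \<theta> \<alpha>) k"
      using comp_assoc[of k \<alpha> \<eta>] comp_assoc[of k \<alpha> \<theta>] h \<theta>l k arr \<eta>a \<theta>a cod by simp
    then have "Comp C \<eta> \<alpha> = Comp C \<theta> \<alpha>"
      using L0_epi[OF k(1)] comp_arr comp_dom arr \<eta>a \<theta>a cod h k(3) by simp
    then show "\<eta> = \<theta>" using iso_cancel_right[OF k(2)] \<eta>a \<theta>a cod h by simp
  qed (use \<theta>i \<theta>a \<theta>l r\<theta> in auto)
qed

theorem reedy: "generalized_reedy C {-1..} \<psi> (comp_class C (isos C) L0)
    (comp_class C {f \<in> Arr C. \<forall>v\<in>set (vl f). 0 \<le> \<psi> v} (isos C))"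
  unfolding generalized_reedy_def Neg_eq Pos_def[symmetric] Pos_eq
proof (intro conjI ballI impI)
  show "category C" by (rule category_axioms)
  show "subcategory C Neg" "subcategory C Pos" by (fact subcategory_Neg subcategory_Pos)+
  show "wfp_on {-1::int..} (<)" by (rule wfp_on_int_atLeast)
  show "\<psi> a \<in> {-1..}" if "a \<in> Obj C" for a using degree_ge that by simp
  show "orthogonal_factorization_system C Neg Pos"
    unfolding orthogonal_factorization_system_def
  proof (intro conjI allI impI ballI)
    fix f assume f: "f \<in> Arr C"
    obtain l r where lr: "l \<in> L0" "r \<in> Arr C" "Cod C l = Dom C r" "Comp C r l = f"
      "set (vl r) \<subseteq> {v \<in> set (vl f). 0 \<le> \<psi> v}"
      using L0_factor[OF f] by auto
    moreover have "l \<in> Neg" "r \<in> Pos" using lr L0_Neg by (auto simp: Pos_def)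
    ultimately show "\<exists>l r. factorizes C Neg Pos f l r"
      unfolding factorizes_def by blast
  next
    fix f l r l' r'
    assume h: "f \<in> Arr C \<and> factorizes C Neg Pos f l r \<and> factorizes C Neg Pos f l' r'"
    then have "l \<in> Neg" "r \<in> Pos" "Cod C l = Dom C r" "l' \<in> Neg" "r' \<in> Pos" "Cod C l' = Dom C r'"
      "Comp C r l = Comp C r' l'"
      by (simp_all add: factorizes_def)
    then show "\<exists>!\<theta>. \<theta> \<in> isos C \<and> Dom C \<theta> = Cod C l \<and> Cod C \<theta> = Cod C l' \<and> Comp C \<theta> l = l' \<and> Comp C r' \<theta> = r"
      by (rule factorization_unique)
  qed (use isos_Neg isos_Pos in auto)
  show "\<psi> (Cod C f) < \<psi> (Dom C f)" if "f \<in> Neg - isos C" for f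
  proof -
    have f: "f \<in> Arr C" "\<forall>v\<in>set (vl f). \<psi> v \<le> 0" "\<exists>v\<in>set (vl f). \<psi> v \<noteq> 0"
      using that iso_iff[of f] by (auto simp: Neg_def)
    then show ?thesis using degree[OF f(1)] sum_list_neg[of "map \<psi> (vl f)"] by simp
  qed
  show "\<psi> (Dom C f) < \<psi> (Cod C f)" if "f \<in> Pos - isos C" for f
  proof -
    have f: "f \<in> Arr C" "\<forall>v\<in>set (vl f). \<psi> v \<ge> 0" "\<exists>v\<in>set (vl f). \<psi> v \<noteq> 0"
      using that iso_iff[of f] by (auto simp: Pos_def)
    then show ?thesis using degree[OF f(1)] sum_list_pos[of "map \<psi> (vl f)"] by simp
  qed
  show "\<psi> (Dom C f) = \<psi> (Cod C f)" if "f \<in> isos C" for f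
  proof -
    have "\<forall>v\<in>set (vl f). \<psi> v = 0" using that iso_iff isos_arr by blast
    then have "map \<psi> (vl f) = map (\<lambda>_. 0) (vl f)" by simp
    then have "sum_list (map \<psi> (vl f)) = 0" by (simp only: sum_list_0)
    then show ?thesis using degree[OF isos_arr[OF that]] by simp
  qed
  \<comment> \<open>With \<open>f\<close> written as \<open>\<alpha>\<close> after \<open>k\<close>,
    cancelling the epi \<open>k\<close> and then the isomorphism \<open>\<alpha>\<close> on the
    right leaves the identity.\<close>
  show "\<theta> = Id C (Cod C f)" if f: "f \<in> Neg" and \<theta>: "\<theta> \<in> isos C" and h: "Dom C \<theta> = Cod C f \<and> Comp C \<theta> f = f" for f \<theta>
  proof -
    obtain k \<alpha> where k: "k \<in> L0" "\<alpha> \<in> isos C" "Cod C k = Dom C \<alpha>" "Comp C \<alpha> k = f"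
      using f by (rule Neg_decomp)
    note arr = isos_arr[OF k(2)] L0_arr[OF k(1)] isos_arr[OF \<theta>]
    have cod: "Cod C \<alpha> = Cod C f" using comp_cod[of k \<alpha>] k arr by simp
    have "Comp C (Comp C \<theta> \<alpha>) k = Comp C \<theta> (Comp C \<alpha> k)"
      using comp_assoc[of k \<alpha> \<theta>] arr k(3) cod h by simp
    then have "Comp C (Comp C \<theta> \<alpha>) k = Comp C \<alpha> k" using h k(4) by simp
    then have "Comp C \<theta> \<alpha> = \<alpha>"
      by (rule L0_epi[OF k(1), rotated -1]) (simp_all add: comp_arr comp_dom arr cod h k(3))
    then have eq: "Comp C \<theta> \<alpha> = Comp C (Id C (Cod C \<alpha>)) \<alpha>"
      using comp_id_left[OF arr(1)] by (rule trans[OF _ sym])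
    have "\<theta> = Id C (Cod C \<alpha>)"
      by (rule iso_cancel_right[OF k(2) _ _ _ _ eq])
        (simp_all add: h cod cod_obj[OF arr(1)] id_arr id_dom arr cod_obj[OF arr(1), unfolded cod])
    then show ?thesis by (simp only: cod)
  qed
qed

end

lemma reedy_pos_iso:
  assumes "generalized_reedy C D deg L (comp_class C R (isos C))" "R \<subseteq> Arr C" "f \<in> R"
    and "\<not> deg (Dom C f) < deg (Cod C f)"
  shows "f \<in> isos C"
proof -
  interpret category C using assms(1) by (simp add: generalized_reedy_def)
  have "f \<in> comp_class C R (isos C)" using comp_class_id assms(2,3) by blast
  then show ?thesis using assms(1,4) by (auto simp: generalized_reedy_def)
qed

section \<open>Planar operads and gradings\<close>

text \<open>No grading is mentioned, and being unary is part of the condition. So it makes sense for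
  every operation, before those of grading 0 are known to form a category.\<close>

definition invertible :: "('c, 'o, 'x) operad_scheme \<Rightarrow> 'o \<Rightarrow> bool" where
  "invertible P v \<longleftrightarrow> v \<in> opers P \<and> (\<exists>w\<in>opers P. ins P w = [out P v] \<and> ins P v = [out P w] \<and>
     gcomp P v [w] = ident P (out P v) \<and> gcomp P w [v] = ident P (out P w))"

definition op_inv :: "('c, 'o, 'x) operad_scheme \<Rightarrow> 'o \<Rightarrow> 'o" where
  "op_inv P v = (SOME w. w \<in> opers P \<and> ins P w = [out P v] \<and> ins P v = [out P w] \<and>
     gcomp P v [w] = ident P (out P v) \<and> gcomp P w [v] = ident P (out P w))"

lemma op_inv:
  assumes "invertible P v"
  shows "v \<in> opers P" "op_inv P v \<in> opers P" "ins P (op_inv P v) = [out P v]" "ins P v = [out P (op_inv P v)]"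
    "gcomp P v [op_inv P v] = ident P (out P v)" "gcomp P (op_inv P v) [v] = ident P (out P (op_inv P v))"
    "invertible P (op_inv P v)"
proof -
  have *: "op_inv P v \<in> opers P \<and> ins P (op_inv P v) = [out P v] \<and> ins P v = [out P (op_inv P v)] \<and>
     gcomp P v [op_inv P v] = ident P (out P v) \<and> gcomp P (op_inv P v) [v] = ident P (out P (op_inv P v))"
    unfolding op_inv_def by (rule someI_ex) (use assms in \<open>auto simp: invertible_def\<close>)
  moreover show "v \<in> opers P" using assms by (simp add: invertible_def)
  ultimately show "op_inv P v \<in> opers P" "ins P (op_inv P v) = [out P v]" "ins P v = [out P (op_inv P v)]"
    "gcomp P v [op_inv P v] = ident P (out P v)" "gcomp P (op_inv P v) [v] = ident P (out P (op_inv P v))"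
    "invertible P (op_inv P v)"
    unfolding invertible_def by auto
qed

section \<open>Partial and simultaneous composition\<close>

context planar_operad
begin

lemma composable_length: "composable P p qs \<Longrightarrow> length qs = arity P p"
  unfolding composable_def by (metis length_map)

lemma ins_colour: "p \<in> opers P \<Longrightarrow> c \<in> set (ins P p) \<Longrightarrow> c \<in> colours P"
  using ins_colours by blast

lemma gcomp_arity: "composable P p qs \<Longrightarrow> arity P (gcomp P p qs) = sum_list (map (arity P) qs)"
  by (simp add: gcomp_ins length_concat o_def)

lemma idents_opers: "set cs \<subseteq> colours P \<Longrightarrow> set (map (ident P) cs) \<subseteq> opers P"
  using ident_opers by auto

lemma idents_out: "set cs \<subseteq> colours P \<Longrightarrow> map (out P) (map (ident P) cs) = cs"
  using ident_out by (auto intro!: map_idI)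

lemma idents_ins: "set cs \<subseteq> colours P \<Longrightarrow> concat (map (ins P) (map (ident P) cs)) = cs"
  using ident_ins by (induction cs) auto

lemma composable_idents: "p \<in> opers P \<Longrightarrow> composable P p (map (ident P) (ins P p))"
  unfolding composable_def using idents_opers[OF ins_colours] idents_out[OF ins_colours] by blast

lemma composable_ident: "a \<in> opers P \<Longrightarrow> composable P (ident P (out P a)) [a]"
  unfolding composable_def using out_colours ident_opers ident_ins by simp

lemma pcomposable_composable:
  assumes "pcomposable P r i x"
  shows "composable P r ((map (ident P) (ins P r))[i := x])"
proof -
  have r: "r \<in> opers P" "x \<in> opers P" "i < arity P r" "out P x = ins P r ! i"
    using assms by (auto simp: pcomposable_def)
  have "set ((map (ident P) (ins P r))[i := x]) \<subseteq> opers P"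
    using set_update_subset_insert[of "map (ident P) (ins P r)" i x] idents_opers[OF ins_colours[OF r(1)]] r
    by blast
  moreover have "map (out P) ((map (ident P) (ins P r))[i := x]) = ins P r"
    unfolding map_update idents_out[OF ins_colours[OF r(1)]] r(4) by simp
  ultimately show ?thesis using r by (simp add: composable_def)
qed

lemma pcomp_opers: "pcomposable P r i x \<Longrightarrow> pcomp P r i x \<in> opers P"
  unfolding pcomp_def by (intro gcomp_opers pcomposable_composable)

lemma pcomp_out: "pcomposable P r i x \<Longrightarrow> out P (pcomp P r i x) = out P r"
  unfolding pcomp_def by (intro gcomp_out pcomposable_composable)

lemma pcomp_alt:
  assumes "i < arity P r"
  shows "pcomp P r i x = gcomp P r (map (ident P) (take i (ins P r)) @ [x] @ map (ident P) (drop (Suc i) (ins P r)))"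
  unfolding pcomp_def using assms by (simp add: upd_conv_take_nth_drop take_map drop_map)

lemma pcomp_ins:
  assumes "pcomposable P r i x"
  shows "ins P (pcomp P r i x) = take i (ins P r) @ ins P x @ drop (Suc i) (ins P r)"
proof -
  have r: "r \<in> opers P" "i < arity P r" using assms by (auto simp: pcomposable_def)
  have s: "set (take i (ins P r)) \<subseteq> colours P" "set (drop (Suc i) (ins P r)) \<subseteq> colours P"
    using ins_colours[OF r(1)] set_take_subset set_drop_subset by (metis subset_trans)+
  have "ins P (pcomp P r i x) = concat (map (ins P) ((map (ident P) (ins P r))[i := x]))"
    unfolding pcomp_def by (rule gcomp_ins[OF pcomposable_composable[OF assms]])
  also have "(map (ident P) (ins P r))[i := x] = map (ident P) (take i (ins P r)) @ [x] @ map (ident P) (drop (Suc i) (ins P r))"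
    using r by (simp add: upd_conv_take_nth_drop take_map drop_map)
  also have "concat (map (ins P) \<dots>) = take i (ins P r) @ ins P x @ drop (Suc i) (ins P r)"
    using idents_ins[OF s(1)] idents_ins[OF s(2)] by (simp add: o_def)
  finally show ?thesis .
qed

lemma pcomp_arity:
  assumes "pcomposable P r i x"
  shows "arity P (pcomp P r i x) = arity P r - 1 + arity P x"
  using assms pcomp_ins[OF assms] by (simp add: pcomposable_def)

text \<open>After unfolding \<open>pcomp\<close> this is \<open>gcomp_assoc\<close>: each entry of
  \<open>A\<close> and \<open>D\<close> stands above an identity, and \<open>B\<close> stands above
  \<open>x\<close>.\<close>

lemma gcomp_pcomp:
  assumes r: "pcomposable P r i x" and B: "composable P x B"
    and A: "map (out P) A = take i (ins P r)" "set A \<subseteq> opers P"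
    and D: "map (out P) D = drop (Suc i) (ins P r)" "set D \<subseteq> opers P"
  shows "gcomp P (pcomp P r i x) (A @ B @ D) = gcomp P r (A @ [gcomp P x B] @ D)"
    and "composable P r (A @ [gcomp P x B] @ D)" and "composable P (pcomp P r i x) (A @ B @ D)"
proof -
  have ri: "r \<in> opers P" "x \<in> opers P" "i < arity P r" "out P x = ins P r ! i"
    using r by (auto simp: pcomposable_def)
  let ?qs = "map (ident P) (map (out P) A) @ [x] @ map (ident P) (map (out P) D)"
  let ?rss = "map (\<lambda>a. [a]) A @ [B] @ map (\<lambda>d. [d]) D"
  have e: "(map (ident P) (ins P r))[i := x] = ?qs"
    using ri A D by (simp add: upd_conv_take_nth_drop take_map drop_map)
  then have p: "pcomp P r i x = gcomp P r ?qs" by (simp add: pcomp_def)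
  have c: "composable P r ?qs" using pcomposable_composable[OF r] unfolding e .
  have la: "list_all2 (composable P) ?qs ?rss"
    using composable_ident A(2) D(2) B
    by (intro list_all2_appendI) (auto simp: list_all2_map1 list_all2_map2 list_all2_same)
  have m: "map2 (gcomp P) (map (ident P) (map (out P) X)) (map (\<lambda>a. [a]) X) = X" if "set X \<subseteq> opers P" for X
    using that gcomp_ident_left by (induction X) auto
  have "gcomp P (gcomp P r ?qs) (concat ?rss) = gcomp P r (map2 (gcomp P) ?qs ?rss)"
    by (rule gcomp_assoc[OF c la])
  then show "gcomp P (pcomp P r i x) (A @ B @ D) = gcomp P r (A @ [gcomp P x B] @ D)"
    using m[OF A(2)] m[OF D(2)] unfolding p by simp
  show "composable P r (A @ [gcomp P x B] @ D)"
    using c A D gcomp_opers[OF B] gcomp_out[OF B] ri unfolding composable_def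
    by (simp add: id_take_nth_drop[symmetric])
  show "composable P (pcomp P r i x) (A @ B @ D)"
    using pcomp_opers[OF r] A D B unfolding composable_def pcomp_ins[OF r] by simp
qed

text \<open>Grafting at an input of \<open>q(L,y,R)\<close> that belongs to \<open>y\<close>; the
  offset counts the inputs contributed by the arguments in \<open>L\<close>. Every other argument is
  composed with identities only, so \<open>gcomp_assoc\<close> leaves it unchanged.\<close>

lemma pcomp_gcomp:
  assumes c: "composable P q (L @ [y] @ R)" and yx: "pcomposable P y j x"
  shows "pcomp P (gcomp P q (L @ [y] @ R)) (sum_list (map (arity P) L) + j) x = gcomp P q (L @ [pcomp P y j x] @ R)"
    and "composable P q (L @ [pcomp P y j x] @ R)"
    and "pcomposable P (gcomp P q (L @ [y] @ R)) (sum_list (map (arity P) L) + j) x"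
proof -
  let ?m = "sum_list (map (arity P) L)"
  have o: "set L \<subseteq> opers P" "set R \<subseteq> opers P" "y \<in> opers P" using c by (auto simp: composable_def)
  have y: "x \<in> opers P" "j < arity P y" "out P x = ins P y ! j" using yx by (auto simp: pcomposable_def)
  have m: "?m = length (concat (map (ins P) L))" by (simp add: length_concat o_def)
  let ?rss = "map (\<lambda>l. map (ident P) (ins P l)) L @ [(map (ident P) (ins P y))[j := x]] @ map (\<lambda>l. map (ident P) (ins P l)) R"
  have la: "list_all2 (composable P) (L @ [y] @ R) ?rss"
    using composable_idents o pcomposable_composable[OF yx]
    by (intro list_all2_appendI) (auto simp: list_all2_map2 list_all2_same)
  have id: "map2 (gcomp P) X (map (\<lambda>l. map (ident P) (ins P l)) X) = X" if "set X \<subseteq> opers P" for X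
    using that gcomp_ident_right by (induction X) auto
  have "concat ?rss = (map (ident P) (ins P (gcomp P q (L @ [y] @ R))))[?m + j := x]"
    unfolding gcomp_ins[OF c] using y(2) by (simp add: list_update_append map_concat length_concat o_def)
  then have "pcomp P (gcomp P q (L @ [y] @ R)) (?m + j) x = gcomp P (gcomp P q (L @ [y] @ R)) (concat ?rss)"
    unfolding pcomp_def by simp
  also have "\<dots> = gcomp P q (map2 (gcomp P) (L @ [y] @ R) ?rss)" by (rule gcomp_assoc[OF c la])
  also have "\<dots> = gcomp P q (L @ [pcomp P y j x] @ R)"
    using id[OF o(1)] id[OF o(2)] by (simp add: pcomp_def)
  finally show "pcomp P (gcomp P q (L @ [y] @ R)) (?m + j) x = gcomp P q (L @ [pcomp P y j x] @ R)" .
  show "composable P q (L @ [pcomp P y j x] @ R)"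
    using c pcomp_opers[OF yx] pcomp_out[OF yx] by (simp add: composable_def)
  show "pcomposable P (gcomp P q (L @ [y] @ R)) (?m + j) x"
    using y gcomp_opers[OF c] unfolding pcomposable_def gcomp_ins[OF c] m by (simp add: nth_append)
qed

lemma pcomp_ident_left: "x \<in> opers P \<Longrightarrow> pcomp P (ident P (out P x)) 0 x = x"
  using gcomp_ident_left[of x] out_colours[of x] ident_ins by (simp add: pcomp_def)

lemma pcomposable_ident_left: "x \<in> opers P \<Longrightarrow> pcomposable P (ident P (out P x)) 0 x"
  using out_colours[of x] ident_ins ident_opers by (simp add: pcomposable_def)

lemma pcomp_ident_right: "p \<in> opers P \<Longrightarrow> i < arity P p \<Longrightarrow> pcomp P p i (ident P (ins P p ! i)) = p"
  using gcomp_ident_right[of p] unfolding pcomp_def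
  by (metis (no_types, lifting) length_map list_update_id nth_map)

text \<open>An identity holds a slot open until an operation is grafted there. In a composite tree
  the lower vertex keeps the slot of the source open in this way.\<close>

lemma pcomp_replace_ident:
  assumes "composable P q (L @ [ident P (out P x)] @ R)" "x \<in> opers P"
  shows "pcomp P (gcomp P q (L @ [ident P (out P x)] @ R)) (sum_list (map (arity P) L)) x = gcomp P q (L @ [x] @ R)"
    and "pcomposable P (gcomp P q (L @ [ident P (out P x)] @ R)) (sum_list (map (arity P) L)) x"
    and "composable P q (L @ [x] @ R)"
  using pcomp_gcomp[OF assms(1) pcomposable_ident_left[OF assms(2)]] pcomp_ident_left[OF assms(2)] by simp_all

lemma pcomp_pcomp:
  assumes r: "pcomposable P r j q" and q: "pcomposable P q i x"
  shows "pcomp P r j (pcomp P q i x) = pcomp P (pcomp P r j q) (j + i) x"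
    and "pcomposable P r j (pcomp P q i x)" and "pcomposable P (pcomp P r j q) (j + i) x"
proof -
  have rj: "j < arity P r" "r \<in> opers P" using r by (auto simp: pcomposable_def)
  let ?L = "map (ident P) (take j (ins P r))" and ?R = "map (ident P) (drop (Suc j) (ins P r))"
  have s: "set (take j (ins P r)) \<subseteq> colours P"
    using ins_colours[OF rj(2)] set_take_subset by (metis subset_trans)
  have m: "sum_list (map (arity P) ?L) = j"
    using arg_cong[OF idents_ins[OF s], of length] rj by (simp add: length_concat o_def)
  have e: "(map (ident P) (ins P r))[j := q] = ?L @ [q] @ ?R"
    using rj by (simp add: upd_conv_take_nth_drop take_map drop_map)
  have c: "composable P r (?L @ [q] @ ?R)" using pcomposable_composable[OF r] unfolding e .
  show "pcomp P r j (pcomp P q i x) = pcomp P (pcomp P r j q) (j + i) x"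
    using pcomp_gcomp(1)[OF c q] unfolding pcomp_alt[OF rj(1)] m by simp
  show "pcomposable P r j (pcomp P q i x)"
    using r pcomp_opers[OF q] pcomp_out[OF q] by (simp add: pcomposable_def)
  show "pcomposable P (pcomp P r j q) (j + i) x"
    using pcomp_gcomp(3)[OF c q] unfolding pcomp_alt[OF rj(1)] m .
qed

lemma gcomp_unary_assoc:
  assumes "composable P p [q]" "composable P q [r]"
  shows "gcomp P (gcomp P p [q]) [r] = gcomp P p [gcomp P q [r]]"
  using gcomp_assoc[of p "[q]" "[[r]]"] assms by simp

text \<open>Here \<open>u = v w u = v\<close>, so the right inverse of \<open>w\<close> is
  \<open>v\<close> itself. The composites of a morphism with its inverse in the two orders supply
  precisely such chains of right inverses.\<close>

lemma invertible_two_sided: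
  assumes v: "composable P v [w]" "gcomp P v [w] = ident P (out P v)"
    and w: "composable P w [u]" "gcomp P w [u] = ident P (out P w)"
  shows "invertible P v"
proof -
  have o: "v \<in> opers P" "w \<in> opers P" "u \<in> opers P" using v w by (auto simp: composable_def)
  have iw: "ins P w = [out P v]" using gcomp_ins[OF v(1)] v(2) ident_ins[OF out_colours[OF o(1)]] by simp
  have iu: "ins P u = [out P w]" using gcomp_ins[OF w(1)] w(2) ident_ins[OF out_colours[OF o(2)]] by simp
  have iv: "ins P v = [out P w]" using v(1) by (simp add: composable_def)
  have ou: "out P u = out P v" using w(1) iw by (simp add: composable_def)
  have "u = gcomp P (gcomp P v [w]) [u]" using gcomp_ident_left[OF o(3)] v(2) ou by simp
  also have "\<dots> = gcomp P v [ident P (out P w)]" using gcomp_unary_assoc[OF v(1) w(1)] w(2) by simp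
  also have "\<dots> = v" using gcomp_ident_right[OF o(1)] iv by simp
  finally show ?thesis using o iw iv v w unfolding invertible_def by auto
qed

end

section \<open>Gradings of composites and the groupoid condition\<close>

locale graded_operad = planar_operad P for P :: "('c, 'o, 'x) operad_scheme" +
  fixes \<psi> :: "'o \<Rightarrow> int"
  assumes grading: "planar_grading P \<psi>" and nice: "nice P \<psi>"
begin

lemma grading_ge: "p \<in> opers P \<Longrightarrow> - 1 \<le> \<psi> p"
  using nice by (auto simp: nice_def)

lemma grading_minus1: "p \<in> opers P \<Longrightarrow> \<psi> p = - 1 \<Longrightarrow> ins P p = []"
  using nice by (auto simp: nice_def)

lemma grading_nonneg: "p \<in> opers P \<Longrightarrow> ins P p \<noteq> [] \<Longrightarrow> 0 \<le> \<psi> p"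
  using grading_ge[of p] grading_minus1[of p] by fastforce

lemma grading_ident: "c \<in> colours P \<Longrightarrow> \<psi> (ident P c) = 0"
  using grading by (auto simp: planar_grading_def)

lemma grading_pcomp: "pcomposable P p i q \<Longrightarrow> \<psi> (pcomp P p i q) = \<psi> p + \<psi> q"
  using grading by (auto simp: planar_grading_def)

text \<open>Additivity is assumed for partial compositions only. The arguments are grafted one at a
  time from the left, the slots of the remaining ones being held by identities of grading 0.\<close>

lemma grading_gcomp:
  assumes c: "composable P p qs"
  shows "\<psi> (gcomp P p qs) = \<psi> p + sum_list (map \<psi> qs)"
proof -
  have o: "p \<in> opers P" "set qs \<subseteq> opers P" "map (out P) qs = ins P p" using c by (auto simp: composable_def)
  have "\<psi> (gcomp P p (xs @ map (ident P) (map (out P) zs))) = \<psi> p + sum_list (map \<psi> xs)" if "qs = xs @ zs" for xs zs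
    using that
  proof (induction xs arbitrary: zs rule: rev_induct)
    case Nil
    then show ?case using gcomp_ident_right[OF o(1)] o(3) by simp
  next
    case (snoc x xs)
    have x: "x \<in> opers P" using snoc.prems o by auto
    let ?R = "map (ident P) (map (out P) zs)"
    have z: "set (map (out P) zs) \<subseteq> colours P" using snoc.prems o out_colours by auto
    have cc: "composable P p (xs @ [ident P (out P x)] @ ?R)"
      using o snoc.prems out_colours[OF x] ident_out ident_opers idents_out[OF z] idents_opers[OF z]
      unfolding composable_def by (simp del: map_map)
    have "\<psi> (gcomp P p (xs @ [x] @ ?R)) = \<psi> (gcomp P p (xs @ [ident P (out P x)] @ ?R)) + \<psi> x"
      using pcomp_replace_ident(1)[OF cc x] grading_pcomp[OF pcomp_replace_ident(2)[OF cc x]] by simp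
    also have "\<psi> (gcomp P p (xs @ [ident P (out P x)] @ ?R)) = \<psi> p + sum_list (map \<psi> xs)"
      using snoc.IH[of "x # zs"] snoc.prems by simp
    finally show ?case by simp
  qed
  from this[of qs "[]"] show ?thesis by simp
qed

text \<open>The gradings of \<open>v\<close> and of its inverse add up to 0, and both are
  nonnegative because both operations have an input.\<close>

lemma invertible_grading:
  assumes "invertible P v"
  shows "\<psi> v = 0"
proof -
  obtain w where w: "v \<in> opers P" "w \<in> opers P" "ins P w = [out P v]" "ins P v = [out P w]"
    "gcomp P v [w] = ident P (out P v)"
    using assms by (auto simp: invertible_def)
  then have "composable P v [w]" by (simp add: composable_def)
  then have "\<psi> v + \<psi> w = 0"
    using grading_gcomp[of v "[w]"] w(5) grading_ident[OF out_colours[OF w(1)]] by simp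
  then show ?thesis using grading_nonneg[of v] grading_nonneg[of w] w by simp
qed

text \<open>\<open>grade0_cat\<close> records only the first input as the domain, so inverses there
  become inverses in the operad only with arity 1. Conversely \<open>invertible\<close> contains
  arity 1, which is what makes \<open>grade0_cat\<close> a category.\<close>

lemma groupoid_iff_invertible:
  "(\<forall>p\<in>opers P. \<psi> p = 0 \<longrightarrow> arity P p = 1) \<and> groupoid (grade0_cat P \<psi>) \<longleftrightarrow>
   (\<forall>p\<in>opers P. \<psi> p = 0 \<longrightarrow> invertible P p)"
proof
  assume h: "(\<forall>p\<in>opers P. \<psi> p = 0 \<longrightarrow> arity P p = 1) \<and> groupoid (grade0_cat P \<psi>)"
  show "\<forall>p\<in>opers P. \<psi> p = 0 \<longrightarrow> invertible P p"
  proof (intro ballI impI)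
    fix p assume p: "p \<in> opers P" "\<psi> p = 0"
    then have "p \<in> isos (grade0_cat P \<psi>)" using h by (auto simp: groupoid_def grade0_cat_def)
    then obtain g where g: "g \<in> opers P" "\<psi> g = 0" "hd (ins P g) = out P p" "out P g = hd (ins P p)"
      "gcomp P g [p] = ident P (hd (ins P p))" "gcomp P p [g] = ident P (out P p)"
      by (auto simp: isos_def grade0_cat_def)
    have "length (ins P p) = Suc 0" "length (ins P g) = Suc 0" using h p g by auto
    then have "ins P p = [hd (ins P p)]" "ins P g = [hd (ins P g)]"
      unfolding length_Suc_conv by auto
    then show "invertible P p" using p g unfolding invertible_def by (intro conjI bexI[of _ g]) auto
  qed
next
  assume h: "\<forall>p\<in>opers P. \<psi> p = 0 \<longrightarrow> invertible P p"
  have un: "\<exists>c. ins P p = [c] \<and> c \<in> colours P" if "p \<in> opers P" "\<psi> p = 0" for p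
    using h that ins_colours[OF that(1)] by (auto simp: invertible_def)
  let ?C = "grade0_cat P \<psi>"
  have comp: "composable P g [f]" if "f \<in> opers P" "g \<in> opers P" "\<psi> g = 0" "out P f = hd (ins P g)" for f g
    using un[OF that(2,3)] that by (auto simp: composable_def)
  have cat: "category ?C"
  proof
    fix f assume "f \<in> Arr ?C"
    then have f: "f \<in> opers P" "\<psi> f = 0" by (auto simp: grade0_cat_def)
    show "Dom ?C f \<in> Obj ?C" "Cod ?C f \<in> Obj ?C"
      using un[OF f] f out_colours by (auto simp: grade0_cat_def)
    show "Comp ?C f (Id ?C (Dom ?C f)) = f" "Comp ?C (Id ?C (Cod ?C f)) f = f"
      using un[OF f] f gcomp_ident_left[of f] gcomp_ident_right[of f] by (auto simp: grade0_cat_def)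
  next
    fix a assume "a \<in> Obj ?C"
    then show "Id ?C a \<in> Arr ?C" "Dom ?C (Id ?C a) = a" "Cod ?C (Id ?C a) = a"
      using ident_opers ident_ins ident_out grading_ident by (auto simp: grade0_cat_def)
  next
    fix f g assume "f \<in> Arr ?C" "g \<in> Arr ?C" "Cod ?C f = Dom ?C g"
    then have f: "f \<in> opers P" "\<psi> f = 0" "g \<in> opers P" "\<psi> g = 0" "out P f = hd (ins P g)"
      by (auto simp: grade0_cat_def)
    have c: "composable P g [f]" using comp f by blast
    show "Comp ?C g f \<in> Arr ?C" "Dom ?C (Comp ?C g f) = Dom ?C f" "Cod ?C (Comp ?C g f) = Cod ?C g"
      using gcomp_opers[OF c] grading_gcomp[OF c] f gcomp_ins[OF c] gcomp_out[OF c] by (auto simp: grade0_cat_def)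
  next
    fix f g k assume "f \<in> Arr ?C" "g \<in> Arr ?C" "k \<in> Arr ?C" "Cod ?C f = Dom ?C g" "Cod ?C g = Dom ?C k"
    then have f: "f \<in> opers P" "\<psi> f = 0" "g \<in> opers P" "\<psi> g = 0" "out P f = hd (ins P g)"
      "k \<in> opers P" "\<psi> k = 0" "out P g = hd (ins P k)"
      by (auto simp: grade0_cat_def)
    show "Comp ?C k (Comp ?C g f) = Comp ?C (Comp ?C k g) f"
      using gcomp_unary_assoc[of k g f] comp[of g k] comp[of f g] f by (auto simp: grade0_cat_def)
  qed
  have "f \<in> isos ?C" if "f \<in> opers P" "\<psi> f = 0" for f
  proof -
    have "invertible P f" using h that by blast
    note w = op_inv[OF this]
    show ?thesis
      unfolding isos_def grade0_cat_def
      using w invertible_grading[OF w(7)] that by (auto intro!: bexI[of _ "op_inv P f"])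
  qed
  then have "isos ?C = Arr ?C" by (auto simp: isos_def grade0_cat_def)
  moreover have "arity P p = 1" if "p \<in> opers P" "\<psi> p = 0" for p using un[OF that] by auto
  ultimately show "(\<forall>p\<in>opers P. \<psi> p = 0 \<longrightarrow> arity P p = 1) \<and> groupoid ?C"
    using cat by (auto simp: groupoid_def)
qed

end

section \<open>The planar twisted arrow category\<close>

lemma chop_concat: "map length xss = ns \<Longrightarrow> chop ns (concat xss) = xss"
  by (induction xss arbitrary: ns) auto

lemma concat_concat_map: "concat (concat xsss) = concat (map concat xsss)"
  by (induction xsss) auto

lemma length_le_concat: "\<forall>x\<in>set xs. f x \<noteq> [] \<Longrightarrow> length xs \<le> length (concat (map f xs))"
proof (induction xs)
  case (Cons x xs)
  then show ?case by (cases "f x") auto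
qed simp

lemma list_all2_concat_split:
  assumes "list_all2 R (concat xss) ys"
  shows "\<exists>yss. ys = concat yss \<and> list_all2 (list_all2 R) xss yss"
  using assms
proof (induction xss arbitrary: ys)
  case (Cons xs xss)
  then obtain us vs where u: "ys = us @ vs" "list_all2 R xs us" "list_all2 R (concat xss) vs"
    by (auto simp: list_all2_append1)
  with Cons.IH obtain yss where "vs = concat yss" "list_all2 (list_all2 R) xss yss" by blast
  with u show ?case by (intro exI[of _ "us # yss"]) auto
qed simp

lemma map2_concat:
  "list_all2 (list_all2 R) xss yss \<Longrightarrow> map2 f (concat xss) (concat yss) = concat (map2 (map2 f) xss yss)"
  by (induction xss yss rule: list_all2_induct) (auto simp: list_all2_lengthD)

section \<open>Planar trees: composability of blocks of vertices\<close>

context planar_operad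
begin

lemma composable_concat_split:
  assumes "map (out P) M = concat (map (ins P) qs)" "set M \<subseteq> opers P" "set qs \<subseteq> opers P"
  shows "\<exists>Ms. M = concat Ms \<and> list_all2 (composable P) qs Ms"
  using assms
proof (induction qs arbitrary: M)
  case (Cons q qs)
  from Cons.prems(1) obtain A B where M: "M = A @ B" "map (out P) A = ins P q" "map (out P) B = concat (map (ins P) qs)"
    by (auto simp: map_eq_append_conv)
  with Cons obtain Ms where "B = concat Ms" "list_all2 (composable P) qs Ms" by auto
  with M Cons.prems show ?case by (intro exI[of _ "A # Ms"]) (auto simp: composable_def[of P q])
qed simp

lemma composable_map_length: "list_all2 (composable P) qs Ms \<Longrightarrow> map length Ms = map (arity P) qs"
  by (induction rule: list_all2_induct) (auto simp: composable_length)

lemma map2_gcomp: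
  assumes "list_all2 (composable P) qs Ms"
  shows "map (out P) (map2 (gcomp P) qs Ms) = map (out P) qs" "set (map2 (gcomp P) qs Ms) \<subseteq> opers P"
    "map (ins P) (map2 (gcomp P) qs Ms) = map (\<lambda>M. concat (map (ins P) M)) Ms"
  using assms by (induction rule: list_all2_induct) (auto simp: gcomp_out gcomp_opers gcomp_ins)

lemma map2_gcomp_arity:
  assumes "list_all2 (composable P) qs Ms"
  shows "sum_list (map (arity P) (map2 (gcomp P) qs Ms)) = sum_list (map (arity P) (concat Ms))"
  using assms by (induction rule: list_all2_induct) (auto simp: gcomp_arity)

lemma composable_map2_gcomp:
  assumes "composable P p qs" "list_all2 (composable P) qs Ms"
  shows "composable P p (map2 (gcomp P) qs Ms)" "composable P (gcomp P p qs) (concat Ms)"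
proof -
  show "composable P p (map2 (gcomp P) qs Ms)"
    using assms map2_gcomp[OF assms(2)] by (simp add: composable_def)
  have "map (out P) (concat Ms) = concat (map (ins P) qs)" "set (concat Ms) \<subseteq> opers P"
    using assms(2) by (induction rule: list_all2_induct) (auto simp: composable_def)
  then show "composable P (gcomp P p qs) (concat Ms)"
    using gcomp_opers[OF assms(1)] gcomp_ins[OF assms(1)] by (simp add: composable_def)
qed

lemma map2_gcomp_assoc:
  assumes "list_all2 (composable P) qs Ms" "list_all2 (list_all2 (composable P)) Ms Bs"
  shows "map2 (gcomp P) (map2 (gcomp P) qs Ms) (map concat Bs) = map2 (gcomp P) qs (map2 (map2 (gcomp P)) Ms Bs)"
    and "list_all2 (composable P) (map2 (gcomp P) qs Ms) (map concat Bs)"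
    and "list_all2 (composable P) qs (map2 (map2 (gcomp P)) Ms Bs)"
  using assms
  by (induction qs Ms arbitrary: Bs rule: list_all2_induct)
    (auto simp: list_all2_Cons1 gcomp_assoc composable_map2_gcomp)

lemma map2_gcomp_ident_left: "set M \<subseteq> opers P \<Longrightarrow> map2 (gcomp P) (map (ident P) (map (out P) M)) (map (\<lambda>m. [m]) M) = M"
  using gcomp_ident_left by (induction M) auto

lemma map2_gcomp_ident_right: "set qs \<subseteq> opers P \<Longrightarrow> map2 (gcomp P) qs (map (\<lambda>q. map (ident P) (ins P q)) qs) = qs"
  using gcomp_ident_right by (induction qs) auto

lemma ptarget_pcomposable:
  assumes "composable P p qs" "pcomposable P q0 i p"
  shows "pcomposable P q0 i (gcomp P p qs)"
  using assms gcomp_opers[OF assms(1)] gcomp_out[OF assms(1)] by (simp add: pcomposable_def)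

lemma ptarget_ins:
  assumes "ptree_arrow P (PTree p q0 i qs)"
  shows "ins P (ptarget P (PTree p q0 i qs)) = take i (ins P q0) @ concat (map (ins P) qs) @ drop (Suc i) (ins P q0)"
    and "ptarget P (PTree p q0 i qs) \<in> opers P" and "out P (ptarget P (PTree p q0 i qs)) = out P q0"
  using assms pcomp_ins[OF ptarget_pcomposable] gcomp_ins pcomp_opers[OF ptarget_pcomposable] pcomp_out[OF ptarget_pcomposable]
  by (simp_all add: ptree_arrow_def ptarget_def)

end

text \<open>A relational form of the \<open>take\<close>, \<open>drop\<close> and
  \<open>chop\<close> in \<open>ptcomp\<close>: \<open>L\<close> and \<open>R\<close> stand over the
  inputs of the lower vertex on either side of the source, and \<open>Ms ! k\<close> over the upper
  vertex \<open>k\<close>. With the groups given as variables, composites can be rewritten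
  directly.\<close>

definition upper_split :: "('c, 'o, 'x) operad_scheme \<Rightarrow> 'o ptree \<Rightarrow> 'o list \<Rightarrow> 'o list list \<Rightarrow> 'o list \<Rightarrow> bool" where
  "upper_split P f L Ms R \<longleftrightarrow> map (out P) L = take (ppos f) (ins P (plower f)) \<and> set L \<subseteq> opers P \<and>
     list_all2 (composable P) (pupper f) Ms \<and>
     map (out P) R = drop (Suc (ppos f)) (ins P (plower f)) \<and> set R \<subseteq> opers P"

context planar_operad
begin

lemma upper_split_exists:
  assumes f: "ptree_arrow P f" and rs: "composable P (ptarget P f) rs"
  obtains L Ms R where "rs = L @ concat Ms @ R" "upper_split P f L Ms R"
proof -
  obtain p q0 i qs where fe: "f = PTree p q0 i qs" by (cases f)
  have "map (out P) rs = take i (ins P q0) @ concat (map (ins P) qs) @ drop (Suc i) (ins P q0)"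
    using rs ptarget_ins[OF f[unfolded fe]] fe by (simp add: composable_def)
  then obtain L V where L: "rs = L @ V" "map (out P) L = take i (ins P q0)"
    "map (out P) V = concat (map (ins P) qs) @ drop (Suc i) (ins P q0)"
    unfolding map_eq_append_conv[of _ rs] by metis
  from L(3) obtain M R where M: "V = M @ R"
    "map (out P) M = concat (map (ins P) qs)" "map (out P) R = drop (Suc i) (ins P q0)"
    unfolding map_eq_append_conv[of _ V] by metis
  note r = L(1)[unfolded M(1)] L(2) M(2,3)
  have o: "set rs \<subseteq> opers P" "set qs \<subseteq> opers P" using rs f fe by (auto simp: composable_def ptree_arrow_def)
  obtain Ms where "M = concat Ms" "list_all2 (composable P) qs Ms"
    using composable_concat_split[OF r(3)] o r(1) by auto
  then show ?thesis using that[of L Ms R] r o fe by (auto simp: upper_split_def)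
qed

text \<open>In the lower vertex an identity keeps the slot of the source open. The last equation
  says that composing the target with a new layer of vertices distributes that layer over the lower
  and the upper vertices, so that targets of composites come out right.\<close>

lemma upper_split_lower:
  assumes f: "ptree_arrow P (PTree p q0 i qs)" and s: "upper_split P (PTree p q0 i qs) L Ms R"
  shows "composable P q0 (L @ [ident P (out P p)] @ R)" "length L = i"
    "composable P (ptarget P (PTree p q0 i qs)) (L @ concat Ms @ R)"
    "gcomp P (ptarget P (PTree p q0 i qs)) (L @ concat Ms @ R) =
     gcomp P q0 (L @ [gcomp P p (map2 (gcomp P) qs Ms)] @ R)"
proof -
  have f': "composable P p qs" "pcomposable P q0 i p" using f by (simp_all add: ptree_arrow_def)
  have s': "map (out P) L = take i (ins P q0)" "set L \<subseteq> opers P" "list_all2 (composable P) qs Ms"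
    "map (out P) R = drop (Suc i) (ins P q0)" "set R \<subseteq> opers P" using s by (simp_all add: upper_split_def)
  have p: "p \<in> opers P" "i < arity P q0" "out P p = ins P q0 ! i" "q0 \<in> opers P" using f' by (auto simp: pcomposable_def)
  show "length L = i" using arg_cong[OF s'(1), of length] p by simp
  show "composable P q0 (L @ [ident P (out P p)] @ R)"
    using p s' ident_opers ident_out out_colours[OF p(1)] unfolding composable_def
    by (simp add: id_take_nth_drop[symmetric])
  note c = composable_map2_gcomp[OF f'(1) s'(3)]
  have t: "ptarget P (PTree p q0 i qs) = pcomp P q0 i (gcomp P p qs)" by (simp add: ptarget_def)
  note g = gcomp_pcomp[OF ptarget_pcomposable[OF f'] c(2) s'(1,2,4,5)]
  show "composable P (ptarget P (PTree p q0 i qs)) (L @ concat Ms @ R)" using g(3) unfolding t .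
  show "gcomp P (ptarget P (PTree p q0 i qs)) (L @ concat Ms @ R) =
     gcomp P q0 (L @ [gcomp P p (map2 (gcomp P) qs Ms)] @ R)"
    using g(1) gcomp_assoc[OF f'(1) s'(3)] unfolding t by simp
qed

lemma ptcomp_split:
  assumes f: "ptree_arrow P (PTree p q0 i qs)" and s: "upper_split P (PTree p q0 i qs) L Ms R"
  shows "ptcomp P (PTree t r0 j (L @ concat Ms @ R)) (PTree p q0 i qs) =
    PTree p (pcomp P r0 j (gcomp P q0 (L @ [ident P (out P p)] @ R))) (j + sum_list (map (arity P) L)) (map2 (gcomp P) qs Ms)"
proof -
  have l: "length L = i" using upper_split_lower[OF f s] by simp
  have m: "map length Ms = map (arity P) qs"
    using s composable_map_length by (simp add: upper_split_def)
  have "length (concat Ms) = sum_list (map (arity P) qs)" unfolding m[symmetric] by (simp add: length_concat)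
  then show ?thesis using l chop_concat[OF m] by (simp add: ptcomp_def Let_def)
qed

lemma ptcomp_arrow:
  assumes f: "ptree_arrow P f" and g: "ptree_arrow P g" and fg: "ptarget P f = psource g"
  shows "ptree_arrow P (ptcomp P g f)" and "ptarget P (ptcomp P g f) = ptarget P g" and "psource (ptcomp P g f) = psource f"
proof -
  obtain p q0 i qs where fe: "f = PTree p q0 i qs" by (cases f)
  obtain t r0 j rs where ge: "g = PTree t r0 j rs" by (cases g)
  have t: "t = ptarget P (PTree p q0 i qs)" using fg fe ge by simp
  have g': "composable P t rs" "pcomposable P r0 j t" using g ge by (simp_all add: ptree_arrow_def)
  obtain L Ms R where r: "rs = L @ concat Ms @ R" "upper_split P f L Ms R"
    using upper_split_exists[OF f, of rs] g'(1) t fe by metis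
  note f1 = f[unfolded fe] and s1 = r(2)[unfolded fe]
  have f': "composable P p qs" "pcomposable P q0 i p" using f1 by (simp_all add: ptree_arrow_def)
  have la: "list_all2 (composable P) qs Ms" using s1 by (simp add: upper_split_def)
  note low = upper_split_lower[OF f1 s1]
  note e = ptcomp_split[OF f1 s1, of t r0 j]
  let ?W = "gcomp P q0 (L @ [ident P (out P p)] @ R)" and ?X = "gcomp P p (map2 (gcomp P) qs Ms)"
  note cX = composable_map2_gcomp(1)[OF f'(1) la]
  have oX: "?X \<in> opers P" "out P ?X = out P p" "p \<in> opers P"
    using gcomp_opers[OF cX] gcomp_out[OF cX] f' by (auto simp: composable_def)
  have rW: "pcomposable P r0 j ?W"
    using g'(2) gcomp_opers[OF low(1)] gcomp_out[OF low(1)] ptarget_ins(3)[OF f1] unfolding t by (simp add: pcomposable_def)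
  \<comment> \<open>The same open slot is filled with the source \<open>p\<close> for
    well-formedness and with \<open>?X\<close>, the source with its upper vertices, for the
    target.\<close>
  note Wp = pcomp_replace_ident[OF low(1) oX(3)]
  note WX = pcomp_replace_ident[of q0 L ?X R, unfolded oX(2), OF low(1) oX(1)]
  show "ptree_arrow P (ptcomp P g f)"
    unfolding fe ge r(1) e ptree_arrow_def using pcomp_pcomp(3)[OF rW Wp(2)] cX by simp
  show "psource (ptcomp P g f) = psource f" unfolding fe ge r(1) e by simp
  show "ptarget P (ptcomp P g f) = ptarget P g"
    unfolding fe ge r(1) e
    using pcomp_pcomp(1)[OF rW WX(2)] WX(1) low(4) unfolding t by (simp add: ptarget_def)
qed

text \<open>The upper vertices of \<open>h\<close> are grouped over those of \<open>g\<close>, and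
  the groups \<open>Ns\<close> are cut again into \<open>A\<close>, \<open>Bs\<close> and
  \<open>D\<close> according to the position of the vertices of \<open>g\<close> over
  \<open>f\<close>. Upper vertices then agree by associativity. Both lower vertices become
  \<open>s0\<close> composed with \<open>r0(L',?Z,R')\<close>, where \<open>?Z\<close> is
  \<open>q0\<close> with two layers grafted beside the open slot.\<close>

lemma ptcomp_assoc:
  assumes f: "ptree_arrow P f" and g: "ptree_arrow P g" and h: "ptree_arrow P h"
    and fg: "ptarget P f = psource g" and gh: "ptarget P g = psource h"
  shows "ptcomp P h (ptcomp P g f) = ptcomp P (ptcomp P h g) f"
proof -
  obtain p q0 i qs where fe: "f = PTree p q0 i qs" by (cases f)
  obtain t r0 j rs where ge: "g = PTree t r0 j rs" by (cases g)
  obtain u s0 k ss where he: "h = PTree u s0 k ss" by (cases h)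
  have t: "t = ptarget P (PTree p q0 i qs)" using fg fe ge by simp
  have u: "u = ptarget P (PTree t r0 j rs)" using gh he ge by simp
  have g': "composable P t rs" "pcomposable P r0 j t" using g ge by (simp_all add: ptree_arrow_def)
  have h': "composable P u ss" "pcomposable P s0 k u" using h he by (simp_all add: ptree_arrow_def)
  obtain L Ms R where r: "rs = L @ concat Ms @ R" "upper_split P f L Ms R"
    using upper_split_exists[OF f, of rs] g'(1) t fe by metis
  obtain L' Ns R' where s: "ss = L' @ concat Ns @ R'" "upper_split P g L' Ns R'"
    using upper_split_exists[OF g, of ss] h'(1) u ge by metis
  have la: "list_all2 (composable P) qs Ms" using r(2) fe by (simp add: upper_split_def)
  have "list_all2 (composable P) (L @ concat Ms @ R) Ns" using s(2) ge r(1) by (simp add: upper_split_def)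
  then obtain A B D where N: "Ns = A @ B @ D" "list_all2 (composable P) L A"
    "list_all2 (composable P) (concat Ms) B" "list_all2 (composable P) R D"
    by (auto simp: list_all2_append1)
  then obtain Bs where B: "B = concat Bs" "list_all2 (list_all2 (composable P)) Ms Bs"
    using list_all2_concat_split by blast
  note f1 = f[unfolded fe] and s1 = r(2)[unfolded fe]
  note g1 = g[unfolded ge r(1)] and s2 = s(2)[unfolded ge r(1) N(1) B(1)]
  note low1 = upper_split_lower[OF f1 s1] and low2 = upper_split_lower[OF g1 s2]
  let ?id = "ident P (out P p)"
  let ?L2 = "map2 (gcomp P) L A" and ?R2 = "map2 (gcomp P) R D" and ?M2 = "map2 (map2 (gcomp P)) Ms Bs"
  let ?W = "gcomp P q0 (L @ [?id] @ R)"
  have lens: "length L = length A" "length R = length D" "length (concat Ms) = length (concat Bs)"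
    using N B by (auto dest: list_all2_lengthD)
  have m2: "map2 (gcomp P) (L @ concat Ms @ R) (A @ concat Bs @ D) = ?L2 @ concat ?M2 @ ?R2"
    using lens map2_concat[OF B(2)] by simp
  have gf: "ptcomp P g f = PTree p (pcomp P r0 j ?W) (j + sum_list (map (arity P) L)) (map2 (gcomp P) qs Ms)"
    unfolding fe ge r(1) by (rule ptcomp_split[OF f1 s1])
  have hg: "ptcomp P h g = PTree t (pcomp P s0 k (gcomp P r0 (L' @ [ident P (out P t)] @ R')))
      (k + sum_list (map (arity P) L')) (?L2 @ concat ?M2 @ ?R2)"
    unfolding ge he s(1) r(1) N(1) B(1) m2[symmetric] by (rule ptcomp_split[OF g1 s2])
  have s3: "upper_split P (PTree p q0 i qs) ?L2 ?M2 ?R2"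
    using s1 map2_gcomp[OF N(2)] map2_gcomp[OF N(4)] map2_gcomp_assoc[OF la B(2)] by (simp add: upper_split_def)
  note low3 = upper_split_lower[OF f1 s3]
  let ?Z = "gcomp P q0 (?L2 @ [?id] @ ?R2)"
  have l: "ptcomp P (ptcomp P h g) f = PTree p (pcomp P (pcomp P s0 k (gcomp P r0 (L' @ [ident P (out P t)] @ R')))
      (k + sum_list (map (arity P) L')) ?Z) (k + sum_list (map (arity P) L') + sum_list (map (arity P) ?L2)) (map2 (gcomp P) qs ?M2)"
    unfolding hg fe by (rule ptcomp_split[OF f1 s3])
  have idc: "composable P ?id [?id]" "gcomp P ?id [?id] = ?id" "?id \<in> opers P" "ins P ?id = [out P p]"
    using f1 out_colours ident_opers ident_out ident_ins gcomp_ident_left[of ?id]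
    by (auto simp: ptree_arrow_def composable_def)
  have la2: "list_all2 (composable P) (L @ [?id] @ R) (A @ [[?id]] @ D)"
    using N idc by (auto intro!: list_all2_appendI)
  have WZ: "gcomp P ?W (concat A @ [?id] @ concat D) = ?Z"
    using gcomp_assoc[OF low1(1) la2] lens idc by simp
  have cW: "composable P ?W (concat A @ [?id] @ concat D)"
    using composable_map2_gcomp(2)[OF low1(1) la2] by simp
  have oW: "?W \<in> opers P" "out P ?W = out P t"
    using gcomp_opers[OF low1(1)] gcomp_out[OF low1(1)] ptarget_ins(3)[OF f1] t by auto
  have rW: "pcomposable P r0 j ?W" using g'(2) oW by (simp add: pcomposable_def)
  have s2': "map (out P) L' = take j (ins P r0)" "set L' \<subseteq> opers P" "map (out P) R' = drop (Suc j) (ins P r0)" "set R' \<subseteq> opers P"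
    using s2 by (simp_all add: upper_split_def)
  have pidx: "pcomposable P ?W (sum_list (map (arity P) L)) p"
    by (rule pcomp_replace_ident(2)[OF low1(1)]) (use f1 in \<open>simp add: ptree_arrow_def composable_def\<close>)
  have outs: "map (out P) (concat X) = concat (map (ins P) Y)" "set (concat X) \<subseteq> opers P" if "list_all2 (composable P) Y X" for X Y
    using that by (induction rule: list_all2_induct) (auto simp: composable_def)
  have mm: "sum_list (map (arity P) L) = length (concat (map (ins P) L))" by (simp add: length_concat o_def)
  have jl: "j < arity P r0" using g'(2) by (simp add: pcomposable_def)
  have iW: "ins P (pcomp P r0 j ?W) = take j (ins P r0) @ (concat (map (ins P) L) @ [out P p] @ concat (map (ins P) R)) @
      drop (Suc j) (ins P r0)"
    using pcomp_ins[OF rW] gcomp_ins[OF low1(1)] idc(4) by simp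
  have s4: "upper_split P (ptcomp P g f) (L' @ concat A) (map concat Bs) (concat D @ R')"
    unfolding upper_split_def gf
    using s2' outs[OF N(2)] outs[OF N(4)] map2_gcomp_assoc(2)[OF la B(2)] jl iW
    by (simp add: mm)
  have a: "ptree_arrow P (ptcomp P g f)" by (rule ptcomp_arrow[OF f g fg])
  have ss: "ss = (L' @ concat A) @ concat (map concat Bs) @ (concat D @ R')"
    unfolding s(1) N(1) B(1) by (simp add: concat_concat_map)
  have r': "ptcomp P h (ptcomp P g f) = PTree p (pcomp P s0 k (gcomp P (pcomp P r0 j ?W) ((L' @ concat A) @ [?id] @ concat D @ R')))
      (k + sum_list (map (arity P) (L' @ concat A))) (map2 (gcomp P) (map2 (gcomp P) qs Ms) (map concat Bs))"
    unfolding he ss gf by (rule ptcomp_split[OF a[unfolded gf] s4[unfolded gf]])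
  have e1: "gcomp P (pcomp P r0 j ?W) ((L' @ concat A) @ [?id] @ concat D @ R') = gcomp P r0 (L' @ [?Z] @ R')"
    using gcomp_pcomp(1)[OF rW cW s2'] unfolding WZ by simp
  have oZ: "?Z \<in> opers P" "out P ?Z = out P t"
    using gcomp_opers[OF low3(1)] gcomp_out[OF low3(1)] ptarget_ins(3)[OF f1] t by auto
  note Y = pcomp_replace_ident[of r0 L' ?Z R', unfolded oZ(2), OF low2(1) oZ(1)]
  have sY: "pcomposable P s0 k (gcomp P r0 (L' @ [ident P (out P t)] @ R'))"
    using h'(2) gcomp_opers[OF low2(1)] gcomp_out[OF low2(1)] ptarget_ins(3)[OF g1] u r(1)
    by (simp add: pcomposable_def)
  have e2: "pcomp P (pcomp P s0 k (gcomp P r0 (L' @ [ident P (out P t)] @ R'))) (k + sum_list (map (arity P) L')) ?Z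
     = pcomp P s0 k (gcomp P r0 (L' @ [?Z] @ R'))"
    using pcomp_pcomp(1)[OF sY Y(2)] Y(1) by simp
  show ?thesis
    unfolding l r' e1 e2 using map2_gcomp_arity[OF N(2)] map2_gcomp_assoc(1)[OF la B(2)] by simp
qed

text \<open>Nothing can be grafted on a nullary vertex, so it would remain nullary in the composite,
  whose vertices are identities and have one input.\<close>

lemma no_nullary_if_left_inverse:
  assumes f: "ptree_arrow P f" and g: "ptree_arrow P g" and fg: "ptarget P f = psource g"
    and inv: "ptcomp P g f = pid P (psource f)" and q: "q \<in> set (pupper f)"
  shows "ins P q \<noteq> []"
proof
  assume n: "ins P q = []"
  obtain p q0 i qs where fe: "f = PTree p q0 i qs" by (cases f)
  obtain t r0 j rs where ge: "g = PTree t r0 j rs" by (cases g)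
  have t: "t = ptarget P f" using fg ge by simp
  have "composable P t rs" using g ge by (simp add: ptree_arrow_def)
  then obtain L Ms R where r: "rs = L @ concat Ms @ R" "upper_split P f L Ms R"
    using upper_split_exists[OF f, of rs] t by metis
  have la: "list_all2 (composable P) qs Ms" using r(2) fe by (simp add: upper_split_def)
  have pp: "p \<in> opers P" using f fe by (simp add: ptree_arrow_def composable_def)
  have "map2 (gcomp P) qs Ms = map (ident P) (ins P p)"
    using inv ptcomp_split[OF f[unfolded fe] r(2)[unfolded fe], of t r0 j] unfolding ge fe r(1) by (simp add: pid_def)
  moreover obtain k where k: "k < length qs" "q = qs ! k" using q fe by (auto simp: in_set_conv_nth)
  moreover have kM: "k < length Ms" "composable P q (Ms ! k)" using la k by (auto simp: list_all2_conv_all_nth)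
  ultimately have "gcomp P q (Ms ! k) \<in> set (map (ident P) (ins P p))"
    by (metis (no_types, lifting) nth_mem length_map length_zip min_less_iff_conj nth_map nth_zip split_conv)
  then obtain c where "c \<in> colours P" "gcomp P q (Ms ! k) = ident P c" using ins_colour[OF pp] by auto
  moreover have "Ms ! k = []" using composable_length[OF kM(2)] n by simp
  ultimately show False using gcomp_ins[OF kM(2)] ident_ins[of c] by simp
qed

text \<open>Without nullary vertices every vertex contributes at least one leaf. An identity has one
  input, so nothing stands beside the source over the lower vertex, and each block over an upper
  vertex consists of a single vertex.\<close>

lemma pvertices_if_left_inverse:
  assumes f: "ptree_arrow P f" and g: "ptree_arrow P g" and fg: "ptarget P f = psource g"
    and inv: "ptcomp P g f = pid P (psource f)"
    and nz: "\<forall>q\<in>set (pupper f) \<union> set (pupper g). ins P q \<noteq> []"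
  shows "\<forall>v\<in>set (pupper f). \<exists>w\<in>set (pupper g). composable P v [w] \<and> gcomp P v [w] = ident P (out P v)"
    and "composable P (plower g) [plower f] \<and> gcomp P (plower g) [plower f] = ident P (out P (plower g))"
proof -
  obtain p q0 i qs where fe: "f = PTree p q0 i qs" by (cases f)
  obtain t r0 j rs where ge: "g = PTree t r0 j rs" by (cases g)
  have t: "t = ptarget P f" using fg ge by simp
  have g': "composable P t rs" "pcomposable P r0 j t" using g ge by (simp_all add: ptree_arrow_def)
  then obtain L Ms R where r: "rs = L @ concat Ms @ R" "upper_split P f L Ms R"
    using upper_split_exists[OF f, of rs] t by metis
  note f1 = f[unfolded fe] and s1 = r(2)[unfolded fe]
  note low = upper_split_lower[OF f1 s1]
  have la: "list_all2 (composable P) qs Ms" using s1 by (simp add: upper_split_def)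
  have pp: "p \<in> opers P" using f fe by (simp add: ptree_arrow_def composable_def)
  let ?W = "gcomp P q0 (L @ [ident P (out P p)] @ R)"
  have e: "map2 (gcomp P) qs Ms = map (ident P) (ins P p)" "pcomp P r0 j ?W = ident P (out P p)"
    "j + sum_list (map (arity P) L) = 0"
    using inv ptcomp_split[OF f1 s1, of t r0 j] unfolding ge fe r(1) pid_def ptree.sel by (metis ptree.inject)+
  \<comment> \<open>The source is attached at position 0 of the composite lower vertex, and an entry
    of \<open>L\<close> would put an input to its left.\<close>
  have L: "L = []" using e(3) nz ge r(1) by (cases L) auto
  have qq: "q0 \<in> opers P" "i < arity P q0" using f1 by (auto simp: ptree_arrow_def pcomposable_def)
  have oW: "?W \<in> opers P" "out P ?W = out P t"
    using gcomp_opers[OF low(1)] gcomp_out[OF low(1)] ptarget_ins(3)[OF f1] t fe by auto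
  have rW: "pcomposable P r0 j ?W" using g'(2) oW by (simp add: pcomposable_def)
  have idp: "ins P (ident P (out P p)) = [out P p]" using ident_ins out_colours[OF pp] by blast
  have iW: "ins P ?W = out P p # concat (map (ins P) R)" using gcomp_ins[OF low(1)] L idp by simp
  have i1: "take j (ins P r0) @ ins P ?W @ drop (Suc j) (ins P r0) = [out P p]"
    using pcomp_ins[OF rW] e(2) idp by simp
  then have R: "R = []" and j0: "j = 0" and d: "drop (Suc 0) (ins P r0) = []"
    using nz ge r(1) e(3) unfolding iW by (cases R; auto)+
  have i0: "i = 0" using low(2) L by simp
  have len: "arity P q0 = 1" using composable_length[OF low(1)] L R by simp
  have ro: "r0 \<in> opers P" "0 < arity P r0" using g'(2) by (auto simp: pcomposable_def)
  have lenr: "arity P r0 = 1" using d ro by (cases "ins P r0") auto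
  have "ins P q0 = [out P p]" using low(1) L R ident_out[OF out_colours[OF pp]] by (simp add: composable_def)
  then have W: "?W = q0" using gcomp_ident_right[OF qq(1)] L R by simp
  have c: "composable P r0 [q0]" using pcomposable_composable[OF rW] lenr j0 W by (cases "ins P r0") auto
  have "gcomp P r0 [q0] = ident P (out P p)" using e(2) W j0 lenr unfolding pcomp_def by (cases "ins P r0") auto
  moreover from this have "out P r0 = out P p" using gcomp_out[OF c] ident_out[OF out_colours[OF pp]] by simp
  ultimately show "composable P (plower g) [plower f] \<and> gcomp P (plower g) [plower f] = ident P (out P (plower g))"
    using c fe ge by simp
  show "\<forall>v\<in>set (pupper f). \<exists>w\<in>set (pupper g). composable P v [w] \<and> gcomp P v [w] = ident P (out P v)"
  proof
    fix v assume "v \<in> set (pupper f)"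
    then obtain k where k: "k < length qs" "v = qs ! k" using fe by (auto simp: in_set_conv_nth)
    have kM: "k < length Ms" "composable P v (Ms ! k)" using la k by (auto simp: list_all2_conv_all_nth)
    have kp: "length (ins P p) = length qs" using arg_cong[OF e(1), of length] la by (simp add: list_all2_lengthD)
    have "gcomp P v (Ms ! k) = ident P (ins P p ! k)"
      using arg_cong[OF e(1), of "\<lambda>x. x ! k"] k kM kp by simp
    moreover have ck: "ins P p ! k \<in> colours P" using ins_colour[OF pp] k kp by simp
    ultimately have o: "out P v = ins P p ! k" "concat (map (ins P) (Ms ! k)) = [ins P p ! k]"
      using gcomp_out[OF kM(2)] gcomp_ins[OF kM(2)] ident_out ident_ins by auto
    have nzM: "\<forall>m\<in>set (Ms ! k). ins P m \<noteq> []" using nz ge r(1) kM(1) nth_mem by auto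
    then have "length (Ms ! k) \<le> length (concat (map (ins P) (Ms ! k)))" by (rule length_le_concat)
    then have "length (Ms ! k) \<le> 1" using o(2) by simp
    moreover have "Ms ! k \<noteq> []" using o(2) by auto
    ultimately obtain m where m: "Ms ! k = [m]" by (cases "Ms ! k") auto
    then have "m \<in> set (pupper g)" using ge r(1) nth_mem[OF kM(1)] by force
    then show "\<exists>w\<in>set (pupper g). composable P v [w] \<and> gcomp P v [w] = ident P (out P v)"
      using \<open>gcomp P v (Ms ! k) = _\<close> kM(2) m o(1) by auto
  qed
qed

section \<open>Identities, category axioms and isomorphisms in the planar case\<close>

lemma pid_arrow:
  assumes "p \<in> opers P"
  shows "ptree_arrow P (pid P p)" "ptarget P (pid P p) = p"
  using composable_idents[OF assms] pcomposable_ident_left[OF assms] pcomp_ident_left[OF assms] gcomp_ident_right[OF assms]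
  by (auto simp: pid_def ptree_arrow_def ptarget_def)

lemma ptcomp_pid_right:
  assumes f: "ptree_arrow P f"
  shows "ptcomp P f (pid P (psource f)) = f"
proof -
  obtain p q0 i qs where fe: "f = PTree p q0 i qs" by (cases f)
  have c: "composable P p qs" "pcomposable P q0 i p" "p \<in> opers P" using f fe by (auto simp: ptree_arrow_def composable_def)
  have o: "set qs \<subseteq> opers P" "map (out P) qs = ins P p" using c by (auto simp: composable_def)
  let ?id = "ident P (out P p)" and ?Ms = "map (\<lambda>q. [q]) qs"
  have idc: "composable P ?id [?id]" "gcomp P ?id [?id] = ?id" "ins P ?id = [out P p]"
    using c(3) out_colours ident_opers ident_out ident_ins gcomp_ident_left[of ?id] by (auto simp: composable_def)
  have "list_all2 (composable P) (map (ident P) (map (out P) qs)) ?Ms"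
    using composable_ident o(1) by (auto simp: list_all2_map1 list_all2_map2 list_all2_same)
  then have s: "upper_split P (PTree p ?id 0 (map (ident P) (ins P p))) [] ?Ms []"
    using idc unfolding upper_split_def o(2) by simp
  have "ptcomp P (PTree p q0 i ([] @ concat ?Ms @ [])) (PTree p ?id 0 (map (ident P) (ins P p))) =
    PTree p (pcomp P q0 i ?id) i (map2 (gcomp P) (map (ident P) (ins P p)) ?Ms)"
    using ptcomp_split[OF _ s, of p q0 i] pid_arrow(1)[OF c(3)] idc unfolding pid_def by simp
  also have "map2 (gcomp P) (map (ident P) (ins P p)) ?Ms = qs" using map2_gcomp_ident_left[OF o(1)] unfolding o(2) .
  also have "pcomp P q0 i ?id = q0"
    using pcomp_ident_right[of q0 i] c(2) by (simp add: pcomposable_def)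
  finally show ?thesis unfolding fe by (simp add: pid_def)
qed

lemma ptcomp_pid_left:
  assumes f: "ptree_arrow P f"
  shows "ptcomp P (pid P (ptarget P f)) f = f"
proof -
  obtain p q0 i qs where fe: "f = PTree p q0 i qs" by (cases f)
  note f1 = f[unfolded fe]
  have c: "composable P p qs" "pcomposable P q0 i p" using f1 by (auto simp: ptree_arrow_def)
  have o: "set qs \<subseteq> opers P" "map (out P) qs = ins P p" "q0 \<in> opers P" "i < arity P q0" "out P p = ins P q0 ! i"
    using c by (auto simp: composable_def pcomposable_def)
  let ?t = "ptarget P (PTree p q0 i qs)"
  note t = ptarget_ins[OF f1]
  let ?L = "map (ident P) (take i (ins P q0))" and ?R = "map (ident P) (drop (Suc i) (ins P q0))"
  let ?Ms = "map (\<lambda>q. map (ident P) (ins P q)) qs"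
  have s0: "set (take i (ins P q0)) \<subseteq> colours P" "set (drop (Suc i) (ins P q0)) \<subseteq> colours P"
    using ins_colours[OF o(3)] set_take_subset set_drop_subset by (metis subset_trans)+
  have s: "upper_split P (PTree p q0 i qs) ?L ?Ms ?R"
    unfolding upper_split_def using idents_out[OF s0(1)] idents_out[OF s0(2)] idents_opers[OF s0(1)] idents_opers[OF s0(2)]
      composable_idents o(1) by (auto simp: list_all2_map2 list_all2_same simp del: map_map)
  have m: "sum_list (map (arity P) ?L) = i"
    using arg_cong[OF idents_ins[OF s0(1)], of length] o(4) by (simp add: length_concat o_def)
  have e: "map (ident P) (ins P ?t) = ?L @ concat ?Ms @ ?R" unfolding t(1) by (simp add: map_concat o_def)
  have "ptcomp P (pid P ?t) (PTree p q0 i qs) =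
      PTree p (pcomp P (ident P (out P ?t)) 0 (gcomp P q0 (?L @ [ident P (out P p)] @ ?R))) (0 + i) (map2 (gcomp P) qs ?Ms)"
    unfolding pid_def e using ptcomp_split[OF f1 s, of ?t "ident P (out P ?t)" 0] m by simp
  also have "?L @ [ident P (out P p)] @ ?R = map (ident P) (ins P q0)"
    using arg_cong[OF id_take_nth_drop[OF o(4)], of "map (ident P)"] o(5) by simp
  also have "gcomp P q0 \<dots> = q0" by (rule gcomp_ident_right[OF o(3)])
  also have "pcomp P (ident P (out P ?t)) 0 q0 = q0" using pcomp_ident_left[OF o(3)] t(3) by simp
  also have "map2 (gcomp P) qs ?Ms = qs" by (rule map2_gcomp_ident_right[OF o(1)])
  finally show ?thesis unfolding fe by simp
qed

lemma ptree_arrow_objects: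
  assumes "ptree_arrow P f"
  shows "psource f \<in> opers P" "ptarget P f \<in> opers P"
  using assms ptarget_ins(2) by (cases f; simp add: ptree_arrow_def composable_def)+

lemma category_planar_Tw: "category (planar_Tw P)"
proof (rule category.intro, unfold planar_Tw_def cat.simps mem_Collect_eq)
  fix f g h assume "ptree_arrow P f" "ptree_arrow P g" "ptree_arrow P h" "ptarget P f = psource g" "ptarget P g = psource h"
  then show "ptcomp P h (ptcomp P g f) = ptcomp P (ptcomp P h g) f" by (rule ptcomp_assoc)
next
  fix f g assume "ptree_arrow P f" "ptree_arrow P g" "ptarget P f = psource g"
  then show "ptree_arrow P (ptcomp P g f)" "psource (ptcomp P g f) = psource f" "ptarget P (ptcomp P g f) = ptarget P g"
    by (rule ptcomp_arrow)+
next
  fix p assume "p \<in> opers P"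
  then show "ptree_arrow P (pid P p)" "ptarget P (pid P p) = p" by (rule pid_arrow)+
  show "psource (pid P p) = p" by (simp add: pid_def)
qed (rule ptree_arrow_objects ptcomp_pid_left ptcomp_pid_right, assumption)+

lemma ptcomp_cases:
  assumes f: "ptree_arrow P f" and g: "ptree_arrow P g" and fg: "ptarget P f = psource g"
  obtains p q0 i qs r0 j L Ms R where "f = PTree p q0 i qs" "g = PTree (ptarget P f) r0 j (L @ concat Ms @ R)"
    "upper_split P (PTree p q0 i qs) L Ms R" "list_all2 (composable P) qs Ms"
    "composable P q0 (L @ [ident P (out P p)] @ R)" "length L = i"
    "pcomposable P r0 j (gcomp P q0 (L @ [ident P (out P p)] @ R))" "p \<in> opers P"
    "ptcomp P g f = PTree p (pcomp P r0 j (gcomp P q0 (L @ [ident P (out P p)] @ R)))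
      (j + sum_list (map (arity P) L)) (map2 (gcomp P) qs Ms)"
proof -
  obtain p q0 i qs where fe: "f = PTree p q0 i qs" by (cases f)
  obtain t r0 j rs where ge: "g = PTree t r0 j rs" by (cases g)
  have t: "t = ptarget P f" using fg ge by simp
  have g': "composable P t rs" "pcomposable P r0 j t" using g ge by (simp_all add: ptree_arrow_def)
  then obtain L Ms R where r: "rs = L @ concat Ms @ R" "upper_split P f L Ms R"
    using upper_split_exists[OF f, of rs] t by metis
  note f1 = f[unfolded fe] and s1 = r(2)[unfolded fe]
  note low = upper_split_lower[OF f1 s1]
  have "pcomposable P r0 j (gcomp P q0 (L @ [ident P (out P p)] @ R))"
    using g'(2) gcomp_opers[OF low(1)] gcomp_out[OF low(1)] ptarget_ins(3)[OF f1] unfolding t fe by (simp add: pcomposable_def)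
  moreover have "list_all2 (composable P) qs Ms" "p \<in> opers P"
    using s1 f1 by (simp_all add: upper_split_def ptree_arrow_def composable_def)
  ultimately show ?thesis
    using that[OF fe ge[unfolded r(1) t] s1] low ptcomp_split[OF f1 s1, of t r0 j] unfolding fe ge r(1) t by blast
qed

lemma planar_isos_invertible:
  assumes f: "f \<in> isos (planar_Tw P)" and v: "v \<in> pvertices f"
  shows "invertible P v"
proof -
  obtain g where g: "ptree_arrow P f" "ptree_arrow P g" "psource g = ptarget P f" "ptarget P g = psource f"
    "ptcomp P g f = pid P (psource f)" "ptcomp P f g = pid P (psource g)"
    using f by (auto simp: isos_def planar_Tw_def)
  have nz: "\<forall>q\<in>set (pupper f) \<union> set (pupper g). ins P q \<noteq> []"
    using no_nullary_if_left_inverse[OF g(1,2) g(3)[symmetric] g(5)]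
      no_nullary_if_left_inverse[OF g(2,1) g(4) g(6)] by blast
  note a = pvertices_if_left_inverse[OF g(1,2) g(3)[symmetric] g(5) nz]
  note b = pvertices_if_left_inverse[OF g(2,1) g(4) g(6) nz[unfolded Un_commute[of "set (pupper f)"]]]
  have "invertible P (plower f)" using invertible_two_sided a(2) b(2) by blast
  moreover have "invertible P v" if "v \<in> set (pupper f)"
  proof -
    obtain w where w: "w \<in> set (pupper g)" "composable P v [w]" "gcomp P v [w] = ident P (out P v)"
      using a(1) \<open>v \<in> set (pupper f)\<close> by blast
    obtain u where "composable P w [u]" "gcomp P w [u] = ident P (out P w)" using b(1) w(1) by blast
    with w show ?thesis using invertible_two_sided by blast
  qed
  ultimately show ?thesis using v by (auto simp: pvertices_def)
qed

lemma op_inv_composable: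
  assumes "invertible P v"
  shows "composable P v [op_inv P v]" "composable P (op_inv P v) [v]"
  using op_inv(1-4)[OF assms] by (simp_all add: composable_def)

lemma planar_isosI:
  assumes "ptree_arrow P f" "\<forall>v\<in>pvertices f. invertible P v"
  shows "f \<in> isos (planar_Tw P)"
proof -
  interpret C: category "planar_Tw P" by (rule category_planar_Tw)
  let ?E = "{f. ptree_arrow P f \<and> (\<forall>v\<in>pvertices f. invertible P v)}"
  have "?E \<subseteq> isos (planar_Tw P)"
  proof (rule C.isos_if_left_inverses)
    show "?E \<subseteq> Arr (planar_Tw P)" by (auto simp: planar_Tw_def)
    fix f assume "f \<in> ?E"
    then obtain p q0 i qs where fe: "f = PTree p q0 i qs" and f: "ptree_arrow P (PTree p q0 i qs)"
      and inv: "invertible P q0" "\<forall>q\<in>set qs. invertible P q"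
      by (cases f) (auto simp: pvertices_def)
    have c: "composable P p qs" "pcomposable P q0 i p" "p \<in> opers P"
      using f by (auto simp: ptree_arrow_def composable_def)
    note q0 = op_inv[OF inv(1)]
    have i: "i = 0" "ins P q0 = [out P p]" using c(2) q0(4) by (auto simp: pcomposable_def)
    have qs: "set qs \<subseteq> opers P" "map (out P) qs = ins P p" using c(1) by (auto simp: composable_def)
    let ?t = "ptarget P f" and ?Ms = "map (\<lambda>q. [op_inv P q]) qs"
    have t: "ins P ?t = concat (map (ins P) qs)" "out P ?t = out P q0" "?t \<in> opers P"
      using ptarget_ins[OF f] i unfolding fe by auto
    have ct: "concat (map (ins P) qs) = map (out P) (map (op_inv P) qs)"
      using inv(2)
    proof (induction qs)
      case (Cons q qs)
      then show ?case using op_inv(4)[of P q] by simp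
    qed simp
    \<comment> \<open>As all vertices are unary, upper vertex \<open>k\<close> contributes exactly
      input \<open>k\<close> of the target, so the inverse carries the inverse operation at the same
      place. Only the left inverse equation is needed by
      \<open>isos_if_left_inverses\<close>.\<close>
    let ?g = "PTree ?t (op_inv P q0) 0 (map (op_inv P) qs)"
    have o: "set (map (op_inv P) qs) \<subseteq> opers P" using inv(2) op_inv(2)[of P] by auto
    have "composable P ?t (map (op_inv P) qs)"
      using o t ct by (simp add: composable_def)
    then have ga: "ptree_arrow P ?g" using q0 t by (simp add: ptree_arrow_def pcomposable_def)
    have s: "upper_split P (PTree p q0 i qs) [] ?Ms []"
      using i inv(2) op_inv_composable(1) by (auto simp: upper_split_def list_all2_map2 list_all2_same)
    have "ptcomp P (PTree ?t (op_inv P q0) 0 ([] @ concat ?Ms @ [])) (PTree p q0 i qs) =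
      PTree p (pcomp P (op_inv P q0) 0 (gcomp P q0 [ident P (out P p)])) 0 (map2 (gcomp P) qs ?Ms)"
      using ptcomp_split[OF f s, of ?t "op_inv P q0" 0] by simp
    also have "concat ?Ms = map (op_inv P) qs" by (induction qs) auto
    also have "gcomp P q0 [ident P (out P p)] = q0" using gcomp_ident_right[OF q0(1)] i by simp
    also have "pcomp P (op_inv P q0) 0 q0 = ident P (out P p)" using q0 i by (simp add: pcomp_def)
    also have "map2 (gcomp P) qs ?Ms = map (ident P) (map (out P) qs)"
      using inv(2) op_inv(5)[of P] by (induction qs) auto
    finally have e: "ptcomp P ?g f = pid P p" unfolding fe pid_def qs(2) by simp
    have "\<forall>v\<in>pvertices ?g. invertible P v" using q0(7) inv(2) op_inv(7)[of P] by (auto simp: pvertices_def)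
    then show "\<exists>g\<in>?E. Dom (planar_Tw P) g = Cod (planar_Tw P) f \<and> Comp (planar_Tw P) g f = Id (planar_Tw P) (Dom (planar_Tw P) f)"
      using ga e fe by (intro bexI[of _ ?g]) (auto simp: planar_Tw_def)
  qed
  then show ?thesis using assms by blast
qed

end

section \<open>The factorization in the planar case\<close>

context graded_operad
begin

abbreviation "pR \<equiv> R_eq_minus1 P \<psi> (planar_Tw P) pvertices (\<lambda>_. True)"

text \<open>The lower vertex has an input, so it cannot have grading -1 and must be an identity. All
  the freedom is in the upper vertices, each an identity or nullary.\<close>

lemma pR_cases:
  assumes "l \<in> pR"
  obtains p ls where "l = PTree p (ident P (out P p)) 0 ls" "p \<in> opers P" "composable P p ls" "ptree_arrow P l"
    "\<forall>k<length ls. ls ! k = ident P (ins P p ! k) \<or> \<psi> (ls ! k) = - 1 \<and> ins P (ls ! k) = []"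
    "ptarget P l = gcomp P p ls"
proof -
  obtain p q0 i qs where l: "l = PTree p q0 i qs" by (cases l)
  have a: "ptree_arrow P l" and v: "\<forall>q\<in>insert q0 (set qs). q \<in> ident P ` colours P \<or> \<psi> q = - 1"
    using assms l by (auto simp: R_eq_minus1_def planar_Tw_def pvertices_def)
  have c: "composable P p qs" "pcomposable P q0 i p" "p \<in> opers P" using a l by (auto simp: ptree_arrow_def composable_def)
  have q0: "q0 \<in> opers P" "i < arity P q0" "out P p = ins P q0 ! i" using c by (auto simp: pcomposable_def)
  have "\<psi> q0 \<noteq> - 1" using grading_minus1[OF q0(1)] q0(2) by auto
  then obtain d where "q0 = ident P d" "d \<in> colours P" using v by blast
  moreover from this have "ins P q0 = [d]" using ident_ins by simp
  ultimately have q: "q0 = ident P (out P p)" "i = 0" using q0(2,3) by simp_all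
  have "qs ! k = ident P (ins P p ! k) \<or> \<psi> (qs ! k) = - 1 \<and> ins P (qs ! k) = []" if "k < length qs" for k
  proof -
    have o: "out P (qs ! k) = ins P p ! k" "qs ! k \<in> opers P" "qs ! k \<in> set qs"
      using c(1) that nth_map[OF that, of "out P"] by (auto simp: composable_def)
    show ?thesis
    proof (cases "\<psi> (qs ! k) = - 1")
      case True
      then show ?thesis using grading_minus1[OF o(2)] by simp
    next
      case False
      then obtain c where "c \<in> colours P" "qs ! k = ident P c" using v o(3) by blast
      then show ?thesis using ident_out[of c] o(1) by simp
    qed
  qed
  moreover have "ptarget P l = gcomp P p qs"
    using l q pcomp_ident_left[OF gcomp_opers[OF c(1)]] gcomp_out[OF c(1)] by (simp add: ptarget_def)
  ultimately show ?thesis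
    by (intro that[of p qs]) (use l q c a in simp_all)
qed

text \<open>The lower vertex of \<open>l\<close> is an identity, whose only input carries the
  source. No vertices of \<open>g\<close> stand beside it, so the lower vertex and the position of
  \<open>g\<close> survive unchanged.\<close>

lemma ptcomp_pR:
  assumes l: "l \<in> pR" and g: "ptree_arrow P g" "psource g = ptarget P l" and le: "l = PTree p q0 0 ls"
  obtains Ms where "pupper g = concat Ms" "list_all2 (composable P) ls Ms"
    "ptcomp P g l = PTree p (plower g) (ppos g) (map2 (gcomp P) ls Ms)"
proof -
  obtain p' ls' where l': "l = PTree p' (ident P (out P p')) 0 ls'" "p' \<in> opers P" "composable P p' ls'" "ptree_arrow P l"
      "\<forall>k<length ls'. ls' ! k = ident P (ins P p' ! k) \<or> \<psi> (ls' ! k) = - 1 \<and> ins P (ls' ! k) = []"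
      "ptarget P l = gcomp P p' ls'"
    by (rule pR_cases[OF l])
  have p': "p' = p" "ls' = ls" "q0 = ident P (out P p)" using l' le by auto
  have p: "p \<in> opers P" using l' p' by simp
  have idc: "ins P (ident P (out P p)) = [out P p]" using ident_ins out_colours[OF p] by blast
  obtain p2 q2 i2 qs2 r0 j L Ms R where c: "l = PTree p2 q2 i2 qs2" "g = PTree (ptarget P l) r0 j (L @ concat Ms @ R)"
    "upper_split P (PTree p2 q2 i2 qs2) L Ms R" "list_all2 (composable P) qs2 Ms"
    "composable P q2 (L @ [ident P (out P p2)] @ R)" "length L = i2"
    "pcomposable P r0 j (gcomp P q2 (L @ [ident P (out P p2)] @ R))" "p2 \<in> opers P"
    "ptcomp P g l = PTree p2 (pcomp P r0 j (gcomp P q2 (L @ [ident P (out P p2)] @ R)))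
      (j + sum_list (map (arity P) L)) (map2 (gcomp P) qs2 Ms)"
    by (rule ptcomp_cases[OF l'(4) g(1) g(2)[symmetric]])
  have e: "p2 = p" "q2 = ident P (out P p)" "i2 = 0" "qs2 = ls" using c(1) le p' by auto
  have LR: "L = []" "R = []" using c(3) idc unfolding e upper_split_def by auto
  have W: "gcomp P (ident P (out P p)) [ident P (out P p)] = ident P (out P p)"
    using gcomp_ident_left[of "ident P (out P p)"] ident_opers ident_out out_colours[OF p] by simp
  have "pcomp P r0 j (ident P (out P p)) = r0"
    using c(7) pcomp_ident_right[of r0 j] ident_out[OF out_colours[OF p]] unfolding e LR by (simp add: W pcomposable_def)
  then show ?thesis using that[of Ms] c(2,4,9) unfolding e LR by (simp add: W)
qed

lemma planar_factor:
  assumes f: "ptree_arrow P f"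
  shows "\<exists>l\<in>pR. \<exists>r. ptree_arrow P r \<and> ptarget P l = psource r \<and> ptcomp P r l = f \<and>
      pvertices r \<subseteq> {v \<in> pvertices f. 0 \<le> \<psi> v}"
proof -
  obtain p q0 i qs where fe: "f = PTree p q0 i qs" by (cases f)
  have c: "composable P p qs" "pcomposable P q0 i p" "p \<in> opers P" using f fe by (auto simp: ptree_arrow_def composable_def)
  have qs: "set qs \<subseteq> opers P" "map (out P) qs = ins P p" "q0 \<in> opers P" "ins P q0 \<noteq> []"
    using c by (auto simp: composable_def pcomposable_def)
  \<comment> \<open>The first factor attaches the vertices of grading -1 and has identities
    elsewhere. Its leaves are the slots of the other vertices, in the same order, and
    \<open>?us\<close> fills them.\<close>
  let ?keep = "\<lambda>q. if \<psi> q = - 1 then q else ident P (out P q)"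
  let ?ls = "map ?keep qs" and ?us = "filter (\<lambda>q. \<psi> q \<noteq> - 1) qs"
  let ?l = "PTree p (ident P (out P p)) 0 ?ls"
  have keep: "set ?ls \<subseteq> opers P" "map (out P) ?ls = map (out P) qs"
    using qs(1) ident_opers ident_out out_colours by auto
  have cl: "composable P p ?ls" unfolding composable_def keep(2) using qs c(3) keep(1) by simp
  have la: "ptree_arrow P ?l" using cl pcomposable_ident_left[OF c(3)] by (simp add: ptree_arrow_def)
  have lR: "?l \<in> pR"
    using la qs(1) out_colours c(3) by (auto simp: R_eq_minus1_def planar_Tw_def pvertices_def)
  have tl: "ptarget P ?l = gcomp P p ?ls"
    using pcomp_ident_left[OF gcomp_opers[OF cl]] gcomp_out[OF cl] by (simp add: ptarget_def)
  have ct: "concat (map (ins P) ?ls) = map (out P) ?us"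
    using qs(1) ident_ins out_colours grading_minus1 by (induction qs) auto
  let ?r = "PTree (ptarget P ?l) q0 i ?us"
  have "composable P (gcomp P p ?ls) ?us"
    using gcomp_opers[OF cl] gcomp_ins[OF cl] ct qs(1) by (auto simp: composable_def)
  then have ra: "ptree_arrow P ?r"
    unfolding tl using c(2) gcomp_opers[OF cl] gcomp_out[OF cl] by (simp add: ptree_arrow_def pcomposable_def)
  obtain Ms where M: "?us = concat Ms" "list_all2 (composable P) ?ls Ms"
    "ptcomp P ?r ?l = PTree p q0 i (map2 (gcomp P) ?ls Ms)"
    using ptcomp_pR[OF lR ra _ refl] by auto
  have "map2 (gcomp P) ?ls Ms = qs" using M(1,2) qs(1)
  proof (induction qs arbitrary: Ms)
    case (Cons q qs)
    then obtain N Ns where N: "Ms = N # Ns" "composable P (?keep q) N" "list_all2 (composable P) (map ?keep qs) Ns"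
      by (auto simp: list_all2_Cons1)
    show ?case
    proof (cases "\<psi> q = - 1")
      case True
      then have "N = []" using N(2) grading_minus1[of q] Cons.prems(3) by (simp add: composable_def)
      then show ?thesis using True Cons N gcomp_ident_right[of q] grading_minus1[of q] by simp
    next
      case False
      then have "length N = 1" using composable_length[OF N(2)] ident_ins out_colours Cons.prems(3) by simp
      then obtain n where "N = [n]" by (auto simp: length_Suc_conv)
      then show ?thesis using False Cons N gcomp_ident_left[of q] by simp
    qed
  qed simp
  then have "ptcomp P ?r ?l = f" using M(3) fe by simp
  moreover have "pvertices ?r \<subseteq> {v \<in> pvertices f. 0 \<le> \<psi> v}"
    using grading_nonneg[OF qs(3,4)] grading_ge qs(1) unfolding fe pvertices_def by fastforce
  ultimately show ?thesis using lR ra by (intro bexI[of _ ?l] exI[of _ ?r]) auto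
qed

text \<open>Over an identity the block is a single vertex, equal to the composite; over a nullary
  vertex the block is empty. Hence the composite determines the blocks, which makes morphisms of
  \<open>pR\<close> epi.\<close>

lemma pR_upper_inj:
  assumes "list_all2 (composable P) ls Ms" "list_all2 (composable P) ls Ms'" "map2 (gcomp P) ls Ms = map2 (gcomp P) ls Ms'"
    "\<forall>q\<in>set ls. (\<exists>c\<in>colours P. q = ident P c) \<or> ins P q = []"
  shows "Ms = Ms'"
  using assms
proof (induction ls arbitrary: Ms Ms')
  case (Cons q qs)
  then obtain N Ns N' Ns' where N: "Ms = N # Ns" "composable P q N" "Ms' = N' # Ns'" "composable P q N'"
    by (auto simp: list_all2_Cons1)
  have "N = N'"
  proof (cases "ins P q = []")
    case False
    then obtain c where cc: "c \<in> colours P" "q = ident P c" using Cons.prems(4) by auto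
    then have "length N = 1" "length N' = 1"
      using composable_length[OF N(2)] composable_length[OF N(4)] ident_ins by simp_all
    then obtain n n' where n: "N = [n]" "N' = [n']" by (auto simp: length_Suc_conv)
    then have "out P n = c" "out P n' = c" "n \<in> opers P" "n' \<in> opers P"
      using N cc ident_ins by (auto simp: composable_def)
    then have "gcomp P q N = n" "gcomp P q N' = n'" using gcomp_ident_left[of n] gcomp_ident_left[of n'] n cc by auto
    then show ?thesis using n Cons.prems(3) N by simp
  qed (use N in \<open>auto simp: composable_def\<close>)
  then show ?case using Cons N by simp
qed simp

lemma planar_graded_vertices:
  assumes H: "\<forall>p\<in>opers P. \<psi> p = 0 \<longrightarrow> invertible P p"
  shows "graded_vertices (planar_Tw P) \<psi> (\<lambda>f. plower f # pupper f) pR"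
proof (intro graded_vertices.intro category_planar_Tw graded_vertices_axioms.intro)
  fix f assume f: "f \<in> Arr (planar_Tw P)"
  then have fa: "ptree_arrow P f" by (simp add: planar_Tw_def)
  then have fo: "composable P (psource f) (pupper f)" "pcomposable P (plower f) (ppos f) (psource f)"
    by (simp_all add: ptree_arrow_def)
  then have vo: "pvertices f \<subseteq> opers P" by (auto simp: pvertices_def composable_def pcomposable_def)
  have s: "set (plower f # pupper f) = pvertices f" by (auto simp: pvertices_def)
  show "f \<in> isos (planar_Tw P) \<longleftrightarrow> (\<forall>v\<in>set (plower f # pupper f). \<psi> v = 0)"
    unfolding s using planar_isos_invertible invertible_grading planar_isosI[OF fa] H vo by blast
  show "\<psi> (Cod (planar_Tw P) f) = \<psi> (Dom (planar_Tw P) f) + sum_list (map \<psi> (plower f # pupper f))"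
    using grading_pcomp[OF ptarget_pcomposable[OF fo]] grading_gcomp[OF fo(1)] by (simp add: planar_Tw_def ptarget_def)
  show "\<exists>l\<in>pR. \<exists>r\<in>Arr (planar_Tw P). Cod (planar_Tw P) l = Dom (planar_Tw P) r \<and> Comp (planar_Tw P) r l = f \<and>
      set (plower r # pupper r) \<subseteq> {v \<in> set (plower f # pupper f). 0 \<le> \<psi> v}"
    using planar_factor[OF fa] by (fastforce simp: planar_Tw_def pvertices_def)
next
  fix a assume "a \<in> Obj (planar_Tw P)"
  then show "- 1 \<le> \<psi> a" using grading_ge by (simp add: planar_Tw_def)
next
  fix f g v assume "f \<in> Arr (planar_Tw P)" "g \<in> Arr (planar_Tw P)" "Cod (planar_Tw P) f = Dom (planar_Tw P) g"
    and v: "v \<in> set (plower (Comp (planar_Tw P) g f) # pupper (Comp (planar_Tw P) g f))"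
  then have a: "ptree_arrow P f" "ptree_arrow P g" "ptarget P f = psource g"
    by (simp_all add: planar_Tw_def)
  obtain p q0 i qs r0 j L Ms R where c: "f = PTree p q0 i qs" "g = PTree (ptarget P f) r0 j (L @ concat Ms @ R)"
    "upper_split P (PTree p q0 i qs) L Ms R"
    "list_all2 (composable P) qs Ms" "composable P q0 (L @ [ident P (out P p)] @ R)" "length L = i"
    "pcomposable P r0 j (gcomp P q0 (L @ [ident P (out P p)] @ R))" "p \<in> opers P"
    "ptcomp P g f = PTree p (pcomp P r0 j (gcomp P q0 (L @ [ident P (out P p)] @ R)))
      (j + sum_list (map (arity P) L)) (map2 (gcomp P) qs Ms)"
    by (rule ptcomp_cases[OF a])
  have sel: "plower f = q0" "pupper f = qs" "plower g = r0" "pupper g = L @ concat Ms @ R"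
    by (subst c(1), simp)+ (subst c(2), simp)+
  consider "v = pcomp P r0 j (gcomp P q0 (L @ [ident P (out P p)] @ R))" | "v \<in> set (map2 (gcomp P) qs Ms)"
    using v c(9) by (auto simp: planar_Tw_def)
  then show "\<exists>us. set us \<subseteq> set (plower f # pupper f) \<union> set (plower g # pupper g) \<and> \<psi> v = sum_list (map \<psi> us)"
  proof cases
    case 1
    then have "\<psi> v = sum_list (map \<psi> (r0 # q0 # L @ R))"
      using grading_pcomp[OF c(7)] grading_gcomp[OF c(5)] grading_ident[OF out_colours[OF c(8)]] by simp
    moreover have "set (r0 # q0 # L @ R) \<subseteq> set (plower f # pupper f) \<union> set (plower g # pupper g)"
      unfolding sel by auto
    ultimately show ?thesis by blast
  next
    case 2
    then obtain k where k: "k < length qs" "k < length Ms" "v = gcomp P (qs ! k) (Ms ! k)"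
      by (auto simp: in_set_conv_nth)
    then have "composable P (qs ! k) (Ms ! k)" using c(4) by (auto simp: list_all2_conv_all_nth)
    then have "\<psi> v = sum_list (map \<psi> (qs ! k # Ms ! k))" using grading_gcomp k by simp
    moreover have "set (qs ! k # Ms ! k) \<subseteq> set (plower f # pupper f) \<union> set (plower g # pupper g)"
      using nth_mem[OF k(1)] nth_mem[OF k(2)] unfolding sel by (auto intro: bexI[of _ "Ms ! k"])
    ultimately show ?thesis by blast
  qed
next
  fix l assume l: "l \<in> pR"
  then show "l \<in> Arr (planar_Tw P)" by (simp add: R_eq_minus1_def)
  fix v assume "v \<in> set (plower l # pupper l)"
  then show "\<psi> v \<le> 0" using l grading_ident by (auto simp: R_eq_minus1_def pvertices_def)
next
  fix l g h
  assume l: "l \<in> pR" and "g \<in> Arr (planar_Tw P)" "h \<in> Arr (planar_Tw P)"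
    "Dom (planar_Tw P) g = Cod (planar_Tw P) l" "Dom (planar_Tw P) h = Cod (planar_Tw P) l"
    "Comp (planar_Tw P) g l = Comp (planar_Tw P) h l"
  then have gh: "ptree_arrow P g" "ptree_arrow P h" "psource g = ptarget P l" "psource h = ptarget P l"
    and eq: "ptcomp P g l = ptcomp P h l" by (simp_all add: planar_Tw_def)
  obtain p ls where le: "l = PTree p (ident P (out P p)) 0 ls" "p \<in> opers P" "composable P p ls" "ptree_arrow P l"
      "\<forall>k<length ls. ls ! k = ident P (ins P p ! k) \<or> \<psi> (ls ! k) = - 1 \<and> ins P (ls ! k) = []"
      "ptarget P l = gcomp P p ls"
    by (rule pR_cases[OF l])
  obtain Ms where M: "pupper g = concat Ms" "list_all2 (composable P) ls Ms"
    "ptcomp P g l = PTree p (plower g) (ppos g) (map2 (gcomp P) ls Ms)"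
    by (rule ptcomp_pR[OF l gh(1,3) le(1)])
  obtain Ms' where M': "pupper h = concat Ms'" "list_all2 (composable P) ls Ms'"
    "ptcomp P h l = PTree p (plower h) (ppos h) (map2 (gcomp P) ls Ms')"
    by (rule ptcomp_pR[OF l gh(2,4) le(1)])
  have "\<forall>q\<in>set ls. (\<exists>c\<in>colours P. q = ident P c) \<or> ins P q = []"
  proof
    fix q assume "q \<in> set ls"
    then obtain k where k: "k < length ls" "q = ls ! k" by (auto simp: in_set_conv_nth)
    then have "ins P p ! k \<in> colours P" using composable_length[OF le(3)] ins_colour[OF le(2)] by simp
    then show "(\<exists>c\<in>colours P. q = ident P c) \<or> ins P q = []" using le(5) k by blast
  qed
  then have "Ms = Ms'" using pR_upper_inj[OF M(2) M'(2)] eq M(3) M'(3) by simp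
  then show "g = h" using eq M M' gh by (cases g, cases h) simp
next
  fix l l' g h
  assume l: "l \<in> pR" and l': "l' \<in> pR" and "g \<in> Arr (planar_Tw P)" "h \<in> Arr (planar_Tw P)"
    "Dom (planar_Tw P) g = Cod (planar_Tw P) l" "Dom (planar_Tw P) h = Cod (planar_Tw P) l'"
    "Comp (planar_Tw P) g l = Comp (planar_Tw P) h l'"
    and nn: "\<forall>v\<in>set (plower g # pupper g) \<union> set (plower h # pupper h). 0 \<le> \<psi> v"
  then have gh: "ptree_arrow P g" "ptree_arrow P h" "psource g = ptarget P l" "psource h = ptarget P l'"
    and eq: "ptcomp P g l = ptcomp P h l'" by (simp_all add: planar_Tw_def)
  \<comment> \<open>If the vertices of \<open>g\<close> have grading at least 0, a vertex of grading
    -1 in the composite can only be a vertex of \<open>l\<close>, and at every other place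
    \<open>l\<close> has an identity. So \<open>l\<close> can be read off from the
    composite.\<close>
  have *: "\<exists>c. pupper (ptcomp P g l) = c \<and> length ls = length (ins P p) \<and>
      (\<forall>k<length ls. ls ! k = (if \<psi> (c ! k) = - 1 then c ! k else ident P (ins P p ! k)))"
    if l: "l \<in> pR" and g: "ptree_arrow P g" "psource g = ptarget P l" "\<forall>v\<in>set (pupper g). 0 \<le> \<psi> v"
      and lp: "l = PTree p q0 i ls" for l g p q0 i ls
  proof (intro exI conjI allI impI)
    have le: "l = PTree p (ident P (out P p)) 0 ls" "composable P p ls" "p \<in> opers P"
      "\<forall>k<length ls. ls ! k = ident P (ins P p ! k) \<or> \<psi> (ls ! k) = - 1 \<and> ins P (ls ! k) = []"
      using pR_cases[OF l] lp by auto
    obtain Ms where M: "pupper g = concat Ms" "list_all2 (composable P) ls Ms"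
      "ptcomp P g l = PTree p (plower g) (ppos g) (map2 (gcomp P) ls Ms)"
      by (rule ptcomp_pR[OF l g(1,2) le(1)])
    show "length ls = length (ins P p)" using composable_length[OF le(2)] .
    fix k assume k: "k < length ls"
    have kM: "k < length Ms" "composable P (ls ! k) (Ms ! k)" using M(2) k by (auto simp: list_all2_conv_all_nth)
    have nth: "pupper (ptcomp P g l) ! k = gcomp P (ls ! k) (Ms ! k)" using M(3) k kM by simp
    show "ls ! k = (if \<psi> (pupper (ptcomp P g l) ! k) = - 1 then pupper (ptcomp P g l) ! k else ident P (ins P p ! k))"
    proof (cases "\<psi> (ls ! k) = - 1 \<and> ins P (ls ! k) = []")
      case True
      then have "gcomp P (ls ! k) (Ms ! k) = ls ! k"
        using kM(2) gcomp_ident_right[of "ls ! k"] by (auto simp: composable_def)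
      then show ?thesis using True nth by simp
    next
      case False
      then have id: "ls ! k = ident P (ins P p ! k)" using le(4) k by blast
      have kc: "ins P p ! k \<in> colours P" using k composable_length[OF le(2)] ins_colour[OF le(3)] by simp
      have "sum_list (map \<psi> (Ms ! k)) \<ge> 0" using g(3) M(1) nth_mem[OF kM(1)] by (intro sum_list_nonneg) auto
      then have "\<psi> (gcomp P (ls ! k) (Ms ! k)) \<ge> 0" using grading_gcomp[OF kM(2)] id grading_ident[OF kc] by simp
      then show ?thesis using id nth by simp
    qed
  qed simp
  obtain p ls where le: "l = PTree p (ident P (out P p)) 0 ls" using pR_cases[OF l] by metis
  obtain p' ls' where le': "l' = PTree p' (ident P (out P p')) 0 ls'" using pR_cases[OF l'] by metis
  have "psource (ptcomp P g l) = p" "psource (ptcomp P h l') = p'" using le le' by (simp_all add: ptcomp_def Let_def)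
  then have p: "p = p'" using eq by simp
  have "length ls = length ls'" "\<forall>k<length ls. ls ! k = ls' ! k"
    using *[OF l gh(1,3) _ le] *[OF l' gh(2,4) _ le'] nn eq p by auto
  then have "ls = ls'" by (simp add: list_eq_iff_nth_eq)
  then show "l = l'" using le le' p by simp
qed

theorem planar_reedy_iff:
  "generalized_reedy (planar_Tw P) {-1..} \<psi> (R_minus P \<psi> (planar_Tw P) pvertices (\<lambda>_. True))
     (R_plus \<psi> (planar_Tw P) pvertices)
   \<longleftrightarrow> (\<forall>p\<in>opers P. \<psi> p = 0 \<longrightarrow> arity P p = 1) \<and> groupoid (grade0_cat P \<psi>)"
  unfolding groupoid_iff_invertible
proof
  assume H: "\<forall>p\<in>opers P. \<psi> p = 0 \<longrightarrow> invertible P p"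
  interpret graded_vertices "planar_Tw P" \<psi> "\<lambda>f. plower f # pupper f" pR by (rule planar_graded_vertices[OF H])
  show "generalized_reedy (planar_Tw P) {-1..} \<psi> (R_minus P \<psi> (planar_Tw P) pvertices (\<lambda>_. True))
     (R_plus \<psi> (planar_Tw P) pvertices)"
    using reedy by (simp add: R_minus_def R_plus_def R_ge_0_def pvertices_def)
next
  assume R: "generalized_reedy (planar_Tw P) {-1..} \<psi> (R_minus P \<psi> (planar_Tw P) pvertices (\<lambda>_. True))
     (R_plus \<psi> (planar_Tw P) pvertices)"
  show "\<forall>p\<in>opers P. \<psi> p = 0 \<longrightarrow> invertible P p"
  proof (intro ballI impI)
    fix p assume p: "p \<in> opers P" "\<psi> p = 0"
    let ?c = "out P p"
    let ?f = "PTree (ident P ?c) (ident P ?c) 0 [p]"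
    have c: "?c \<in> colours P" using out_colours[OF p(1)] .
    have f: "ptree_arrow P ?f"
      using composable_ident[OF p(1)] pcomposable_ident_left[OF ident_opers[OF c]] ident_out[OF c]
      by (simp add: ptree_arrow_def)
    have t: "ptarget P ?f = p"
      using gcomp_ident_left[OF p(1)] pcomp_ident_left[OF p(1)] by (simp add: ptarget_def)
    have "?f \<in> isos (planar_Tw P)"
    proof (rule reedy_pos_iso[OF R[unfolded R_plus_def]])
      show "R_ge_0 \<psi> (planar_Tw P) pvertices \<subseteq> Arr (planar_Tw P)" by (auto simp: R_ge_0_def)
      show "?f \<in> R_ge_0 \<psi> (planar_Tw P) pvertices"
        using f p grading_ident[OF c] by (simp add: R_ge_0_def planar_Tw_def pvertices_def)
      show "\<not> \<psi> (Dom (planar_Tw P) ?f) < \<psi> (Cod (planar_Tw P) ?f)"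
        using t p grading_ident[OF c] by (simp add: planar_Tw_def)
    qed
    then show "invertible P p" by (rule planar_isos_invertible) (simp add: pvertices_def)
  qed
qed

end

section \<open>Labelled operations\<close>

text \<open>Sorting labels and reordering blocks preserve multisets, so this criterion recognizes
  permutations without computing any entries.\<close>

lemma perm_iff_mset: "s \<in> permutations_of_set {..<n} \<longleftrightarrow> mset s = mset [0..<n]"
proof
  assume h: "s \<in> permutations_of_set {..<n}"
  have "set s = set [0..<n]" using permutations_of_setD(1)[OF h] by (simp only: set_upt lessThan_atLeast0)
  then show "mset s = mset [0..<n]"
    using set_eq_iff_mset_eq_distinct[OF permutations_of_setD(2)[OF h] distinct_upt] by blast
next
  assume h: "mset s = mset [0..<n]"
  show "s \<in> permutations_of_set {..<n}"
  proof (rule permutations_of_setI)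
    show "set s = {..<n}" using mset_eq_setD[OF h] by (simp only: set_upt lessThan_atLeast0)
    show "distinct s" using mset_eq_imp_distinct_iff[OF h] by (simp only: distinct_upt)
  qed
qed

lemma perm_length: "s \<in> permutations_of_set {..<n} \<Longrightarrow> length s = n"
  unfolding perm_iff_mset by (drule mset_eq_length) simp

lemma perm_set: "s \<in> permutations_of_set {..<n} \<Longrightarrow> set s = {..<n}"
  by (simp add: permutations_of_set_def)

lemma perm_id: "[0..<n] \<in> permutations_of_set {..<n}"
  by (simp add: perm_iff_mset)

lemma mset_map_nth_perm:
  assumes "s \<in> permutations_of_set {..<length xs}"
  shows "mset (map ((!) xs) s) = mset xs"
proof -
  have "mset (map ((!) xs) s) = image_mset ((!) xs) (mset [0..<length xs])"
    using assms unfolding perm_iff_mset by simp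
  also have "\<dots> = mset (map ((!) xs) [0..<length xs])" by (simp only: mset_map)
  finally show ?thesis by (simp only: map_nth)
qed

lemma perm_comp:
  "s \<in> permutations_of_set {..<n} \<Longrightarrow> t \<in> permutations_of_set {..<n} \<Longrightarrow> map ((!) t) s \<in> permutations_of_set {..<n}"
  using mset_map_nth_perm[of s t] perm_length[of t n] by (simp add: perm_iff_mset)

lemma map_nth_map: "set s \<subseteq> {..<length xs} \<Longrightarrow> map ((!) (map f xs)) s = map f (map ((!) xs) s)"
  by (induction s) auto

lemma mset_concat_cong: "mset xss = mset yss \<Longrightarrow> mset (concat xss) = mset (concat yss)"
proof -
  assume "mset xss = mset yss"
  moreover have "mset (concat zss) = sum_mset (image_mset mset (mset zss))" for zss :: "'a list list"
    by (induction zss) auto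
  ultimately show ?thesis by (simp only:)
qed

lemma chop_map: "chop ns (map f xs) = map (map f) (chop ns xs)"
  by (induction ns arbitrary: xs) (auto simp: take_map drop_map)

text \<open>\<open>B\<close> lists the positions occupied by each block in the concatenation. The
  lists \<open>input_blocks\<close> in the equivariance axioms are of this kind, and indexing by
  them recovers the blocks.\<close>

lemma chop_upt:
  fixes xss :: "'a list list"
  defines "B \<equiv> chop (map length xss) [0..<length (concat xss)]"
  shows "length B = length xss" "concat B = [0..<length (concat xss)]"
    and "map (map ((!) (concat xss))) B = xss"
    and "map length B = map length xss"
proof -
  have l: "length (chop ns xs) = length ns" for ns and xs :: "nat list" by (induction ns arbitrary: xs) auto
  show "length B = length xss" by (simp add: B_def l)
  have "concat (chop ns xs) = xs" if "length xs = sum_list ns" for ns and xs :: "nat list"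
    using that by (induction ns arbitrary: xs) auto
  then show "concat B = [0..<length (concat xss)]" by (simp add: B_def length_concat)
  have "map (map ((!) (concat xss))) B = chop (map length xss) (map ((!) (concat xss)) [0..<length (concat xss)])"
    by (simp only: B_def chop_map)
  also have "\<dots> = xss" unfolding map_nth by (rule chop_concat) simp
  finally show m: "map (map ((!) (concat xss))) B = xss" .
  have "map length B = map length (map (map ((!) (concat xss))) B)" by (simp add: o_def)
  then show "map length B = map length xss" unfolding m .
qed

section \<open>Ranks and sorting of labels\<close>

definition rank :: "nat set \<Rightarrow> nat \<Rightarrow> nat" where "rank S x = card {y \<in> S. y < x}"

lemma ranks_rank: "ranks ls = map (rank (set ls)) ls"
  by (simp add: ranks_def rank_def)

lemma map_rank_sort:
  assumes "distinct ls"
  shows "map (rank (set ls)) (sort ls) = [0..<length ls]"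
proof (rule nth_equalityI)
  fix k assume "k < length (map (rank (set ls)) (sort ls))"
  then have k: "k < length (sort ls)" by simp
  have sd: "sorted (sort ls)" "distinct (sort ls)" using assms by auto
  then have lt: "sort ls ! i < sort ls ! j \<longleftrightarrow> i < j" if "i < length (sort ls)" "j < length (sort ls)" for i j
    using that by (metis linorder_neqE_nat nth_eq_iff_index_eq order_le_less order_less_asym sorted_nth_mono)
  have "{y \<in> set ls. y < sort ls ! k} = (!) (sort ls) ` {..<k}"
  proof -
    have "{y \<in> set (sort ls). y < sort ls ! k} = (!) (sort ls) ` {..<k}"
    proof (intro set_eqI iffI)
      fix y assume "y \<in> {y \<in> set (sort ls). y < sort ls ! k}"
      then have y: "y \<in> set (sort ls)" "y < sort ls ! k" by simp_all
      from y(1) obtain i where "i < length (sort ls)" "sort ls ! i = y" unfolding in_set_conv_nth by blast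
      with y(2) show "y \<in> (!) (sort ls) ` {..<k}" using lt k by auto
    next
      fix y assume "y \<in> (!) (sort ls) ` {..<k}"
      then obtain i where "i < k" "y = sort ls ! i" by auto
      then show "y \<in> {y \<in> set (sort ls). y < sort ls ! k}" using lt[of i k] k nth_mem[of i "sort ls"] by simp
    qed
    then show ?thesis by simp
  qed
  moreover have "inj_on ((!) (sort ls)) {..<k}" using sd(2) k by (simp add: inj_on_def nth_eq_iff_index_eq)
  ultimately have "rank (set ls) (sort ls ! k) = k" by (simp add: rank_def card_image)
  then show "map (rank (set ls)) (sort ls) ! k = [0..<length ls] ! k" using k by simp
qed simp

lemma perm_ranks: 
  assumes "distinct ls"
  shows "ranks ls \<in> permutations_of_set {..<length ls}"
proof -
  have "mset (ranks ls) = image_mset (rank (set ls)) (mset (sort ls))" by (simp add: ranks_rank)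
  also have "\<dots> = mset (map (rank (set ls)) (sort ls))" by (simp only: mset_map)
  finally show ?thesis unfolding map_rank_sort[OF assms] perm_iff_mset .
qed

lemma sort_ranks:
  assumes "distinct ls"
  shows "map ((!) (sort ls)) (ranks ls) = ls"
proof -
  have "sort ls ! rank (set ls) x = x" if x: "x \<in> set ls" for x
  proof -
    from x have "x \<in> set (sort ls)" by simp
    then obtain k where k: "k < length (sort ls)" "sort ls ! k = x" by (metis in_set_conv_nth)
    then have "rank (set ls) x = k" using arg_cong[OF map_rank_sort[OF assms], of "\<lambda>l. l ! k"] by simp
    then show ?thesis using k by simp
  qed
  then show ?thesis by (simp add: ranks_rank map_idI)
qed

lemma ranks_sorted: "sorted ls \<Longrightarrow> distinct ls \<Longrightarrow> ranks ls = [0..<length ls]"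
  using map_rank_sort[of ls] by (simp add: ranks_rank sorted_sort_id)

lemma ranks_perm:
  assumes "ls \<in> permutations_of_set {..<n}"
  shows "ranks ls = ls"
proof -
  have s: "set ls = {..<n}" using assms by (simp add: permutations_of_set_def)
  have "rank {..<n} x = x" if "x < n" for x
  proof -
    have "{y \<in> {..<n}. y < x} = {..<x}" using that by auto
    then show ?thesis by (simp add: rank_def)
  qed
  then show ?thesis using s by (auto simp: ranks_rank intro!: map_idI)
qed

lemma sort_perm: "ls \<in> permutations_of_set {..<n} \<Longrightarrow> sort ls = [0..<n]"
  unfolding perm_iff_mset by (rule properties_for_sort) simp_all

text \<open>Labels for the inputs of a lower vertex. The first input, to which the source is
  attached, must stay in place; it gets the least label 0, so that sorting all labels has the same
  effect as sorting the others.\<close>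

definition mark :: "nat list \<Rightarrow> nat list" where "mark ls = 0 # map Suc ls"

lemma ranks_mark: "ranks (mark ls) = 0 # map Suc (ranks ls)"
proof -
  have "rank (set (mark ls)) (Suc x) = Suc (rank (set ls) x)" for x
  proof -
    have "{y \<in> insert 0 (Suc ` set ls). y < Suc x} = insert 0 (Suc ` {y \<in> set ls. y < x})" by auto
    then show ?thesis by (simp add: rank_def mark_def card_image)
  qed
  moreover have "rank (set (mark ls)) 0 = 0" by (simp add: rank_def)
  ultimately show ?thesis by (simp add: ranks_rank) (simp add: mark_def ranks_rank)
qed

lemma sort_mark: "sort (mark ls) = mark (sort ls)"
  by (rule properties_for_sort) (simp_all add: mark_def sorted_map sorted_wrt_map)

lemma distinct_mark: "distinct (mark ls) \<longleftrightarrow> distinct ls" by (auto simp: mark_def distinct_map)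

lemma mark_inj: "mark ls = mark ls' \<longleftrightarrow> ls = ls'" by (auto simp: mark_def inj_map_eq_map)

lemma map_case_nat_mark: "map (case_nat a f) (mark ls) = a # map f ls" by (simp add: mark_def o_def)

text \<open>Operations whose inputs carry labels; \<open>relab\<close> relates a labelled operation to the
  results of permuting its inputs together with their labels, \<open>nf\<close> sorts the labels, and
  \<open>sub G\<close> composes with \<open>G l\<close> at the input labelled \<open>l\<close>.\<close>

definition relab :: "('c, 'o, 'x) sym_operad_scheme \<Rightarrow> 'o \<times> nat list \<Rightarrow> 'o \<times> nat list \<Rightarrow> bool" where
  "relab P v w \<longleftrightarrow> fst v \<in> opers P \<and> length (snd v) = arity P (fst v) \<and> length (snd w) = arity P (fst v) \<and>
     (\<exists>s\<in>permutations_of_set {..<arity P (fst v)}. fst w = act P s (fst v) \<and> snd v = map ((!) (snd w)) s)"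

definition nf :: "('c, 'o, 'x) sym_operad_scheme \<Rightarrow> 'o \<times> nat list \<Rightarrow> 'o \<times> nat list" where
  "nf P v = (act P (ranks (snd v)) (fst v), sort (snd v))"

definition sub :: "('c, 'o, 'x) sym_operad_scheme \<Rightarrow> (nat \<Rightarrow> 'o \<times> nat list) \<Rightarrow> 'o \<times> nat list \<Rightarrow> 'o \<times> nat list" where
  "sub P G v = (gcomp P (fst v) (map (\<lambda>l. fst (G l)) (snd v)), concat (map (\<lambda>l. snd (G l)) (snd v)))"

text \<open>Colours are attached to labels instead of positions, so that a permutation of the inputs
  with their labels does not affect them (\<open>lop_relab\<close>).\<close>

definition lop :: "('c, 'o, 'x) sym_operad_scheme \<Rightarrow> (nat \<Rightarrow> 'c) \<Rightarrow> 'o \<times> nat list \<Rightarrow> bool" where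
  "lop P col v \<longleftrightarrow> fst v \<in> opers P \<and> ins P (fst v) = map col (snd v)"

text \<open>\<open>col\<close> colours the labels at which \<open>G\<close> is substituted and
  \<open>col'\<close> the labels that \<open>G\<close> produces.\<close>

definition lops :: "('c, 'o, 'x) sym_operad_scheme \<Rightarrow> (nat \<Rightarrow> 'c) \<Rightarrow> (nat \<Rightarrow> 'c) \<Rightarrow> (nat \<Rightarrow> 'o \<times> nat list) \<Rightarrow> nat set \<Rightarrow> bool" where
  "lops P col col' G A \<longleftrightarrow> (\<forall>l\<in>A. lop P col' (G l) \<and> out P (fst (G l)) = col l)"

lemma lops_subset: "lops P col col' G A \<Longrightarrow> B \<subseteq> A \<Longrightarrow> lops P col col' G B"
  by (auto simp: lops_def)

section \<open>Relabelling and substitution\<close>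

context symmetric_operad
begin

lemma lop_length: "lop P col v \<Longrightarrow> length (snd v) = arity P (fst v)"
  by (simp add: lop_def)

lemma relab_refl: "fst v \<in> opers P \<Longrightarrow> length (snd v) = arity P (fst v) \<Longrightarrow> relab P v v"
  unfolding relab_def using act_id[of "fst v"] perm_id map_nth[of "snd v"]
  by (intro conjI bexI[of _ "[0..<arity P (fst v)]"]) auto

lemma relab_trans:
  assumes "relab P u v" "relab P v w"
  shows "relab P u w"
proof -
  obtain s where s: "fst u \<in> opers P" "length (snd u) = arity P (fst u)" "length (snd v) = arity P (fst u)"
    "s \<in> permutations_of_set {..<arity P (fst u)}" "fst v = act P s (fst u)" "snd u = map ((!) (snd v)) s"
    using assms(1) by (auto simp: relab_def)
  have a: "arity P (fst v) = arity P (fst u)" using act_arity s by simp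
  obtain t where t: "length (snd w) = arity P (fst u)" "t \<in> permutations_of_set {..<arity P (fst u)}"
    "fst w = act P t (fst v)" "snd v = map ((!) (snd w)) t"
    using assms(2) a by (auto simp: relab_def)
  have "fst w = act P (map ((!) t) s) (fst u)" using act_act s t by simp
  moreover have "snd u = map ((!) (snd w)) (map ((!) t) s)"
    unfolding s(6) t(4) by (rule map_nth_map) (use perm_set[OF s(4)] perm_length[OF t(2)] in simp)
  ultimately show ?thesis using s t perm_comp[OF s(4) t(2)] unfolding relab_def by blast
qed

lemma relab_map: "relab P (x, ls) (y, ls') \<Longrightarrow> relab P (x, map f ls) (y, map f ls')"
  unfolding relab_def by (auto simp: map_nth_map perm_set simp del: map_map)

lemma relab_mset:
  assumes "relab P v w"
  shows "mset (snd v) = mset (snd w)"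
proof -
  obtain s where s: "length (snd w) = arity P (fst v)" "s \<in> permutations_of_set {..<arity P (fst v)}"
    "snd v = map ((!) (snd w)) s" using assms by (auto simp: relab_def)
  show ?thesis unfolding s(3) by (rule mset_map_nth_perm) (use s in simp)
qed

lemma relab_out:
  assumes "relab P v w"
  shows "fst w \<in> opers P" "out P (fst w) = out P (fst v)" "arity P (fst w) = arity P (fst v)"
    "length (snd w) = arity P (fst w)"
proof -
  obtain s where s: "fst v \<in> opers P" "length (snd w) = arity P (fst v)"
    "s \<in> permutations_of_set {..<arity P (fst v)}" "fst w = act P s (fst v)"
    using assms by (auto simp: relab_def)
  show "fst w \<in> opers P" "out P (fst w) = out P (fst v)" "arity P (fst w) = arity P (fst v)"
    "length (snd w) = arity P (fst w)"
    using act_opers[OF s(1,3)] act_out[OF s(1,3)] act_arity[OF s(1,3)] s(2,4) by simp_all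
qed

lemma lop_relab:
  assumes "relab P v w" "lop P col v"
  shows "lop P col w"
proof -
  obtain s where s: "fst v \<in> opers P" "length (snd v) = arity P (fst v)" "length (snd w) = arity P (fst v)"
    "s \<in> permutations_of_set {..<arity P (fst v)}" "fst w = act P s (fst v)" "snd v = map ((!) (snd w)) s"
    using assms(1) by (auto simp: relab_def)
  have a: "arity P (fst w) = arity P (fst v)" using act_arity[OF s(1,4)] s(5) by simp
  have "ins P (fst w) = map col (snd w)"
  proof (rule nth_equalityI)
    show "arity P (fst w) = length (map col (snd w))" using a s(3) by simp
    fix j assume "j < arity P (fst w)"
    then have "j \<in> set s" unfolding a perm_set[OF s(4)] by simp
    then obtain k where k: "k < length s" "s ! k = j" by (auto simp: in_set_conv_nth)
    have kl: "k < arity P (fst v)" using k perm_length[OF s(4)] by simp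
    have "ins P (fst w) ! j = ins P (fst v) ! k" using act_ins[OF s(1,4) kl] s(5) k by simp
    also have "\<dots> = col (snd v ! k)" using assms(2) kl by (simp add: lop_def)
    also have "snd v ! k = snd w ! j" unfolding s(6) using k by simp
    finally show "ins P (fst w) ! j = map col (snd w) ! j"
      using \<open>j < arity P (fst w)\<close> a s(3) by simp
  qed
  then show ?thesis using relab_out(1)[OF assms(1)] by (simp add: lop_def)
qed

lemma relab_nf:
  assumes "fst v \<in> opers P" "length (snd v) = arity P (fst v)" "distinct (snd v)"
  shows "relab P v (nf P v)"
  unfolding relab_def nf_def
  using assms perm_ranks[OF assms(3)] sort_ranks[OF assms(3)] by (intro conjI bexI[of _ "ranks (snd v)"]) auto

text \<open>If \<open>s\<close> leads from \<open>v\<close> to \<open>w\<close>, the ranks of the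
  labels of \<open>w\<close> composed with \<open>s\<close> are the ranks of the labels of
  \<open>v\<close>. So sorting \<open>w\<close> after the permutation is the same as sorting
  \<open>v\<close> at once.\<close>

lemma nf_relab:
  assumes "relab P v w" "distinct (snd v)"
  shows "nf P v = nf P w"
proof -
  obtain s where s: "fst v \<in> opers P" "length (snd v) = arity P (fst v)" "length (snd w) = arity P (fst v)"
    "s \<in> permutations_of_set {..<arity P (fst v)}" "fst w = act P s (fst v)" "snd v = map ((!) (snd w)) s"
    using assms(1) by (auto simp: relab_def)
  note m = relab_mset[OF assms(1)]
  have d: "distinct (snd w)" "set (snd w) = set (snd v)"
    using mset_eq_imp_distinct_iff[OF m] mset_eq_setD[OF m] assms(2) by auto
  have r: "ranks (snd w) \<in> permutations_of_set {..<arity P (fst v)}" using perm_ranks[OF d(1)] s(3) by simp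
  have "map ((!) (ranks (snd w))) s = map (rank (set (snd v))) (map ((!) (snd w)) s)"
    unfolding ranks_rank d(2) by (rule map_nth_map) (use perm_set[OF s(4)] s(3) in simp)
  also have "\<dots> = ranks (snd v)" unfolding s(6)[symmetric] by (simp only: ranks_rank)
  finally have "act P (ranks (snd w)) (fst w) = act P (ranks (snd v)) (fst v)"
    using act_act[OF s(1,4) r] s(5) by simp
  moreover have "sort (snd v) = sort (snd w)" using m by (intro properties_for_sort) simp_all
  ultimately show ?thesis by (simp add: nf_def)
qed

lemma nf_sorted:
  assumes "fst v \<in> opers P" "length (snd v) = arity P (fst v)" "sorted (snd v)" "distinct (snd v)"
  shows "nf P v = v"
  using act_id[OF assms(1)] assms ranks_sorted[OF assms(3,4)] by (simp add: nf_def sorted_sort_id prod_eq_iff)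

lemma sub_composable:
  assumes "lop P col v" "lops P col col' G (set (snd v))"
  shows "composable P (fst v) (map (\<lambda>l. fst (G l)) (snd v))"
  using assms unfolding lop_def lops_def composable_def by auto

lemma lop_sub:
  assumes "lop P col v" "lops P col col' G (set (snd v))"
  shows "lop P col' (sub P G v)" "out P (fst (sub P G v)) = out P (fst v)"
proof -
  note c = sub_composable[OF assms]
  have "map (ins P) (map (\<lambda>l. fst (G l)) (snd v)) = map (map col') (map (\<lambda>l. snd (G l)) (snd v))"
    using assms(2) by (auto simp: lops_def lop_def)
  then show "lop P col' (sub P G v)" using gcomp_opers[OF c] gcomp_ins[OF c]
    by (simp add: lop_def sub_def map_concat del: map_map)
  show "out P (fst (sub P G v)) = out P (fst v)" using gcomp_out[OF c] by (simp add: sub_def)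
qed

lemma sub_cong: "(\<And>l. l \<in> set (snd v) \<Longrightarrow> G l = G' l) \<Longrightarrow> sub P G v = sub P G' v"
  unfolding sub_def by (auto intro!: arg_cong[of _ _ "gcomp P (fst v)"] arg_cong[of _ _ concat])

text \<open>Substitution does not sort, and it orders the new labels by concatenation, just as
  \<open>gcomp\<close> orders inputs. So associativity holds strictly.\<close>

lemma sub_sub:
  assumes v: "lop P col v" and G: "lops P col col' G (set (snd v))"
    and H: "lops P col' col'' H (\<Union>l\<in>set (snd v). set (snd (G l)))"
  shows "sub P H (sub P G v) = sub P (\<lambda>l. sub P H (G l)) v"
proof -
  note c = sub_composable[OF v G]
  let ?rss = "map (\<lambda>l. map (\<lambda>l. fst (H l)) (snd (G l))) (snd v)"
  have "list_all2 (composable P) (map (\<lambda>l. fst (G l)) (snd v)) ?rss"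
    using G H sub_composable[of col' "G l" col'' H for l] 
    by (auto simp: list_all2_map1 list_all2_map2 list_all2_same lops_def)
  from gcomp_assoc[OF c this]
  have "gcomp P (gcomp P (fst v) (map (\<lambda>l. fst (G l)) (snd v))) (map (\<lambda>l. fst (H l)) (concat (map (\<lambda>l. snd (G l)) (snd v)))) =
    gcomp P (fst v) (map (\<lambda>l. gcomp P (fst (G l)) (map (\<lambda>l. fst (H l)) (snd (G l)))) (snd v))"
    by (simp add: map_concat o_def map2_map_map)
  moreover have "concat (map (\<lambda>l. snd (H l)) (concat (map (\<lambda>l. snd (G l)) (snd v)))) =
      concat (map (\<lambda>l. concat (map (\<lambda>l. snd (H l)) (snd (G l)))) (snd v))"
    by (simp add: map_concat concat_concat_map o_def)
  ultimately show ?thesis by (simp add: sub_def o_def)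
qed

lemma sub_ident_right:
  assumes "lop P col v" "\<And>l. l \<in> set (snd v) \<Longrightarrow> G l = (ident P (col l), [l])"
  shows "sub P G v = v"
proof -
  have 1: "map (\<lambda>l. fst (G l)) (snd v) = map (ident P) (ins P (fst v))" using assms by (auto simp: lop_def)
  have 2: "map (\<lambda>l. snd (G l)) (snd v) = map (\<lambda>l. [l]) (snd v)" using assms(2) by auto
  show ?thesis
    unfolding sub_def 1 2 using gcomp_ident_right[of "fst v"] assms(1) by (simp add: lop_def)
qed

lemma input_blocks_alt:
  assumes "map (arity P) qs = map length xss"
  shows "input_blocks P qs = chop (map length xss) [0..<length (concat xss)]"
  unfolding input_blocks_def assms by (simp add: length_concat)

text \<open>The labelled form of \<open>equivariant_outer\<close>. Permuting the inputs of
  \<open>v\<close> permutes the blocks of inputs as wholes, and the labels produced by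
  \<open>G\<close> move with their blocks.\<close>

lemma relab_sub_outer:
  assumes v: "lop P col v" and G: "lops P col col' G (set (snd v))" and r: "relab P v w"
  shows "relab P (sub P G v) (sub P G w)"
proof -
  obtain s where s: "fst v \<in> opers P" "length (snd v) = arity P (fst v)" "length (snd w) = arity P (fst v)"
    "s \<in> permutations_of_set {..<arity P (fst v)}" "fst w = act P s (fst v)" "snd v = map ((!) (snd w)) s"
    using r by (auto simp: relab_def)
  have w: "lop P col w" by (rule lop_relab[OF r v])
  have st: "set (snd w) = set (snd v)" using mset_eq_setD[OF relab_mset[OF r]] by simp
  have Gw: "lops P col col' G (set (snd w))" using G st by simp
  note cv = sub_composable[OF v G] and cw = sub_composable[OF w Gw]
  let ?qs = "map (\<lambda>l. fst (G l)) (snd w)" and ?xss = "map (\<lambda>l. snd (G l)) (snd w)"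
  have len: "map (arity P) ?qs = map length ?xss" using Gw by (auto simp: lops_def lop_def)
  define B where "B = chop (map length ?xss) [0..<length (concat ?xss)]"
  have ib: "input_blocks P ?qs = B" unfolding B_def by (rule input_blocks_alt[OF len])
  note B = chop_upt[of ?xss, folded B_def]
  have sl: "set s \<subseteq> {..<length B}" "set s \<subseteq> {..<length (snd w)}"
    using perm_set[OF s(4)] B(1) s(3) by simp_all
  let ?S = "concat (map ((!) B) s)"
  have "gcomp P (fst w) ?qs = act P (concat (map ((!) (input_blocks P ?qs)) s)) (gcomp P (fst v) (map ((!) ?qs) s))"
    using equivariant_outer[OF s(1,4)] cw s(5) by simp
  also have "map ((!) ?qs) s = map (\<lambda>l. fst (G l)) (snd v)" unfolding s(6) by (rule map_nth_map[OF sl(2)])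
  finally have e: "fst (sub P G w) = act P ?S (fst (sub P G v))" by (simp add: sub_def ib)
  have "mset (map ((!) B) s) = mset B" by (rule mset_map_nth_perm) (use s B(1) in simp)
  then have "mset ?S = mset (concat B)" by (rule mset_concat_cong)
  then have p: "?S \<in> permutations_of_set {..<length (concat ?xss)}" unfolding perm_iff_mset B(2) .
  have "map ((!) (snd (sub P G w))) ?S = concat (map (map ((!) (concat ?xss))) (map ((!) B) s))"
    by (simp add: sub_def map_concat)
  also have "map (map ((!) (concat ?xss))) (map ((!) B) s) = map ((!) ?xss) s"
    unfolding map_nth_map[OF sl(1), symmetric] B(3) ..
  also have "\<dots> = map (\<lambda>l. snd (G l)) (snd v)" unfolding s(6) by (rule map_nth_map[OF sl(2)])
  finally have l: "snd (sub P G v) = map ((!) (snd (sub P G w))) ?S" by (simp add: sub_def)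
  have lv: "length (snd (sub P G v)) = arity P (fst (sub P G v))" using lop_length[OF lop_sub(1)[OF v G]] .
  have ll: "length (concat ?xss) = arity P (fst (sub P G v))"
    unfolding lv[symmetric] l length_map perm_length[OF p] ..
  have p': "?S \<in> permutations_of_set {..<arity P (fst (sub P G v))}" using p unfolding ll .
  have lw: "length (snd (sub P G w)) = arity P (fst (sub P G v))" unfolding ll[symmetric] by (simp add: sub_def)
  have ov: "fst (sub P G v) \<in> opers P" using lop_sub(1)[OF v G] by (simp add: lop_def)
  show ?thesis
    unfolding relab_def by (intro conjI bexI[of _ ?S] ov lv lw e l p')
qed

text \<open>The labelled form of \<open>equivariant_inner\<close>. The order of the blocks is kept,
  and each is permuted within itself by the permutation \<open>\<sigma> l\<close> relating
  \<open>G l\<close> and \<open>G' l\<close>.\<close>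

lemma relab_sub_inner:
  assumes v: "lop P col v" and G: "lops P col col' G (set (snd v))"
    and r: "\<And>l. l \<in> set (snd v) \<Longrightarrow> relab P (G l) (G' l)"
  shows "relab P (sub P G v) (sub P G' v)"
proof -
  have "\<forall>l\<in>set (snd v). \<exists>s. s \<in> permutations_of_set {..<arity P (fst (G l))} \<and> fst (G' l) = act P s (fst (G l)) \<and>
      snd (G l) = map ((!) (snd (G' l))) s \<and> length (snd (G' l)) = arity P (fst (G l))"
    using r by (auto simp: relab_def)
  then obtain \<sigma> where \<sigma>: "\<And>l. l \<in> set (snd v) \<Longrightarrow> \<sigma> l \<in> permutations_of_set {..<arity P (fst (G l))}"
    "\<And>l. l \<in> set (snd v) \<Longrightarrow> fst (G' l) = act P (\<sigma> l) (fst (G l))"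
    "\<And>l. l \<in> set (snd v) \<Longrightarrow> snd (G l) = map ((!) (snd (G' l))) (\<sigma> l)"
    "\<And>l. l \<in> set (snd v) \<Longrightarrow> length (snd (G' l)) = arity P (fst (G l))"
    by metis
  note c = sub_composable[OF v G]
  let ?qs = "map (\<lambda>l. fst (G l)) (snd v)" and ?xss = "map (\<lambda>l. snd (G' l)) (snd v)" and ?ss = "map \<sigma> (snd v)"
  have len: "map (arity P) ?qs = map length ?xss" using \<sigma>(4) by auto
  define B where "B = chop (map length ?xss) [0..<length (concat ?xss)]"
  have ib: "input_blocks P ?qs = B" unfolding B_def by (rule input_blocks_alt[OF len])
  note B = chop_upt[of ?xss, folded B_def]
  let ?Bs = "map2 (\<lambda>B s. map ((!) B) s) B ?ss"
  have la: "list_all2 (\<lambda>q s. s \<in> permutations_of_set {..<arity P q}) ?qs ?ss"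
    using \<sigma>(1) by (auto simp: list_all2_map1 list_all2_map2 list_all2_same)
  have "gcomp P (fst v) (map2 (act P) ?ss ?qs) = act P (concat ?Bs) (gcomp P (fst v) ?qs)"
    using equivariant_inner[OF c la] unfolding ib .
  also have "map2 (act P) ?ss ?qs = map (\<lambda>l. fst (G' l)) (snd v)"
    using \<sigma>(2) by (auto simp: map2_map_map)
  finally have e: "fst (sub P G' v) = act P (concat ?Bs) (fst (sub P G v))" by (simp add: sub_def)
  have nB: "length (B ! k) = arity P (fst (G (snd v ! k)))" "map ((!) (concat ?xss)) (B ! k) = snd (G' (snd v ! k))"
    if "k < length (snd v)" for k
  proof -
    have "length (B ! k) = length (?xss ! k)"
      using arg_cong[OF B(4), of "\<lambda>l. l ! k"] that B(1) by simp
    then show "length (B ! k) = arity P (fst (G (snd v ! k)))" using that \<sigma>(4) by simp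
    show "map ((!) (concat ?xss)) (B ! k) = snd (G' (snd v ! k))"
      using arg_cong[OF B(3), of "\<lambda>l. l ! k"] that B(1) by simp
  qed
  have lB: "length B = length (snd v)" using B(1) by simp
  have "map mset ?Bs = map mset B"
  proof (rule nth_equalityI)
    fix k assume "k < length (map mset ?Bs)"
    then have k: "k < length (snd v)" by simp
    have "\<sigma> (snd v ! k) \<in> permutations_of_set {..<length (B ! k)}" using \<sigma>(1) k nB(1)[OF k] by simp
    from mset_map_nth_perm[OF this] show "map mset ?Bs ! k = map mset B ! k" using k lB by simp
  qed (use lB in simp)
  then have "mset (concat ?Bs) = mset (concat B)" by (simp add: mset_concat)
  then have p: "concat ?Bs \<in> permutations_of_set {..<length (concat ?xss)}" unfolding perm_iff_mset B(2) .
  have "map (map ((!) (concat ?xss))) ?Bs = map (\<lambda>l. snd (G l)) (snd v)"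
  proof (rule nth_equalityI)
    fix k assume "k < length (map (map ((!) (concat ?xss))) ?Bs)"
    then have k: "k < length (snd v)" by simp
    have sk: "set (\<sigma> (snd v ! k)) \<subseteq> {..<length (B ! k)}" using perm_set[OF \<sigma>(1)] k nB(1)[OF k] by simp
    have "map ((!) (concat ?xss)) (map ((!) (B ! k)) (\<sigma> (snd v ! k))) = map ((!) (snd (G' (snd v ! k)))) (\<sigma> (snd v ! k))"
      unfolding map_nth_map[OF sk, symmetric] nB(2)[OF k] ..
    then show "map (map ((!) (concat ?xss))) ?Bs ! k = map (\<lambda>l. snd (G l)) (snd v) ! k"
      using k lB \<sigma>(3) by (simp del: map_map)
  qed (use lB in simp)
  then have l: "snd (sub P G v) = map ((!) (snd (sub P G' v))) (concat ?Bs)"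
    by (simp add: sub_def map_concat del: map_map)
  have lv: "length (snd (sub P G v)) = arity P (fst (sub P G v))" using lop_length[OF lop_sub(1)[OF v G]] .
  have ll: "length (concat ?xss) = arity P (fst (sub P G v))"
    unfolding lv[symmetric] l length_map perm_length[OF p] ..
  have p': "concat ?Bs \<in> permutations_of_set {..<arity P (fst (sub P G v))}" using p unfolding ll .
  have lw: "length (snd (sub P G' v)) = arity P (fst (sub P G v))" unfolding ll[symmetric] by (simp add: sub_def)
  have ov: "fst (sub P G v) \<in> opers P" using lop_sub(1)[OF v G] by (simp add: lop_def)
  show ?thesis
    unfolding relab_def by (intro conjI bexI[of _ "concat ?Bs"] ov lv lw e l p')
qed

text \<open>Composition of vertices is associative because \<open>sub\<close> is, as sorting the labels at an
  intermediate stage does not change the normal form.\<close>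

lemma nf_sub_nf_outer:
  assumes "lop P col v" "distinct (snd v)" "lops P col col' G (set (snd v))" "distinct (snd (sub P G v))"
  shows "nf P (sub P G (nf P v)) = nf P (sub P G v)"
  using nf_relab[OF relab_sub_outer[OF assms(1,3) relab_nf] assms(4)] assms(1,2) lop_length
  by (simp add: lop_def)

lemma nf_sub_nf_inner:
  assumes "lop P col v" "lops P col col' G (set (snd v))" "distinct (snd (sub P G v))"
    "\<And>l. l \<in> set (snd v) \<Longrightarrow> distinct (snd (G l))"
  shows "nf P (sub P (\<lambda>l. nf P (G l)) v) = nf P (sub P G v)"
proof -
  have "relab P (G l) (nf P (G l))" if "l \<in> set (snd v)" for l
    using assms(2,4) that lop_length[of col' "G l"] by (intro relab_nf) (auto simp: lops_def lop_def)
  from nf_relab[OF relab_sub_inner[OF assms(1,2) this] assms(3)] show ?thesis by simp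
qed

end

definition sh :: "'o \<times> nat list \<Rightarrow> 'o \<times> nat list" where "sh v = (fst v, map Suc (snd v))"

definition ids :: "('c, 'o, 'x) operad_scheme \<Rightarrow> (nat \<Rightarrow> 'c) \<Rightarrow> nat \<Rightarrow> 'o \<times> nat list" where
  "ids P col k = (ident P (col k), [k])"

text \<open>\<open>low\<close> grafts \<open>X\<close> on the first input, labelled 0, of a lower vertex whose other labels are
  shifted by \<open>mark\<close>; \<open>mcomp\<close> is the composition of lower vertices, which keeps that first input.\<close>

definition low :: "('c, 'o, 'x) sym_operad_scheme \<Rightarrow> (nat \<Rightarrow> 'c) \<Rightarrow> 'o \<times> nat list \<Rightarrow> 'o \<times> nat list \<Rightarrow> 'o \<times> nat list" where
  "low P col X r = sub P (case_nat X (ids P col)) r"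

definition mcomp :: "('c, 'o, 'x) sym_operad_scheme \<Rightarrow> 'c \<Rightarrow> (nat \<Rightarrow> 'c) \<Rightarrow> (nat \<Rightarrow> 'o \<times> nat list) \<Rightarrow> 'o \<times> nat list \<Rightarrow> 'o \<times> nat list \<Rightarrow> 'o \<times> nat list" where
  "mcomp P c col G q r =
     sub P (case_nat (sub P (case_nat (ident P c, [0]) (\<lambda>k. sh (G k))) q) (\<lambda>k. sh (ids P col k))) r"

lemma sub_sh: "sub P (case_nat X G) (sh v) = sub P G v"
  by (simp add: sub_def sh_def o_def)

lemma lop_sh: "lop P (case_nat c col) (sh v) \<longleftrightarrow> lop P col v"
  by (simp add: lop_def sh_def o_def)

lemma lops_sh: "lops P col (case_nat c col') (\<lambda>k. sh (G k)) A \<longleftrightarrow> lops P col col' G A"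
  by (simp add: lops_def lop_sh) (simp add: sh_def)

lemma set_mark: "set (mark m) = insert 0 (Suc ` set m)"
  by (simp add: mark_def)

lemma lops_case: "lops P (case_nat c col) col' (case_nat X G) (insert 0 (Suc ` A)) \<longleftrightarrow>
   lop P col' X \<and> out P (fst X) = c \<and> lops P col col' G A"
  by (auto simp: lops_def)

section \<open>Grafting on lower vertices and composing them\<close>

context symmetric_operad
begin

lemma lop_colours: "lop P col v \<Longrightarrow> k \<in> set (snd v) \<Longrightarrow> col k \<in> colours P"
  using ins_colours[of "fst v"] by (auto simp: lop_def)

lemma lops_ids: "(\<And>k. k \<in> A \<Longrightarrow> col k \<in> colours P) \<Longrightarrow> lops P col col (ids P col) A"
  by (simp add: lops_def lop_def ids_def ident_opers ident_ins ident_out)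

lemma sub_unit: "lop P col (G l) \<Longrightarrow> out P (fst (G l)) = c \<Longrightarrow> sub P G (ident P c, [l]) = G l"
  using gcomp_ident_left[of "fst (G l)"] by (simp add: sub_def lop_def)

lemma lop_ident: "col l \<in> colours P \<Longrightarrow> lop P col (ident P (col l), [l])"
  by (simp add: lop_def ident_opers ident_ins)

lemma low_env:
  assumes X: "lop P col X" "out P (fst X) = c" and r: "lop P (case_nat c col) (r, mark m)"
  shows "lops P (case_nat c col) col (case_nat X (ids P col)) (set (mark m))"
proof -
  have "col k \<in> colours P" if "k \<in> set m" for k using lop_colours[OF r, of "Suc k"] that by (simp add: set_mark)
  then show ?thesis unfolding set_mark lops_case using X lops_ids by blast
qed

lemma lop_low:
  assumes "lop P col X" "out P (fst X) = c" "lop P (case_nat c col) (r, mark m)"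
  shows "lop P col (low P col X (r, mark m))" "out P (fst (low P col X (r, mark m))) = out P r"
  using lop_sub[OF assms(3), of col "case_nat X (ids P col)"] low_env[OF assms] unfolding low_def by simp_all

lemma low_eq:
  assumes "lop P (case_nat c col) (r, mark m)"
  shows "low P col X (r, mark m) = (pcomp P r 0 (fst X), snd X @ m)"
proof -
  have "ins P r = c # map col m" using assms by (simp add: lop_def map_case_nat_mark)
  then show ?thesis by (simp add: low_def sub_def pcomp_def mark_def ids_def o_def)
qed

lemma relab_low:
  assumes X: "lop P col X" "out P (fst X) = c" and r: "lop P (case_nat c col) (r, mark m)"
    and rX: "relab P X X'" and rr: "relab P (r, mark m) (r', mark m')"
  shows "relab P (low P col X (r, mark m)) (low P col X' (r', mark m'))"
proof -
  have r': "lop P (case_nat c col) (r', mark m')" by (rule lop_relab[OF rr r])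
  note e = low_env[OF X r] and e' = low_env[OF X r']
  have 1: "relab P (low P col X (r, mark m)) (low P col X (r', mark m'))"
    unfolding low_def by (rule relab_sub_outer[OF r _ rr]) (use e in simp)
  have "relab P (case_nat X (ids P col) l) (case_nat X' (ids P col) l)" if "l \<in> set (mark m')" for l
  proof (cases l)
    case (Suc k)
    have "lop P col (ids P col k)" using e' that Suc by (auto simp: lops_def)
    then show ?thesis using Suc relab_refl lop_length by (simp add: lop_def)
  qed (use rX in simp)
  then have 2: "relab P (low P col X (r', mark m')) (low P col X' (r', mark m'))"
    unfolding low_def by (intro relab_sub_inner[OF r']) (use e' in simp_all)
  show ?thesis by (rule relab_trans[OF 1 2])
qed

lemma mcomp_env:
  assumes c: "c \<in> colours P" and q: "lop P (case_nat c col) (q, mark l)"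
    and G: "lops P col col' G (set l)" and r: "lop P (case_nat (out P q) col') (r, mark m)"
  shows "lops P (case_nat c col) (case_nat c col') (case_nat (ident P c, [0]) (\<lambda>k. sh (G k))) (set (mark l))"
    and "lops P (case_nat (out P q) col') (case_nat c col')
      (case_nat (sub P (case_nat (ident P c, [0]) (\<lambda>k. sh (G k))) (q, mark l)) (\<lambda>k. sh (ids P col' k))) (set (mark m))"
proof -
  show 1: "lops P (case_nat c col) (case_nat c col') (case_nat (ident P c, [0]) (\<lambda>k. sh (G k))) (set (mark l))"
    unfolding set_mark lops_case lops_sh using lop_ident[of "case_nat c col'" 0] c G ident_out by simp
  have "col' k \<in> colours P" if "k \<in> set m" for k using lop_colours[OF r, of "Suc k"] that by (simp add: set_mark)
  then show "lops P (case_nat (out P q) col') (case_nat c col')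
      (case_nat (sub P (case_nat (ident P c, [0]) (\<lambda>k. sh (G k))) (q, mark l)) (\<lambda>k. sh (ids P col' k))) (set (mark m))"
    unfolding set_mark lops_case lops_sh using lop_sub[OF q, of "case_nat c col'"] 1 lops_ids by simp
qed

lemma lop_mcomp:
  assumes "c \<in> colours P" "lop P (case_nat c col) (q, mark l)"
    "lops P col col' G (set l)" "lop P (case_nat (out P q) col') (r, mark m)"
  shows "lop P (case_nat c col') (mcomp P c col' G (q, mark l) (r, mark m))"
    "out P (fst (mcomp P c col' G (q, mark l) (r, mark m))) = out P r"
  using lop_sub[OF assms(4) , of "case_nat c col'"] mcomp_env(2)[OF assms] unfolding mcomp_def by simp_all

lemma mcomp_eq:
  assumes r: "lop P (case_nat c' col') (r, mark m)"
  shows "mcomp P c col' G (q, mark l) (r, mark m) =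
    (pcomp P r 0 (gcomp P q (ident P c # map (\<lambda>k. fst (G k)) l)), mark (concat (map (\<lambda>k. snd (G k)) l) @ m))"
proof -
  have "ins P r = c' # map col' m" using r by (simp add: lop_def map_case_nat_mark)
  then show ?thesis by (simp add: mcomp_def sub_def pcomp_def mark_def ids_def sh_def o_def map_concat)
qed

lemma relab_mcomp:
  assumes a: "c \<in> colours P" "lop P (case_nat c col) (q, mark l)"
    "lops P col col' G (set l)" "lop P (case_nat (out P q) col') (r, mark m)"
    and rr: "relab P (r, mark m) (r', mark m')" and rq: "relab P (q, mark l) (q', mark l')"
    and rG: "\<And>k. k \<in> set l \<Longrightarrow> relab P (G k) (G' k)"
  shows "relab P (mcomp P c col' G (q, mark l) (r, mark m)) (mcomp P c col' G' (q', mark l') (r', mark m'))"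
proof -
  have r': "lop P (case_nat (out P q) col') (r', mark m')" by (rule lop_relab[OF rr a(4)])
  note e = mcomp_env[OF a] and e' = mcomp_env[OF a(1-3) r']
  have 1: "relab P (mcomp P c col' G (q, mark l) (r, mark m)) (mcomp P c col' G (q, mark l) (r', mark m'))"
    unfolding mcomp_def by (rule relab_sub_outer[OF a(4) _ rr]) (use e(2) in simp)
  let ?H = "case_nat (ident P c, [0]) (\<lambda>k. sh (G k))" and ?H' = "case_nat (ident P c, [0]) (\<lambda>k. sh (G' k))"
  have q': "lop P (case_nat c col) (q', mark l')" by (rule lop_relab[OF rq a(2)])
  have st: "set (mark l') = set (mark l)" using mset_eq_setD[OF relab_mset[OF rq]] by simp
  have "relab P (?H k) (?H' k)" if "k \<in> set (mark l)" for k
  proof (cases k)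
    case 0
    then show ?thesis using relab_refl[of "(ident P c, [0])"] a(1) ident_opers ident_ins by simp
  next
    case (Suc j)
    then have "relab P (G j) (G' j)" using rG that by (auto simp: mark_def)
    then show ?thesis using Suc relab_map[of "fst (G j)" "snd (G j)" "fst (G' j)" "snd (G' j)" Suc] by (simp add: sh_def)
  qed
  then have "relab P (sub P ?H (q', mark l')) (sub P ?H' (q', mark l'))"
    using relab_sub_inner[OF q', of _ ?H ?H'] e(1) st by simp
  moreover have "relab P (sub P ?H (q, mark l)) (sub P ?H (q', mark l'))"
    by (rule relab_sub_outer[OF a(2) _ rq]) (use e(1) in simp)
  ultimately have r0: "relab P (sub P ?H (q, mark l)) (sub P ?H' (q', mark l'))" by (rule relab_trans[rotated])
  have "relab P (case_nat (sub P ?H (q, mark l)) (\<lambda>k. sh (ids P col' k)) k) (case_nat (sub P ?H' (q', mark l')) (\<lambda>k. sh (ids P col' k)) k)"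
    if "k \<in> set (mark m')" for k
  proof (cases k)
    case (Suc j)
    have "lop P (case_nat c col') (sh (ids P col' j))" using e'(2) that Suc by (auto simp: lops_def)
    then show ?thesis using Suc relab_refl lop_length by (simp add: lop_def)
  qed (use r0 in simp)
  then have 2: "relab P (mcomp P c col' G (q, mark l) (r', mark m')) (mcomp P c col' G' (q', mark l') (r', mark m'))"
    unfolding mcomp_def by (intro relab_sub_inner[OF r']) (use e'(2) in simp_all)
  show ?thesis by (rule relab_trans[OF 1 2])
qed

text \<open>Composing the lower vertices and then grafting agrees with grafting first and then
  composing. Both sides are nested substitutions, which \<open>sub_sub\<close> brings to one form
  with \<open>sub P (case_nat (sub P G X) G) (q, mark l)\<close> at the first input of
  \<open>r\<close>. This is the equation behind the target of a composite.\<close>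

lemma low_mcomp:
  assumes c: "c \<in> colours P" and q: "lop P (case_nat c col) (q, mark l)"
    and G: "lops P col col' G (set l \<union> set (snd X))" and r: "lop P (case_nat (out P q) col') (r, mark m)"
    and X: "lop P col X" "out P (fst X) = c"
  shows "low P col' (sub P G X) (mcomp P c col' G (q, mark l) (r, mark m)) =
         low P col' (sub P G (low P col X (q, mark l))) (r, mark m)"
proof -
  have Gl: "lops P col col' G (set l)" and GX: "lops P col col' G (set (snd X))"
    using G by (auto intro: lops_subset)
  note e = mcomp_env[OF c q Gl r]
  let ?Y = "sub P G X"
  have Y: "lop P col' ?Y" "out P (fst ?Y) = c" using lop_sub[OF X(1) GX] X(2) by simp_all
  let ?K = "case_nat ?Y (ids P col')" and ?H = "case_nat (ident P c, [0]) (\<lambda>k. sh (G k))"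
  have colm: "col' k \<in> colours P" if "k \<in> set m" for k using lop_colours[OF r, of "Suc k"] that by (simp add: set_mark)
  have coll: "col k \<in> colours P" if "k \<in> set l" for k using lop_colours[OF q, of "Suc k"] that by (simp add: set_mark)
  have colG: "col' j \<in> colours P" if "k \<in> set l" "j \<in> set (snd (G k))" for j k
    using lop_colours[of col' "G k"] Gl that by (auto simp: lops_def)
  have K: "lops P (case_nat c col') col' ?K (insert 0 (Suc ` A))" if "\<And>k. k \<in> A \<Longrightarrow> col' k \<in> colours P" for A
    unfolding lops_case using Y lops_ids that by blast
  have labs: "snd (?H k) = (if k = 0 then [0] else map Suc (snd (G (k - 1))))" for k
    by (cases k) (simp_all add: sh_def)
  have in1: "(\<Union>k\<in>set (mark l). set (snd (?H k))) \<subseteq> insert 0 (Suc ` (\<Union>k\<in>set l. set (snd (G k))))"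
    by (auto simp: set_mark labs sh_def)
  have s1: "sub P ?K (sub P ?H (q, mark l)) = sub P (\<lambda>k. sub P ?K (?H k)) (q, mark l)"
    by (rule sub_sub[OF q, of "case_nat c col'" _ col'])
      (use e(1) lops_subset[OF K in1[unfolded snd_conv]] colG in \<open>auto intro: lops_subset\<close>)
  have s2: "sub P (\<lambda>k. sub P ?K (?H k)) (q, mark l) = sub P (case_nat ?Y G) (q, mark l)"
  proof (rule sub_cong)
    fix k assume kk: "k \<in> set (snd (q, mark l))"
    show "sub P ?K (?H k) = case_nat ?Y G k"
    proof (cases k)
      case 0
      then show ?thesis using sub_unit[of col' ?K 0 c] Y by simp
    next
      case (Suc j)
      then have j: "j \<in> set l" using kk by (auto simp: set_mark)
      have "sub P ?K (sh (G j)) = sub P (ids P col') (G j)" by (rule sub_sh)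
      also have "\<dots> = G j" by (rule sub_ident_right[of col']) (use Gl j in \<open>auto simp: lops_def ids_def\<close>)
      finally show ?thesis using Suc by simp
    qed
  qed
  let ?A = "case_nat (sub P ?H (q, mark l)) (\<lambda>k. sh (ids P col' k))"
  have in2: "(\<Union>k\<in>set (mark m). set (snd (?A k))) \<subseteq> insert 0 (Suc ` (\<Union>k\<in>set l. set (snd (G k)))) \<union> Suc ` set m"
    by (auto simp: set_mark labs sh_def ids_def sub_def)
  have e2: "lops P (case_nat c col') col' ?K (\<Union>k\<in>set (mark m). set (snd (?A k)))"
    by (rule lops_subset[OF K[of "(\<Union>k\<in>set l. set (snd (G k))) \<union> set m"]]) (use in2 colG colm in auto)
  have "low P col' ?Y (mcomp P c col' G (q, mark l) (r, mark m)) = sub P ?K (sub P ?A (r, mark m))"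
    by (simp add: low_def mcomp_def)
  also have "\<dots> = sub P (\<lambda>k. sub P ?K (?A k)) (r, mark m)"
    by (rule sub_sub[OF r, of "case_nat c col'" _ col']) (use e(2) e2 in simp_all)
  also have "\<dots> = sub P (case_nat (sub P (case_nat ?Y G) (q, mark l)) (ids P col')) (r, mark m)"
  proof (rule sub_cong)
    fix k assume kk: "k \<in> set (snd (r, mark m))"
    show "sub P ?K (?A k) = case_nat (sub P (case_nat ?Y G) (q, mark l)) (ids P col') k"
    proof (cases k)
      case 0
      then show ?thesis using s1 s2 by simp
    next
      case (Suc j)
      then have j: "col' j \<in> colours P" using kk colm by (auto simp: set_mark)
      have "sub P ?K (sh (ids P col' j)) = sub P (ids P col') (ids P col' j)" by (rule sub_sh)
      also have "\<dots> = ids P col' j"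
        by (rule sub_ident_right[of col']) (use lop_ident[of col' j] j in \<open>auto simp: ids_def\<close>)
      finally show ?thesis using Suc by simp
    qed
  qed
  also have "sub P (case_nat ?Y G) (q, mark l) = sub P (\<lambda>k. sub P G (case_nat X (ids P col) k)) (q, mark l)"
  proof (rule sub_cong)
    fix k assume kk: "k \<in> set (snd (q, mark l))"
    show "case_nat ?Y G k = sub P G (case_nat X (ids P col) k)"
      using sub_unit[of col' G "k - 1" "col (k - 1)"] Gl kk
      by (cases k) (auto simp: set_mark ids_def lops_def)
  qed
  also have "\<dots> = sub P G (low P col X (q, mark l))"
    unfolding low_def
  proof (rule sub_sub[symmetric, OF q])
    show "lops P (case_nat c col) col (case_nat X (ids P col)) (set (snd (q, mark l)))"
      using low_env[OF X q] by simp
    show "lops P col col' G (\<Union>k\<in>set (snd (q, mark l)). set (snd (case_nat X (ids P col) k)))"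
      by (rule lops_subset[OF G]) (auto simp: set_mark ids_def)
  qed
  finally show ?thesis by (simp only: low_def)
qed

text \<open>Both sides reduce to \<open>s\<close> composed with \<open>r(?Z,...)\<close>, where
  \<open>?Z\<close> is \<open>q\<close> with all layers grafted and an identity at the first input.
  The inner composites get names of the form \<open>(x, mark ls)\<close>, because
  \<open>mcomp_eq\<close> reads labels in that form.\<close>

lemma mcomp_mcomp:
  assumes c: "c \<in> colours P" and q: "lop P (case_nat c col) (q, mark l)"
    and G: "lops P col col' G (set l)" and r: "lop P (case_nat (out P q) col') (r, mark m)"
    and H: "lops P col' col'' H ((\<Union>k\<in>set l. set (snd (G k))) \<union> set m)"
    and s: "lop P (case_nat (out P r) col'') (s, mark n)"
    and qr: "mcomp P c col' G (q, mark l) (r, mark m) = (qr, mark lm)"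
    and rs: "mcomp P (out P q) col'' H (r, mark m) (s, mark n) = (rs, mark mn)"
  shows "mcomp P c col'' H (qr, mark lm) (s, mark n) =
    mcomp P c col'' (\<lambda>k. sub P H (G k)) (q, mark l) (rs, mark mn)"
proof -
  have oq: "out P q \<in> colours P" using q out_colours by (simp add: lop_def)
  have e1: "mcomp P c col' G (q, mark l) (r, mark m) =
    (pcomp P r 0 (gcomp P q (ident P c # map (\<lambda>k. fst (G k)) l)), mark (concat (map (\<lambda>k. snd (G k)) l) @ m))"
    by (rule mcomp_eq[OF r])
  have e2: "mcomp P (out P q) col'' H (r, mark m) (s, mark n) =
    (pcomp P s 0 (gcomp P r (ident P (out P q) # map (\<lambda>k. fst (H k)) m)), mark (concat (map (\<lambda>k. snd (H k)) m) @ n))"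
    by (rule mcomp_eq[OF s])
  have qr': "qr = pcomp P r 0 (gcomp P q (ident P c # map (\<lambda>k. fst (G k)) l))" "lm = concat (map (\<lambda>k. snd (G k)) l) @ m"
    and rs': "rs = pcomp P s 0 (gcomp P r (ident P (out P q) # map (\<lambda>k. fst (H k)) m))" "mn = concat (map (\<lambda>k. snd (H k)) m) @ n"
    using qr rs e1 e2 by (simp_all add: mark_inj)
  have Hl: "lops P col' col'' H (set (snd (G k)))" if "k \<in> set l" for k using lops_subset[OF H] that by blast
  have Hm: "lops P col' col'' H (set m)" using lops_subset[OF H] by blast
  have HG: "lops P col col'' (\<lambda>k. sub P H (G k)) (set l)"
    using G Hl lop_sub[of col' "G k" col'' H for k] by (auto simp: lops_def)
  have rs2: "lop P (case_nat (out P q) col'') (rs, mark mn)"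
    using lop_mcomp(1)[OF oq r Hm s] unfolding rs .
  let ?V = "map (\<lambda>k. fst (G k)) l" and ?HV = "map (\<lambda>k. fst (sub P H (G k))) l" and ?Hm = "map (\<lambda>k. fst (H k)) m"
  have iq: "ins P q = c # map col l" and ir: "ins P r = out P q # map col' m" and is': "ins P s = out P r # map col'' n"
    using q r s by (simp_all add: lop_def map_case_nat_mark)
  have oo: "q \<in> opers P" "r \<in> opers P" "s \<in> opers P" using q r s by (simp_all add: lop_def)
  have idc: "ident P c \<in> opers P" "out P (ident P c) = c" "ins P (ident P c) = [c]" "gcomp P (ident P c) [ident P c] = ident P c"
    using c ident_opers ident_out ident_ins gcomp_ident_left[of "ident P c"] by simp_all
  have cq: "composable P q (ident P c # ?V)" using oo iq idc G by (auto simp: composable_def lops_def lop_def)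
  let ?rss = "[ident P c] # map (\<lambda>k. map (\<lambda>j. fst (H j)) (snd (G k))) l"
  have la: "list_all2 (composable P) (ident P c # ?V) ?rss"
    using idc G Hl sub_composable[of col' "G k" col'' H for k]
    by (auto simp: list_all2_map1 list_all2_map2 list_all2_same lops_def composable_def)
  have HVe: "map2 (gcomp P) (ident P c # ?V) ?rss = ident P c # ?HV"
    using idc by (simp add: map2_map_map sub_def)
  have cs: "concat ?rss = ident P c # map (\<lambda>j. fst (H j)) (concat (map (\<lambda>k. snd (G k)) l))"
    by (simp add: map_concat o_def)
  let ?W = "gcomp P q (ident P c # ?V)"
  have WZ: "gcomp P ?W (concat ?rss) = gcomp P q (ident P c # ?HV)" using gcomp_assoc[OF cq la] HVe by simp
  have cW: "composable P ?W (concat ?rss)" by (rule composable_map2_gcomp(2)[OF cq la])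
  have cZ: "composable P q (ident P c # ?HV)" using composable_map2_gcomp(1)[OF cq la] HVe by simp
  have rW: "pcomposable P r 0 ?W"
    using gcomp_opers[OF cq] gcomp_out[OF cq] oo ir by (simp add: pcomposable_def)
  have hm: "map (out P) ?Hm = drop (Suc 0) (ins P r)" "set ?Hm \<subseteq> opers P"
    using Hm ir by (auto simp: lops_def lop_def)
  have L: "gcomp P qr (ident P c # map (\<lambda>k. fst (H k)) lm) = gcomp P r (gcomp P q (ident P c # ?HV) # ?Hm)"
    using gcomp_pcomp(1)[OF rW cW _ _ hm, of "[]", unfolded WZ] unfolding cs qr' by simp
  let ?Z = "gcomp P q (ident P c # ?HV)"
  have oZ: "?Z \<in> opers P" "out P ?Z = out P q" using gcomp_opers[OF cZ] gcomp_out[OF cZ] by simp_all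
  have crid: "composable P r ([] @ [ident P (out P ?Z)] @ ?Hm)"
    using oo ir oZ hm ident_opers ident_out oq by (simp add: composable_def)
  note Y = pcomp_replace_ident[OF crid oZ(1), simplified, unfolded oZ(2)]
  have sY: "pcomposable P s 0 (gcomp P r (ident P (out P q) # ?Hm))"
    using oo is' gcomp_opers[OF crid] gcomp_out[OF crid] oZ by (simp add: pcomposable_def)
  have R: "pcomp P rs 0 ?Z = pcomp P s 0 (gcomp P r (?Z # ?Hm))"
    using pcomp_pcomp(1)[OF sY Y(2)] Y(1) unfolding rs' by simp
  have "mcomp P c col'' H (qr, mark lm) (s, mark n) =
      (pcomp P s 0 (gcomp P r (?Z # ?Hm)), mark (concat (map (\<lambda>k. snd (H k)) lm) @ n))"
    unfolding mcomp_eq[OF s] L ..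
  also have "concat (map (\<lambda>k. snd (H k)) lm) @ n = concat (map (\<lambda>k. snd (sub P H (G k))) l) @ mn"
    unfolding qr' rs' by (simp add: map_concat concat_concat_map sub_def o_def)
  finally show ?thesis unfolding mcomp_eq[OF rs2] R .
qed

end

lemma distinct_concat_nth: "distinct (concat xss) \<Longrightarrow> k < length xss \<Longrightarrow> distinct (xss ! k)"
  using nth_mem[of k xss] by (metis distinct_append concat_append concat.simps(2) split_list)

lemma perm_distinct: "s \<in> permutations_of_set {..<n} \<Longrightarrow> distinct s"
  by (simp add: permutations_of_set_def)

lemma concat_inj:
  assumes "concat xss = concat yss" "map length xss = map length yss"
  shows "xss = yss"
proof -
  have "xss = chop (map length yss) (concat xss)" by (rule chop_concat[OF assms(2), symmetric])
  also have "\<dots> = yss" unfolding assms(1) by (rule chop_concat[OF refl])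
  finally show ?thesis .
qed

lemma concat_map_nth_singletons:
  "set ls \<subseteq> {..<n} \<Longrightarrow> concat (map ((!) (map (\<lambda>k. [k]) [0..<n])) ls) = ls"
  by (induction ls) auto

lemma set_subset_concat: "k < length xss \<Longrightarrow> set (xss ! k) \<subseteq> set (concat xss)"
  using nth_mem by fastforce

section \<open>Targets as normal forms\<close>

context symmetric_operad
begin

lemma lop_nth_upt: "p \<in> opers P \<Longrightarrow> lop P ((!) (ins P p)) (p, [0..<arity P p])"
  by (simp add: lop_def map_nth)

text \<open>An operation whose labels form a permutation represents the operation obtained by that
  permutation, labelled in order. In this way the numbering of the leaves turns a raw composite into
  the target of a tree.\<close>

lemma relab_perm_target:
  assumes "x \<in> opers P" "s \<in> permutations_of_set {..<arity P x}"
  shows "relab P (x, s) (act P s x, [0..<arity P x])" "lop P ((!) (ins P (act P s x))) (x, s)"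
proof -
  note l = perm_length[OF assms(2)]
  have "map ((!) [0..<arity P x]) s = s"
  proof (rule map_idI)
    fix k assume "k \<in> set s"
    then show "[0..<arity P x] ! k = k" unfolding perm_set[OF assms(2)] by simp
  qed
  then show "relab P (x, s) (act P s x, [0..<arity P x])"
    unfolding relab_def using assms l by (intro conjI bexI[of _ s]) simp_all
  have "ins P x = map ((!) (ins P (act P s x))) s"
  proof (rule nth_equalityI)
    fix k assume k: "k < arity P x"
    have "map ((!) (ins P (act P s x))) s ! k = ins P (act P s x) ! (s ! k)" by (rule nth_map) (simp only: l k)
    then show "ins P x ! k = map ((!) (ins P (act P s x))) s ! k" by (simp only: act_ins[OF assms k])
  qed (simp only: length_map l)
  then show "lop P ((!) (ins P (act P s x))) (x, s)" using assms by (simp add: lop_def)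
qed

lemma nf_perm: "s \<in> permutations_of_set {..<n} \<Longrightarrow> nf P (x, s) = (act P s x, [0..<n])"
  by (simp add: nf_def ranks_perm sort_perm)

text \<open>The sorting between the two substitutions is dropped, \<open>sub_sub\<close>
  reassociates, and a sorting is inserted at the inner stage. The distinctness assumptions are what
  each change of normal form requires.\<close>

lemma nf_sub_assoc:
  assumes v: "lop P col v" and G: "lops P col col' G (set (snd v))"
    and H: "lops P col' col'' H (\<Union>l\<in>set (snd v). set (snd (G l)))"
    and d: "distinct (snd (sub P G v))" "\<And>l. l \<in> set (snd v) \<Longrightarrow> distinct (snd (sub P H (G l)))"
      "distinct (snd (sub P H (nf P (sub P G v))))"
  shows "nf P (sub P H (nf P (sub P G v))) = nf P (sub P (\<lambda>l. nf P (sub P H (G l))) v)"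
proof -
  note s = sub_sub[OF v G H]
  have Hs: "lops P col' col'' H (set (snd (sub P G v)))"
    using H by (simp add: sub_def)
  note lg = lop_sub[OF v G]
  have "relab P (sub P G v) (nf P (sub P G v))"
    using relab_nf[OF _ lop_length[OF lg(1)] d(1)] lg(1) by (simp add: lop_def)
  from relab_mset[OF relab_sub_outer[OF lg(1) Hs this]]
  have d': "distinct (snd (sub P H (sub P G v)))" using d(3) mset_eq_imp_distinct_iff by blast
  have 1: "nf P (sub P H (nf P (sub P G v))) = nf P (sub P H (sub P G v))"
    by (rule nf_sub_nf_outer[OF lg(1) d(1) Hs d'])
  have HG: "lops P col col'' (\<lambda>l. sub P H (G l)) (set (snd v))"
    unfolding lops_def
  proof
    fix l assume l: "l \<in> set (snd v)"
    have "lop P col' (G l)" "out P (fst (G l)) = col l" using G l by (auto simp: lops_def)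
    moreover have "lops P col' col'' H (set (snd (G l)))" by (rule lops_subset[OF H]) (use l in blast)
    ultimately show "lop P col'' (sub P H (G l)) \<and> out P (fst (sub P H (G l))) = col l" using lop_sub by simp
  qed
  have "nf P (sub P (\<lambda>l. nf P (sub P H (G l))) v) = nf P (sub P (\<lambda>l. sub P H (G l)) v)"
    by (rule nf_sub_nf_inner[OF v HG]) (use d(2) d' s in simp_all)
  then show ?thesis using 1 s by simp
qed

end

section \<open>The symmetric twisted arrow category\<close>

definition sU :: "'o stree \<Rightarrow> nat \<Rightarrow> 'o \<times> nat list" where "sU f k = (supper f ! k, supper_labels f ! k)"

section \<open>Composition of symmetric trees\<close>

context symmetric_operad
begin

abbreviation "sM f \<equiv> (slower f, mark (slower_labels f))"
abbreviation "scol p \<equiv> (!) (ins P p)"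

text \<open>The dictionary between trees and labelled operations. Substituting the upper vertices
  into the source and grafting the result on the lower vertex gives the raw composite labelled by
  \<open>sleaves f\<close>, and its normal form is the target with inputs in order.\<close>

lemma stree_arrowD:
  assumes f: "stree_arrow P f"
  shows "ssource f \<in> opers P" "starget P f \<in> opers P" "out P (starget P f) = out P (slower f)"
    "arity P (starget P f) = length (sleaves f)"
    "length (supper f) = arity P (ssource f)" "length (supper_labels f) = arity P (ssource f)"
    "lops P (scol (ssource f)) (scol (starget P f)) (sU f) {..<arity P (ssource f)}"
    "lop P (case_nat (out P (ssource f)) (scol (starget P f))) (sM f)"
    "low P (scol (starget P f)) (sub P (sU f) (ssource f, [0..<arity P (ssource f)])) (sM f) =
      (pcomp P (slower f) 0 (gcomp P (ssource f) (supper f)), sleaves f)"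
    "lop P (scol (starget P f)) (sub P (sU f) (ssource f, [0..<arity P (ssource f)]))"
    "out P (fst (sub P (sU f) (ssource f, [0..<arity P (ssource f)]))) = out P (ssource f)"
    "lop P (scol (starget P f)) (pcomp P (slower f) 0 (gcomp P (ssource f) (supper f)), sleaves f)"
    "relab P (pcomp P (slower f) 0 (gcomp P (ssource f) (supper f)), sleaves f) (starget P f, [0..<arity P (starget P f)])"
    "nf P (pcomp P (slower f) 0 (gcomp P (ssource f) (supper f)), sleaves f) = (starget P f, [0..<arity P (starget P f)])"
    "sleaves f \<in> permutations_of_set {..<arity P (starget P f)}"
    "slower f \<in> opers P" "out P (ssource f) \<in> colours P"
proof -
  let ?p = "ssource f" and ?t = "starget P f" and ?T = "pcomp P (slower f) 0 (gcomp P (ssource f) (supper f))"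
  have c: "composable P ?p (supper f)" "pcomposable P (slower f) 0 ?p"
    and ll: "map length (supper_labels f) = map (arity P) (supper f)"
    and l0: "Suc (length (slower_labels f)) = arity P (slower f)"
    and pm: "sleaves f \<in> permutations_of_set {..<length (sleaves f)}"
    using f by (auto simp: stree_arrow_def)
  show p: "?p \<in> opers P" and q0: "slower f \<in> opers P" using c by (simp_all add: composable_def pcomposable_def)
  then show "out P ?p \<in> colours P" using out_colours by simp
  note tp = ptarget_pcomposable[OF c]
  have T: "?T \<in> opers P" "out P ?T = out P (slower f)" by (rule pcomp_opers[OF tp], rule pcomp_out[OF tp])
  have insT: "ins P ?T = concat (map (ins P) (supper f)) @ drop (Suc 0) (ins P (slower f))"
    using pcomp_ins[OF tp] gcomp_ins[OF c(1)] by simp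
  have "length (concat (supper_labels f)) = length (concat (map (ins P) (supper f)))"
    unfolding length_concat map_map o_def ll ..
  then have aT: "arity P ?T = length (sleaves f)" unfolding insT sleaves_def using l0 by simp
  have pT: "sleaves f \<in> permutations_of_set {..<arity P ?T}" using pm aT by simp
  have t: "?t = act P (sleaves f) ?T" by (simp add: starget_def)
  show "?t \<in> opers P" "out P ?t = out P (slower f)" "arity P ?t = length (sleaves f)"
    using act_opers[OF T(1) pT] act_out[OF T(1) pT] act_arity[OF T(1) pT] T(2) aT unfolding t by simp_all
  then show "sleaves f \<in> permutations_of_set {..<arity P ?t}" using pm by simp
  note rT = relab_perm_target[OF T(1) pT, folded t]
  have at: "arity P ?t = arity P ?T" using act_arity[OF T(1) pT] t by simp
  show "relab P (?T, sleaves f) (?t, [0..<arity P ?t])" using rT(1) unfolding at .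
  show lT: "lop P (scol ?t) (?T, sleaves f)" by (rule rT(2))
  show "nf P (?T, sleaves f) = (?t, [0..<arity P ?t])" by (simp only: nf_perm[OF pT] at t[symmetric])
  show len: "length (supper f) = arity P ?p" using composable_length[OF c(1)] .
  then show len': "length (supper_labels f) = arity P ?p" using arg_cong[OF ll, of length] by simp
  \<comment> \<open>The input colours of the raw composite are listed in two ways. Since the lengths
    agree block by block, this equality of lists splits into one for each vertex.\<close>
  have e: "concat (map (map (scol ?t)) (supper_labels f)) @ map (scol ?t) (slower_labels f) =
      concat (map (ins P) (supper f)) @ drop (Suc 0) (ins P (slower f))"
    using lT unfolding lop_def fst_conv snd_conv insT sleaves_def map_append map_concat by simp
  have le: "length (concat (map (map (scol ?t)) (supper_labels f))) = length (concat (map (ins P) (supper f)))"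
    unfolding length_concat map_map o_def length_map ll ..
  have e1: "concat (map (map (scol ?t)) (supper_labels f)) = concat (map (ins P) (supper f))"
    and e2: "map (scol ?t) (slower_labels f) = drop (Suc 0) (ins P (slower f))" using e le by simp_all
  have e3: "map (map (scol ?t)) (supper_labels f) = map (ins P) (supper f)"
    by (rule concat_inj[OF e1]) (use ll in \<open>simp add: o_def\<close>)
  have ek: "ins P (supper f ! k) = map (scol ?t) (supper_labels f ! k)" if "k < arity P ?p" for k
    using arg_cong[OF e3, of "\<lambda>l. l ! k"] that len len' by simp
  have ok: "supper f ! k \<in> opers P" "out P (supper f ! k) = ins P ?p ! k" if "k < arity P ?p" for k
    using c(1) that len nth_map[of k "supper f" "out P"] nth_mem[of k "supper f"]
    by (auto simp: composable_def)
  show U: "lops P (scol ?p) (scol ?t) (sU f) {..<arity P ?p}"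
    unfolding lops_def lop_def sU_def using ek ok by simp
  have "ins P (slower f) = out P ?p # map (scol ?t) (slower_labels f)"
    unfolding e2 using c(2) by (cases "ins P (slower f)") (auto simp: pcomposable_def)
  then show M: "lop P (case_nat (out P ?p) (scol ?t)) (sM f)"
    using q0 by (simp add: lop_def map_case_nat_mark)
  have m1: "map (\<lambda>l. fst (sU f l)) [0..<arity P ?p] = supper f" and m2: "map (\<lambda>l. snd (sU f l)) [0..<arity P ?p] = supper_labels f"
    using map_nth[of "supper f"] map_nth[of "supper_labels f"] len len' by (simp_all add: sU_def)
  have X: "sub P (sU f) (?p, [0..<arity P ?p]) = (gcomp P ?p (supper f), concat (supper_labels f))"
    unfolding sub_def fst_conv snd_conv m1 m2 ..
  show "low P (scol ?t) (sub P (sU f) (?p, [0..<arity P ?p])) (sM f) = (?T, sleaves f)"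
    unfolding low_eq[OF M] X by (simp add: sleaves_def)
  have U': "lops P (scol ?p) (scol ?t) (sU f) (set (snd (?p, [0..<arity P ?p])))" using U by (simp add: lessThan_atLeast0)
  show "lop P (scol ?t) (sub P (sU f) (?p, [0..<arity P ?p]))" "out P (fst (sub P (sU f) (?p, [0..<arity P ?p]))) = out P ?p"
    using lop_sub[OF lop_nth_upt[OF p] U'] by simp_all
qed

lemma stree_arrow_labels:
  assumes f: "stree_arrow P f" and k: "k < arity P (ssource f)"
  shows "set (snd (sU f k)) \<subseteq> {..<arity P (starget P f)}" "distinct (snd (sU f k))" "sorted (snd (sU f k))"
    and "set (slower_labels f) \<subseteq> {..<arity P (starget P f)}" "distinct (slower_labels f)" "sorted (slower_labels f)"
proof -
  note D = stree_arrowD[OF f]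
  have s: "set (sleaves f) = {..<arity P (starget P f)}" "distinct (sleaves f)"
    using D(15) perm_set perm_distinct by blast+
  have kl: "k < length (supper_labels f)" using k D(6) by simp
  show "set (snd (sU f k)) \<subseteq> {..<arity P (starget P f)}"
    using set_subset_concat[OF kl] s(1) by (auto simp: sU_def sleaves_def)
  show "distinct (snd (sU f k))" using distinct_concat_nth[OF _ kl] s(2) by (simp add: sU_def sleaves_def)
  show "sorted (snd (sU f k))" "sorted (slower_labels f)" using f nth_mem[OF kl] by (simp_all add: stree_arrow_def sU_def)
  show "set (slower_labels f) \<subseteq> {..<arity P (starget P f)}" "distinct (slower_labels f)"
    using s by (auto simp: sleaves_def)
qed

lemma stree_arrow_lower_labels:
  assumes f: "stree_arrow P f"
  shows "set (slower_labels f) \<subseteq> {..<arity P (starget P f)}" "distinct (slower_labels f)" "sorted (slower_labels f)"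
proof -
  note D = stree_arrowD[OF f]
  have s: "set (sleaves f) = {..<arity P (starget P f)}" "distinct (sleaves f)"
    using D(15) perm_set perm_distinct by blast+
  show "sorted (slower_labels f)" using f by (simp add: stree_arrow_def)
  show "set (slower_labels f) \<subseteq> {..<arity P (starget P f)}" "distinct (slower_labels f)"
    using s by (auto simp: sleaves_def)
qed

lemma stree_eqI:
  assumes "ssource f = ssource g" "sM f = sM g" "\<And>k. k < n \<Longrightarrow> sU f k = sU g k"
    "length (supper f) = n" "length (supper g) = n" "length (supper_labels f) = n" "length (supper_labels g) = n"
  shows "f = g"
proof -
  have "supper f = supper g" "supper_labels f = supper_labels g"
    by (rule nth_equalityI; use assms in \<open>simp add: sU_def\<close>)+
  then show ?thesis using assms(1,2) by (cases f, cases g) (simp add: mark_inj)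
qed

text \<open>Composition in labelled form: every vertex of a composite is a normal form. For the
  lower vertex, \<open>ranks_mark\<close> and \<open>sort_mark\<close> absorb the special treatment
  of its first input.\<close>

lemma stcomp_sel:
  assumes f: "stree_arrow P f" and g: "stree_arrow P g" and fg: "starget P f = ssource g"
  shows "ssource (stcomp P g f) = ssource f"
    "length (supper (stcomp P g f)) = arity P (ssource f)" "length (supper_labels (stcomp P g f)) = arity P (ssource f)"
    "k < arity P (ssource f) \<Longrightarrow> sU (stcomp P g f) k = nf P (sub P (sU g) (sU f k))"
    "sM (stcomp P g f) = nf P (mcomp P (out P (ssource f)) (scol (starget P g)) (sU g) (sM f) (sM g))"
    "mcomp P (out P (ssource f)) (scol (starget P g)) (sU g) (sM f) (sM g) =
      (pcomp P (slower g) 0 (gcomp P (slower f) (ident P (out P (ssource f)) # map ((!) (supper g)) (slower_labels f))),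
       mark (concat (map ((!) (supper_labels g)) (slower_labels f)) @ slower_labels g))"
proof -
  note F = stree_arrowD[OF f] and G = stree_arrowD[OF g]
  show "ssource (stcomp P g f) = ssource f"
    "length (supper (stcomp P g f)) = arity P (ssource f)" "length (supper_labels (stcomp P g f)) = arity P (ssource f)"
    using F(5,6) by (simp_all add: stcomp_def Let_def)
  show "k < arity P (ssource f) \<Longrightarrow> sU (stcomp P g f) k = nf P (sub P (sU g) (sU f k))"
    using F(5,6) by (simp add: stcomp_def Let_def sU_def nf_def sub_def)
  have Mg: "lop P (case_nat (out P (slower f)) (scol (starget P g))) (sM g)" using G(8) fg F(3) by simp
  show e: "mcomp P (out P (ssource f)) (scol (starget P g)) (sU g) (sM f) (sM g) =
      (pcomp P (slower g) 0 (gcomp P (slower f) (ident P (out P (ssource f)) # map ((!) (supper g)) (slower_labels f))),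
       mark (concat (map ((!) (supper_labels g)) (slower_labels f)) @ slower_labels g))"
    unfolding mcomp_eq[OF Mg] by (simp add: sU_def)
  show "sM (stcomp P g f) = nf P (mcomp P (out P (ssource f)) (scol (starget P g)) (sU g) (sM f) (sM g))"
    unfolding e by (simp add: stcomp_def Let_def nf_def ranks_mark sort_mark)
qed

text \<open>Before sorting, the labels of the composite are those of \<open>g\<close> in another
  order. So they are distinct, as comparisons of normal forms require.\<close>

lemma stcomp_labels:
  assumes f: "stree_arrow P f" and g: "stree_arrow P g" and fg: "starget P f = ssource g"
  defines "RL \<equiv> concat (map ((!) (supper_labels g)) (sleaves f)) @ slower_labels g"
  shows "mset RL = mset (sleaves g)" "distinct RL"
    and "k < arity P (ssource f) \<Longrightarrow> distinct (snd (sub P (sU g) (sU f k)))"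
    and "distinct (concat (map ((!) (supper_labels g)) (slower_labels f)) @ slower_labels g)"
proof -
  note F = stree_arrowD[OF f] and G = stree_arrowD[OF g]
  have "mset (map ((!) (supper_labels g)) (sleaves f)) = mset (supper_labels g)"
    by (rule mset_map_nth_perm) (use F(15) G(6) fg in simp)
  from mset_concat_cong[OF this] show m: "mset RL = mset (sleaves g)" by (simp add: RL_def sleaves_def)
  show d: "distinct RL" using mset_eq_imp_distinct_iff[OF m] perm_distinct[OF G(15)] by simp
  have sp: "RL = concat (map (\<lambda>ls. concat (map ((!) (supper_labels g)) ls)) (supper_labels f)) @
      concat (map ((!) (supper_labels g)) (slower_labels f)) @ slower_labels g"
    by (simp add: RL_def sleaves_def map_concat concat_concat_map o_def)
  show "distinct (concat (map ((!) (supper_labels g)) (slower_labels f)) @ slower_labels g)"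
    using d unfolding sp by simp
  have "distinct (concat (map (\<lambda>ls. concat (map ((!) (supper_labels g)) ls)) (supper_labels f)))"
    using d unfolding sp by simp
  then show "distinct (snd (sub P (sU g) (sU f k)))" if "k < arity P (ssource f)"
    using distinct_concat_nth[of "map (\<lambda>ls. concat (map ((!) (supper_labels g)) ls)) (supper_labels f)" k] that F(6)
    by (simp add: sub_def sU_def)
qed

text \<open>The last two facts relate each vertex of the composite to its version before sorting;
  through them the sorting is controlled in the proofs about targets and associativity.\<close>

lemma stcomp_lop:
  assumes f: "stree_arrow P f" and g: "stree_arrow P g" and fg: "starget P f = ssource g"
  shows "k < arity P (ssource f) \<Longrightarrow> lops P (scol (starget P f)) (scol (starget P g)) (sU g) (set (snd (sU f k)))"
    and "lops P (scol (starget P f)) (scol (starget P g)) (sU g) (set (slower_labels f))"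
    and "lops P (scol (starget P f)) (scol (starget P g)) (sU g) {..<arity P (starget P f)}"
    and "lop P (case_nat (out P (slower f)) (scol (starget P g))) (sM g)"
    and "k < arity P (ssource f) \<Longrightarrow> lop P (scol (starget P f)) (sU f k)"
    and "k < arity P (ssource f) \<Longrightarrow> lop P (scol (starget P g)) (sU (stcomp P g f) k) \<and>
      out P (fst (sU (stcomp P g f) k)) = ins P (ssource f) ! k"
    and "lop P (case_nat (out P (ssource f)) (scol (starget P g)))
      (mcomp P (out P (ssource f)) (scol (starget P g)) (sU g) (sM f) (sM g))"
    and "lop P (case_nat (out P (ssource f)) (scol (starget P g))) (sM (stcomp P g f))"
    and "out P (slower (stcomp P g f)) = out P (slower g)"
    and "k < arity P (ssource f) \<Longrightarrow> relab P (sub P (sU g) (sU f k)) (sU (stcomp P g f) k)"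
    and "relab P (mcomp P (out P (ssource f)) (scol (starget P g)) (sU g) (sM f) (sM g)) (sM (stcomp P g f))"
proof -
  note F = stree_arrowD[OF f] and G = stree_arrowD[OF g]
  note S = stcomp_sel[OF f g fg] and L = stcomp_labels[OF f g fg]
  show a: "lops P (scol (starget P f)) (scol (starget P g)) (sU g) {..<arity P (starget P f)}"
    using G(7) fg by simp
  show b: "lops P (scol (starget P f)) (scol (starget P g)) (sU g) (set (slower_labels f))"
    by (rule lops_subset[OF a stree_arrow_lower_labels(1)[OF f]])
  show Mg: "lop P (case_nat (out P (slower f)) (scol (starget P g))) (sM g)" using G(8) fg F(3) by simp
  let ?m = "mcomp P (out P (ssource f)) (scol (starget P g)) (sU g) (sM f) (sM g)"
  show m: "lop P (case_nat (out P (ssource f)) (scol (starget P g))) ?m"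
    by (rule lop_mcomp(1)[OF F(17,8) b Mg])
  have om: "out P (fst ?m) = out P (slower g)" by (rule lop_mcomp(2)[OF F(17,8) b Mg])
  have dm: "distinct (snd ?m)" unfolding S(6) snd_conv distinct_mark by (rule L(4))
  have "fst ?m \<in> opers P" using m by (simp add: lop_def)
  from relab_nf[OF this lop_length[OF m] dm]
  show rm: "relab P ?m (sM (stcomp P g f))" unfolding S(5) .
  show "lop P (case_nat (out P (ssource f)) (scol (starget P g))) (sM (stcomp P g f))" by (rule lop_relab[OF rm m])
  show "out P (slower (stcomp P g f)) = out P (slower g)" using relab_out(2)[OF rm] om by simp
  assume k: "k < arity P (ssource f)"
  show c: "lops P (scol (starget P f)) (scol (starget P g)) (sU g) (set (snd (sU f k)))"
    by (rule lops_subset[OF a stree_arrow_labels(1)[OF f k]])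
  show v: "lop P (scol (starget P f)) (sU f k)" using F(7) k by (simp add: lops_def)
  have ov: "out P (fst (sU f k)) = ins P (ssource f) ! k" using F(7) k by (simp add: lops_def)
  note s = lop_sub[OF v c]
  have "fst (sub P (sU g) (sU f k)) \<in> opers P" using s(1) by (simp add: lop_def)
  from relab_nf[OF this lop_length[OF s(1)] L(3)[OF k]]
  show r: "relab P (sub P (sU g) (sU f k)) (sU (stcomp P g f) k)" unfolding S(4)[OF k] .
  show "lop P (scol (starget P g)) (sU (stcomp P g f) k) \<and> out P (fst (sU (stcomp P g f) k)) = ins P (ssource f) ! k"
    using lop_relab[OF r s(1)] relab_out(2)[OF r] s(2) ov by simp
qed

lemma stcomp_arrow:
  assumes f: "stree_arrow P f" and g: "stree_arrow P g" and fg: "starget P f = ssource g"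
  shows "stree_arrow P (stcomp P g f)"
proof -
  note F = stree_arrowD[OF f] and G = stree_arrowD[OF g]
  note S = stcomp_sel[OF f g fg] and L = stcomp_labels[OF f g fg] and C = stcomp_lop[OF f g fg]
  let ?h = "stcomp P g f"
  have n: "k < arity P (ssource f) \<Longrightarrow> supper ?h ! k \<in> opers P \<and> out P (supper ?h ! k) = ins P (ssource f) ! k
     \<and> ins P (supper ?h ! k) = map (scol (starget P g)) (supper_labels ?h ! k)" for k
    using C(6)[of k] by (simp add: lop_def sU_def)
  have 1: "composable P (ssource ?h) (supper ?h)"
    unfolding composable_def S(1)
  proof (intro conjI F(1))
    show "set (supper ?h) \<subseteq> opers P" using n S(2) by (auto simp: in_set_conv_nth)
    show "map (out P) (supper ?h) = ins P (ssource f)" by (rule nth_equalityI) (use n S(2) in simp_all)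
  qed
  have M: "slower ?h \<in> opers P" "ins P (slower ?h) = out P (ssource f) # map (scol (starget P g)) (slower_labels ?h)"
    using C(8) by (simp_all add: lop_def map_case_nat_mark)
  have 2: "pcomposable P (slower ?h) 0 (ssource ?h)" using M F(1) S(1) by (simp add: pcomposable_def)
  have 3: "map length (supper_labels ?h) = map (arity P) (supper ?h)"
    by (rule nth_equalityI) (use n S(2,3) in simp_all)
  have 4: "Suc (length (slower_labels ?h)) = arity P (slower ?h)" using M by simp
  let ?l = "\<lambda>ls. concat (map ((!) (supper_labels g)) ls)"
  have ls: "supper_labels ?h = map (\<lambda>ls. sort (?l ls)) (supper_labels f)"
    "slower_labels ?h = sort (?l (slower_labels f) @ slower_labels g)"
    by (simp_all add: stcomp_def Let_def)
  have mc: "mset (concat (map (\<lambda>ls. sort (?l ls)) X)) = mset (concat (map ?l X))" for X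
    by (induction X) auto
  have "mset (sleaves ?h) = mset (concat (map ?l (supper_labels f))) + mset (?l (slower_labels f) @ slower_labels g)"
    unfolding sleaves_def ls mset_append mc by simp
  also have "\<dots> = mset (concat (map ((!) (supper_labels g)) (sleaves f)) @ slower_labels g)"
    by (simp add: sleaves_def map_concat concat_concat_map o_def)
  finally have m: "mset (sleaves ?h) = mset (sleaves g)" using L(1) by simp
  have 5: "sleaves ?h \<in> permutations_of_set {..<length (sleaves ?h)}"
    using G(15) G(4) mset_eq_length[OF m] m unfolding perm_iff_mset by simp
  have 6: "\<forall>l\<in>insert (slower_labels ?h) (set (supper_labels ?h)). sorted l" unfolding ls by auto
  show ?thesis unfolding stree_arrow_def using 1 2 3 4 5 6 by blast
qed

text \<open>For raw trees the claim is \<open>low_mcomp\<close>. Sorting the composed vertices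
  changes its left side by a relabelling (\<open>r1\<close>), and replacing the raw composite of
  \<open>f\<close> by the target of \<open>f\<close> changes its right side by another
  (\<open>r2\<close>). As all labels are distinct, the normal forms agree.\<close>

lemma stcomp_target:
  assumes f: "stree_arrow P f" and g: "stree_arrow P g" and fg: "starget P f = ssource g"
  shows "starget P (stcomp P g f) = starget P g"
proof -
  note F = stree_arrowD[OF f] and G = stree_arrowD[OF g]
  note S = stcomp_sel[OF f g fg] and L = stcomp_labels[OF f g fg] and C = stcomp_lop[OF f g fg]
  let ?h = "stcomp P g f"
  note H = stree_arrowD[OF stcomp_arrow[OF f g fg]]
  let ?p = "ssource f" and ?t = "starget P f" and ?u = "starget P g" and ?c = "out P (ssource f)"
  let ?v = "(?p, [0..<arity P ?p])"
  let ?X = "sub P (sU f) ?v" and ?m = "mcomp P ?c (scol ?u) (sU g) (sM f) (sM g)"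
  have pv: "lop P (scol ?p) ?v" by (rule lop_nth_upt[OF F(1)])
  have pU: "lops P (scol ?p) (scol ?t) (sU f) (set (snd ?v))" using F(7) by (simp add: lessThan_atLeast0)
  have Xl: "set (snd ?X) \<subseteq> {..<arity P ?t}"
    using stree_arrow_labels(1)[OF f] by (fastforce simp: sub_def)
  have gX: "lops P (scol ?t) (scol ?u) (sU g) (set (slower_labels f) \<union> set (snd ?X))"
    by (rule lops_subset[OF C(3)]) (use Xl stree_arrow_lower_labels(1)[OF f] in blast)
  have raw: "low P (scol ?u) (sub P (sU g) ?X) ?m = low P (scol ?u) (sub P (sU g) (low P (scol ?t) ?X (sM f))) (sM g)"
    by (rule low_mcomp[OF F(17) F(8) gX C(4) F(10,11)])
  have gX': "lops P (scol ?t) (scol ?u) (sU g) (set (snd ?X))" by (rule lops_subset[OF gX]) blast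
  have ss: "sub P (sU g) ?X = sub P (\<lambda>k. sub P (sU g) (sU f k)) ?v"
    by (rule sub_sub[OF pv pU]) (use gX' in \<open>simp add: sub_def\<close>)
  have "lops P (scol ?p) (scol ?u) (\<lambda>k. sub P (sU g) (sU f k)) (set (snd ?v))"
    unfolding lops_def
  proof
    fix k assume "k \<in> set (snd ?v)"
    then have k: "k < arity P ?p" by simp
    show "lop P (scol ?u) (sub P (sU g) (sU f k)) \<and> out P (fst (sub P (sU g) (sU f k))) = ins P ?p ! k"
      using lop_sub[OF C(5)[OF k] C(1)[OF k]] F(7) k by (simp add: lops_def)
  qed
  then have "relab P (sub P (\<lambda>k. sub P (sU g) (sU f k)) ?v) (sub P (sU ?h) ?v)"
    by (intro relab_sub_inner[OF pv]) (use C(10) in auto)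
  then have rX: "relab P (sub P (sU g) ?X) (sub P (sU ?h) ?v)" unfolding ss .
  have gXl: "lop P (scol ?u) (sub P (sU g) ?X)" "out P (fst (sub P (sU g) ?X)) = ?c"
    using lop_sub[OF F(10) gX'] F(11) by simp_all
  have r1: "relab P (low P (scol ?u) (sub P (sU g) ?X) ?m) (low P (scol ?u) (sub P (sU ?h) ?v) (sM ?h))"
    unfolding S(6) by (rule relab_low[OF gXl C(7)[unfolded S(6)] rX C(11)[unfolded S(6)]])
  have t1: "low P (scol ?u) (sub P (sU ?h) ?v) (sM ?h) =
      (pcomp P (slower ?h) 0 (gcomp P ?p (supper ?h)), sleaves ?h)"
    using H(9) unfolding S(1) low_eq[OF C(8)] low_eq[OF H(8)[unfolded S(1)]] .
  have gt: "lops P (scol ?t) (scol ?u) (sU g) (set (snd (low P (scol ?t) ?X (sM f))))"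
    unfolding F(9) using C(3) perm_set[OF F(15)] by simp
  have "relab P (sub P (sU g) (low P (scol ?t) ?X (sM f))) (sub P (sU g) (?t, [0..<arity P ?t]))"
    by (rule relab_sub_outer[OF _ gt]) (use F(12,13) in \<open>simp_all only: F(9)\<close>)
  moreover have "lop P (scol ?u) (sub P (sU g) (low P (scol ?t) ?X (sM f)))"
     "out P (fst (sub P (sU g) (low P (scol ?t) ?X (sM f)))) = out P (slower f)"
    using lop_sub[OF _ gt] lop_low[OF F(10,11,8)] by simp_all
  ultimately have r2: "relab P (low P (scol ?u) (sub P (sU g) (low P (scol ?t) ?X (sM f))) (sM g))
      (low P (scol ?u) (sub P (sU g) (?t, [0..<arity P ?t])) (sM g))"
    using C(4) relab_refl[of "sM g"] lop_length[OF C(4)] G(16) by (intro relab_low) auto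
  have t2: "low P (scol ?u) (sub P (sU g) (?t, [0..<arity P ?t])) (sM g) =
     (pcomp P (slower g) 0 (gcomp P (ssource g) (supper g)), sleaves g)"
    using G(9) unfolding fg .
  let ?r = "low P (scol ?u) (sub P (sU g) ?X) ?m"
  have d: "distinct (snd ?r)"
    using relab_mset[OF r1] perm_distinct[OF H(15)] mset_eq_imp_distinct_iff unfolding t1 by fastforce
  have "nf P (pcomp P (slower ?h) 0 (gcomp P ?p (supper ?h)), sleaves ?h) = nf P ?r"
    using nf_relab[OF r1 d] t1 by simp
  also have "\<dots> = nf P (pcomp P (slower g) 0 (gcomp P (ssource g) (supper g)), sleaves g)"
    using nf_relab[OF r2 d[unfolded raw]] raw t2 by simp
  finally show ?thesis using H(14) G(14) S(1) by simp
qed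

text \<open>Upper vertices are compared by \<open>nf_sub_assoc\<close>. For the lower vertex the
  unsorted composites agree by \<open>mcomp_mcomp\<close>, and \<open>r1\<close> and
  \<open>r2\<close> relate them to the two ways of sorting at an intermediate stage.\<close>

lemma stcomp_assoc:
  assumes f: "stree_arrow P f" and g: "stree_arrow P g" and h: "stree_arrow P h"
    and fg: "starget P f = ssource g" and gh: "starget P g = ssource h"
  shows "stcomp P h (stcomp P g f) = stcomp P (stcomp P h g) f"
proof -
  note F = stree_arrowD[OF f] and G = stree_arrowD[OF g] and H = stree_arrowD[OF h]
  let ?gf = "stcomp P g f" and ?hg = "stcomp P h g"
  have agf: "stree_arrow P ?gf" and ahg: "stree_arrow P ?hg" using stcomp_arrow f g h fg gh by blast+
  have tgf: "starget P ?gf = ssource h" using stcomp_target[OF f g fg] gh by simp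
  have shg: "starget P f = ssource ?hg" using stcomp_sel(1)[OF g h gh] fg by simp
  note GF = stree_arrowD[OF agf] and HG = stree_arrowD[OF ahg]
  note Sgf = stcomp_sel[OF f g fg] and Cgf = stcomp_lop[OF f g fg] and Lgf = stcomp_labels[OF f g fg]
  note Shg = stcomp_sel[OF g h gh] and Chg = stcomp_lop[OF g h gh] and Lhg = stcomp_labels[OF g h gh]
  note S1 = stcomp_sel[OF agf h tgf] and C1 = stcomp_lop[OF agf h tgf] and L1 = stcomp_labels[OF agf h tgf]
  note S2 = stcomp_sel[OF f ahg shg] and C2 = stcomp_lop[OF f ahg shg] and L2 = stcomp_labels[OF f ahg shg]
  let ?p = "ssource f" and ?t = "starget P f" and ?u = "starget P g" and ?w = "starget P h" and ?c = "out P (ssource f)"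
  have tw: "starget P ?hg = ?w" by (rule stcomp_target[OF g h gh])
  have at: "arity P ?t = arity P (ssource g)" using fg by simp
  show ?thesis
  proof (rule stree_eqI[of _ _ "arity P ?p"])
    show "ssource (stcomp P h ?gf) = ssource (stcomp P ?hg f)" using S1(1) S2(1) Sgf(1) by simp
    show "length (supper (stcomp P h ?gf)) = arity P ?p" "length (supper_labels (stcomp P h ?gf)) = arity P ?p"
      "length (supper (stcomp P ?hg f)) = arity P ?p" "length (supper_labels (stcomp P ?hg f)) = arity P ?p"
      using S1(2,3) S2(2,3) Sgf(1) by simp_all
    have lt: "l < arity P (ssource g)" if "l \<in> set (snd (sU f k))" "k < arity P ?p" for l k
      using stree_arrow_labels(1)[OF f that(2)] that(1) at by auto
    fix k assume k: "k < arity P ?p"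
    have "sU (stcomp P h ?gf) k = nf P (sub P (sU h) (nf P (sub P (sU g) (sU f k))))"
      using S1(4) Sgf(1,4) k by simp
    also have "\<dots> = nf P (sub P (\<lambda>l. nf P (sub P (sU h) (sU g l))) (sU f k))"
    proof (rule nf_sub_assoc[OF Cgf(5)[OF k] Cgf(1)[OF k]])
      show "lops P (scol ?u) (scol ?w) (sU h) (\<Union>l\<in>set (snd (sU f k)). set (snd (sU g l)))"
        by (rule lops_subset[OF Chg(3)]) (use stree_arrow_labels(1)[OF g] lt k in fastforce)
      show "distinct (snd (sub P (sU g) (sU f k)))" by (rule Lgf(3)[OF k])
      show "distinct (snd (sub P (sU h) (sU g l)))" if "l \<in> set (snd (sU f k))" for l
        by (rule Lhg(3)) (rule lt[OF that k])
      show "distinct (snd (sub P (sU h) (nf P (sub P (sU g) (sU f k)))))"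
        using L1(3)[of k] Sgf(1,4) k by simp
    qed
    also have "\<dots> = nf P (sub P (sU ?hg) (sU f k))"
      by (rule arg_cong[of _ _ "nf P"], rule sub_cong) (use Shg(4) lt k in simp)
    also have "\<dots> = sU (stcomp P ?hg f) k" using S2(4) k by simp
    finally show "sU (stcomp P h ?gf) k = sU (stcomp P ?hg f) k" .
  next
    let ?m = "mcomp P ?c (scol ?u) (sU g) (sM f) (sM g)"
    let ?m' = "mcomp P (out P (slower f)) (scol ?w) (sU h) (sM g) (sM h)"
    have os: "out P (ssource g) = out P (slower f)" using F(3) fg by simp
    have Mh: "lop P (case_nat (out P (slower g)) (scol ?w)) (sM h)" by (rule Chg(4))
    obtain qr lm where qr: "?m = (qr, mark lm)" using Sgf(6) by blast
    obtain rs mn where rs: "?m' = (rs, mark mn)" using Shg(6) os by metis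
    have lmr: "mset (mark lm) = mset (mark (slower_labels ?gf))"
      using relab_mset[OF Cgf(11)] unfolding qr by simp
    have lms: "set lm = set (slower_labels ?gf)"
    proof -
      have "Suc ` set lm = set (mark lm) - {0}" "Suc ` set (slower_labels ?gf) = set (mark (slower_labels ?gf)) - {0}"
        by (auto simp: set_mark)
      then show ?thesis using mset_eq_setD[OF lmr] inj_image_eq_iff[OF inj_Suc] by metis
    qed
    have Hl: "lops P (scol ?u) (scol ?w) (sU h) (set lm)"
      using C1(2) stcomp_target[OF f g fg] lms by simp
    have oqr: "out P qr = out P (slower g)" using lop_mcomp(2)[OF F(17,8) Cgf(2,4)] qr by simp
    have r1: "relab P (mcomp P ?c (scol ?w) (sU h) (qr, mark lm) (sM h)) (mcomp P ?c (scol ?w) (sU h) (sM ?gf) (sM h))"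
    proof (rule relab_mcomp[OF F(17) Cgf(7)[unfolded qr] Hl])
      show "lop P (case_nat (out P qr) (scol ?w)) (sM h)" using Mh oqr by simp
      show "relab P (sM h) (sM h)" using relab_refl[of "sM h"] lop_length[OF Mh] H(16) by simp
      show "relab P (qr, mark lm) (sM ?gf)" using Cgf(11) unfolding qr .
      fix j assume "j \<in> set lm"
      then show "relab P (sU h j) (sU h j)" using Hl by (intro relab_refl lop_length[of "scol ?w"]) (auto simp: lops_def lop_def)
    qed
    have HGl: "lops P (scol ?u) (scol ?w) (sU h) ((\<Union>j\<in>set (slower_labels f). set (snd (sU g j))) \<union> set (slower_labels g))"
      by (rule lops_subset[OF Chg(3)])
        (use stree_arrow_labels(1)[OF g] stree_arrow_lower_labels(1)[OF f] stree_arrow_lower_labels(1)[OF g] at in fastforce)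
    have raw: "mcomp P ?c (scol ?w) (sU h) (qr, mark lm) (sM h) =
        mcomp P ?c (scol ?w) (\<lambda>j. sub P (sU h) (sU g j)) (sM f) (rs, mark mn)"
      by (rule mcomp_mcomp[OF F(17,8) Cgf(2,4) HGl Mh qr rs])
    have subl: "lops P (scol ?t) (scol ?w) (\<lambda>j. sub P (sU h) (sU g j)) (set (slower_labels f))"
      unfolding lops_def
    proof
      fix j assume "j \<in> set (slower_labels f)"
      then have j: "j < arity P (ssource g)" using stree_arrow_lower_labels(1)[OF f] at by auto
      show "lop P (scol ?w) (sub P (sU h) (sU g j)) \<and> out P (fst (sub P (sU h) (sU g j))) = scol ?t j"
        using lop_sub[OF Chg(5)[OF j] Chg(1)[OF j]] G(7) j fg by (simp add: lops_def)
    qed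
    have rs1: "relab P (rs, mark mn) (sM ?hg)" using Chg(11) unfolding os rs .
    have rsl: "lop P (case_nat (out P (slower f)) (scol ?w)) (rs, mark mn)" using Chg(7) unfolding os rs .
    have r2: "relab P (mcomp P ?c (scol ?w) (\<lambda>j. sub P (sU h) (sU g j)) (sM f) (rs, mark mn))
        (mcomp P ?c (scol ?w) (sU ?hg) (sM f) (sM ?hg))"
    proof (rule relab_mcomp[OF F(17,8) subl rsl rs1])
      show "relab P (sM f) (sM f)" using relab_refl[of "sM f"] lop_length[OF F(8)] F(16) by simp
      fix j assume "j \<in> set (slower_labels f)"
      then have j: "j < arity P (ssource g)" using stree_arrow_lower_labels(1)[OF f] at by auto
      show "relab P (sub P (sU h) (sU g j)) (sU ?hg j)" by (rule Chg(10)[OF j])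
    qed
    let ?r = "mcomp P ?c (scol ?w) (sU h) (qr, mark lm) (sM h)"
    have e1: "mcomp P ?c (scol ?w) (sU h) (sM ?gf) (sM h) = mcomp P (out P (ssource ?gf)) (scol ?w) (sU h) (sM ?gf) (sM h)"
      using Sgf(1) by simp
    have "distinct (snd (mcomp P ?c (scol ?w) (sU h) (sM ?gf) (sM h)))"
      unfolding e1 S1(6) snd_conv distinct_mark by (rule L1(4))
    then have d: "distinct (snd ?r)" using relab_mset[OF r1] mset_eq_imp_distinct_iff by blast
    have "sM (stcomp P h ?gf) = nf P ?r" unfolding S1(5) e1[symmetric] using nf_relab[OF r1 d] by simp
    also have "\<dots> = nf P (mcomp P ?c (scol ?w) (sU ?hg) (sM f) (sM ?hg))"
      using nf_relab[OF r2] d raw by simp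
    also have "\<dots> = sM (stcomp P ?hg f)" using S2(5) tw by simp
    finally show "sM (stcomp P h ?gf) = sM (stcomp P ?hg f)" .
  qed
qed

lemma sU_sid: "k < arity P p \<Longrightarrow> sU (sid P p) k = (ident P (ins P p ! k), [k])"
  by (simp add: sU_def sid_def)

lemma sid_arrow:
  assumes p: "p \<in> opers P"
  shows "stree_arrow P (sid P p)" "starget P (sid P p) = p" "ssource (sid P p) = p"
proof -
  have c: "out P p \<in> colours P" using p out_colours by simp
  have cc: "concat (map (\<lambda>k. [k]) [0..<arity P p]) = [0..<arity P p]" by (simp add: concat_map_singleton)
  have "map length (map (\<lambda>k. [k]) [0..<arity P p]) = map (arity P) (map (ident P) (ins P p))"
    using ident_ins ins_colour[OF p] by (intro nth_equalityI) auto
  then show "stree_arrow P (sid P p)"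
    using composable_idents[OF p] pcomposable_ident_left[OF p] perm_id[of "arity P p"] ident_ins[OF c]
    by (auto simp: stree_arrow_def sid_def sleaves_def cc)
  show "starget P (sid P p) = p"
    using gcomp_ident_right[OF p] pcomp_ident_left[OF p] act_id[OF p] by (simp add: starget_def sid_def sleaves_def cc)
  show "ssource (sid P p) = p" by (simp add: sid_def)
qed

lemma nf_sU:
  assumes "stree_arrow P f" "k < arity P (ssource f)"
  shows "nf P (sU f k) = sU f k"
proof (rule nf_sorted)
  have l: "lop P (scol (starget P f)) (sU f k)" using stree_arrowD(7)[OF assms(1)] assms(2) by (simp add: lops_def)
  show "fst (sU f k) \<in> opers P" "length (snd (sU f k)) = arity P (fst (sU f k))"
    using l lop_length[OF l] by (simp_all add: lop_def)
qed (use stree_arrow_labels[OF assms] in simp_all)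

lemma nf_sM:
  assumes f: "stree_arrow P f"
  shows "nf P (sM f) = sM f"
proof (rule nf_sorted)
  note l = stree_arrowD(8,16)[OF f]
  show "fst (sM f) \<in> opers P" "length (snd (sM f)) = arity P (fst (sM f))"
    using l(2) lop_length[OF l(1)] by simp_all
  have "sort (mark (slower_labels f)) = mark (slower_labels f)"
    unfolding sort_mark using stree_arrow_lower_labels(3)[OF f] by (simp add: sorted_sort_id)
  then show "sorted (snd (sM f))" by (metis snd_conv sorted_sort)
qed (use stree_arrow_lower_labels(2)[OF f] in \<open>simp add: distinct_mark\<close>)

lemma stcomp_sid_right:
  assumes f: "stree_arrow P f"
  shows "stcomp P f (sid P (ssource f)) = f"
proof -
  let ?p = "ssource f"
  note F = stree_arrowD[OF f]
  note i = sid_arrow[OF F(1)]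
  note S = stcomp_sel[OF i(1) f i(2), unfolded i(3)]
  show ?thesis
  proof (rule stree_eqI[of _ _ "arity P ?p"])
    fix k assume k: "k < arity P ?p"
    have "sub P (sU f) (ident P (ins P ?p ! k), [k]) = sU f k"
      using F(7) k by (intro sub_unit[of "scol (starget P f)"]) (auto simp: lops_def)
    then show "sU (stcomp P f (sid P ?p)) k = sU f k" using S(4)[OF k] sU_sid[OF k] nf_sU[OF f k] by simp
  next
    have sl: "slower (sid P ?p) = ident P (out P ?p)" "slower_labels (sid P ?p) = []" by (simp_all add: sid_def)
    have "gcomp P (ident P (out P ?p)) [ident P (out P ?p)] = ident P (out P ?p)"
      using gcomp_ident_left[of "ident P (out P ?p)"] ident_opers[OF F(17)] ident_out[OF F(17)] by simp
    moreover have iq: "ins P (slower f) = out P ?p # map (scol (starget P f)) (slower_labels f)"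
      using F(8) by (simp add: lop_def map_case_nat_mark)
    moreover have "pcomp P (slower f) 0 (ident P (out P ?p)) = slower f"
      using pcomp_ident_right[OF F(16), of 0] iq by simp
    ultimately show "sM (stcomp P f (sid P ?p)) = sM f"
      unfolding S(5) unfolding S(6) unfolding sl using nf_sM[OF f] by simp
  qed (use S F(5,6) in simp_all)
qed

lemma stcomp_sid_left:
  assumes f: "stree_arrow P f"
  shows "stcomp P (sid P (starget P f)) f = f"
proof -
  let ?p = "ssource f" and ?t = "starget P f"
  note F = stree_arrowD[OF f]
  note i = sid_arrow[OF F(2)]
  note S = stcomp_sel[OF f i(1) i(3)[symmetric]]
  have sl: "slower (sid P ?t) = ident P (out P ?t)" "slower_labels (sid P ?t) = []"
    "supper (sid P ?t) = map (ident P) (ins P ?t)" "supper_labels (sid P ?t) = map (\<lambda>k. [k]) [0..<arity P ?t]"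
    by (simp_all add: sid_def)
  show ?thesis
  proof (rule stree_eqI[of _ _ "arity P ?p"])
    fix k assume k: "k < arity P ?p"
    have "sub P (sU (sid P ?t)) (sU f k) = sU f k"
    proof (rule sub_ident_right[of "scol ?t"])
      show "lop P (scol ?t) (sU f k)" using F(7) k by (simp add: lops_def)
      fix l assume "l \<in> set (snd (sU f k))"
      then show "sU (sid P ?t) l = (ident P (ins P ?t ! l), [l])"
        using stree_arrow_labels(1)[OF f k] by (intro sU_sid) auto
    qed
    then show "sU (stcomp P (sid P ?t) f) k = sU f k" using S(4)[OF k] nf_sU[OF f k] by simp
  next
    have lt: "set (slower_labels f) \<subseteq> {..<arity P ?t}" by (rule stree_arrow_lower_labels(1)[OF f])
    have iq: "ins P (slower f) = out P ?p # map (scol ?t) (slower_labels f)"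
      using F(8) by (simp add: lop_def map_case_nat_mark)
    have e: "map ((!) (map (ident P) (ins P ?t))) (slower_labels f) = map (ident P) (map (scol ?t) (slower_labels f))"
      by (rule map_nth_map) (use lt in simp)
    have e': "gcomp P (slower f) (ident P (out P ?p) # map (ident P) (map (scol ?t) (slower_labels f))) = slower f"
      using gcomp_ident_right[OF F(16)] iq by simp
    have "gcomp P (slower f) (ident P (out P ?p) # map ((!) (map (ident P) (ins P ?t))) (slower_labels f)) = slower f"
      unfolding e by (rule e')
    moreover have "concat (map ((!) (map (\<lambda>k. [k]) [0..<arity P ?t])) (slower_labels f)) = slower_labels f"
      by (rule concat_map_nth_singletons[OF lt])
    moreover have "pcomp P (ident P (out P ?t)) 0 (slower f) = slower f"
      using pcomp_ident_left[OF F(16)] F(3) by simp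
    ultimately show "sM (stcomp P (sid P ?t) f) = sM f"
      unfolding S(5) unfolding S(6) unfolding sl using nf_sM[OF f] by simp
  qed (use S F(5,6) in simp_all)
qed

lemma category_symmetric_Tw: "category (symmetric_Tw P)"
proof (rule category.intro, unfold symmetric_Tw_def cat.simps mem_Collect_eq)
  fix f g h assume "stree_arrow P f" "stree_arrow P g" "stree_arrow P h" "starget P f = ssource g" "starget P g = ssource h"
  then show "stcomp P h (stcomp P g f) = stcomp P (stcomp P h g) f" by (rule stcomp_assoc)
next
  fix f g assume "stree_arrow P f" "stree_arrow P g" "starget P f = ssource g"
  then show "stree_arrow P (stcomp P g f)" "ssource (stcomp P g f) = ssource f" "starget P (stcomp P g f) = starget P g"
    by (rule stcomp_arrow stcomp_sel(1) stcomp_target)+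
next
  fix p assume "p \<in> opers P"
  then show "stree_arrow P (sid P p)" "starget P (sid P p) = p" "ssource (sid P p) = p" by (rule sid_arrow)+
qed (rule stree_arrowD(1,2) stcomp_sid_left stcomp_sid_right, assumption)+

end

lemma perm_inverse:
  assumes s: "s \<in> permutations_of_set {..<n}"
  obtains t where "t \<in> permutations_of_set {..<n}" "\<And>k. k < n \<Longrightarrow> t ! (s ! k) = k" "\<And>k. k < n \<Longrightarrow> s ! (t ! k) = k"
proof -
  have "\<forall>j<n. \<exists>k<n. s ! k = j"
  proof (intro allI impI)
    fix j assume "j < n"
    then have "j \<in> set s" using perm_set[OF s] by simp
    then show "\<exists>k<n. s ! k = j" unfolding in_set_conv_nth perm_length[OF s] by blast
  qed
  then obtain \<tau> where \<tau>: "\<And>j. j < n \<Longrightarrow> \<tau> j < n" "\<And>j. j < n \<Longrightarrow> s ! \<tau> j = j" by metis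
  define t where "t = map \<tau> [0..<n]"
  have l: "length t = n" by (simp add: t_def)
  have st: "s ! (t ! k) = k" if "k < n" for k using \<tau> that by (simp add: t_def)
  have "inj_on \<tau> {..<n}" by (rule inj_onI) (metis \<tau>(2) lessThan_iff)
  moreover have "\<tau> ` {..<n} \<subseteq> {..<n}" using \<tau>(1) by auto
  ultimately have im: "\<tau> ` {..<n} = {..<n}" by (intro endo_inj_surj) auto
  have "t \<in> permutations_of_set {..<n}"
  proof (rule permutations_of_setI)
    show "set t = {..<n}" using im by (simp add: t_def lessThan_atLeast0)
    show "distinct t" unfolding t_def using \<open>inj_on \<tau> {..<n}\<close> by (simp add: distinct_map lessThan_atLeast0)
  qed
  moreover have "t ! (s ! k) = k" if k: "k < n" for k
  proof -
    have sk: "s ! k < n" using k perm_set[OF s] nth_mem[of k s] perm_length[OF s] by auto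
    have "s ! (t ! (s ! k)) = s ! k" by (rule st[OF sk])
    moreover have "t ! (s ! k) < n" using sk \<tau>(1) by (simp add: t_def)
    ultimately show ?thesis using k perm_distinct[OF s] perm_length[OF s] by (simp add: nth_eq_iff_index_eq)
  qed
  ultimately show ?thesis using that st by blast
qed

text \<open>Labels of the part of a factorization that deletes the vertices violating \<open>Q\<close>: the remaining
  ones are numbered consecutively from \<open>n\<close>.\<close>

fun keep_labels :: "('a \<Rightarrow> bool) \<Rightarrow> nat \<Rightarrow> 'a list \<Rightarrow> nat list list" where
  "keep_labels Q n [] = []"
| "keep_labels Q n (x # xs) = (if Q x then [n] # keep_labels Q (Suc n) xs else [] # keep_labels Q n xs)"

lemma length_keep_labels: "length (keep_labels Q n xs) = length xs"
  by (induction xs arbitrary: n) auto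

lemma concat_keep_labels: "concat (keep_labels Q n xs) = [n..<n + length (filter Q xs)]"
proof (induction xs arbitrary: n)
  case (Cons x xs)
  show ?case
    using Cons[of n] Cons[of "Suc n"] upt_conv_Cons[of n "n + length (filter Q (x # xs))"]
    by (cases "Q x") (simp_all del: upt_Suc)
qed simp

lemma nth_keep_labels:
  assumes "k < length xs"
  shows "if Q (xs ! k) then \<exists>j<length (filter Q xs). keep_labels Q n xs ! k = [n + j] \<and> filter Q xs ! j = xs ! k
     else keep_labels Q n xs ! k = []"
  using assms
proof (induction xs arbitrary: n k)
  case (Cons x xs)
  show ?case
  proof (cases k)
    case (Suc k')
    have k': "k' < length xs" using Cons.prems Suc by simp
    show ?thesis
    proof (cases "Q x")
      case True
      show ?thesis
      proof (cases "Q (xs ! k')")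
        case q: True
        obtain j where "j < length (filter Q xs)" "keep_labels Q (Suc n) xs ! k' = [Suc n + j]" "filter Q xs ! j = xs ! k'"
          using Cons.IH[OF k', of "Suc n"] q by auto
        then show ?thesis using True q Suc by (auto intro!: exI[of _ "Suc j"])
      qed (use Cons.IH[OF k', of "Suc n"] True Suc in simp)
    qed (use Cons.IH[OF k', of n] Suc in simp)
  qed auto
qed simp

section \<open>Isomorphisms of symmetric trees\<close>

context symmetric_operad
begin

lemma nf_nullary: "x \<in> opers P \<Longrightarrow> ins P x = [] \<Longrightarrow> nf P (x, []) = (x, [])"
  using act_id[of x] by (simp add: nf_def ranks_rank)

lemma sub_nullary: "x \<in> opers P \<Longrightarrow> ins P x = [] \<Longrightarrow> sub P G (x, []) = (x, [])"
  using gcomp_ident_right[of x] by (simp add: sub_def)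

text \<open>The identity has a single label, and sorting preserves the number of labels. So
  \<open>v\<close> is not nullary; and if everything above it carries a label, only one operation
  stands above it. Sorting a single label does nothing, which gives the equation for
  \<open>gcomp\<close>.\<close>

lemma nf_sub_identD:
  assumes v: "lop P col v" and G: "lops P col col' G (set (snd v))" and c: "c \<in> colours P"
    and e: "nf P (sub P G v) = (ident P c, [k])"
  shows "snd v \<noteq> []"
    and "(\<And>l. l \<in> set (snd v) \<Longrightarrow> snd (G l) \<noteq> []) \<Longrightarrow>
      \<exists>l. snd v = [l] \<and> snd (G l) = [k] \<and> composable P (fst v) [fst (G l)] \<and> gcomp P (fst v) [fst (G l)] = ident P c \<and> out P (fst v) = c"
proof -
  have s: "sort (snd (sub P G v)) = [k]" using e by (simp add: nf_def)
  then have k: "snd (sub P G v) = [k]"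
    by (metis length_0_conv length_Suc_conv length_sort set_sort list.set_intros(1) list.simps(15) empty_set singletonD)
  show "snd v \<noteq> []" using k by (auto simp: sub_def)
  assume nz: "\<And>l. l \<in> set (snd v) \<Longrightarrow> snd (G l) \<noteq> []"
  have kc: "concat (map (\<lambda>l. snd (G l)) (snd v)) = [k]" using k by (simp add: sub_def)
  have "length (snd v) \<le> length (concat (map (\<lambda>l. snd (G l)) (snd v)))" by (rule length_le_concat) (use nz in blast)
  then have "length (snd v) \<le> 1" unfolding kc by simp
  then obtain l where l: "snd v = [l]" using \<open>snd v \<noteq> []\<close> by (cases "snd v") auto
  then have gl: "snd (G l) = [k]" using kc by simp
  note L = lop_sub[OF v G]
  have x: "fst (sub P G v) \<in> opers P" "arity P (fst (sub P G v)) = 1" using L(1) k by (simp_all add: lop_def)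
  have "ranks [k] = [0]" by (simp add: ranks_def)
  then have "fst (nf P (sub P G v)) = fst (sub P G v)" using act_id[OF x(1)] x(2) k by (simp add: nf_def)
  then have g: "gcomp P (fst v) [fst (G l)] = ident P c" using e l by (simp add: sub_def)
  have cc: "composable P (fst v) [fst (G l)]" using sub_composable[OF v G] l by simp
  have "out P (fst v) = c" using gcomp_out[OF cc] g ident_out[OF c] by simp
  then show "\<exists>l. snd v = [l] \<and> snd (G l) = [k] \<and> composable P (fst v) [fst (G l)] \<and> gcomp P (fst v) [fst (G l)] = ident P c \<and> out P (fst v) = c"
    using l gl g cc by blast
qed

lemma symmetric_isos_nonnullary:
  assumes f: "stree_arrow P f" and g: "stree_arrow P g" and fg: "starget P f = ssource g"
    and inv: "stcomp P g f = sid P (ssource f)" and k: "k < arity P (ssource f)"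
  shows "nf P (sub P (sU g) (sU f k)) = (ident P (ins P (ssource f) ! k), [k])"
    "ins P (ssource f) ! k \<in> colours P" "snd (sU f k) \<noteq> []"
proof -
  note C = stcomp_lop[OF f g fg] and S = stcomp_sel[OF f g fg]
  show 1: "nf P (sub P (sU g) (sU f k)) = (ident P (ins P (ssource f) ! k), [k])"
    using S(4)[OF k] sU_sid[OF k] unfolding inv by simp
  show 2: "ins P (ssource f) ! k \<in> colours P"
    using ins_colour[OF stree_arrowD(1)[OF f]] k by simp
  show "snd (sU f k) \<noteq> []" by (rule nf_sub_identD(1)[OF C(5)[OF k] C(1)[OF k] 2 1])
qed

text \<open>For the upper vertices this is \<open>nf_sub_identD\<close>. The lower vertex of the
  identity has only the marked label 0, so \<open>g\<close> has no other lower labels; neither has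
  \<open>f\<close>, because the upper vertices of \<open>g\<close> over them would contribute
  leaves.\<close>

lemma symmetric_left_inverse:
  assumes f: "stree_arrow P f" and g: "stree_arrow P g" and fg: "starget P f = ssource g"
    and inv: "stcomp P g f = sid P (ssource f)"
    and nz: "\<And>l. l < arity P (ssource g) \<Longrightarrow> snd (sU g l) \<noteq> []"
  shows "k < arity P (ssource f) \<Longrightarrow> \<exists>l<arity P (ssource g). composable P (fst (sU f k)) [fst (sU g l)] \<and>
      gcomp P (fst (sU f k)) [fst (sU g l)] = ident P (out P (fst (sU f k)))"
    and "composable P (slower g) [slower f] \<and> gcomp P (slower g) [slower f] = ident P (out P (slower g))"
proof -
  note F = stree_arrowD[OF f] and G = stree_arrowD[OF g]
  note C = stcomp_lop[OF f g fg] and S = stcomp_sel[OF f g fg]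
  have at: "arity P (starget P f) = arity P (ssource g)" using fg by simp
  {
    assume k: "k < arity P (ssource f)"
    note N = symmetric_isos_nonnullary[OF f g fg inv k]
    have ll: "l < arity P (ssource g)" if "l \<in> set (snd (sU f k))" for l
      using stree_arrow_labels(1)[OF f k] that at by auto
    obtain l where l: "snd (sU f k) = [l]" "composable P (fst (sU f k)) [fst (sU g l)]"
       "gcomp P (fst (sU f k)) [fst (sU g l)] = ident P (ins P (ssource f) ! k)" "out P (fst (sU f k)) = ins P (ssource f) ! k"
      using nf_sub_identD(2)[OF C(5)[OF k] C(1)[OF k] N(2) N(1)] nz ll by blast
    then show "\<exists>l<arity P (ssource g). composable P (fst (sU f k)) [fst (sU g l)] \<and>
      gcomp P (fst (sU f k)) [fst (sU g l)] = ident P (out P (fst (sU f k)))"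
      using ll by (intro exI[of _ l]) simp
  }
  let ?c = "out P (ssource f)"
  let ?m = "mcomp P ?c (scol (starget P g)) (sU g) (sM f) (sM g)"
  have "nf P ?m = sM (sid P (ssource f))" using S(5) unfolding inv by simp
  then have m: "nf P ?m = (ident P ?c, mark [])" by (simp add: sid_def)
  have "snd (nf P ?m) = mark (sort (concat (map ((!) (supper_labels g)) (slower_labels f)) @ slower_labels g))"
    unfolding S(6) by (simp add: nf_def sort_mark)
  then have "sort (concat (map ((!) (supper_labels g)) (slower_labels f)) @ slower_labels g) = []"
    using m by (simp add: mark_inj)
  then have e: "concat (map ((!) (supper_labels g)) (slower_labels f)) @ slower_labels g = []"
    by (metis length_0_conv length_sort)
  have l0: "slower_labels f = []"
  proof (rule ccontr)
    assume "slower_labels f \<noteq> []"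
    then obtain j where j: "j \<in> set (slower_labels f)" by (cases "slower_labels f") auto
    then have "j < arity P (ssource g)" using stree_arrow_lower_labels(1)[OF f] at by auto
    then have "supper_labels g ! j \<noteq> []" using nz by (simp add: sU_def)
    then show False using e j by auto
  qed
  have m0: "slower_labels g = []" using e by simp
  have iq: "ins P (slower f) = [?c]" using F(8) l0 by (simp add: lop_def map_case_nat_mark)
  have ir: "ins P (slower g) = [out P (slower f)]" using G(8) m0 fg F(3) by (simp add: lop_def map_case_nat_mark)
  have c: "composable P (slower g) [slower f]" using ir F(16) G(16) by (simp add: composable_def)
  have "gcomp P (slower f) [ident P ?c] = slower f" using gcomp_ident_right[OF F(16)] iq by simp
  then have "fst ?m = gcomp P (slower g) [slower f]" unfolding S(6) using l0 ir by (simp add: pcomp_def)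
  moreover have "snd ?m = [0]" unfolding S(6) using e by (simp add: mark_def)
  moreover have "arity P (gcomp P (slower g) [slower f]) = 1" using gcomp_arity[OF c] iq by simp
  ultimately have "nf P ?m = (gcomp P (slower g) [slower f], [0])"
    using act_id[OF gcomp_opers[OF c]] by (simp add: nf_def ranks_def)
  then have "gcomp P (slower g) [slower f] = ident P ?c" using m by simp
  moreover from this have "out P (slower g) = ?c" using gcomp_out[OF c] ident_out[OF F(17)] by simp
  ultimately show "composable P (slower g) [slower f] \<and> gcomp P (slower g) [slower f] = ident P (out P (slower g))"
    using c by simp
qed

lemma svertices_alt:
  assumes "stree_arrow P f"
  shows "svertices f = insert (slower f) ((\<lambda>k. fst (sU f k)) ` {..<arity P (ssource f)})"
proof -
  have "set (supper f) = (\<lambda>k. fst (sU f k)) ` {..<arity P (ssource f)}"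
    using stree_arrowD(5)[OF assms] by (auto simp: sU_def in_set_conv_nth image_iff)
  then show ?thesis by (simp add: svertices_def)
qed

lemma symmetric_isos_invertible:
  assumes f: "f \<in> isos (symmetric_Tw P)" and v: "v \<in> svertices f"
  shows "invertible P v"
proof -
  obtain g where g: "stree_arrow P f" "stree_arrow P g" "ssource g = starget P f" "starget P g = ssource f"
    "stcomp P g f = sid P (ssource f)" "stcomp P f g = sid P (ssource g)"
    using f by (auto simp: isos_def symmetric_Tw_def)
  note n1 = symmetric_isos_nonnullary(3)[OF g(1,2) g(3)[symmetric] g(5)]
  note n2 = symmetric_isos_nonnullary(3)[OF g(2,1) g(4) g(6)]
  note a = symmetric_left_inverse[OF g(1,2) g(3)[symmetric] g(5) n2]
  note b = symmetric_left_inverse[OF g(2,1) g(4) g(6) n1]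
  have "invertible P (slower f)" using invertible_two_sided a(2) b(2) by blast
  moreover have "invertible P (fst (sU f k))" if k: "k < arity P (ssource f)" for k
  proof -
    obtain l where l: "l < arity P (ssource g)" "composable P (fst (sU f k)) [fst (sU g l)]"
      "gcomp P (fst (sU f k)) [fst (sU g l)] = ident P (out P (fst (sU f k)))"
      using a(1) k by blast
    obtain j where "composable P (fst (sU g l)) [fst (sU f j)]" "gcomp P (fst (sU g l)) [fst (sU f j)] = ident P (out P (fst (sU g l)))"
      using b(1) l(1) by blast
    with l show ?thesis using invertible_two_sided by blast
  qed
  ultimately show ?thesis using v unfolding svertices_alt[OF g(1)] by auto
qed

lemma symmetric_isosI:
  assumes "stree_arrow P f" "\<forall>v\<in>svertices f. invertible P v"
  shows "f \<in> isos (symmetric_Tw P)"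
proof -
  interpret C: category "symmetric_Tw P" by (rule category_symmetric_Tw)
  let ?E = "{f. stree_arrow P f \<and> (\<forall>v\<in>svertices f. invertible P v)}"
  have "?E \<subseteq> isos (symmetric_Tw P)"
  proof (rule C.isos_if_left_inverses)
    show "?E \<subseteq> Arr (symmetric_Tw P)" by (auto simp: symmetric_Tw_def)
    fix f assume "f \<in> ?E"
    then have f: "stree_arrow P f" and inv: "\<forall>v\<in>svertices f. invertible P v" by auto
    note F = stree_arrowD[OF f]
    let ?n = "arity P (ssource f)" and ?t = "starget P f"
    have iq: "invertible P (slower f)" using inv by (simp add: svertices_def)
    note q0 = op_inv[OF iq]
    have iU: "invertible P (fst (sU f k))" if "k < ?n" for k
      using inv that unfolding svertices_alt[OF f] by simp
    have "ins P (slower f) = out P (ssource f) # map (scol ?t) (slower_labels f)"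
      using F(8) by (simp add: lop_def map_case_nat_mark)
    then have l0: "slower_labels f = []" and oc: "out P (op_inv P (slower f)) = out P (ssource f)"
      using q0(4) by simp_all
    have U1: "\<exists>j. snd (sU f k) = [j] \<and> ins P (fst (sU f k)) = [ins P ?t ! j]" if k: "k < ?n" for k
    proof -
      have "lop P (scol ?t) (sU f k)" using F(7) k by (simp add: lops_def)
      then have "map (scol ?t) (snd (sU f k)) = [out P (op_inv P (fst (sU f k)))]"
        using op_inv(4)[OF iU[OF k]] by (simp add: lop_def)
      then obtain j where "snd (sU f k) = [j]" by (cases "snd (sU f k)") auto
      then show ?thesis using \<open>lop P (scol ?t) (sU f k)\<close> by (simp add: lop_def)
    qed
    define s where "s = sleaves f"
    have "supper_labels f = map (\<lambda>k. [hd (supper_labels f ! k)]) [0..<?n]"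
      by (rule nth_equalityI) (use U1 F(6) in \<open>fastforce simp: sU_def\<close>)+
    then have "concat (supper_labels f) = map (\<lambda>k. hd (supper_labels f ! k)) [0..<?n]"
      by (metis concat_map_singleton)
    then have s: "s = map (\<lambda>k. hd (supper_labels f ! k)) [0..<?n]"
      using l0 by (simp add: s_def sleaves_def)
    have at: "arity P ?t = ?n" using F(4) s by (simp add: s_def)
    have ps: "s \<in> permutations_of_set {..<?n}" using F(15) at by (simp add: s_def)
    have Us: "snd (sU f k) = [s ! k]" "ins P (fst (sU f k)) = [ins P ?t ! (s ! k)]" if "k < ?n" for k
      using U1[OF that] s that by (auto simp: sU_def)
    obtain t where t: "t \<in> permutations_of_set {..<?n}" "\<And>k. k < ?n \<Longrightarrow> t ! (s ! k) = k" "\<And>k. k < ?n \<Longrightarrow> s ! (t ! k) = k"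
      using perm_inverse[OF ps] by metis
    have tl: "t ! j < ?n" if "j < ?n" for j using that perm_set[OF t(1)] perm_length[OF t(1)] nth_mem[of j t] by auto
    \<comment> \<open>All vertices are unary, so the leaves of \<open>f\<close> form a permutation
      \<open>s\<close>. Input \<open>j\<close> of the target lies over upper vertex
      \<open>t ! j\<close> of \<open>f\<close>, with \<open>t\<close> inverse to \<open>s\<close>,
      and the inverse operation is put there.\<close>
    let ?g = "STree ?t (op_inv P (slower f)) (map (\<lambda>j. op_inv P (supper f ! (t ! j))) [0..<?n]) [] (map (\<lambda>j. [t ! j]) [0..<?n])"
    have gU: "sU ?g j = (op_inv P (fst (sU f (t ! j))), [t ! j])" if "j < ?n" for j
      using that by (simp add: sU_def)
    have iUt: "invertible P (supper f ! (t ! j))" if "j < ?n" for j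
      using iU[OF tl[OF that]] by (simp add: sU_def)
    have o1: "out P (op_inv P (supper f ! (t ! j))) = ins P ?t ! j" if "j < ?n" for j
      using op_inv(4)[OF iUt[OF that]] Us(2)[OF tl[OF that]] t(3)[OF that] by (simp add: sU_def)
    have 1: "composable P ?t (supper ?g)"
      unfolding composable_def
    proof (intro conjI F(2))
      show "set (supper ?g) \<subseteq> opers P" using op_inv(2)[OF iUt] by auto
      show "map (out P) (supper ?g) = ins P ?t" by (rule nth_equalityI) (use o1 at in simp_all)
    qed
    have 2: "pcomposable P (slower ?g) 0 ?t" using q0(2,3) F(2,3) by (simp add: pcomposable_def)
    have 3: "map length (supper_labels ?g) = map (arity P) (supper ?g)"
      by (rule nth_equalityI) (use op_inv(3)[OF iUt] in simp_all)
    have "sleaves ?g = map ((!) t) [0..<length t]" using perm_length[OF t(1)] by (simp add: sleaves_def concat_map_singleton)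
    then have sg: "sleaves ?g = t" by (simp only: map_nth)
    have 5: "sleaves ?g \<in> permutations_of_set {..<length (sleaves ?g)}" unfolding sg perm_length[OF t(1)] by (rule t(1))
    have ga: "stree_arrow P ?g" unfolding stree_arrow_def using 1 2 3 5 q0(3) by simp
    have fg: "starget P f = ssource ?g" by simp
    note S = stcomp_sel[OF f ga fg]
    have "stcomp P ?g f = sid P (ssource f)"
    proof (rule stree_eqI[of _ _ ?n])
      show "ssource (stcomp P ?g f) = ssource (sid P (ssource f))" by (simp add: sid_def stcomp_def Let_def)
      show "length (supper (stcomp P ?g f)) = ?n" "length (supper_labels (stcomp P ?g f)) = ?n" by (rule S(2,3))+
      show "length (supper (sid P (ssource f))) = ?n" "length (supper_labels (sid P (ssource f))) = ?n"
        by (simp_all add: sid_def)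
      fix k assume k: "k < ?n"
      have sk: "s ! k < ?n" using k perm_set[OF ps] perm_length[OF ps] nth_mem[of k s] by auto
      have g1: "sU ?g (s ! k) = (op_inv P (fst (sU f k)), [k])" using gU[OF sk] t(2)[OF k] by simp
      have "sub P (sU ?g) (sU f k) = (gcomp P (fst (sU f k)) [op_inv P (fst (sU f k))], [k])"
        unfolding sub_def Us(1)[OF k] by (simp add: g1)
      also have "\<dots> = (ident P (out P (fst (sU f k))), [k])" using op_inv(5)[OF iU[OF k]] by simp
      also have "out P (fst (sU f k)) = ins P (ssource f) ! k" using F(7) k by (simp add: lops_def)
      finally have e: "sub P (sU ?g) (sU f k) = (ident P (ins P (ssource f) ! k), [k])" .
      have c: "ins P (ssource f) ! k \<in> colours P" using ins_colour[OF F(1)] k by simp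
      have "nf P (ident P (ins P (ssource f) ! k), [k]) = (ident P (ins P (ssource f) ! k), [k])"
        by (rule nf_sorted) (use ident_opers[OF c] ident_ins[OF c] in simp_all)
      then show "sU (stcomp P ?g f) k = sU (sid P (ssource f)) k" using S(4)[OF k] e sU_sid[OF k] by simp
    next
      have i0: "ins P (slower f) = [out P (ssource f)]" using q0(4) oc by simp
      have "gcomp P (slower f) [ident P (out P (ssource f))] = slower f"
        using gcomp_ident_right[OF F(16)] i0 by simp
      then have "mcomp P (out P (ssource f)) (scol (starget P ?g)) (sU ?g) (sM f) (sM ?g) =
          (ident P (out P (ssource f)), mark [])"
        unfolding S(6) using l0 q0(3,6) oc by (simp add: pcomp_def)
      moreover have "nf P (ident P (out P (ssource f)), mark []) = (ident P (out P (ssource f)), mark [])"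
        by (rule nf_sorted) (use ident_opers[OF F(17)] ident_ins[OF F(17)] in \<open>simp_all add: mark_def\<close>)
      ultimately show "sM (stcomp P ?g f) = sM (sid P (ssource f))" unfolding S(5) by (simp add: sid_def)
    qed
    moreover have "\<forall>v\<in>svertices ?g. invertible P v" using q0(7) op_inv(7)[OF iUt] by (auto simp: svertices_def)
    ultimately show "\<exists>g\<in>?E. Dom (symmetric_Tw P) g = Cod (symmetric_Tw P) f \<and>
        Comp (symmetric_Tw P) g f = Id (symmetric_Tw P) (Dom (symmetric_Tw P) f)"
      using ga by (intro bexI[of _ ?g]) (simp_all add: symmetric_Tw_def)
  qed
  then show ?thesis using assms by blast
qed

end

section \<open>The factorization in the symmetric case\<close>

locale graded_symmetric_operad = symmetric_operad P + graded_operad P \<psi>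
  for P :: "('c, 'o, 'x) sym_operad_scheme" and \<psi> :: "'o \<Rightarrow> int" +
  assumes grading_act: "p \<in> opers P \<Longrightarrow> s \<in> permutations_of_set {..<arity P p} \<Longrightarrow> \<psi> (act P s p) = \<psi> p"
begin

lemma grading_relab: "relab P v w \<Longrightarrow> \<psi> (fst w) = \<psi> (fst v)"
  using grading_act by (auto simp: relab_def)

lemma grading_sub:
  assumes "lop P col v" "lops P col col' G (set (snd v))"
  shows "\<psi> (fst (sub P G v)) = \<psi> (fst v) + sum_list (map (\<lambda>l. \<psi> (fst (G l))) (snd v))"
  using grading_gcomp[OF sub_composable[OF assms]] by (simp add: sub_def o_def)

abbreviation "sR \<equiv> R_eq_minus1 P \<psi> (symmetric_Tw P) svertices strivial"

text \<open>The two shapes of an upper vertex of a morphism in \<open>sR\<close>, with the number of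
  labels included. The cyclic case uses the same notion.\<close>

definition minus_vertex :: "'c \<Rightarrow> 'o \<times> nat list \<Rightarrow> bool" where
  "minus_vertex c v \<longleftrightarrow> fst v = ident P c \<and> c \<in> colours P \<and> (\<exists>j. snd v = [j]) \<or> \<psi> (fst v) = - 1 \<and> snd v = []"

lemma minus_vertexI:
  assumes "lop P col v" "out P (fst v) = c" "fst v \<in> ident P ` colours P \<or> \<psi> (fst v) = - 1"
  shows "minus_vertex c v"
proof (cases "\<psi> (fst v) = - 1")
  case True
  then show ?thesis using grading_minus1[of "fst v"] assms(1) by (simp add: minus_vertex_def lop_def)
next
  case False
  then obtain d where d: "d \<in> colours P" "fst v = ident P d" using assms(3) by blast
  then have "map col (snd v) = [d]" "d = c" using assms(1,2) ident_ins ident_out by (simp_all add: lop_def)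
  then show ?thesis using d by (auto simp: minus_vertex_def)
qed

text \<open>A nullary vertex is left alone and an identity is replaced by the vertex above it. This
  explicit composite is used both to check the factorization and to see that morphisms of
  \<open>sR\<close> are epi.\<close>

lemma nf_sub_minus_vertex:
  assumes m: "minus_vertex c v" and v: "lop P col v" and G: "lops P col col' G (set (snd v))"
    and oc: "\<And>l. l \<in> set (snd v) \<Longrightarrow> col l = c" and nfG: "\<And>l. l \<in> set (snd v) \<Longrightarrow> nf P (G l) = G l"
  shows "nf P (sub P G v) = (if snd v = [] then v else G (hd (snd v)))"
proof (cases "snd v = []")
  case True
  then have "fst v \<in> opers P" "ins P (fst v) = []" using v by (simp_all add: lop_def)
  then show ?thesis using True sub_nullary[of "fst v" G] nf_nullary[of "fst v"] by (cases v) simp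
next
  case False
  then obtain j where j: "v = (ident P c, [j])" using m by (cases v) (auto simp: minus_vertex_def)
  have "sub P G v = G j" unfolding j
    by (rule sub_unit[of col']) (use G oc j in \<open>auto simp: lops_def\<close>)
  then show ?thesis using nfG j by simp
qed

text \<open>If everything above has grading at least 0, a composite of grading -1 must be the
  nullary vertex itself. So the composite decides which of the two shapes \<open>v\<close>
  has.\<close>

lemma minus_vertex_nonneg_composite:
  assumes m: "minus_vertex c v" and v: "lop P col v" and G: "lops P col col' G (set (snd v))"
    and oc: "\<And>l. l \<in> set (snd v) \<Longrightarrow> col l = c" and nfG: "\<And>l. l \<in> set (snd v) \<Longrightarrow> nf P (G l) = G l"
    and nn: "\<And>l. l \<in> set (snd v) \<Longrightarrow> 0 \<le> \<psi> (fst (G l))"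
  shows "fst v = (if \<psi> (fst (nf P (sub P G v))) = - 1 then fst (nf P (sub P G v)) else ident P c)"
    and "length (snd v) = (if \<psi> (fst (nf P (sub P G v))) = - 1 then 0 else 1)"
proof -
  note e = nf_sub_minus_vertex[OF m v G oc nfG]
  have "fst v = (if \<psi> (fst (nf P (sub P G v))) = - 1 then fst (nf P (sub P G v)) else ident P c) \<and>
    length (snd v) = (if \<psi> (fst (nf P (sub P G v))) = - 1 then 0 else 1)"
  proof (cases "snd v = []")
    case True
    then have "\<psi> (fst v) = - 1" using m by (simp add: minus_vertex_def)
    then show ?thesis using True e by simp
  next
    case False
    then obtain j where j: "fst v = ident P c" "snd v = [j]" using m by (auto simp: minus_vertex_def)
    then show ?thesis using nn[of j] e by simp
  qed
  then show "fst v = (if \<psi> (fst (nf P (sub P G v))) = - 1 then fst (nf P (sub P G v)) else ident P c)"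
    "length (snd v) = (if \<psi> (fst (nf P (sub P G v))) = - 1 then 0 else 1)" by (rule conjunct1, rule conjunct2)
qed

text \<open>The lower vertex has an input, which excludes grading -1, and it is therefore an
  identity without further labels. Triviality of the permutation then says that the labels of the
  upper vertices, read in order, are consecutive.\<close>

lemma sR_cases:
  assumes l: "l \<in> sR"
  shows "stree_arrow P l" "slower l = ident P (out P (ssource l))" "slower_labels l = []"
    "k < arity P (ssource l) \<Longrightarrow> minus_vertex (ins P (ssource l) ! k) (sU l k)"
    "concat (supper_labels l) = [0..<arity P (starget P l)]"
proof -
  show a: "stree_arrow P l" using l by (simp add: R_eq_minus1_def symmetric_Tw_def)
  note F = stree_arrowD[OF a]
  have v: "\<forall>q\<in>svertices l. q \<in> ident P ` colours P \<or> \<psi> q = - 1" and t: "strivial l" using l by (simp_all add: R_eq_minus1_def)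
  have iq: "ins P (slower l) = out P (ssource l) # map (scol (starget P l)) (slower_labels l)"
    using F(8) by (simp add: lop_def map_case_nat_mark)
  then have "\<psi> (slower l) \<noteq> - 1" using grading_minus1[OF F(16)] by auto
  then obtain d where d: "d \<in> colours P" "slower l = ident P d" using v by (auto simp: svertices_def)
  then show "slower l = ident P (out P (ssource l))" "slower_labels l = []" using iq ident_ins by simp_all
  then show "concat (supper_labels l) = [0..<arity P (starget P l)]"
    using t F(4) by (simp add: strivial_def sleaves_def)
  assume k: "k < arity P (ssource l)"
  show "minus_vertex (ins P (ssource l) ! k) (sU l k)"
    by (rule minus_vertexI[of "scol (starget P l)"]) (use F(7) k v in \<open>auto simp: lops_def svertices_alt[OF a]\<close>)
qed

lemma sR_labels:
  assumes l: "l \<in> sR" and k: "k < arity P (ssource l)" and j: "j \<in> set (snd (sU l k))"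
  shows "j < arity P (starget P l)" "ins P (starget P l) ! j = ins P (ssource l) ! k"
proof -
  note R = sR_cases[OF l] and F = stree_arrowD[OF sR_cases(1)[OF l]]
  show "j < arity P (starget P l)" using stree_arrow_labels(1)[OF R(1) k] j by auto
  have "lop P (scol (starget P l)) (sU l k)" using F(7) k by (simp add: lops_def)
  moreover have "snd (sU l k) = [j]" "fst (sU l k) = ident P (ins P (ssource l) ! k)" "ins P (ssource l) ! k \<in> colours P"
    using R(4)[OF k] j by (auto simp: minus_vertex_def)
  ultimately show "ins P (starget P l) ! j = ins P (ssource l) ! k" using ident_ins by (simp add: lop_def)
qed

lemma stcomp_sR:
  assumes l: "l \<in> sR" and g: "stree_arrow P g" and lg: "starget P l = ssource g"
  shows "sM (stcomp P g l) = sM g"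
    and "k < arity P (ssource l) \<Longrightarrow> sU (stcomp P g l) k = (if snd (sU l k) = [] then sU l k else sU g (hd (snd (sU l k))))"
    and "k < arity P (ssource l) \<Longrightarrow> \<forall>v\<in>svertices g. 0 \<le> \<psi> v \<Longrightarrow>
      supper l ! k = (if \<psi> (supper (stcomp P g l) ! k) = - 1 then supper (stcomp P g l) ! k else ident P (ins P (ssource l) ! k)) \<and>
      length (supper_labels l ! k) = (if \<psi> (supper (stcomp P g l) ! k) = - 1 then 0 else 1)"
proof -
  note R = sR_cases[OF l]
  note F = stree_arrowD[OF R(1)] and G = stree_arrowD[OF g]
  note S = stcomp_sel[OF R(1) g lg] and C = stcomp_lop[OF R(1) g lg]
  have "gcomp P (ident P (out P (ssource l))) [ident P (out P (ssource l))] = ident P (out P (ssource l))"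
    using gcomp_ident_left[of "ident P (out P (ssource l))"] ident_opers[OF F(17)] ident_out[OF F(17)] by simp
  moreover have iq: "ins P (slower g) = out P (ssource g) # map (scol (starget P g)) (slower_labels g)"
    using G(8) by (simp add: lop_def map_case_nat_mark)
  moreover have os: "out P (ssource g) = out P (ssource l)" using F(3) R(2) lg ident_out[OF F(17)] by simp
  moreover have "pcomp P (slower g) 0 (ident P (out P (ssource l))) = slower g"
    using pcomp_ident_right[OF G(16), of 0] iq os by simp
  ultimately show "sM (stcomp P g l) = sM g"
    unfolding S(5) unfolding S(6) unfolding R(2,3) using nf_sM[OF g] by simp
  assume k: "k < arity P (ssource l)"
  have jl: "j < arity P (ssource g)" if "j \<in> set (snd (sU l k))" for j using sR_labels(1)[OF l k that] lg by simp
  note N = R(4)[OF k] C(5)[OF k] C(1)[OF k] sR_labels(2)[OF l k] nf_sU[OF g jl]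
  show "sU (stcomp P g l) k = (if snd (sU l k) = [] then sU l k else sU g (hd (snd (sU l k))))"
    unfolding S(4)[OF k] by (rule nf_sub_minus_vertex[OF N])
  assume nn: "\<forall>v\<in>svertices g. 0 \<le> \<psi> v"
  have nG: "0 \<le> \<psi> (fst (sU g j))" if "j \<in> set (snd (sU l k))" for j
    using nn jl[OF that] unfolding svertices_alt[OF g] by blast
  note m = minus_vertex_nonneg_composite[OF N nG, folded S(4)[OF k]]
  show "supper l ! k = (if \<psi> (supper (stcomp P g l) ! k) = - 1 then supper (stcomp P g l) ! k else ident P (ins P (ssource l) ! k)) \<and>
      length (supper_labels l ! k) = (if \<psi> (supper (stcomp P g l) ! k) = - 1 then 0 else 1)"
    using m by (simp add: sU_def)
qed

lemma symmetric_factor: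
  assumes f: "stree_arrow P f"
  shows "\<exists>l\<in>sR. \<exists>r. stree_arrow P r \<and> starget P l = ssource r \<and> stcomp P r l = f \<and>
      svertices r \<subseteq> {v \<in> svertices f. 0 \<le> \<psi> v}"
proof -
  note F = stree_arrowD[OF f]
  let ?p = "ssource f" and ?n = "arity P (ssource f)"
  define zs where "zs = zip (supper f) (supper_labels f)"
  define Q where "Q = (\<lambda>z :: 'o \<times> nat list. \<psi> (fst z) \<noteq> - 1)"
  let ?zs = "filter Q zs" and ?keep = "\<lambda>z. if Q z then ident P (out P (fst z)) else fst z"
  \<comment> \<open>\<open>Q\<close> selects the vertices that survive to the second factor.
    Numbering them consecutively makes the permutation of \<open>?l\<close> trivial; the permutation
    of \<open>f\<close> is carried by the second factor, which reuses the labels of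
    \<open>f\<close>.\<close>
  let ?l = "STree ?p (ident P (out P ?p)) (map ?keep zs) [] (keep_labels Q 0 zs)"
  have lz: "length zs = ?n" using F(5,6) by (simp add: zs_def)
  have zk: "zs ! k = sU f k" if "k < ?n" for k using that F(5,6) by (simp add: zs_def sU_def)
  have zo: "fst z \<in> opers P \<and> length (snd z) = arity P (fst z)" if z: "z \<in> set zs" for z
  proof -
    obtain k where k: "k < length zs" "zs ! k = z" using z unfolding in_set_conv_nth by blast
    then have "lop P (scol (starget P f)) z" using F(7) zk[of k] lz by (auto simp: lops_def)
    then show ?thesis by (simp add: lop_def)
  qed
  have keep: "?keep z \<in> opers P" "out P (?keep z) = out P (fst z)" "arity P (?keep z) = (if Q z then 1 else 0)" if "z \<in> set zs" for z
  proof -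
    have o: "fst z \<in> opers P" using zo[OF that] by blast
    note c = out_colours[OF o]
    show "?keep z \<in> opers P" "out P (?keep z) = out P (fst z)" "arity P (?keep z) = (if Q z then 1 else 0)"
      using o ident_opers[OF c] ident_out[OF c] ident_ins[OF c] grading_minus1[OF o] by (simp_all add: Q_def)
  qed
  have mo: "map (\<lambda>z. out P (fst z)) zs = ins P ?p"
    by (rule nth_equalityI) (use lz zk F(7) in \<open>auto simp: lops_def\<close>)
  have "map (out P) (map ?keep zs) = map (\<lambda>z. out P (fst z)) zs" unfolding map_map o_def by (rule map_cong[OF refl keep(2)])
  then have mk: "map (out P) (map ?keep zs) = ins P ?p" unfolding mo .
  have cl: "composable P ?p (map ?keep zs)" unfolding composable_def mk set_map image_subset_iff using F(1) keep(1) by blast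
  have cc: "concat (keep_labels Q 0 zs) = [0..<length ?zs]" by (simp add: concat_keep_labels)
  have ll: "map length (keep_labels Q 0 zs) = map (arity P) (map ?keep zs)"
  proof (rule nth_equalityI)
    fix k assume "k < length (map length (keep_labels Q 0 zs))"
    then have k: "k < length zs" by (simp add: length_keep_labels)
    have "map (arity P) (map ?keep zs) ! k = arity P (?keep (zs ! k))" using k by simp
    also have "\<dots> = (if Q (zs ! k) then 1 else 0)" by (rule keep(3)[OF nth_mem[OF k]])
    also have "\<dots> = map length (keep_labels Q 0 zs) ! k"
      using nth_keep_labels[OF k, of Q 0] k by (cases "Q (zs ! k)") (auto simp: length_keep_labels)
    finally show "map length (keep_labels Q 0 zs) ! k = map (arity P) (map ?keep zs) ! k" by (rule sym)
  qed (simp add: length_keep_labels)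
  have srt: "sorted x" if x: "x \<in> set (keep_labels Q 0 zs)" for x
  proof -
    obtain k where "k < length zs" "x = keep_labels Q 0 zs ! k" using x by (auto simp: in_set_conv_nth length_keep_labels)
    then show ?thesis using nth_keep_labels[of k zs Q 0] by (auto split: if_splits)
  qed
  have la: "stree_arrow P ?l"
    unfolding stree_arrow_def
    using cl pcomposable_ident_left[OF F(1)] ll ident_ins[OF F(17)] perm_id[of "length ?zs"] srt
    by (auto simp: sleaves_def cc)
  have tl: "strivial ?l" by (simp add: strivial_def sleaves_def cc)
  have "?keep z \<in> ident P ` colours P \<or> \<psi> (?keep z) = - 1" if "z \<in> set zs" for z
    using zo[OF that] out_colours[of "fst z"] by (simp add: Q_def)
  then have "\<forall>q\<in>svertices ?l. q \<in> ident P ` colours P \<or> \<psi> q = - 1"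
    using F(17) unfolding svertices_def stree.sel set_map by blast
  then have lR: "?l \<in> sR"
    using la tl by (simp add: R_eq_minus1_def symmetric_Tw_def)
  let ?t = "starget P ?l"
  note L = stree_arrowD[OF la]
  have at: "arity P ?t = length ?zs" using L(4) by (simp add: sleaves_def cc)
  have t: "?t = gcomp P ?p (map ?keep zs)"
  proof -
    have g: "gcomp P ?p (map ?keep zs) \<in> opers P" by (rule gcomp_opers[OF cl])
    have "pcomp P (ident P (out P ?p)) 0 (gcomp P ?p (map ?keep zs)) = gcomp P ?p (map ?keep zs)"
      using pcomp_ident_left[OF g] gcomp_out[OF cl] by simp
    then have "?t = act P [0..<length ?zs] (gcomp P ?p (map ?keep zs))" by (simp add: starget_def sleaves_def cc)
    moreover have "arity P (gcomp P ?p (map ?keep zs)) = length ?zs"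
      unfolding gcomp_arity[OF cl] ll[symmetric] using arg_cong[OF cc, of length] by (simp add: length_concat)
    ultimately show ?thesis using act_id[OF g] by simp
  qed
  have it: "ins P ?t = map (\<lambda>z. out P (fst z)) ?zs"
  proof -
    have "concat (map (ins P) (map ?keep ys)) = map (\<lambda>z. out P (fst z)) (filter Q ys)" if "set ys \<subseteq> set zs" for ys
      using that
    proof (induction ys)
      case (Cons y ys)
      have "ins P (?keep y) = (if Q y then [out P (fst y)] else [])"
        using zo[of y] Cons.prems out_colours[of "fst y"] ident_ins grading_minus1[of "fst y"] by (auto simp: Q_def)
      then show ?case using Cons by simp
    qed simp
    then show ?thesis unfolding t gcomp_ins[OF cl] by blast
  qed
  let ?r = "STree ?t (slower f) (map fst ?zs) (slower_labels f) (map snd ?zs)"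
  \<comment> \<open>The discarded vertices are nullary and have no labels, so the leaves of the
    second factor are numbered as in \<open>f\<close>.\<close>
  have cf: "concat (map snd (filter Q ys)) = concat (map snd ys)" if "set ys \<subseteq> set zs" for ys
    using that
  proof (induction ys)
    case (Cons y ys)
    have "snd y = []" if "\<not> Q y"
      using zo[of y] Cons.prems grading_minus1[of "fst y"] that by (auto simp: Q_def)
    then show ?case using Cons by auto
  qed simp
  have "map snd zs = supper_labels f" using F(5,6) by (simp add: zs_def)
  then have sr: "sleaves ?r = sleaves f" using cf[of zs] by (simp add: sleaves_def)
  have "fst ` set ?zs \<subseteq> opers P" using zo by auto
  then have cr: "composable P ?t (map fst ?zs)" using it L(2) by (simp add: composable_def o_def)
  have "out P ?t = out P ?p" using t gcomp_out[OF cl] by simp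
  moreover have "pcomposable P (slower f) 0 ?p" using f by (simp add: stree_arrow_def)
  ultimately have pr: "pcomposable P (slower f) 0 ?t" using L(2) by (simp add: pcomposable_def)
  have "snd ` set zs = set (supper_labels f)" using arg_cong[OF \<open>map snd zs = supper_labels f\<close>, of set] by simp
  then have "\<forall>x\<in>set zs. sorted (snd x)" using f by (auto simp: stree_arrow_def simp flip: ball_simps(9))
  then have ra: "stree_arrow P ?r"
    using f cr pr zo unfolding stree_arrow_def sr by auto
  have lr: "starget P ?l = ssource ?r" by simp
  note K = stcomp_sR[OF lR ra lr]
  note S = stcomp_sel[OF la ra lr]
  have "stcomp P ?r ?l = f"
  proof (rule stree_eqI[of _ _ ?n])
    show "ssource (stcomp P ?r ?l) = ssource f" using S(1) by simp
    show "sM (stcomp P ?r ?l) = sM f" unfolding K(1) by simp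
    show "length (supper (stcomp P ?r ?l)) = ?n" "length (supper_labels (stcomp P ?r ?l)) = ?n" using S(2,3) by simp_all
    show "length (supper f) = ?n" "length (supper_labels f) = ?n" by (rule F(5,6))+
    fix k assume k: "k < ?n"
    have Uk: "sU ?l k = (?keep (zs ! k), keep_labels Q 0 zs ! k)" using k lz by (simp add: sU_def)
    have kk: "k < arity P (ssource ?l)" using k by simp
    show "sU (stcomp P ?r ?l) k = sU f k"
    proof (cases "Q (zs ! k)")
      case True
      then obtain j where "j < length ?zs" "keep_labels Q 0 zs ! k = [j]" "?zs ! j = zs ! k"
        using nth_keep_labels[of k zs Q 0] k lz by auto
      then show ?thesis unfolding K(2)[OF kk] Uk using zk[OF k] by (simp add: sU_def)
    next
      case False
      then have "keep_labels Q 0 zs ! k = []" using nth_keep_labels[of k zs Q 0] k lz by auto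
      moreover have "snd (zs ! k) = []"
        using zo[of "zs ! k"] k lz False grading_minus1[of "fst (zs ! k)"] by (auto simp: Q_def)
      ultimately show ?thesis unfolding K(2)[OF kk] Uk using False unfolding zk[OF k] by (simp add: prod_eq_iff)
    qed
  qed
  moreover have "svertices ?r \<subseteq> {v \<in> svertices f. 0 \<le> \<psi> v}"
  proof
    fix v assume "v \<in> svertices ?r"
    then consider "v = slower f" | z where "z \<in> set zs" "Q z" "v = fst z" by (auto simp: svertices_def)
    then show "v \<in> {v \<in> svertices f. 0 \<le> \<psi> v}"
    proof cases
      case 1
      have "ins P (slower f) \<noteq> []" using F(8) by (simp add: lop_def map_case_nat_mark)
      then show ?thesis using 1 grading_nonneg[OF F(16)] by (simp add: svertices_def)
    next
      case 2
      then have "0 \<le> \<psi> v" using zo[of z] grading_ge[of v] by (auto simp: Q_def)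
      moreover have "v \<in> set (supper f)" using 2 set_zip_leftD[of "fst z" "snd z" "supper f" "supper_labels f"] by (simp add: zs_def)
      ultimately show ?thesis by (simp add: svertices_def)
    qed
  qed
  ultimately show ?thesis using lR ra by (intro bexI[of _ ?l] exI[of _ ?r]) auto
qed

lemma symmetric_graded_vertices:
  assumes H: "\<forall>p\<in>opers P. \<psi> p = 0 \<longrightarrow> invertible P p"
  shows "graded_vertices (symmetric_Tw P) \<psi> (\<lambda>f. slower f # supper f) sR"
proof (intro graded_vertices.intro category_symmetric_Tw graded_vertices_axioms.intro)
  fix f assume f: "f \<in> Arr (symmetric_Tw P)"
  then have fa: "stree_arrow P f" by (simp add: symmetric_Tw_def)
  then have fo: "composable P (ssource f) (supper f)" "pcomposable P (slower f) 0 (ssource f)"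
    by (simp_all add: stree_arrow_def)
  then have vo: "svertices f \<subseteq> opers P" by (auto simp: svertices_def composable_def pcomposable_def)
  have s: "set (slower f # supper f) = svertices f" by (auto simp: svertices_def)
  show "f \<in> isos (symmetric_Tw P) \<longleftrightarrow> (\<forall>v\<in>set (slower f # supper f). \<psi> v = 0)"
    unfolding s using symmetric_isos_invertible invertible_grading symmetric_isosI[OF fa] H vo by blast
  show "\<psi> (Cod (symmetric_Tw P) f) = \<psi> (Dom (symmetric_Tw P) f) + sum_list (map \<psi> (slower f # supper f))"
    using grading_relab[OF stree_arrowD(13)[OF fa]] grading_pcomp[OF ptarget_pcomposable[OF fo]] grading_gcomp[OF fo(1)]
    by (simp add: symmetric_Tw_def)
  show "\<exists>l\<in>sR. \<exists>r\<in>Arr (symmetric_Tw P). Cod (symmetric_Tw P) l = Dom (symmetric_Tw P) r \<and> Comp (symmetric_Tw P) r l = f \<and>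
      set (slower r # supper r) \<subseteq> {v \<in> set (slower f # supper f). 0 \<le> \<psi> v}"
    using symmetric_factor[OF fa] by (fastforce simp: symmetric_Tw_def svertices_def)
next
  fix a assume "a \<in> Obj (symmetric_Tw P)"
  then show "- 1 \<le> \<psi> a" using grading_ge by (simp add: symmetric_Tw_def)
next
  fix f g v assume "f \<in> Arr (symmetric_Tw P)" "g \<in> Arr (symmetric_Tw P)" "Cod (symmetric_Tw P) f = Dom (symmetric_Tw P) g"
    and "v \<in> set (slower (Comp (symmetric_Tw P) g f) # supper (Comp (symmetric_Tw P) g f))"
  then have a: "stree_arrow P f" "stree_arrow P g" "starget P f = ssource g" and v: "v \<in> svertices (stcomp P g f)"
    by (simp_all add: symmetric_Tw_def svertices_def)
  note F = stree_arrowD[OF a(1)] and C = stcomp_lop[OF a] and S = stcomp_sel[OF a]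
  have at: "arity P (starget P f) = arity P (ssource g)" using a(3) by simp
  have gU: "fst (sU g j) \<in> set (supper g)" if "j < arity P (ssource g)" for j
    using that stree_arrowD(5)[OF a(2)] by (simp add: sU_def)
  have "\<exists>us. set us \<subseteq> svertices f \<union> svertices g \<and> \<psi> v = sum_list (map \<psi> us)"
  proof (cases "v = slower (stcomp P g f)")
    case True
    let ?m = "mcomp P (out P (ssource f)) (scol (starget P g)) (sU g) (sM f) (sM g)"
    have v1: "\<psi> v = \<psi> (fst ?m)" using grading_relab[OF C(11)] True by simp
    let ?W = "gcomp P (slower f) (ident P (out P (ssource f)) # map (\<lambda>j. fst (sU g j)) (slower_labels f))"
    have iq: "ins P (slower f) = out P (ssource f) # map (scol (starget P f)) (slower_labels f)"
      using F(8) by (simp add: lop_def map_case_nat_mark)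
    have cW: "composable P (slower f) (ident P (out P (ssource f)) # map (\<lambda>j. fst (sU g j)) (slower_labels f))"
      using C(2) F(16,17) iq ident_opers ident_out by (auto simp: composable_def lops_def lop_def)
    have ir: "ins P (slower g) = out P (slower f) # map (scol (starget P g)) (slower_labels g)"
      using C(4) by (simp add: lop_def map_case_nat_mark)
    have pW: "pcomposable P (slower g) 0 ?W"
      using gcomp_opers[OF cW] gcomp_out[OF cW] stree_arrowD(16)[OF a(2)] ir by (simp add: pcomposable_def)
    have "fst ?m = pcomp P (slower g) 0 ?W" unfolding S(6) by (simp add: sU_def)
    then have "\<psi> v = sum_list (map \<psi> (slower g # slower f # map (\<lambda>j. fst (sU g j)) (slower_labels f)))"
      using v1 grading_pcomp[OF pW] grading_gcomp[OF cW] grading_ident[OF F(17)] by simp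
    moreover have "set (slower g # slower f # map (\<lambda>j. fst (sU g j)) (slower_labels f)) \<subseteq> svertices f \<union> svertices g"
      using gU stree_arrow_lower_labels(1)[OF a(1)] at by (auto simp: svertices_def)
    ultimately show ?thesis by blast
  next
    case False
    then obtain k where k: "k < arity P (ssource f)" "v = fst (sU (stcomp P g f) k)"
      using v svertices_alt[OF stcomp_arrow[OF a]] S(1) by auto
    have "\<psi> v = \<psi> (fst (sub P (sU g) (sU f k)))" using grading_relab[OF C(10)[OF k(1)]] k(2) by simp
    then have "\<psi> v = sum_list (map \<psi> (fst (sU f k) # map (\<lambda>j. fst (sU g j)) (snd (sU f k))))"
      using grading_sub[OF C(5)[OF k(1)] C(1)[OF k(1)]] by (simp add: o_def)
    moreover have "set (fst (sU f k) # map (\<lambda>j. fst (sU g j)) (snd (sU f k))) \<subseteq> svertices f \<union> svertices g"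
      using gU stree_arrow_labels(1)[OF a(1) k(1)] k(1) F(5) at by (auto simp: svertices_def sU_def)
    ultimately show ?thesis by blast
  qed
  then show "\<exists>us. set us \<subseteq> set (slower f # supper f) \<union> set (slower g # supper g) \<and> \<psi> v = sum_list (map \<psi> us)"
    by (simp add: svertices_def)
next
  fix l assume l: "l \<in> sR"
  then show "l \<in> Arr (symmetric_Tw P)" by (simp add: R_eq_minus1_def)
  fix v assume "v \<in> set (slower l # supper l)"
  then show "\<psi> v \<le> 0" using l grading_ident by (auto simp: R_eq_minus1_def svertices_def)
next
  fix l g h
  assume l: "l \<in> sR" and "g \<in> Arr (symmetric_Tw P)" "h \<in> Arr (symmetric_Tw P)"
    "Dom (symmetric_Tw P) g = Cod (symmetric_Tw P) l" "Dom (symmetric_Tw P) h = Cod (symmetric_Tw P) l"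
    "Comp (symmetric_Tw P) g l = Comp (symmetric_Tw P) h l"
  then have gh: "stree_arrow P g" "stree_arrow P h" "starget P l = ssource g" "starget P l = ssource h"
    and eq: "stcomp P g l = stcomp P h l" by (simp_all add: symmetric_Tw_def)
  note R = sR_cases[OF l] and F = stree_arrowD[OF sR_cases(1)[OF l]]
  note G = stree_arrowD[OF gh(1)] and Hh = stree_arrowD[OF gh(2)]
  note K = stcomp_sR[OF l gh(1,3)] and K' = stcomp_sR[OF l gh(2,4)]
  show "g = h"
  proof (rule stree_eqI[of _ _ "arity P (starget P l)"])
    show "ssource g = ssource h" using gh by simp
    show "sM g = sM h" using K(1) K'(1) eq by simp
    show "length (supper g) = arity P (starget P l)" "length (supper_labels g) = arity P (starget P l)"
      "length (supper h) = arity P (starget P l)" "length (supper_labels h) = arity P (starget P l)"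
      using G(5,6) Hh(5,6) gh(3,4) by simp_all
    \<comment> \<open>Since the labels of \<open>l\<close> run through all inputs of its target,
      \<open>j\<close> labels some upper vertex of \<open>l\<close>. That vertex is an identity, and
      the vertex of the composite at this place is vertex \<open>j\<close> of
      \<open>g\<close>.\<close>
    fix j assume "j < arity P (starget P l)"
    then have "j \<in> set (concat (supper_labels l))" unfolding R(5) by simp
    then obtain k where k: "k < arity P (ssource l)" "j \<in> set (snd (sU l k))"
      using F(6) by (auto simp: sU_def in_set_conv_nth) (metis in_set_conv_nth)
    then have "snd (sU l k) = [j]" using R(4)[OF k(1)] by (auto simp: minus_vertex_def)
    then show "sU g j = sU h j" using K(2)[OF k(1)] K'(2)[OF k(1)] eq by simp
  qed
next
  fix l l' g h
  assume l: "l \<in> sR" and l': "l' \<in> sR" and "g \<in> Arr (symmetric_Tw P)" "h \<in> Arr (symmetric_Tw P)"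
    "Dom (symmetric_Tw P) g = Cod (symmetric_Tw P) l" "Dom (symmetric_Tw P) h = Cod (symmetric_Tw P) l'"
    "Comp (symmetric_Tw P) g l = Comp (symmetric_Tw P) h l'"
    and nn: "\<forall>v\<in>set (slower g # supper g) \<union> set (slower h # supper h). 0 \<le> \<psi> v"
  then have gh: "stree_arrow P g" "stree_arrow P h" "starget P l = ssource g" "starget P l' = ssource h"
    and eq: "stcomp P g l = stcomp P h l'" by (simp_all add: symmetric_Tw_def)
  note R = sR_cases[OF l] and R' = sR_cases[OF l']
  note F = stree_arrowD[OF R(1)] and F' = stree_arrowD[OF R'(1)]
  have p: "ssource l = ssource l'"
    using stcomp_sel(1)[OF R(1) gh(1,3)] stcomp_sel(1)[OF R'(1) gh(2,4)] eq by simp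
  have nng: "\<forall>v\<in>svertices g. 0 \<le> \<psi> v" "\<forall>v\<in>svertices h. 0 \<le> \<psi> v" using nn by (auto simp: svertices_def)
  have K: "supper l ! k = supper l' ! k \<and> length (supper_labels l ! k) = length (supper_labels l' ! k)"
    if "k < arity P (ssource l)" for k
    using stcomp_sR(3)[OF l gh(1,3) that nng(1)] stcomp_sR(3)[OF l' gh(2,4) that[unfolded p] nng(2)] p eq by simp
  have u: "supper l = supper l'" by (rule nth_equalityI) (use K F(5) F'(5) p in simp_all)
  \<comment> \<open>The composite determines only how many labels each vertex of \<open>l\<close>
    has; consecutive numbering then fixes the labels themselves.\<close>
  have ll: "map length (supper_labels l) = map length (supper_labels l')"
    by (rule nth_equalityI) (use K F(6) F'(6) p in simp_all)
  have "length (concat (supper_labels l)) = length (concat (supper_labels l'))" unfolding length_concat ll ..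
  then have "concat (supper_labels l) = concat (supper_labels l')" unfolding R(5) R'(5) by simp
  then have "supper_labels l = supper_labels l'" using ll by (rule concat_inj)
  then show "l = l'" using u p R(2,3) R'(2,3) by (cases l, cases l') simp
qed

theorem symmetric_reedy_iff:
  "generalized_reedy (symmetric_Tw P) {-1..} \<psi> (R_minus P \<psi> (symmetric_Tw P) svertices strivial)
     (R_plus \<psi> (symmetric_Tw P) svertices)
   \<longleftrightarrow> (\<forall>p\<in>opers P. \<psi> p = 0 \<longrightarrow> arity P p = 1) \<and> groupoid (grade0_cat P \<psi>)"
  unfolding groupoid_iff_invertible
proof
  assume H: "\<forall>p\<in>opers P. \<psi> p = 0 \<longrightarrow> invertible P p"
  interpret graded_vertices "symmetric_Tw P" \<psi> "\<lambda>f. slower f # supper f" sR by (rule symmetric_graded_vertices[OF H])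
  show "generalized_reedy (symmetric_Tw P) {-1..} \<psi> (R_minus P \<psi> (symmetric_Tw P) svertices strivial)
     (R_plus \<psi> (symmetric_Tw P) svertices)"
    using reedy by (simp add: R_minus_def R_plus_def R_ge_0_def svertices_def)
next
  assume R: "generalized_reedy (symmetric_Tw P) {-1..} \<psi> (R_minus P \<psi> (symmetric_Tw P) svertices strivial)
     (R_plus \<psi> (symmetric_Tw P) svertices)"
  show "\<forall>p\<in>opers P. \<psi> p = 0 \<longrightarrow> invertible P p"
  proof (intro ballI impI)
    fix p assume p: "p \<in> opers P" "\<psi> p = 0"
    let ?c = "out P p"
    let ?f = "STree (ident P ?c) (ident P ?c) [p] [] [[0..<arity P p]]"
    have c: "?c \<in> colours P" using out_colours[OF p(1)] .
    have f: "stree_arrow P ?f"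
      using composable_ident[OF p(1)] pcomposable_ident_left[OF ident_opers[OF c]] ident_out[OF c] ident_ins[OF c] perm_id
      by (simp add: stree_arrow_def sleaves_def)
    have t: "starget P ?f = p"
      using gcomp_ident_left[OF p(1)] pcomp_ident_left[OF p(1)] act_id[OF p(1)] by (simp add: starget_def sleaves_def)
    have "?f \<in> isos (symmetric_Tw P)"
    proof (rule reedy_pos_iso[OF R[unfolded R_plus_def]])
      show "R_ge_0 \<psi> (symmetric_Tw P) svertices \<subseteq> Arr (symmetric_Tw P)" by (auto simp: R_ge_0_def)
      show "?f \<in> R_ge_0 \<psi> (symmetric_Tw P) svertices"
        using f p grading_ident[OF c] by (simp add: R_ge_0_def symmetric_Tw_def svertices_def)
      show "\<not> \<psi> (Dom (symmetric_Tw P) ?f) < \<psi> (Cod (symmetric_Tw P) ?f)"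
        using t p grading_ident[OF c] by (simp add: symmetric_Tw_def)
    qed
    then show "invertible P p" by (rule symmetric_isos_invertible) (simp add: svertices_def)
  qed
qed

end

section \<open>Gluing in cyclic operads\<close>

text \<open>With a single colour, lists of colours are compared by length, and every colour
  condition becomes a condition on arities.\<close>

lemma unit_list_eq: "(xs :: unit list) = ys \<longleftrightarrow> length xs = length ys"
  by (auto intro: nth_equalityI)

text \<open>The counterpart of \<open>relab\<close> for permutations of all legs. The output is
  labelled too, its label being the head of the list.\<close>

definition crelab :: "('o, 'x) cyc_operad_scheme \<Rightarrow> 'o \<times> nat list \<Rightarrow> 'o \<times> nat list \<Rightarrow> bool" where
  "crelab P v w \<longleftrightarrow> fst v \<in> opers P \<and> length (snd v) = Suc (arity P (fst v)) \<and> length (snd w) = Suc (arity P (fst v)) \<and>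
     (\<exists>s\<in>permutations_of_set {..<Suc (arity P (fst v))}. fst w = cact P s (fst v) \<and> snd v = map ((!) (snd w)) s)"

definition cnf :: "('o, 'x) cyc_operad_scheme \<Rightarrow> 'o \<times> nat list \<Rightarrow> 'o \<times> nat list" where
  "cnf P v = (cact P (ranks (snd v)) (fst v), sort (snd v))"

text \<open>The operation belonging to the head label is glued to the output by
  \<open>glue_root\<close>, the others are composed at the inputs. As \<open>glue_root\<close> puts
  the legs of its last argument first, the new labels are simply concatenated.\<close>

definition cglue :: "('o, 'x) cyc_operad_scheme \<Rightarrow> (nat \<Rightarrow> 'o \<times> nat list) \<Rightarrow> 'o \<times> nat list \<Rightarrow> 'o \<times> nat list" where
  "cglue P G v = (glue_root P (gcomp P (fst v) (map (\<lambda>l. fst (G l)) (tl (snd v)))) (fst (G (hd (snd v)))),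
     concat (map (\<lambda>l. snd (G l)) (snd v)))"

text \<open>The rotation lowers leg numbers by one cyclically; written as adding \<open>n\<close>
  modulo \<open>n + 1\<close> it is easy to iterate.\<close>

lemma list_update_rotation: "n # [0..<n] = map (\<lambda>i. (i + n) mod Suc n) [0..<Suc n]"
proof (rule nth_equalityI)
  fix i assume "i < length (n # [0..<n])"
  then have "i < Suc n" by simp
  then show "(n # [0..<n]) ! i = map (\<lambda>i. (i + n) mod Suc n) [0..<Suc n] ! i"
  proof (cases i)
    case (Suc j)
    then have "(i + n) mod Suc n = (j + Suc n) mod Suc n" by simp
    also have "\<dots> = j" using Suc \<open>i < Suc n\<close> by (simp only: mod_add_self2) simp
    finally show ?thesis using Suc \<open>i < Suc n\<close> by (simp del: upt_Suc)
  qed (simp del: upt_Suc)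
qed simp

lemma perm_map_upt:
  assumes "inj_on f {..<n}" "\<And>i. i < n \<Longrightarrow> f i < n"
  shows "map f [0..<n] \<in> permutations_of_set {..<n}"
proof (rule permutations_of_setI)
  have "f ` {..<n} = {..<n}" using assms by (intro endo_inj_surj) auto
  then show "set (map f [0..<n]) = {..<n}" by (simp add: lessThan_atLeast0)
  show "distinct (map f [0..<n])" using assms(1) by (simp add: distinct_map lessThan_atLeast0)
qed

lemma perm_rot: "n # [0..<n] \<in> permutations_of_set {..<Suc n}"
  by (auto simp: perm_iff_mset)

lemma map_nth_map_upt: "(\<And>i. i < n \<Longrightarrow> g i < n) \<Longrightarrow> map ((!) (map f [0..<n])) (map g [0..<n]) = map (\<lambda>i. f (g i)) [0..<n]"
  by simp

section \<open>Rotations and permutations of legs\<close>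

context cyclic_operad
begin

lemma composable_unit: "composable P p qs \<longleftrightarrow> p \<in> opers P \<and> set qs \<subseteq> opers P \<and> length qs = arity P p"
  by (auto simp: composable_def unit_list_eq)

lemma pcomposable_unit: "pcomposable P p i q \<longleftrightarrow> p \<in> opers P \<and> q \<in> opers P \<and> i < arity P p"
  by (auto simp: pcomposable_def)

abbreviation "ulop \<equiv> lop P (\<lambda>_. ())"

lemma ulop: "lop P col v \<longleftrightarrow> fst v \<in> opers P \<and> length (snd v) = arity P (fst v)"
  by (auto simp: lop_def unit_list_eq)

lemma ulops: "lops P col col' G A \<longleftrightarrow> (\<forall>l\<in>A. fst (G l) \<in> opers P \<and> length (snd (G l)) = arity P (fst (G l)))"
  by (simp add: lops_def ulop)

abbreviation (input) "uid \<equiv> ident P ()"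

lemma uid: "uid \<in> opers P" "ins P uid = [()]"
  using ident_opers ident_ins single_colour by auto

lemma atMost_perm: "permutations_of_set {..n} = permutations_of_set {..<Suc n}"
  by (simp add: lessThan_Suc_atMost)

lemmas cact_opers' = cact_opers[unfolded atMost_perm] and cact_arity' = cact_arity[unfolded atMost_perm]
  and cact_cact' = cact_cact[unfolded atMost_perm]

lemma rot_opers: "x \<in> opers P \<Longrightarrow> rot P x \<in> opers P"
  and rot_arity: "x \<in> opers P \<Longrightarrow> arity P (rot P x) = arity P x"
  unfolding rot_def by (auto intro: cact_opers' cact_arity' perm_rot)

lemma rotn_opers: "x \<in> opers P \<Longrightarrow> (rot P ^^ k) x \<in> opers P \<and> arity P ((rot P ^^ k) x) = arity P x"
  by (induction k) (auto simp: rot_opers rot_arity)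

lemma rotn_cact:
  assumes x: "x \<in> opers P"
  shows "(rot P ^^ k) x = cact P (map (\<lambda>i. (i + k * arity P x) mod Suc (arity P x)) [0..<Suc (arity P x)]) x"
proof (induction k)
  case 0
  have "map (\<lambda>i. i mod Suc (arity P x)) [0..<Suc (arity P x)] = [0..<Suc (arity P x)]"
    by (rule map_idI) auto
  then show ?case using cact_id[OF x] by simp
next
  case (Suc k)
  let ?n = "arity P x"
  let ?s = "map (\<lambda>i. (i + k * ?n) mod Suc ?n) [0..<Suc ?n]" and ?r = "map (\<lambda>i. (i + ?n) mod Suc ?n) [0..<Suc ?n]"
  have "inj_on (\<lambda>i. (i + k * ?n) mod Suc ?n) {..<Suc ?n}"
  proof (rule inj_onI)
    fix i j assume h: "i \<in> {..<Suc ?n}" "j \<in> {..<Suc ?n}" "(i + k * ?n) mod Suc ?n = (j + k * ?n) mod Suc ?n"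
    \<comment> \<open>\<open>k * ?n + k\<close> is a multiple of \<open>Suc ?n\<close>, so adding
      \<open>k\<close> undoes the shift.\<close>
    have "(i + k * ?n + k) mod Suc ?n = (j + k * ?n + k) mod Suc ?n" using h(3) by (rule mod_add_cong) simp
    moreover have "l + k * ?n + k = l + k * Suc ?n" for l by simp
    ultimately have "i mod Suc ?n = j mod Suc ?n" by (simp only: mod_mult_self1)
    then show "i = j" using h by simp
  qed
  then have s: "?s \<in> permutations_of_set {..<Suc ?n}" by (rule perm_map_upt) simp
  have r: "?r \<in> permutations_of_set {..<Suc ?n}" using perm_rot[of ?n] unfolding list_update_rotation .
  have "(rot P ^^ Suc k) x = rot P (cact P ?s x)" using Suc by simp
  also have "\<dots> = cact P ?r (cact P ?s x)" unfolding rot_def cact_arity'[OF x s] list_update_rotation ..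
  also have "\<dots> = cact P (map ((!) ?r) ?s) x" by (rule cact_cact'[OF x s r])
  also have "map ((!) ?r) ?s = map (\<lambda>i. ((i + k * ?n) mod Suc ?n + ?n) mod Suc ?n) [0..<Suc ?n]"
    by (rule map_nth_map_upt) simp
  also have "\<dots> = map (\<lambda>i. (i + Suc k * ?n) mod Suc ?n) [0..<Suc ?n]"
  proof (rule map_cong[OF refl])
    fix i
    have "i + k * ?n + ?n = i + Suc k * ?n" by simp
    then show "((i + k * ?n) mod Suc ?n + ?n) mod Suc ?n = (i + Suc k * ?n) mod Suc ?n"
      by (simp only: mod_add_left_eq)
  qed
  finally show ?case .
qed

lemma rotn_id:
  assumes x: "x \<in> opers P"
  shows "(rot P ^^ Suc (arity P x)) x = x"
proof -
  have "map (\<lambda>i. (i + Suc (arity P x) * arity P x) mod Suc (arity P x)) [0..<Suc (arity P x)] = [0..<Suc (arity P x)]"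
    by (rule map_idI) (simp only: mod_mult_self2 set_upt, simp)
  then show ?thesis unfolding rotn_cact[OF x] using cact_id[OF x] by simp
qed

lemma rotn_pcomp:
  assumes "q \<in> opers P" "s \<in> opers P" "j \<le> i" "i < arity P q"
  shows "(rot P ^^ j) (pcomp P q i s) = pcomp P ((rot P ^^ j) q) (i - j) s"
  using assms
proof (induction j)
  case (Suc j)
  then have "(rot P ^^ Suc j) (pcomp P q i s) = rot P (pcomp P ((rot P ^^ j) q) (i - j) s)" by simp
  also have "\<dots> = pcomp P (rot P ((rot P ^^ j) q)) (i - j - 1) s"
    by (rule rot_pcomp) (use Suc.prems rotn_opers[of q j] in auto)
  finally show ?case by simp
qed simp

text \<open>Both sides glue the outputs of \<open>q\<close> and \<open>s\<close> to each other, with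
  the legs of \<open>q\<close> first or those of \<open>s\<close> first. All but one of the
  rotations carry the graft to the first input, the last one exchanges the roles by
  \<open>rot_pcomp_first\<close>, and \<open>q\<close> has then been turned around
  completely.\<close>

lemma rot_pcomp_swap:
  assumes q: "q \<in> opers P" "1 \<le> arity P q" and s: "s \<in> opers P" "1 \<le> arity P s"
  shows "(rot P ^^ arity P q) (pcomp P (rot P q) (arity P q - 1) s) = pcomp P (rot P s) (arity P s - 1) q"
proof -
  obtain m where m: "arity P q = Suc m" using q(2) by (cases "arity P q") auto
  note rq = rot_opers[OF q(1)] rot_arity[OF q(1)]
  have "(rot P ^^ m) (pcomp P (rot P q) m s) = pcomp P ((rot P ^^ m) (rot P q)) 0 s"
    using rotn_pcomp[of "rot P q" s m m] rq s m by simp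
  also have "(rot P ^^ m) (rot P q) = (rot P ^^ Suc m) q" by (simp only: funpow_Suc_right o_apply)
  finally have "(rot P ^^ Suc m) (pcomp P (rot P q) m s) = rot P (pcomp P ((rot P ^^ Suc m) q) 0 s)" by simp
  also have "\<dots> = pcomp P (rot P s) (arity P s - 1) (rot P ((rot P ^^ Suc m) q))"
    by (rule rot_pcomp_first) (use rotn_opers[OF q(1), of "Suc m"] q s in simp_all)
  also have "rot P ((rot P ^^ Suc m) q) = q" using rotn_id[OF q(1)] unfolding m by simp
  finally show ?thesis unfolding m by simp
qed

lemma crelab_refl: "fst v \<in> opers P \<Longrightarrow> length (snd v) = Suc (arity P (fst v)) \<Longrightarrow> crelab P v v"
  unfolding crelab_def using cact_id[of "fst v"] perm_id map_nth[of "snd v"]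
  by (intro conjI bexI[of _ "[0..<Suc (arity P (fst v))]"]) (auto simp del: upt_Suc)

lemma crelab_trans:
  assumes "crelab P u v" "crelab P v w"
  shows "crelab P u w"
proof -
  obtain s where s: "fst u \<in> opers P" "length (snd u) = Suc (arity P (fst u))" "length (snd v) = Suc (arity P (fst u))"
    "s \<in> permutations_of_set {..<Suc (arity P (fst u))}" "fst v = cact P s (fst u)" "snd u = map ((!) (snd v)) s"
    using assms(1) by (auto simp: crelab_def)
  have a: "arity P (fst v) = arity P (fst u)" using cact_arity'[OF s(1,4)] s(5) by simp
  obtain t where t: "length (snd w) = Suc (arity P (fst u))" "t \<in> permutations_of_set {..<Suc (arity P (fst u))}"
    "fst w = cact P t (fst v)" "snd v = map ((!) (snd w)) t"
    using assms(2) a by (auto simp: crelab_def)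
  have "fst w = cact P (map ((!) t) s) (fst u)" using cact_cact'[OF s(1,4) t(2)] s(5) t(3) by simp
  moreover have "snd u = map ((!) (snd w)) (map ((!) t) s)"
    unfolding s(6) t(4) by (rule map_nth_map) (use perm_set[OF s(4)] perm_length[OF t(2)] in simp)
  ultimately show ?thesis using s t perm_comp[OF s(4) t(2)] unfolding crelab_def by blast
qed

lemma crelab_mset:
  assumes "crelab P v w"
  shows "mset (snd v) = mset (snd w)"
proof -
  obtain s where s: "length (snd w) = Suc (arity P (fst v))" "s \<in> permutations_of_set {..<Suc (arity P (fst v))}"
    "snd v = map ((!) (snd w)) s" using assms by (auto simp: crelab_def)
  show ?thesis unfolding s(3) by (rule mset_map_nth_perm) (use s in simp)
qed

lemma crelab_distinct: "crelab P v w \<Longrightarrow> distinct (snd v) \<longleftrightarrow> distinct (snd w)"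
  using crelab_mset mset_eq_imp_distinct_iff by blast

lemma crelab_opers:
  assumes "crelab P v w"
  shows "fst v \<in> opers P" "length (snd v) = Suc (arity P (fst v))"
    "fst w \<in> opers P" "arity P (fst w) = arity P (fst v)" "length (snd w) = Suc (arity P (fst w))"
proof -
  obtain s where s: "fst v \<in> opers P" "length (snd v) = Suc (arity P (fst v))" "length (snd w) = Suc (arity P (fst v))"
    "s \<in> permutations_of_set {..<Suc (arity P (fst v))}" "fst w = cact P s (fst v)"
    using assms by (auto simp: crelab_def)
  show "fst v \<in> opers P" "length (snd v) = Suc (arity P (fst v))"
    "fst w \<in> opers P" "arity P (fst w) = arity P (fst v)" "length (snd w) = Suc (arity P (fst w))"
    using s cact_opers'[OF s(1,4)] cact_arity'[OF s(1,4)] by simp_all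
qed

lemma cnf_crelab:
  assumes "crelab P v w" "distinct (snd v)"
  shows "cnf P v = cnf P w"
proof -
  obtain s where s: "fst v \<in> opers P" "length (snd v) = Suc (arity P (fst v))" "length (snd w) = Suc (arity P (fst v))"
    "s \<in> permutations_of_set {..<Suc (arity P (fst v))}" "fst w = cact P s (fst v)" "snd v = map ((!) (snd w)) s"
    using assms(1) by (auto simp: crelab_def)
  note m = crelab_mset[OF assms(1)]
  have d: "distinct (snd w)" "set (snd w) = set (snd v)"
    using mset_eq_imp_distinct_iff[OF m] mset_eq_setD[OF m] assms(2) by auto
  have r: "ranks (snd w) \<in> permutations_of_set {..<Suc (arity P (fst v))}" using perm_ranks[OF d(1)] unfolding s(3) .
  have "map ((!) (ranks (snd w))) s = map (rank (set (snd v))) (map ((!) (snd w)) s)"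
    unfolding ranks_rank d(2) by (rule map_nth_map) (use perm_set[OF s(4)] s(3) in simp)
  also have "\<dots> = ranks (snd v)" unfolding s(6)[symmetric] by (simp only: ranks_rank)
  finally have "cact P (ranks (snd w)) (fst w) = cact P (ranks (snd v)) (fst v)"
    using cact_cact'[OF s(1,4) r] s(5) by simp
  moreover have "sort (snd v) = sort (snd w)" using m by (intro properties_for_sort) simp_all
  ultimately show ?thesis by (simp add: cnf_def)
qed

lemma crelab_relab:
  assumes "relab P (x, ls) (y, ls')"
  shows "crelab P (x, l # ls) (y, l # ls')"
proof -
  obtain s where s: "x \<in> opers P" "length ls = arity P x" "length ls' = arity P x"
    "s \<in> permutations_of_set {..<arity P x}" "y = act P s x" "ls = map ((!) ls') s"
    using assms by (auto simp: relab_def)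
  have y: "y = cact P (0 # map Suc s) x" using cact_extends[OF s(1,4)] s(5) by simp
  have "mset (0 # map Suc s) = mset (0 # map Suc [0..<arity P x])"
    using s(4) unfolding perm_iff_mset by simp
  also have "0 # map Suc [0..<arity P x] = [0..<Suc (arity P x)]" by (simp add: map_Suc_upt upt_conv_Cons del: upt_Suc)
  finally have p: "0 # map Suc s \<in> permutations_of_set {..<Suc (arity P x)}" unfolding perm_iff_mset .
  have "l # ls = map ((!) (l # ls')) (0 # map Suc s)" using s(6) by simp
  then show ?thesis unfolding crelab_def fst_conv snd_conv using s(1-3) y p by auto
qed

lemma crelab_rot:
  assumes x: "x \<in> opers P" and l: "length ls = arity P x"
  shows "crelab P (x, l # ls) (rot P x, ls @ [l])"
proof -
  have "map ((!) (ls @ [l])) [0..<arity P x] = map ((!) ls) [0..<arity P x]"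
    by (rule map_cong[OF refl]) (simp add: nth_append l)
  then have "map ((!) (ls @ [l])) (arity P x # [0..<arity P x]) = l # ls"
    using map_nth[of ls] nth_append_length[of ls l "[]"] unfolding l by simp
  then show ?thesis unfolding crelab_def fst_conv snd_conv
    using x l perm_rot[of "arity P x"] by (intro conjI bexI[of _ "arity P x # [0..<arity P x]"]) (simp_all add: rot_def)
qed

lemma crelab_rotn:
  assumes "x \<in> opers P" "length ls = Suc (arity P x)"
  shows "crelab P (x, ls) ((rot P ^^ k) x, rotate k ls)"
proof (induction k)
  case 0
  then show ?case using assms crelab_refl by simp
next
  case (Suc k)
  have l: "length (rotate k ls) = Suc (arity P ((rot P ^^ k) x))" using assms rotn_opers by simp
  then obtain a bs where ab: "rotate k ls = a # bs" by (cases "rotate k ls") auto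
  have "crelab P ((rot P ^^ k) x, a # bs) (rot P ((rot P ^^ k) x), bs @ [a])"
    by (rule crelab_rot) (use rotn_opers[OF assms(1), of k] l ab in simp_all)
  moreover have "rotate (Suc k) ls = bs @ [a]" using ab by (simp add: rotate_def)
  ultimately show ?case using crelab_trans[OF Suc] ab by simp
qed

lemma rot_nullary: "x \<in> opers P \<Longrightarrow> arity P x = 0 \<Longrightarrow> rot P x = x"
  using rotn_id[of x] by simp

lemma crelab_sym:
  assumes "crelab P v w"
  shows "crelab P w v"
proof -
  obtain s where s: "fst v \<in> opers P" "length (snd v) = Suc (arity P (fst v))" "length (snd w) = Suc (arity P (fst v))"
    "s \<in> permutations_of_set {..<Suc (arity P (fst v))}" "fst w = cact P s (fst v)" "snd v = map ((!) (snd w)) s"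
    using assms by (auto simp: crelab_def)
  obtain t where t: "t \<in> permutations_of_set {..<Suc (arity P (fst v))}" "\<And>k. k < Suc (arity P (fst v)) \<Longrightarrow> t ! (s ! k) = k"
    "\<And>k. k < Suc (arity P (fst v)) \<Longrightarrow> s ! (t ! k) = k" by (rule perm_inverse[OF s(4)]) blast
  have tl: "length t = Suc (arity P (fst v))" "length s = Suc (arity P (fst v))" using perm_length t(1) s(4) by blast+
  have "map ((!) t) s = [0..<Suc (arity P (fst v))]"
    by (rule nth_equalityI) (use t(2) tl in \<open>simp_all del: upt_Suc\<close>)
  then have "cact P t (fst w) = fst v" using cact_cact'[OF s(1,4) t(1)] s(5) cact_id[OF s(1)] by simp
  moreover have "snd w = map ((!) (snd v)) t"
  proof (rule nth_equalityI)
    fix k assume "k < length (snd w)"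
    then have k: "k < Suc (arity P (fst v))" using s(3) by simp
    have "t ! k < length s" using perm_set[OF t(1)] nth_mem[of k t] tl k by auto
    then show "snd w ! k = map ((!) (snd v)) t ! k" using k tl t(3)[OF k] s(6) by simp
  qed (use s(3) tl in simp)
  moreover have "arity P (fst w) = arity P (fst v)" "fst w \<in> opers P" using crelab_opers[OF assms] by simp_all
  ultimately show ?thesis unfolding crelab_def using s t(1) by (intro conjI bexI[of _ t]) simp_all
qed

text \<open>The labels after an operation labelled \<open>m\<close> has been grafted at the leg
  labelled \<open>\<rho>\<close>.\<close>

definition sbl :: "nat \<Rightarrow> nat list \<Rightarrow> nat list \<Rightarrow> nat list" where
  "sbl \<rho> m ls = concat (map (\<lambda>l. if l = \<rho> then m else [l]) ls)"

lemma sbl_simps: "sbl \<rho> m [] = []" "sbl \<rho> m (l # ls) = (if l = \<rho> then m else [l]) @ sbl \<rho> m ls"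
  "sbl \<rho> m (ls @ ls') = sbl \<rho> m ls @ sbl \<rho> m ls'"
  by (simp_all add: sbl_def)

lemma sbl_notin: "\<rho> \<notin> set ls \<Longrightarrow> sbl \<rho> m ls = ls"
  by (induction ls) (auto simp: sbl_simps)

text \<open>Writing a partial composition as a substitution makes the equivariance lemmas for
  \<open>sub\<close> available to it.\<close>

lemma sub_graft:
  assumes "y \<in> opers P" "length ls = arity P y" "distinct ls" "i < length ls" "ls ! i = \<rho>"
  shows "sub P (\<lambda>l. if l = \<rho> then (x, m) else (uid, [l])) (y, ls) = (pcomp P y i x, sbl \<rho> m ls)"
proof -
  have "map (\<lambda>l. fst (if l = \<rho> then (x, m) else (uid, [l]))) ls = (map (ident P) (ins P y))[i := x]"
  proof (rule nth_equalityI)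
    fix k assume "k < length (map (\<lambda>l. fst (if l = \<rho> then (x, m) else (uid, [l]))) ls)"
    then have k: "k < length ls" by simp
    then have "ls ! k = \<rho> \<longleftrightarrow> k = i" using assms(3-5) nth_eq_iff_index_eq by blast
    then show "map (\<lambda>l. fst (if l = \<rho> then (x, m) else (uid, [l]))) ls ! k = (map (ident P) (ins P y))[i := x] ! k"
      using k assms(2) by (simp add: nth_list_update)
  qed (use assms(2) in simp)
  moreover have "(\<lambda>l. snd (if l = \<rho> then (x, m) else (uid, [l]))) = (\<lambda>l. if l = \<rho> then m else [l])" by auto
  ultimately show ?thesis by (simp add: sub_def pcomp_def sbl_def)
qed

abbreviation "ok \<equiv> lops P (\<lambda>_. ()) (\<lambda>_. ())"

lemma ok_graft: "x \<in> opers P \<Longrightarrow> length m = arity P x \<Longrightarrow> ok (\<lambda>l. if l = \<rho> then (x, m) else (uid, [l])) A"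
  using uid by (simp add: ulops)

lemma relab_graft:
  assumes r: "relab P (y, ls) (y', ls')" and d: "distinct ls" and x: "x \<in> opers P" "length m = arity P x"
    and i: "i < length ls" "ls ! i = \<rho>" "i' < length ls" "ls' ! i' = \<rho>"
  shows "relab P (pcomp P y i x, sbl \<rho> m ls) (pcomp P y' i' x, sbl \<rho> m ls')"
proof -
  have y: "y \<in> opers P" "length ls = arity P y" using r by (simp_all add: relab_def)
  have y': "y' \<in> opers P" "length ls' = arity P y'" "arity P y' = arity P y" using relab_out[OF r] by simp_all
  have d': "distinct ls'" using relab_mset[OF r] d mset_eq_imp_distinct_iff by fastforce
  have v: "ulop (y, ls)" using y by (simp add: ulop)
  have "relab P (sub P (\<lambda>l. if l = \<rho> then (x, m) else (uid, [l])) (y, ls)) (sub P (\<lambda>l. if l = \<rho> then (x, m) else (uid, [l])) (y', ls'))"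
    by (rule relab_sub_outer[OF v ok_graft[OF x] r])
  moreover have "i' < length ls'" using i(3) y y' by simp
  ultimately show ?thesis using sub_graft[OF y d i(1,2)] sub_graft[OF y'(1,2) d' _ i(4)] by simp
qed

text \<open>Distinct labels force the permutation to be the identity. An equation between operations
  can thus be proved by following the labels on both sides.\<close>

lemma relab_same_labels:
  assumes r: "relab P (x, ls) (y, ls)" and d: "distinct ls"
  shows "x = y"
proof -
  obtain s where s: "x \<in> opers P" "length ls = arity P x" "s \<in> permutations_of_set {..<arity P x}"
    "y = act P s x" "ls = map ((!) ls) s" using r by (auto simp: relab_def)
  have "s = [0..<arity P x]"
  proof (rule nth_equalityI)
    fix k assume "k < length s"
    then have k: "k < arity P x" using perm_length[OF s(3)] by simp
    have "s ! k < arity P x" using perm_set[OF s(3)] nth_mem[OF \<open>k < length s\<close>] by auto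
    moreover have "ls ! k = ls ! (s ! k)" using arg_cong[OF s(5), of "\<lambda>l. l ! k"] \<open>k < length s\<close> by simp
    ultimately have "k = s ! k" using d k s(2) nth_eq_iff_index_eq by metis
    then show "s ! k = [0..<arity P x] ! k" using k by simp
  qed (simp add: perm_length[OF s(3)])
  then show ?thesis using s(1,4) act_id by simp
qed

text \<open>Grafting a nullary operation on the first input, which the axioms leave to equivariance:
  two inputs are exchanged so that the rotation passes a single leg at a time.\<close>

lemma rot_pcomp_nullary:
  assumes A: "A \<in> opers P" "2 \<le> arity P A" and e: "e \<in> opers P" "arity P e = 0"
  shows "rot P (pcomp P A 0 e) = pcomp P (rot P (rot P A)) (arity P A - 1) e"
proof -
  define b where "b = arity P A - 2"
  have b: "arity P A = Suc (Suc b)" using A(2) by (simp add: b_def)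
  let ?a = "Suc (Suc b)" and ?N = "Suc (Suc (Suc b))"
  \<comment> \<open>\<open>?f\<close> exchanges the first two inputs, which moves \<open>e\<close>
    to input 1, where \<open>rot_pcomp\<close> applies. \<open>?h\<close> is the permutation of
    inputs by which the rotation of the exchanged operation differs from the double rotation of
    \<open>A\<close>.\<close>
  let ?f = "\<lambda>i::nat. if i = 0 then 1 else if i = 1 then 0 else i"
  let ?h = "\<lambda>i::nat. if i = Suc b then 0 else Suc i"
  let ?t = "map ?f [0..<?a]" and ?u = "map ?h [0..<?a]"
  let ?B = "act P ?t A" and ?rr = "rot P (rot P A)"
  have t: "?t \<in> permutations_of_set {..<?a}" by (rule perm_map_upt) (auto simp: inj_on_def)
  have u: "?u \<in> permutations_of_set {..<?a}" by (rule perm_map_upt) (auto simp: inj_on_def)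
  have B: "?B \<in> opers P" "arity P ?B = ?a" using act_opers[OF A(1)] act_arity[OF A(1)] t b by simp_all
  have rr: "?rr \<in> opers P" "arity P ?rr = ?a" using A(1) b by (simp_all add: rot_opers rot_arity)
  have up: "[0..<?a] = 0 # 1 # [2..<?a]" by (simp add: upt_conv_Cons numeral_2_eq_2 del: upt_Suc)
  have "map ((!) ?t) ?t = map (\<lambda>i. ?f (?f i)) [0..<?a]" by (rule map_nth_map_upt) auto
  also have "\<dots> = [0..<?a]" by (rule map_idI) simp
  finally have tt: "[0..<?a] = map ((!) ?t) ?t" ..
  have "relab P (A, [0..<?a]) (?B, ?t)"
    unfolding relab_def fst_conv snd_conv using A(1) b t tt by (intro conjI bexI[of _ ?t]) (simp_all del: upt_Suc)
  then have r1: "relab P (pcomp P A 0 e, sbl 0 [] [0..<?a]) (pcomp P ?B 1 e, sbl 0 [] ?t)"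
    by (rule relab_graft) (use e in \<open>simp_all del: upt_Suc\<close>)
  have "?t = 1 # 0 # [2..<?a]"
  proof -
    have "map ?f [2..<?a] = [2..<?a]" by (rule map_idI) auto
    then show ?thesis unfolding up by simp
  qed
  then have e1: "sbl 0 [] ?t = sbl 0 [] [0..<?a]" unfolding up by (simp add: sbl_simps)
  have d1: "distinct (sbl 0 [] [0..<?a])" unfolding up by (simp add: sbl_simps sbl_notin)
  \<comment> \<open>Since \<open>e\<close> is nullary, its label 0 is simply deleted, and both sides
    are left with the same list of labels.\<close>
  have 1: "pcomp P A 0 e = pcomp P ?B 1 e" by (rule relab_same_labels[OF r1[unfolded e1] d1])
  \<comment> \<open>\<open>?g\<close> is the rotation as a map of legs; \<open>?T\<close> and
    \<open>?U\<close> are \<open>?f\<close> and \<open>?h\<close> as maps of legs that fix the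
    output.\<close>
  let ?g = "\<lambda>i::nat. if i = 0 then ?a else i - 1"
  let ?T = "\<lambda>i::nat. if i = 1 then 2 else if i = 2 then 1 else i"
  let ?U = "\<lambda>i::nat. if i = 0 then 0 else if i = ?a then 1 else Suc i"
  have sucm: "0 # map Suc (map k [0..<?a]) = map k' [0..<?N]" if "k' 0 = 0" "\<And>i. i < ?a \<Longrightarrow> Suc (k i) = k' (Suc i)" for k k'
  proof -
    have "[0..<?N] = 0 # map Suc [0..<?a]" by (simp only: map_Suc_upt) (simp add: upt_conv_Cons del: upt_Suc)
    then show ?thesis using that by (simp del: upt_Suc)
  qed
  have ST: "0 # map Suc ?t = map ?T [0..<?N]" and SU: "0 # map Suc ?u = map ?U [0..<?N]"
    by (rule sucm; auto)+
  have r: "?a # [0..<?a] = map ?g [0..<?N]"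
  proof -
    have "[0..<?N] = 0 # map Suc [0..<?a]" by (simp only: map_Suc_upt) (simp add: upt_conv_Cons del: upt_Suc)
    then show ?thesis by (simp add: o_def del: upt_Suc)
  qed
  have pr: "map ?g [0..<?N] \<in> permutations_of_set {..<?N}" using perm_rot[of ?a] unfolding r .
  have pT: "map ?T [0..<?N] \<in> permutations_of_set {..<?N}" by (rule perm_map_upt) (auto simp: inj_on_def)
  have pU: "map ?U [0..<?N] \<in> permutations_of_set {..<?N}" by (rule perm_map_upt) (auto simp: inj_on_def)
  have cA: "\<And>s t. s \<in> permutations_of_set {..<?N} \<Longrightarrow> t \<in> permutations_of_set {..<?N} \<Longrightarrow> cact P t (cact P s A) = cact P (map ((!) t) s) A"
    using cact_cact'[OF A(1)] unfolding b .
  have rotA: "rot P A = cact P (map ?g [0..<?N]) A" unfolding rot_def b r ..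
  have rA: "rot P A \<in> opers P" "arity P (rot P A) = ?a" using A(1) b by (simp_all add: rot_opers rot_arity)
  have "cact P (0 # map Suc ?t) A = ?B" by (rule cact_extends[OF A(1)]) (unfold b, rule t)
  then have "?B = cact P (map ?T [0..<?N]) A" unfolding ST by (rule sym)
  then have "rot P ?B = cact P (map ?g [0..<?N]) (cact P (map ?T [0..<?N]) A)" unfolding rot_def B(2) r by simp
  also have "\<dots> = cact P (map ((!) (map ?g [0..<?N])) (map ?T [0..<?N])) A" by (rule cA[OF pT pr])
  also have "map ((!) (map ?g [0..<?N])) (map ?T [0..<?N]) = map (\<lambda>i. ?g (?T i)) [0..<?N]"
    by (rule map_nth_map_upt) auto
  \<comment> \<open>The relation on which the argument rests: \<open>?g\<close> after
    \<open>?T\<close> equals \<open>?U\<close> after two rotations.\<close>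
  also have "\<dots> = map (\<lambda>i. ?U (?g (?g i))) [0..<?N]" by (rule map_cong[OF refl]) auto
  also have "\<dots> = map ((!) (map ?U [0..<?N])) (map ((!) (map ?g [0..<?N])) (map ?g [0..<?N]))"
  proof -
    have "map ((!) (map ?g [0..<?N])) (map ?g [0..<?N]) = map (\<lambda>i. ?g (?g i)) [0..<?N]" by (rule map_nth_map_upt) auto
    moreover have "map ((!) (map ?U [0..<?N])) (map (\<lambda>i. ?g (?g i)) [0..<?N]) = map (\<lambda>i. ?U (?g (?g i))) [0..<?N]"
      by (rule map_nth_map_upt) auto
    ultimately show ?thesis by simp
  qed
  also have "cact P \<dots> A = cact P (map ?U [0..<?N]) (cact P (map ((!) (map ?g [0..<?N])) (map ?g [0..<?N])) A)"
    by (rule cA[OF perm_comp[OF pr pr] pU, symmetric])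
  also have "cact P (map ((!) (map ?g [0..<?N])) (map ?g [0..<?N])) A = ?rr"
    unfolding cA[OF pr pr, symmetric] rotA[symmetric] rot_def[of P "rot P A"] rA(2) r ..
  also have "cact P (map ?U [0..<?N]) ?rr = act P ?u ?rr"
    unfolding SU[symmetric] by (rule cact_extends[OF rr(1)]) (unfold rr(2), rule u)
  finally have rB: "rot P ?B = act P ?u ?rr" .
  have "map ((!) [0..<?a]) ?u = ?u" by (rule nth_equalityI) (auto simp del: upt_Suc)
  then have "relab P (?rr, ?u) (rot P ?B, [0..<?a])"
    unfolding relab_def fst_conv snd_conv rB using rr u by (intro conjI bexI[of _ ?u]) (simp_all del: upt_Suc)
  then have r2: "relab P (pcomp P ?rr (Suc b) e, sbl 0 [] ?u) (pcomp P (rot P ?B) 0 e, sbl 0 [] [0..<?a])"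
    by (rule relab_graft) (use e perm_distinct[OF u] in \<open>simp_all add: nth_append\<close>)
  have "?u = [1..<?a] @ [0]"
  proof -
    have "map ?h [0..<Suc b] = map Suc [0..<Suc b]" by (rule map_cong) auto
    then show ?thesis by (simp add: map_Suc_upt del: upt_Suc) (simp add: map_Suc_upt)
  qed
  then have "sbl 0 [] ?u = [1..<?a]" by (simp add: sbl_simps sbl_notin del: upt_Suc)
  moreover have "[0..<?a] = 0 # [1..<?a]" by (simp add: upt_conv_Cons del: upt_Suc)
  then have "sbl 0 [] [0..<?a] = [1..<?a]" by (simp add: sbl_simps sbl_notin del: upt_Suc)
  ultimately have e2: "sbl 0 [] ?u = sbl 0 [] [0..<?a]" by simp
  have 2: "pcomp P ?rr (Suc b) e = pcomp P (rot P ?B) 0 e" by (rule relab_same_labels[OF r2[unfolded e2] d1])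
  have "rot P (pcomp P ?B 1 e) = pcomp P (rot P ?B) (1 - 1) e" by (rule rot_pcomp) (use B e in simp_all)
  then show ?thesis using 1 2 b by simp
qed

text \<open>The rotations move the output of \<open>z\<close> and then all legs of \<open>s\<close>
  to the end. The input of \<open>z\<close> carrying \<open>s\<close> is thereby passed as a whole,
  so that \<open>z\<close> itself is rotated twice and \<open>s\<close> ends up on its last
  input.\<close>

lemma rotn_pcomp_pass:
  assumes z: "z \<in> opers P" "2 \<le> arity P z" and s: "s \<in> opers P"
  shows "(rot P ^^ Suc (arity P s)) (pcomp P z 0 s) = pcomp P (rot P (rot P z)) (arity P z - 1) s"
proof (cases "arity P s = 0")
  case True
  then show ?thesis using rot_pcomp_nullary[OF z s] by simp
next
  case False
  then have s1: "1 \<le> arity P s" by linarith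
  have "rot P (pcomp P z 0 s) = pcomp P (rot P s) (arity P s - 1) (rot P z)"
    by (rule rot_pcomp_first) (use z s s1 in simp_all)
  then have "(rot P ^^ Suc (arity P s)) (pcomp P z 0 s) = (rot P ^^ arity P s) (pcomp P (rot P s) (arity P s - 1) (rot P z))"
    by (simp only: funpow_Suc_right o_apply)
  also have "\<dots> = pcomp P (rot P (rot P z)) (arity P (rot P z) - 1) s"
    by (rule rot_pcomp_swap) (use z s s1 rot_opers rot_arity in simp_all)
  finally show ?thesis using rot_arity[OF z(1)] by simp
qed

text \<open>Trading one rotation of \<open>y\<close> for a rotation of the list \<open>s\<close>
  lowers the position of the entry 0 by one. Induction on this position leads to a permutation that
  fixes the output.\<close>

lemma cact_rotate1:
  assumes y: "y \<in> opers P" and s: "s \<in> permutations_of_set {..<Suc (arity P y)}"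
  shows "cact P s y = cact P (rotate1 s) (rot P y)" "rotate1 s \<in> permutations_of_set {..<Suc (arity P (rot P y))}"
proof -
  have l: "length s = Suc (arity P y)" by (rule perm_length[OF s])
  obtain a bs where ab: "s = a # bs" using l by (cases s) auto
  have "mset (rotate1 s) = mset s" using ab by simp
  then have r: "rotate1 s \<in> permutations_of_set {..<Suc (arity P y)}" using s unfolding perm_iff_mset by simp
  then show "rotate1 s \<in> permutations_of_set {..<Suc (arity P (rot P y))}" using rot_arity[OF y] by simp
  have "map ((!) (bs @ [a])) [0..<length bs] = bs"
    by (rule nth_equalityI) (simp_all add: nth_append)
  then have "map ((!) (rotate1 s)) (arity P y # [0..<arity P y]) = s"
    using l unfolding ab by (simp add: nth_append)
  then show "cact P s y = cact P (rotate1 s) (rot P y)"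
    unfolding rot_def cact_cact'[OF y perm_rot r] by simp
qed

lemma perm_head_zero:
  assumes s: "s \<in> permutations_of_set {..<Suc n}" "s ! 0 = 0"
  obtains t where "t \<in> permutations_of_set {..<n}" "s = 0 # map Suc t"
proof -
  obtain bs where bs: "s = 0 # bs" using perm_length[OF s(1)] s(2) by (cases s) auto
  have d: "0 \<notin> set bs" "distinct bs" using perm_distinct[OF s(1)] bs by auto
  let ?t = "map (\<lambda>i. i - 1) bs"
  have e: "map Suc ?t = bs" using d(1) by (auto intro!: map_idI) (metis Suc_pred neq0_conv)
  have "mset (map Suc ?t) = mset (map Suc [0..<n])"
    using s(1) unfolding perm_iff_mset bs e by (simp add: map_Suc_upt upt_conv_Cons del: upt_Suc)
  then have "image_mset Suc (mset ?t) = image_mset Suc (mset [0..<n])" by (simp only: mset_map)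
  then have "mset ?t = mset [0..<n]" by (rule injD[OF multiset.inj_map[OF inj_Suc]])
  then show ?thesis using that[of ?t] e bs unfolding perm_iff_mset by simp
qed

text \<open>Grafting on a leg other than the output commutes with permutations of all legs: the
  output is rotated past the other legs one at a time.\<close>

lemma crelab_graft_aux:
  assumes "y \<in> opers P" "length ls = Suc (arity P y)" "length ls' = Suc (arity P y)"
    "s \<in> permutations_of_set {..<Suc (arity P y)}" "ls = map ((!) ls') s" "distinct ls'"
    "s ! j = j'" "1 \<le> j" "j < Suc (arity P y)" "1 \<le> j'" "ls ! j = \<rho>" "ls' ! j' = \<rho>"
    "x \<in> opers P" "length m = arity P x" "s ! k = 0" "k < Suc (arity P y)"
  shows "crelab P (pcomp P y (j - 1) x, sbl \<rho> m ls) (pcomp P (cact P s y) (j' - 1) x, sbl \<rho> m ls')"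
  using assms(1-12,15,16)
proof (induction k arbitrary: y s ls j rule: less_induct)
  case (less k)
  note h = less.prems
  have x: "x \<in> opers P" "length m = arity P x" by fact+
  have sl: "length s = Suc (arity P y)" by (rule perm_length[OF h(4)])
  have dls: "distinct ls"
    using mset_map_nth_perm[of s ls'] h(3,4,5,6) mset_eq_imp_distinct_iff by metis
  have j'l: "j' < Suc (arity P y)" using perm_set[OF h(4)] nth_mem[of j s] sl h(7,9) by auto
  obtain l lt where ls: "ls = l # lt" using h(2) by (cases ls) auto
  obtain l' lt' where ls': "ls' = l' # lt'" using h(3) by (cases ls') auto
  have "lt ! (j - 1) = \<rho>" "j - 1 < length lt" using h(2,8,9,11) ls by (auto simp: nth_Cons')
  then have "\<rho> \<in> set lt" using nth_mem by blast
  then have l\<rho>: "l \<noteq> \<rho>" using dls ls by auto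
  note ry = rot_opers[OF h(1)] rot_arity[OF h(1)]
  show ?case
  proof (cases "k = 0")
    \<comment> \<open>The output already stays in place, so the permutation comes from one of the
      inputs and operadic equivariance applies.\<close>
    case True
    then obtain t where t: "t \<in> permutations_of_set {..<arity P y}" "s = 0 # map Suc t"
      using perm_head_zero[OF h(4)] h(13) by metis
    have "ls = l' # map ((!) lt') t" unfolding h(5) t(2) ls' by simp
    then have lt: "l = l'" "lt = map ((!) lt') t" using ls by simp_all
    have "relab P (y, lt) (act P t y, lt')"
      unfolding relab_def fst_conv snd_conv using h(1,2,3) ls ls' t(1) lt(2) by (intro conjI bexI[of _ t]) simp_all
    then have "relab P (pcomp P y (j - 1) x, sbl \<rho> m lt) (pcomp P (act P t y) (j' - 1) x, sbl \<rho> m lt')"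
      by (rule relab_graft) (use dls ls ls' h(2,3,8,9,10,11,12) j'l x in \<open>simp_all add: nth_Cons'\<close>)
    then have "crelab P (pcomp P y (j - 1) x, l # sbl \<rho> m lt) (pcomp P (act P t y) (j' - 1) x, l # sbl \<rho> m lt')"
      by (rule crelab_relab)
    moreover note l\<rho>
    moreover have "cact P s y = act P t y" using cact_extends[OF h(1) t(1)] t(2) by simp
    ultimately show ?thesis unfolding ls ls' lt(1) by (simp add: sbl_simps)
  next
    case False
    show ?thesis
    proof (cases "j = 1")
      \<comment> \<open>The grafted leg is not the next one, so one rotation commutes with the
        grafting and brings it one step closer.\<close>
      case False
      note c = cact_rotate1[OF h(1,4)]
      have rs: "rotate1 s ! i = s ! Suc i" if "i < arity P y" for i
        using that sl by (cases s) (simp_all add: nth_append)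
      have rl: "rotate1 ls ! i = ls ! Suc i" if "i < arity P y" for i
        using that h(2) by (cases ls) (simp_all add: nth_append)
      have IH: "crelab P (pcomp P (rot P y) (j - 1 - 1) x, sbl \<rho> m (rotate1 ls)) (pcomp P (cact P (rotate1 s) (rot P y)) (j' - 1) x, sbl \<rho> m ls')"
      proof (rule less.IH[of "k - 1"])
        show "k - 1 < k" "k - 1 < Suc (arity P (rot P y))" using \<open>k \<noteq> 0\<close> h(14) ry by auto
        show "rot P y \<in> opers P" "distinct ls'" "1 \<le> j'" "ls' ! j' = \<rho>" by (fact ry(1) h(6) h(10) h(12))+
        show "length (rotate1 ls) = Suc (arity P (rot P y))" "length ls' = Suc (arity P (rot P y))" using h(2,3) ry by simp_all
        show "rotate1 s \<in> permutations_of_set {..<Suc (arity P (rot P y))}" by (rule c(2))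
        show "rotate1 ls = map ((!) ls') (rotate1 s)" unfolding h(5) by (rule rotate1_map)
        show "rotate1 s ! (j - 1) = j'" using rs[of "j - 1"] h(7,8,9) False by simp
        show "1 \<le> j - 1" "j - 1 < Suc (arity P (rot P y))" using h(8,9) False ry by auto
        show "rotate1 ls ! (j - 1) = \<rho>" using rl[of "j - 1"] h(8,9,11) False by simp
        show "rotate1 s ! (k - 1) = 0" using rs[of "k - 1"] h(13,14) \<open>k \<noteq> 0\<close> by simp
      qed
      have p: "pcomposable P y (j - 1) x" using h(1,8,9) x by (simp add: pcomposable_unit)
      have lts: "length (sbl \<rho> m lt) = arity P (pcomp P y (j - 1) x)"
      proof -
        have "j - 1 < length lt" "lt ! (j - 1) = \<rho>" using h(2,8,9,11) ls by (auto simp: nth_Cons')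
        then have "sub P (\<lambda>l. if l = \<rho> then (x, m) else (uid, [l])) (y, lt) = (pcomp P y (j - 1) x, sbl \<rho> m lt)"
          by (intro sub_graft) (use h(1,2) ls dls in simp_all)
        moreover have "ulop (sub P (\<lambda>l. if l = \<rho> then (x, m) else (uid, [l])) (y, lt))"
          by (rule lop_sub(1)[OF _ ok_graft[OF x]]) (use h(1,2) ls in \<open>simp add: ulop\<close>)
        ultimately show ?thesis by (simp add: ulop)
      qed
      have "crelab P (pcomp P y (j - 1) x, l # sbl \<rho> m lt) (rot P (pcomp P y (j - 1) x), sbl \<rho> m lt @ [l])"
        by (rule crelab_rot[OF pcomp_opers[OF p] lts])
      moreover have "rot P (pcomp P y (j - 1) x) = pcomp P (rot P y) (j - 1 - 1) x"
        by (rule rot_pcomp) (use h(1,8,9) x False in auto)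
      ultimately have "crelab P (pcomp P y (j - 1) x, sbl \<rho> m ls) (pcomp P (rot P y) (j - 1 - 1) x, sbl \<rho> m (rotate1 ls))"
        unfolding ls using l\<rho> by (simp add: sbl_simps)
      then show ?thesis using IH unfolding c(1) by (rule crelab_trans)
    next
      case j1: True
      \<comment> \<open>A single rotation would make the grafted leg the output. It is passed
        together with the operation on it, which amounts to two rotations of \<open>y\<close>. This
        does not overshoot: position 1 of \<open>s\<close> holds \<open>j'\<close>, which is not 0,
        so the entry 0 stands at position 2 or later.\<close>
      have k1: "k \<noteq> 1" using h(7,10,13) j1 by auto
      then have k2: "2 \<le> k" "2 \<le> arity P y" using \<open>k \<noteq> 0\<close> h(14) by auto
      obtain rest where ls2: "ls = l # \<rho> # rest" using ls h(2,11) k2 j1 by (cases lt) auto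
      have rest: "length rest = arity P y - 1" "\<rho> \<notin> set rest" "l \<noteq> \<rho>" using h(2) ls2 dls by auto
      note rry = rot_opers[OF ry(1)] rot_arity[OF ry(1), unfolded ry(2)]
      note c = cact_rotate1[OF h(1,4)]
      note c2 = cact_rotate1[OF ry(1) c(2)]
      obtain s0 s1 st where s3: "s = s0 # s1 # st" using sl k2(2) by (cases s; cases "tl s") auto
      have s2: "rotate1 (rotate1 s) = st @ [s0, s1]" "length st = arity P y - 1" "s1 = j'" using s3 sl h(7) j1 by simp_all
      have l2: "rotate1 (rotate1 ls) = rest @ [l, \<rho>]" using ls2 by simp
      have IH: "crelab P (pcomp P (rot P (rot P y)) (arity P y - 1) x, sbl \<rho> m (rotate1 (rotate1 ls)))
          (pcomp P (cact P (rotate1 (rotate1 s)) (rot P (rot P y))) (j' - 1) x, sbl \<rho> m ls')"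
      proof (rule less.IH[of "k - 2"])
        show "k - 2 < k" "k - 2 < Suc (arity P (rot P (rot P y)))" using k2 h(14) rry by auto
        show "rot P (rot P y) \<in> opers P" "distinct ls'" "1 \<le> j'" "ls' ! j' = \<rho>" by (fact rry(1) h(6) h(10) h(12))+
        show "length (rotate1 (rotate1 ls)) = Suc (arity P (rot P (rot P y)))" "length ls' = Suc (arity P (rot P (rot P y)))"
          using h(2,3) rry by simp_all
        show "rotate1 (rotate1 s) \<in> permutations_of_set {..<Suc (arity P (rot P (rot P y)))}" by (rule c2(2))
        show "rotate1 (rotate1 ls) = map ((!) ls') (rotate1 (rotate1 s))" unfolding h(5) by (simp only: rotate1_map)
        have "arity P y = Suc (length st)" using s2(2) k2 by simp
        then show "rotate1 (rotate1 s) ! arity P y = j'" unfolding s2(1) using s2(3) by (simp add: nth_append)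
        show "1 \<le> arity P y" "arity P y < Suc (arity P (rot P (rot P y)))" using k2 rry by auto
        have "arity P y = Suc (length rest)" using rest(1) k2 by simp
        then show "rotate1 (rotate1 ls) ! arity P y = \<rho>" unfolding l2 by (simp add: nth_append)
        have "s ! k = st ! (k - 2)" using k2(1) unfolding s3 by (auto simp: nth_Cons' numeral_2_eq_2)
        moreover have "k - 2 < length st" unfolding s2(2) using h(14) k2 by linarith
        ultimately show "rotate1 (rotate1 s) ! (k - 2) = 0" unfolding s2(1) using h(13) by (simp add: nth_append)
      qed
      have "ins P y \<noteq> []" using k2(2) by auto
      then have p: "pcomposable P y 0 x" using h(1) x by (simp add: pcomposable_unit)
      have ar: "length (l # m @ rest) = Suc (arity P (pcomp P y 0 x))" using pcomp_arity[OF p] x(2) rest(1) by simp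
      have "crelab P (pcomp P y 0 x, l # m @ rest) ((rot P ^^ Suc (arity P x)) (pcomp P y 0 x), rotate (Suc (arity P x)) (l # m @ rest))"
        by (rule crelab_rotn[OF pcomp_opers[OF p] ar])
      moreover have "rotate (Suc (arity P x)) (l # m @ rest) = rest @ l # m"
        using rotate_append[of "l # m" rest] x(2) by simp
      moreover note rotn_pcomp_pass[OF h(1) k2(2) x(1)]
      ultimately have "crelab P (pcomp P y 0 x, l # m @ rest) (pcomp P (rot P (rot P y)) (arity P y - 1) x, rest @ l # m)" by simp
      moreover have "sbl \<rho> m ls = l # m @ rest" "sbl \<rho> m (rotate1 (rotate1 ls)) = rest @ l # m"
        unfolding l2 ls2 using rest(2,3) by (simp_all add: sbl_simps sbl_notin)
      ultimately have "crelab P (pcomp P y (j - 1) x, sbl \<rho> m ls) (pcomp P (rot P (rot P y)) (arity P y - 1) x, sbl \<rho> m (rotate1 (rotate1 ls)))"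
        using j1 by simp
      then show ?thesis using IH unfolding c(1) c2(1) by (rule crelab_trans)
    qed
  qed
qed

lemma crelab_graft:
  assumes r: "crelab P (y, ls) (y', ls')" and d: "distinct ls" and x: "x \<in> opers P" "length m = arity P x"
    and i: "i < arity P y" "ls ! Suc i = \<rho>" "i' < arity P y" "ls' ! Suc i' = \<rho>"
  shows "crelab P (pcomp P y i x, sbl \<rho> m ls) (pcomp P y' i' x, sbl \<rho> m ls')"
proof -
  obtain s where s: "y \<in> opers P" "length ls = Suc (arity P y)" "length ls' = Suc (arity P y)"
    "s \<in> permutations_of_set {..<Suc (arity P y)}" "y' = cact P s y" "ls = map ((!) ls') s"
    using r by (auto simp: crelab_def)
  have d': "distinct ls'" using crelab_distinct[OF r] d by simp
  have sl: "length s = Suc (arity P y)" by (rule perm_length[OF s(4)])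
  have "s ! Suc i < Suc (arity P y)" using perm_set[OF s(4)] nth_mem[of "Suc i" s] sl i(1) by auto
  moreover have "ls' ! (s ! Suc i) = ls' ! Suc i'" using i s(6) sl by simp
  ultimately have si: "s ! Suc i = Suc i'" using d' i(3) s(3) by (simp add: nth_eq_iff_index_eq)
  have "0 \<in> set s" using perm_set[OF s(4)] by simp
  then obtain k where k: "k < Suc (arity P y)" "s ! k = 0" unfolding in_set_conv_nth sl by blast
  show ?thesis
    using crelab_graft_aux[OF s(1,2,3,4,6) d' si _ _ _ i(2,4) x k(2,1)] i(1) s(5) by simp
qed

section \<open>Gluing two outputs\<close>

lemma relab_opers:
  assumes "relab P (x, ls) (y, ls')"
  shows "x \<in> opers P" "y \<in> opers P" "length ls = arity P x" "length ls' = arity P y" "arity P y = arity P x"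
proof -
  show "x \<in> opers P" "length ls = arity P x" using assms by (simp_all add: relab_def)
  show "y \<in> opers P" "length ls' = arity P y" "arity P y = arity P x" using relab_out[OF assms] by simp_all
qed

lemma glue_root_opers:
  assumes "X \<in> opers P" "q \<in> opers P" "1 \<le> arity P X + arity P q"
  shows "glue_root P X q \<in> opers P" "Suc (arity P (glue_root P X q)) = arity P q + arity P X"
proof -
  have "glue_root P X q \<in> opers P \<and> Suc (arity P (glue_root P X q)) = arity P q + arity P X"
  proof (cases "arity P q \<ge> 1")
    case True
    then have p: "pcomposable P (rot P q) (arity P q - 1) X"
      using assms rot_opers rot_arity by (simp add: pcomposable_unit)
    show ?thesis using True pcomp_opers[OF p] pcomp_arity[OF p] rot_arity[OF assms(2)] unfolding glue_root_def by simp
  next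
    case False
    then have p: "pcomposable P (rot P X) (arity P X - 1) q"
      using assms rot_opers[OF assms(1)] rot_arity[OF assms(1)] unfolding pcomposable_unit by linarith
    show ?thesis using False pcomp_opers[OF p] pcomp_arity[OF p] rot_arity[OF assms(1)] assms(3) unfolding glue_root_def by simp
  qed
  then show "glue_root P X q \<in> opers P" "Suc (arity P (glue_root P X q)) = arity P q + arity P X" by blast+
qed

text \<open>Up to relabelling, the second formula of \<open>glue_root\<close> is available whenever
  \<open>X\<close> has an input, for every \<open>q\<close>. Then \<open>q\<close> is grafted at an
  input, where equivariance is known.\<close>

lemma glue_root_swap:
  assumes X: "X \<in> opers P" "length ls = arity P X" "1 \<le> arity P X" and q: "q \<in> opers P" "length m = arity P q"
  shows "crelab P (glue_root P X q, m @ ls) (pcomp P (rot P X) (arity P X - 1) q, ls @ m)"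
proof (cases "1 \<le> arity P q")
  case True
  have g: "glue_root P X q = pcomp P (rot P q) (arity P q - 1) X" using True by (simp add: glue_root_def)
  have o: "glue_root P X q \<in> opers P" "Suc (arity P (glue_root P X q)) = arity P q + arity P X"
    using glue_root_opers[OF X(1) q(1)] True by simp_all
  have "crelab P (glue_root P X q, m @ ls) ((rot P ^^ arity P q) (glue_root P X q), rotate (arity P q) (m @ ls))"
    by (rule crelab_rotn[OF o(1)]) (use o(2) X(2) q(2) in simp)
  moreover have "(rot P ^^ arity P q) (glue_root P X q) = pcomp P (rot P X) (arity P X - 1) q"
    unfolding g by (rule rot_pcomp_swap[OF q(1) True X(1,3)])
  moreover have "rotate (arity P q) (m @ ls) = ls @ m" unfolding q(2)[symmetric] by (rule rotate_append)
  ultimately show ?thesis by simp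
next
  case False
  then have "m = []" using q(2) by (cases m) auto
  moreover have "glue_root P X q = pcomp P (rot P X) (arity P X - 1) q" using False by (simp add: glue_root_def)
  moreover have "crelab P (glue_root P X q, m @ ls) (glue_root P X q, m @ ls)"
    using glue_root_opers[OF X(1) q(1)] X(2,3) q(2) by (intro crelab_refl) simp_all
  ultimately show ?thesis by simp
qed

lemma fresh: "\<exists>\<rho>. \<rho> \<notin> set (ls :: nat list)"
  by (rule ex_new_if_finite) simp_all

lemma crelab_rot_cong:
  assumes "relab P (x, ls) (y, ls')"
  shows "crelab P (rot P x, ls @ [l]) (rot P y, ls' @ [l])"
proof -
  note o = relab_opers[OF assms]
  note 1 = crelab_rot[OF o(1,3), of l] and 2 = crelab_rot[OF o(2,4), of l]
  show ?thesis using crelab_trans[OF crelab_sym[OF 1] crelab_trans[OF crelab_relab[OF assms] 2]] .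
qed

text \<open>A fresh label \<open>\<rho>\<close> marks the glued output. If \<open>X\<close> has an
  input, \<open>glue_root_swap\<close> makes \<open>q\<close> a graft on \<open>rot P X\<close>;
  there \<open>X\<close> is changed by \<open>crelab_graft\<close> and \<open>q\<close> by inner
  equivariance. If \<open>X\<close> has no input it cannot change at all, and \<open>X\<close> is
  regarded as a graft on \<open>rot P q\<close>.\<close>

lemma glue_root_cong:
  assumes rX: "relab P (X, ls) (X', ls')" and rq: "relab P (q, m) (q', m')" and d: "distinct (m @ ls)" "m @ ls \<noteq> []"
  shows "crelab P (glue_root P X q, m @ ls) (glue_root P X' q', m' @ ls')"
proof -
  note X = relab_opers[OF rX] and q = relab_opers[OF rq]
  obtain \<rho> where \<rho>: "\<rho> \<notin> set (m @ ls)" using fresh by blast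
  have ms: "set m' = set m" "set ls' = set ls"
    using mset_eq_setD[OF relab_mset[OF rX]] mset_eq_setD[OF relab_mset[OF rq]] by simp_all
  show ?thesis
  proof (cases "1 \<le> arity P X")
    case True
    note R = crelab_rot_cong[OF rX, of \<rho>]
    have sl: "Suc (arity P X - 1) = length ls" and sl': "Suc (arity P X - 1) = length ls'" using True X by linarith+
    have n: "(ls @ [\<rho>]) ! Suc (arity P X - 1) = \<rho>" "(ls' @ [\<rho>]) ! Suc (arity P X - 1) = \<rho>"
      by (unfold sl, rule nth_append_length) (unfold sl[symmetric] sl', rule nth_append_length)
    have rXo: "rot P X \<in> opers P" "arity P (rot P X) = arity P X" "rot P X' \<in> opers P" "arity P (rot P X') = arity P X"
      using rot_opers rot_arity X by simp_all
    have "crelab P (pcomp P (rot P X) (arity P X - 1) q, sbl \<rho> m (ls @ [\<rho>])) (pcomp P (rot P X') (arity P X - 1) q, sbl \<rho> m (ls' @ [\<rho>]))"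
      by (rule crelab_graft[OF R _ q(1,3)]) (use \<rho> d True rXo n in \<open>simp_all del: One_nat_def\<close>)
    then have 2: "crelab P (pcomp P (rot P X) (arity P X - 1) q, ls @ m) (pcomp P (rot P X') (arity P X - 1) q, ls' @ m)"
      using \<rho> ms by (simp add: sbl_simps sbl_notin)
    \<comment> \<open>Inner equivariance concerns inputs only. The label \<open>a\<close>, which
      belongs to leg 0 after the rotation, is set aside and put back by
      \<open>crelab_relab\<close>.\<close>
    obtain a bs where ab: "ls' = a # bs" using True X(4,5) by (cases ls') auto
    have dl: "distinct (bs @ [\<rho>])" "\<rho> \<notin> set bs" "length (bs @ [\<rho>]) = arity P (rot P X')"
      using d \<rho> ms ab relab_mset[OF rX] mset_eq_imp_distinct_iff[of ls ls'] X rXo by auto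
    have lb: "length bs = arity P X - 1" using ab X by simp
    let ?G = "\<lambda>l. if l = \<rho> then (q, m) else (uid, [l])" and ?G' = "\<lambda>l. if l = \<rho> then (q', m') else (uid, [l])"
    have v: "ulop (rot P X', bs @ [\<rho>])" using rXo dl(3) by (simp add: ulop)
    have "relab P (sub P ?G (rot P X', bs @ [\<rho>])) (sub P ?G' (rot P X', bs @ [\<rho>]))"
      by (rule relab_sub_inner[OF v ok_graft[OF q(1,3)]]) (use rq uid in \<open>auto intro: relab_refl\<close>)
    moreover have "sub P ?G (rot P X', bs @ [\<rho>]) = (pcomp P (rot P X') (length bs) q, sbl \<rho> m (bs @ [\<rho>]))"
      by (rule sub_graft[OF rXo(3) dl(3,1)]) simp_all
    moreover have "sub P ?G' (rot P X', bs @ [\<rho>]) = (pcomp P (rot P X') (length bs) q', sbl \<rho> m' (bs @ [\<rho>]))"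
      by (rule sub_graft[OF rXo(3) dl(3,1)]) simp_all
    ultimately have "relab P (pcomp P (rot P X') (arity P X - 1) q, bs @ m) (pcomp P (rot P X') (arity P X - 1) q', bs @ m')"
      using dl(2) lb by (simp add: sbl_simps sbl_notin)
    then have "crelab P (pcomp P (rot P X') (arity P X - 1) q, a # bs @ m) (pcomp P (rot P X') (arity P X - 1) q', a # bs @ m')"
      by (rule crelab_relab)
    then have 3: "crelab P (pcomp P (rot P X') (arity P X - 1) q, ls' @ m) (pcomp P (rot P X') (arity P X - 1) q', ls' @ m')"
      using ab by simp
    have 1: "crelab P (glue_root P X q, m @ ls) (pcomp P (rot P X) (arity P X - 1) q, ls @ m)"
      by (rule glue_root_swap[OF X(1,3) True q(1,3)])
    have 4: "crelab P (glue_root P X' q', m' @ ls') (pcomp P (rot P X') (arity P X - 1) q', ls' @ m')"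
      using glue_root_swap[OF X(2,4) _ q(2,4)] True X(5) by simp
    show ?thesis by (rule crelab_trans[OF 1 crelab_trans[OF 2 crelab_trans[OF 3 crelab_sym[OF 4]]]])
  next
    case False
    then have a0: "arity P X = 0" by linarith
    then have "length ls = 0" "length ls' = 0" unfolding X(3,4,5) by simp_all
    with a0 have X0: "arity P X = 0" "ls = []" "ls' = []" by simp_all
    have XX: "X' = X" by (rule relab_same_labels[OF _ distinct.simps(1)[THEN iffD2, OF TrueI], symmetric])
      (use rX X0 in simp)
    have m1: "1 \<le> arity P q" "m \<noteq> []" using d X0 q(3) by (cases m; simp)+
    note R = crelab_rot_cong[OF rq, of \<rho>]
    have rqo: "rot P q \<in> opers P" "arity P (rot P q) = arity P q" "rot P q' \<in> opers P" "arity P (rot P q') = arity P q"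
      using rot_opers rot_arity q by simp_all
    have sm: "Suc (arity P q - 1) = length m" and sm': "Suc (arity P q - 1) = length m'" using m1(1) q by linarith+
    have n: "(m @ [\<rho>]) ! Suc (arity P q - 1) = \<rho>" "(m' @ [\<rho>]) ! Suc (arity P q - 1) = \<rho>"
      by (unfold sm, rule nth_append_length) (unfold sm[symmetric] sm', rule nth_append_length)
    have "crelab P (pcomp P (rot P q) (arity P q - 1) X, sbl \<rho> [] (m @ [\<rho>])) (pcomp P (rot P q') (arity P q - 1) X, sbl \<rho> [] (m' @ [\<rho>]))"
      by (rule crelab_graft[OF R _ X(1)]) (use \<rho> d m1 X0 rqo n in \<open>simp_all del: One_nat_def\<close>)
    then show ?thesis
      using \<rho> ms X0 XX m1 q(5) by (simp add: sbl_simps sbl_notin glue_root_def)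
  qed
qed

section \<open>Gluing an operation to every leg\<close>

lemma cglue_eq:
  "cglue P G (x, l # ls) = (glue_root P (fst (sub P G (x, ls))) (fst (G l)), snd (G l) @ snd (sub P G (x, ls)))"
  by (simp add: cglue_def sub_def)

lemma ok_sub:
  assumes "x \<in> opers P" "length ls = arity P x" "ok G (set ls)"
  shows "fst (sub P G (x, ls)) \<in> opers P" "length (snd (sub P G (x, ls))) = arity P (fst (sub P G (x, ls)))"
proof -
  have v: "ulop (x, ls)" using assms(1,2) by (simp add: ulop)
  have G: "ok G (set (snd (x, ls)))" using assms(3) by simp
  from lop_sub(1)[OF v G] show "fst (sub P G (x, ls)) \<in> opers P" "length (snd (sub P G (x, ls))) = arity P (fst (sub P G (x, ls)))"
    unfolding ulop by blast+
qed

lemma cglue_opers: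
  assumes "x \<in> opers P" "length ls = Suc (arity P x)" "ok G (set ls)" "snd (cglue P G (x, ls)) \<noteq> []"
  shows "fst (cglue P G (x, ls)) \<in> opers P" "length (snd (cglue P G (x, ls))) = Suc (arity P (fst (cglue P G (x, ls))))"
proof -
  obtain l lt where ls: "ls = l # lt" using assms(2) by (cases ls) auto
  have o: "fst (G l) \<in> opers P" "length (snd (G l)) = arity P (fst (G l))" using assms(3) ls by (simp_all add: ulops)
  note S = ok_sub[of x lt G]
  have S1: "fst (sub P G (x, lt)) \<in> opers P" "length (snd (sub P G (x, lt))) = arity P (fst (sub P G (x, lt)))"
    using S assms(1-3) ls by (simp_all add: ulops)
  have "length (snd (G l) @ snd (sub P G (x, lt))) \<noteq> 0" using assms(4) unfolding ls cglue_eq by simp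
  then have "1 \<le> arity P (fst (sub P G (x, lt))) + arity P (fst (G l))"
    unfolding length_append o(2) S1(2) by linarith
  from glue_root_opers[OF S1(1) o(1) this]
  show "fst (cglue P G (x, ls)) \<in> opers P" "length (snd (cglue P G (x, ls))) = Suc (arity P (fst (cglue P G (x, ls))))"
    unfolding ls cglue_eq using o(2) S1(2) by simp_all
qed

text \<open>Both sides are \<open>z\<close> composed with identities of which entries
  \<open>i\<close> and \<open>j\<close> have been replaced by \<open>p\<close> and \<open>q\<close>.
  The offset accounts for the inputs of \<open>p\<close> standing where input \<open>i\<close>
  was.\<close>

lemma pcomp_commute:
  assumes z: "z \<in> opers P" "i < j" "j < arity P z" and p: "p \<in> opers P" and q: "q \<in> opers P"
  shows "pcomp P (pcomp P z i p) (j - 1 + arity P p) q = pcomp P (pcomp P z j q) i p"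
proof -
  let ?I = "map (ident P) (ins P z)"
  have lI: "length ?I = arity P z" "set ?I \<subseteq> opers P" "?I ! k = uid" if "k < arity P z" for k using that uid by (auto simp: ident_opers[OF ins_colour[OF z(1)]])
  have rI: "?I = replicate (arity P z) uid" by (rule nth_equalityI) simp_all
  have cat: "pcomp P (gcomp P z xs) (sum_list (map (arity P) (take k xs))) x = gcomp P z (xs[k := x])"
    if "length xs = arity P z" "set xs \<subseteq> opers P" "k < length xs" "xs ! k = uid" "x \<in> opers P" for xs k x
  proof -
    have e: "xs = take k xs @ [ident P (out P x)] @ drop (Suc k) xs" using id_take_nth_drop[OF that(3)] that(4) by simp
    have "composable P z (take k xs @ [ident P (out P x)] @ drop (Suc k) xs)"
      using that z(1) e[symmetric] by (simp add: composable_unit)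
    from pcomp_replace_ident(1)[OF this that(5)] show ?thesis
      using e[symmetric] upd_conv_take_nth_drop[OF that(3), of x] by simp
  qed
  have sI: "sum_list (map (arity P) (take k ?I)) = k" if "k \<le> arity P z" for k
    unfolding rI using that uid by (simp add: sum_list_replicate)
  have up: "set (?I[k := x]) \<subseteq> opers P" if "x \<in> opers P" for k x
    using set_update_subset_insert[of ?I k x] that uid unfolding rI by auto
  have a1: "take j (?I[i := p]) = (take j ?I)[i := p]" by (rule take_update_swap)
  have "sum_list (map (arity P) ((take j ?I)[i := p])) = j - 1 + arity P p"
  proof -
    have "(take j ?I)[i := p] = take i (take j ?I) @ p # drop (Suc i) (take j ?I)"
      by (rule upd_conv_take_nth_drop) (use z in simp)
    also have "\<dots> = replicate i uid @ p # replicate (j - Suc i) uid" unfolding rI using z by simp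
    finally show ?thesis using uid z by (simp add: sum_list_replicate)
  qed
  then have "pcomp P (gcomp P z (?I[i := p])) (j - 1 + arity P p) q = gcomp P z (?I[i := p, j := q])"
    using cat[of "?I[i := p]" j q] up[OF p] z q a1 by simp
  moreover have "pcomp P (gcomp P z (?I[j := q])) i p = gcomp P z (?I[j := q, i := p])"
  proof -
    have "take i (?I[j := q]) = take i ?I" using z(2) by simp
    then show ?thesis using cat[of "?I[j := q]" i p] up[OF q] z p sI[of i] by simp
  qed
  moreover have "?I[i := p, j := q] = ?I[j := q, i := p]" using z(2) by (simp add: list_update_swap)
  ultimately show ?thesis by (simp add: pcomp_def)
qed

text \<open>The first input carries an identity, so all other arguments can be grafted one at a time
  at later inputs, where \<open>rot_pcomp\<close> moves the rotation past them.\<close>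

lemma rot_gcomp_ident:
  assumes x: "x \<in> opers P" "arity P x = Suc n" and qs: "length qs = n" "set qs \<subseteq> opers P"
  shows "rot P (gcomp P x (uid # qs)) = gcomp P (rot P x) (qs @ [uid])"
proof -
  have "rot P (gcomp P x (uid # xs @ replicate (length zs) uid)) = gcomp P (rot P x) (xs @ replicate (length zs) uid @ [uid])"
    if "qs = xs @ zs" for xs zs
    using that
  proof (induction xs arbitrary: zs rule: rev_induct)
    case Nil
    have rep: "map (ident P) (ins P y) = replicate (arity P y) uid" for y by (rule nth_equalityI) simp_all
    have "uid # replicate n uid = map (ident P) (ins P x)" unfolding rep x(2) by simp
    then have "gcomp P x (uid # replicate n uid) = x" using gcomp_ident_right[OF x(1)] by simp
    moreover have "replicate n uid @ [uid] = map (ident P) (ins P (rot P x))"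
      unfolding rep rot_arity[OF x(1)] x(2) by (simp add: replicate_append_same)
    then have "gcomp P (rot P x) (replicate n uid @ [uid]) = rot P x"
      using gcomp_ident_right[OF rot_opers[OF x(1)]] by simp
    moreover have "length zs = n" using Nil qs(1) by simp
    ultimately show ?case by simp
  next
    case (snoc y xs)
    have y: "y \<in> opers P" "set xs \<subseteq> opers P" using snoc.prems qs(2) by auto
    have n: "n = Suc (length xs + length zs)" using snoc.prems qs(1) by simp
    let ?R = "replicate (length zs) uid"
    have R: "set ?R \<subseteq> opers P" using uid by auto
    have c1: "composable P x ((uid # xs) @ [ident P (out P y)] @ ?R)" using x n y R uid by (simp add: composable_unit)
    have c2: "composable P (rot P x) (xs @ [ident P (out P y)] @ ?R @ [uid])"
      using x n y R uid rot_opers rot_arity by (simp add: composable_unit)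
    note p1 = pcomp_replace_ident[OF c1 y(1)] and p2 = pcomp_replace_ident[OF c2 y(1)]
    let ?W = "gcomp P x ((uid # xs) @ [ident P (out P y)] @ ?R)"
    have s: "sum_list (map (arity P) (uid # xs)) = Suc (sum_list (map (arity P) xs))" using uid by simp
    have IH: "rot P ?W = gcomp P (rot P x) (xs @ [ident P (out P y)] @ ?R @ [uid])"
      using snoc.IH[of "y # zs"] snoc.prems by simp
    have pc: "pcomposable P ?W (Suc (sum_list (map (arity P) xs))) y" using p1(2) unfolding s .
    have "rot P (pcomp P ?W (Suc (sum_list (map (arity P) xs))) y) = pcomp P (rot P ?W) (Suc (sum_list (map (arity P) xs)) - 1) y"
      by (rule rot_pcomp) (use pc in \<open>simp_all add: pcomposable_unit\<close>)
    also have "\<dots> = gcomp P (rot P x) (xs @ [y] @ ?R @ [uid])" using p2(1) unfolding IH by simp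
    finally show ?case using p1(1) unfolding s by simp
  qed
  from this[of qs "[]"] show ?thesis by simp
qed

text \<open>Rotating the source makes leg 1 the output, so \<open>q1\<close> takes the part of
  \<open>q0\<close> in \<open>glue_root\<close>. Both sides are expressed by \<open>?A\<close>, the
  source with everything attached except at legs 0 and 1. The cases follow the vanishing of the
  arities of \<open>B\<close> and \<open>q1\<close>, on which \<open>glue_root\<close> and the
  rotation rules depend.\<close>

lemma crelab_cglue_rot:
  assumes x: "x \<in> opers P" "length lt = arity P x" and G: "ok G (insert l0 (set lt))"
    and ne: "snd (cglue P G (x, l0 # lt)) \<noteq> []"
  shows "crelab P (cglue P G (x, l0 # lt)) (cglue P G (rot P x, lt @ [l0]))"
proof (cases lt)
  case Nil
  then have "rot P x = x" using x by (intro rot_nullary) simp_all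
  moreover have "crelab P (cglue P G (x, l0 # lt)) (cglue P G (x, l0 # lt))"
    using cglue_opers[of x "l0 # lt" G] x G ne by (intro crelab_refl) simp_all
  ultimately show ?thesis using Nil by simp
next
  case (Cons l1 lr)
  define q0 L0 q1 L1 where q: "q0 = fst (G l0)" "L0 = snd (G l0)" "q1 = fst (G l1)" "L1 = snd (G l1)"
  define Vs Lr where V: "Vs = map (\<lambda>l. fst (G l)) lr" "Lr = concat (map (\<lambda>l. snd (G l)) lr)"
  have o: "q0 \<in> opers P" "q1 \<in> opers P" "set Vs \<subseteq> opers P" "length L0 = arity P q0" "length L1 = arity P q1"
    using G Cons by (auto simp: ulops q V)
  have Vl: "length Lr = sum_list (map (arity P) Vs)"
  proof -
    have e: "map (\<lambda>l. length (snd (G l))) lr = map (\<lambda>l. arity P (fst (G l))) lr" using G Cons by (simp add: ulops)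
    have "length Lr = sum_list (map (\<lambda>l. length (snd (G l))) lr)" by (simp add: V length_concat o_def)
    also have "\<dots> = sum_list (map (arity P) Vs)" unfolding e by (simp add: V o_def)
    finally show ?thesis .
  qed
  obtain n where n: "arity P x = Suc n" "length Vs = n" using x(2) Cons by (simp add: V)
  let ?A = "gcomp P x (uid # Vs)"
  have cA: "composable P x ([] @ [ident P (out P q1)] @ Vs)" using x(1) n o uid by (simp add: composable_unit)
  have A: "?A \<in> opers P" "arity P ?A = Suc (length Lr)"
    using gcomp_opers[OF cA] gcomp_arity[OF cA] uid Vl by simp_all
  have rA: "rot P ?A = gcomp P (rot P x) (Vs @ [uid])" by (rule rot_gcomp_ident[OF x(1) n o(3)])
  have rAo: "rot P ?A \<in> opers P" "arity P (rot P ?A) = Suc (length Lr)" using rot_opers[OF A(1)] rot_arity[OF A(1)] A(2) by simp_all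
  define B where "B = gcomp P x (q1 # Vs)"
  have BA: "B = pcomp P ?A 0 q1" and pB: "pcomposable P ?A 0 q1"
    using pcomp_replace_ident[OF cA o(2)] by (simp_all add: B_def)
  have Bo: "B \<in> opers P" "arity P B = length (L1 @ Lr)"
    using pcomp_opers[OF pB] pcomp_arity[OF pB] A(2) o(5) unfolding BA by simp_all
  define X1 where "X1 = gcomp P (rot P x) (Vs @ [q0])"
  have cX: "composable P (rot P x) (Vs @ [ident P (out P q0)] @ [])"
    using rot_opers[OF x(1)] rot_arity[OF x(1)] n o uid by (simp add: composable_unit)
  have XA: "X1 = pcomp P (rot P ?A) (length Lr) q0" and pX: "pcomposable P (rot P ?A) (length Lr) q0"
    using pcomp_replace_ident[OF cX o(1)] unfolding rA Vl by (simp_all add: X1_def)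
  have Xo: "X1 \<in> opers P" "arity P X1 = length (Lr @ L0)"
    using pcomp_opers[OF pX] pcomp_arity[OF pX] rAo(2) o(4) unfolding XA by simp_all
  have e1: "cglue P G (x, l0 # lt) = (glue_root P B q0, L0 @ L1 @ Lr)"
    unfolding Cons cglue_eq sub_def B_def q V by simp
  have e2: "cglue P G (rot P x, lt @ [l0]) = (glue_root P X1 q1, L1 @ Lr @ L0)"
    unfolding Cons append_Cons cglue_eq sub_def X1_def q V by simp
  show ?thesis
  proof (cases "1 \<le> arity P B")
    case b: True
    have "crelab P (glue_root P B q0, L0 @ L1 @ Lr) (pcomp P (rot P B) (arity P B - 1) q0, (L1 @ Lr) @ L0)"
      by (rule glue_root_swap[OF Bo(1) Bo(2)[symmetric] b o(1,4)])
    moreover have "pcomp P (rot P B) (arity P B - 1) q0 = glue_root P X1 q1"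
    proof (cases "1 \<le> arity P q1")
      case m: True
      have rB: "rot P B = pcomp P (rot P q1) (arity P q1 - 1) (rot P ?A)"
        unfolding BA by (rule rot_pcomp_first) (use A o m in simp_all)
      have pq: "pcomposable P (rot P q1) (arity P q1 - 1) (rot P ?A)"
        using rot_opers[OF o(2)] rot_arity[OF o(2)] rAo m unfolding pcomposable_unit by simp
      have "glue_root P X1 q1 = pcomp P (rot P q1) (arity P q1 - 1) (pcomp P (rot P ?A) (length Lr) q0)"
        using m unfolding glue_root_def XA by simp
      also have "\<dots> = pcomp P (rot P B) (arity P q1 - 1 + length Lr) q0"
        using pcomp_pcomp(1)[OF pq pX] unfolding rB .
      also have "arity P q1 - 1 + length Lr = arity P B - 1" using Bo(2) o(5) m by simp
      finally show ?thesis by simp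
    next
      \<comment> \<open>\<open>rot_pcomp_first\<close> does not apply to a nullary
        \<open>q1\<close>; \<open>rot_pcomp_nullary\<close> does, as \<open>?A\<close> has at least
        two inputs here. Then \<open>q0\<close> and \<open>q1\<close> are grafted at neighbouring
        inputs of the twice rotated \<open>?A\<close>, in either order.\<close>
      case m: False
      then have a0: "arity P q1 = 0" by linarith
      then have "length L1 = 0" unfolding o(5) .
      with a0 have m0: "arity P q1 = 0" "L1 = []" by simp_all
      have Lr1: "1 \<le> length Lr" using b Bo(2) m0 by simp
      have rB: "rot P B = pcomp P (rot P (rot P ?A)) (length Lr) q1"
        unfolding BA using rot_pcomp_nullary[OF A(1) _ o(2) m0(1)] A(2) Lr1 by simp
      have "rot P X1 = pcomp P (rot P (rot P ?A)) (length Lr - 1) q0"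
        unfolding XA by (rule rot_pcomp) (use rAo o Lr1 in simp_all)
      then have "glue_root P X1 q1 = pcomp P (pcomp P (rot P (rot P ?A)) (length Lr - 1) q0) (length Lr - 1 + arity P q0) q1"
        using m Xo(2) Lr1 o(4) unfolding glue_root_def by simp
      also have "\<dots> = pcomp P (pcomp P (rot P (rot P ?A)) (length Lr) q1) (length Lr - 1) q0"
        by (rule pcomp_commute) (use rot_opers[OF rAo(1)] rot_arity[OF rAo(1)] rAo(2) Lr1 o in simp_all)
      also have "\<dots> = pcomp P (rot P B) (arity P B - 1) q0" using Bo(2) m0 unfolding rB by simp
      finally show ?thesis by simp
    qed
    ultimately show ?thesis unfolding e1 e2 by simp
  next
    \<comment> \<open>All legs of the result come from \<open>q0\<close>. Moreover \<open>?A\<close>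
      is unary, so two rotations restore it.\<close>
    case False
    then have b0: "arity P B = 0" by linarith
    then have "length (L1 @ Lr) = 0" unfolding Bo(2) .
    then have "L1 = []" "Lr = []" by simp_all
    with b0 o(5) have z: "L1 = []" "Lr = []" "arity P q1 = 0" "arity P B = 0" by simp_all
    have q01: "1 \<le> arity P q0" using ne o(4) unfolding e1 z by (cases L0) auto
    have "rot P X1 = pcomp P (rot P q0) (arity P q0 - 1) (rot P (rot P ?A))"
      unfolding XA z(2) list.size by (rule rot_pcomp_first) (use rAo o q01 z in simp_all)
    moreover have "rot P (rot P ?A) = ?A" using rotn_id[OF A(1)] A(2) z by simp
    ultimately have rX: "rot P X1 = pcomp P (rot P q0) (arity P q0 - 1) ?A" by simp
    have pq: "pcomposable P (rot P q0) (arity P q0 - 1) ?A"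
      using rot_opers[OF o(1)] rot_arity[OF o(1)] A q01 unfolding pcomposable_unit by simp
    have "glue_root P X1 q1 = pcomp P (rot P X1) (arity P q0 - 1) q1" using z Xo(2) o(4) unfolding glue_root_def by simp
    also have "\<dots> = pcomp P (rot P q0) (arity P q0 - 1) B"
      using pcomp_pcomp(1)[OF pq pB] unfolding rX BA by simp
    also have "\<dots> = glue_root P B q0" using q01 unfolding glue_root_def by simp
    finally have g: "glue_root P X1 q1 = glue_root P B q0" .
    have "crelab P (cglue P G (x, l0 # lt)) (cglue P G (x, l0 # lt))"
      using cglue_opers[of x "l0 # lt" G] x G ne by (intro crelab_refl) simp_all
    then show ?thesis unfolding e1 e2 g z by simp
  qed
qed

text \<open>The source is rotated, as allowed by \<open>crelab_cglue_rot\<close>, until its output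
  is in the final place. What remains is a permutation of inputs, treated by outer equivariance and
  \<open>glue_root_cong\<close>.\<close>

lemma crelab_cglue_aux:
  assumes "x \<in> opers P" "length ls = Suc (arity P x)" "length ls' = Suc (arity P x)"
    "s \<in> permutations_of_set {..<Suc (arity P x)}" "ls = map ((!) ls') s" "s ! k = 0" "k < Suc (arity P x)"
    "ok G (set ls)" "snd (cglue P G (x, ls)) \<noteq> []" "distinct (snd (cglue P G (x, ls)))"
  shows "crelab P (cglue P G (x, ls)) (cglue P G (cact P s x, ls'))"
  using assms
proof (induction k arbitrary: x s ls)
  case 0
  note h = 0
  obtain t where t: "t \<in> permutations_of_set {..<arity P x}" "s = 0 # map Suc t"
    using perm_head_zero[OF h(4,6)] by metis
  obtain l lt where ls: "ls = l # lt" using h(2) by (cases ls) auto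
  obtain l' lt' where ls': "ls' = l' # lt'" using h(3) by (cases ls') auto
  have "ls = l' # map ((!) lt') t" unfolding h(5) t(2) ls' by simp
  then have lt: "l = l'" "lt = map ((!) lt') t" using ls by simp_all
  have r: "relab P (x, lt) (act P t x, lt')"
    unfolding relab_def fst_conv snd_conv using h(1,2,3) ls ls' t(1) lt(2) by (intro conjI bexI[of _ t]) simp_all
  have v: "ulop (x, lt)" using h(1,2) ls by (simp add: ulop)
  have Gl: "ok G (set (snd (x, lt)))" using h(8) ls by (simp add: ulops)
  have gl: "fst (G l) \<in> opers P" "length (snd (G l)) = arity P (fst (G l))" using h(8) ls by (simp_all add: ulops)
  have rs: "relab P (sub P G (x, lt)) (sub P G (act P t x, lt'))" by (rule relab_sub_outer[OF v Gl r])
  have "crelab P (cglue P G (x, l # lt)) (cglue P G (act P t x, l # lt'))"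
    unfolding cglue_eq
    by (rule glue_root_cong) (use rs gl h(9,10) in \<open>auto simp: ls cglue_eq intro: relab_refl\<close>)
  moreover have "cact P s x = act P t x" using cact_extends[OF h(1) t(1)] t(2) by simp
  ultimately show ?case unfolding ls ls' lt(1) by simp
next
  case (Suc k)
  note h = Suc.prems
  obtain l lt where ls: "ls = l # lt" using h(2) by (cases ls) auto
  note c = cact_rotate1[OF h(1,4)]
  have sl: "length s = Suc (arity P x)" by (rule perm_length[OF h(4)])
  have rs: "rotate1 s ! k = s ! Suc k" using h(7) sl by (cases s) (simp_all add: nth_append)
  have 1: "crelab P (cglue P G (x, ls)) (cglue P G (rot P x, rotate1 ls))"
    unfolding ls rotate1.simps by (rule crelab_cglue_rot) (use h(1,2,8,9) ls in simp_all)
  have m: "mset (snd (cglue P G (x, ls))) = mset (snd (cglue P G (rot P x, rotate1 ls)))" by (rule crelab_mset[OF 1])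
  have 2: "crelab P (cglue P G (rot P x, rotate1 ls)) (cglue P G (cact P (rotate1 s) (rot P x), ls'))"
  proof (rule Suc.IH)
    show "rot P x \<in> opers P" by (rule rot_opers[OF h(1)])
    show "length (rotate1 ls) = Suc (arity P (rot P x))" "length ls' = Suc (arity P (rot P x))"
      "k < Suc (arity P (rot P x))" using h(2,3,7) rot_arity[OF h(1)] by simp_all
    show "rotate1 s \<in> permutations_of_set {..<Suc (arity P (rot P x))}" by (rule c(2))
    show "rotate1 ls = map ((!) ls') (rotate1 s)" unfolding h(5) by (rule rotate1_map)
    show "rotate1 s ! k = 0" using rs h(6) by simp
    show "ok G (set (rotate1 ls))" using h(8) by simp
    show "snd (cglue P G (rot P x, rotate1 ls)) \<noteq> []" using h(9) m by auto
    show "distinct (snd (cglue P G (rot P x, rotate1 ls)))" using h(10) m mset_eq_imp_distinct_iff by blast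
  qed
  show ?case unfolding c(1) by (rule crelab_trans[OF 1 2])
qed

lemma crelab_cglue:
  assumes r: "crelab P v w" and G: "ok G (set (snd v))" and ne: "snd (cglue P G v) \<noteq> []" and d: "distinct (snd (cglue P G v))"
  shows "crelab P (cglue P G v) (cglue P G w)"
proof -
  obtain s where s: "fst v \<in> opers P" "length (snd v) = Suc (arity P (fst v))" "length (snd w) = Suc (arity P (fst v))"
    "s \<in> permutations_of_set {..<Suc (arity P (fst v))}" "fst w = cact P s (fst v)" "snd v = map ((!) (snd w)) s"
    using r by (auto simp: crelab_def)
  have "0 \<in> set s" using perm_set[OF s(4)] by simp
  then obtain k where k: "k < Suc (arity P (fst v))" "s ! k = 0" unfolding in_set_conv_nth perm_length[OF s(4)] by blast
  have w: "w = (cact P s (fst v), snd w)" by (simp add: prod_eq_iff s(5))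
  have "crelab P (cglue P G (fst v, snd v)) (cglue P G (cact P s (fst v), snd w))"
    by (rule crelab_cglue_aux[OF s(1-4,6) k(2,1) G]) (use ne d in simp_all)
  then show ?thesis unfolding w[symmetric] by simp
qed

lemma crelab_cglue_inner:
  assumes v: "x \<in> opers P" "length ls = Suc (arity P x)" and G: "ok G (set ls)"
    and ne: "snd (cglue P G (x, ls)) \<noteq> []" and d: "distinct (snd (cglue P G (x, ls)))"
    and r: "\<And>l. l \<in> set ls \<Longrightarrow> relab P (G l) (G' l)"
  shows "crelab P (cglue P G (x, ls)) (cglue P G' (x, ls))"
proof -
  obtain l lt where ls: "ls = l # lt" using v(2) by (cases ls) auto
  have vl: "ulop (x, lt)" using v ls by (simp add: ulop)
  have Gl: "ok G (set (snd (x, lt)))" using G ls by (simp add: ulops)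
  have rs: "relab P (sub P G (x, lt)) (sub P G' (x, lt))" by (rule relab_sub_inner[OF vl Gl]) (use r ls in simp)
  have rl: "relab P (G l) (G' l)" using r ls by simp
  show ?thesis unfolding ls cglue_eq
    by (rule glue_root_cong) (use rs rl ne d in \<open>simp_all add: ls cglue_eq\<close>)
qed

text \<open>The first gluing joins the output of \<open>X\<close>, the source with its inputs
  filled, to that of \<open>q\<close>, which is not an operadic composition. After a relabelling,
  one of the two is grafted at the last input of the rotation of the other, so associativity applies
  there, and \<open>crelab_cglue_rot\<close> moves the joining edge back to the output.\<close>

lemma cglue_cglue:
  assumes v: "x \<in> opers P" "length ls = Suc (arity P x)" and G: "ok G (set ls)"
    and H: "ok H (set (snd (cglue P G (x, ls))))"
    and dG: "distinct (snd (cglue P G (x, ls)))" "snd (cglue P G (x, ls)) \<noteq> []"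
    and d: "distinct (snd (cglue P H (cglue P G (x, ls))))" "snd (cglue P H (cglue P G (x, ls))) \<noteq> []"
  shows "crelab P (cglue P H (cglue P G (x, ls))) (cglue P (\<lambda>l. sub P H (G l)) (x, ls))"
proof -
  obtain l0 lt where ls: "ls = l0 # lt" using v(2) by (cases ls) auto
  obtain q m where q: "G l0 = (q, m)" by (cases "G l0")
  obtain X lX where X: "sub P G (x, lt) = (X, lX)" by (cases "sub P G (x, lt)")
  have qo: "q \<in> opers P" "length m = arity P q" using G ls q by (auto simp: ulops)
  have Glt: "ok G (set lt)" using G ls by (simp add: ulops)
  have vl: "x \<in> opers P" "length lt = arity P x" using v ls by simp_all
  have Xo: "X \<in> opers P" "length lX = arity P X" using ok_sub[OF vl Glt] X by simp_all
  have e: "cglue P G (x, ls) = (glue_root P X q, m @ lX)" unfolding ls cglue_eq X q by simp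
  have Hm: "ok H (set m)" "ok H (set lX)" using H unfolding e by (simp_all add: ulops)
  have go: "glue_root P X q \<in> opers P" "length (m @ lX) = Suc (arity P (glue_root P X q))"
    using cglue_opers[OF v G dG(2)] unfolding e by simp_all
  define Q where "Q = sub P H (q, m)"
  have Qo: "fst Q \<in> opers P" "length (snd Q) = arity P (fst Q)" using ok_sub[OF qo Hm(1)] by (simp_all add: Q_def)
  have lXe: "lX = concat (map (\<lambda>l. snd (G l)) lt)" using X by (simp add: sub_def)
  have HlX: "ok H (\<Union>l\<in>set (snd (x, lt)). set (snd (G l)))" using Hm(2) unfolding lXe by simp
  have "ulop (x, lt)" using vl by (simp add: ulop)
  moreover have "ok G (set (snd (x, lt)))" using Glt by simp
  ultimately have "sub P (\<lambda>l. sub P H (G l)) (x, lt) = sub P H (X, lX)"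
    using sub_sub[of "\<lambda>_. ()" "(x, lt)" "\<lambda>_. ()" G "\<lambda>_. ()" H] HlX X by simp
  then have R: "cglue P (\<lambda>l. sub P H (G l)) (x, ls) = (glue_root P (fst (sub P H (X, lX))) (fst Q), snd Q @ snd (sub P H (X, lX)))"
    unfolding ls cglue_eq q Q_def by simp
  obtain \<rho> where \<rho>: "\<rho> \<notin> set (m @ lX)" using fresh by blast
  have "concat (map (\<lambda>l. snd (H l)) (m @ lX)) = snd Q @ snd (sub P H (X, lX))" by (simp add: Q_def sub_def)
  then have labs: "snd (cglue P H (cglue P G (x, ls))) = snd Q @ snd (sub P H (X, lX))" unfolding e by (simp add: cglue_def)
  show ?thesis
  proof (cases "1 \<le> arity P X")
    case True
    let ?T = "pcomp P (rot P X) (arity P X - 1) q"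
    have sw: "crelab P (glue_root P X q, m @ lX) (?T, lX @ m)" by (rule glue_root_swap[OF Xo True qo])
    have 1: "crelab P (cglue P H (cglue P G (x, ls))) (cglue P H (?T, lX @ m))"
      using crelab_cglue[OF sw] H d unfolding e by simp
    obtain l1 lr where l1: "lX = l1 # lr" using True Xo(2) by (cases lX) auto
    \<comment> \<open>The label \<open>\<rho>\<close> stands for the edge between \<open>X\<close>
      and \<open>q\<close>; \<open>Q\<close> is \<open>q\<close> with everything that
      \<open>H\<close> glues to it.\<close>
    let ?H = "H(\<rho> := Q)"
    have Hs: "map (\<lambda>l. fst (?H l)) ys = map (\<lambda>l. fst (H l)) ys" "map (\<lambda>l. snd (?H l)) ys = map (\<lambda>l. snd (H l)) ys" if "set ys \<subseteq> set (m @ lX)" for ys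
      using \<rho> that by (auto intro!: map_cong)
    have H\<rho>: "?H \<rho> = Q" by simp
    have l1\<rho>: "?H l1 = H l1" using \<rho> l1 by auto
    have h: "map (\<lambda>l. fst (?H l)) lr = map (\<lambda>l. fst (H l)) lr" "map (\<lambda>l. snd (?H l)) lr = map (\<lambda>l. snd (H l)) lr"
      "map (\<lambda>l. fst (?H l)) lX = map (\<lambda>l. fst (H l)) lX" "map (\<lambda>l. snd (?H l)) lX = map (\<lambda>l. snd (H l)) lX"
      by (rule Hs; use l1 in force)+
    have Qe: "fst Q = gcomp P q (map (\<lambda>l. fst (H l)) m)" "snd Q = concat (map (\<lambda>l. snd (H l)) m)" by (simp_all add: Q_def sub_def)
    let ?Vr = "map (\<lambda>l. fst (H l)) lr" and ?Vm = "map (\<lambda>l. fst (H l)) m"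
    have rX: "rot P X \<in> opers P" "arity P (rot P X) = arity P X" using rot_opers rot_arity Xo by simp_all
    have p: "pcomposable P (rot P X) (arity P X - 1) q" using rX qo True by (simp add: pcomposable_unit)
    have cm: "composable P q ?Vm" using qo Hm(1) by (auto simp: composable_unit ulops)
    have lrl: "length lr = arity P X - 1" using Xo(2) l1 by simp
    have a1: "map (out P) ?Vr = take (arity P X - 1) (ins P (rot P X))"
      unfolding unit_list_eq length_map length_take lrl rX(2) by linarith
    have a2: "set ?Vr \<subseteq> opers P" using Hm(2) l1 by (auto simp: ulops)
    have a3: "map (out P) [] = drop (Suc (arity P X - 1)) (ins P (rot P X))"
      unfolding unit_list_eq length_map length_drop rX(2) by simp
    have "gcomp P ?T (?Vr @ ?Vm @ []) = gcomp P (rot P X) (?Vr @ [gcomp P q ?Vm] @ [])"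
      by (rule gcomp_pcomp(1)[OF p cm a1 a2 a3]) simp
    then have e2: "cglue P H (?T, lX @ m) = cglue P ?H (rot P X, lX @ [\<rho>])"
      unfolding l1 append_Cons cglue_eq by (simp add: sub_def h(1,2) H\<rho> l1\<rho> Qe del: fun_upd_apply)
    have 2: "crelab P (cglue P ?H (X, \<rho> # lX)) (cglue P ?H (rot P X, lX @ [\<rho>]))"
    proof (rule crelab_cglue_rot[OF Xo])
      show "ok ?H (insert \<rho> (set lX))" using Hm(2) Qo by (auto simp: ulops)
      show "snd (cglue P ?H (X, \<rho> # lX)) \<noteq> []" using d(2) unfolding labs cglue_eq by (simp add: sub_def h(4) H\<rho> del: fun_upd_apply)
    qed
    have e3: "cglue P ?H (X, \<rho> # lX) = cglue P (\<lambda>l. sub P H (G l)) (x, ls)"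
      unfolding R cglue_eq by (simp add: sub_def h(3,4) H\<rho> del: fun_upd_apply)
    show ?thesis using crelab_trans[OF 1] crelab_sym[OF 2] unfolding e2 e3 by blast
  next
    \<comment> \<open>Here \<open>X\<close> has no input and cannot serve as the base. So
      \<open>q\<close> does, and \<open>X\<close> hangs at the edge \<open>\<rho>\<close>.\<close>
    case False
    then have a0: "arity P X = 0" by linarith
    then have "length lX = 0" unfolding Xo(2) .
    with a0 have X0: "arity P X = 0" "lX = []" "ins P X = []" by simp_all
    have q1: "1 \<le> arity P q" "m \<noteq> []" using dG(2) qo(2) unfolding e X0 by (cases m; simp)+
    let ?T = "pcomp P (rot P q) (arity P q - 1) X"
    have gT: "glue_root P X q = ?T" using q1 by (simp add: glue_root_def)
    obtain m1 mr where m1: "m = m1 # mr" using q1 by (cases m) auto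
    let ?H = "H(\<rho> := (X, []))"
    have Hs: "map (\<lambda>l. fst (?H l)) ys = map (\<lambda>l. fst (H l)) ys" "map (\<lambda>l. snd (?H l)) ys = map (\<lambda>l. snd (H l)) ys" if "set ys \<subseteq> set (m @ lX)" for ys
      using \<rho> that by (auto intro!: map_cong)
    have H\<rho>: "?H \<rho> = (X, [])" by simp
    have l1\<rho>: "?H m1 = H m1" using \<rho> m1 by auto
    have h: "map (\<lambda>l. fst (?H l)) mr = map (\<lambda>l. fst (H l)) mr" "map (\<lambda>l. snd (?H l)) mr = map (\<lambda>l. snd (H l)) mr"
      "map (\<lambda>l. fst (?H l)) m = map (\<lambda>l. fst (H l)) m" "map (\<lambda>l. snd (?H l)) m = map (\<lambda>l. snd (H l)) m"
      by (rule Hs; use m1 in force)+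
    let ?Vr = "map (\<lambda>l. fst (H l)) mr"
    have rq: "rot P q \<in> opers P" "arity P (rot P q) = arity P q" using rot_opers rot_arity qo by simp_all
    have p: "pcomposable P (rot P q) (arity P q - 1) X" using rq Xo q1 by (simp add: pcomposable_unit)
    have cX: "composable P X []" using Xo X0 by (simp add: composable_unit)
    have mrl: "length mr = arity P q - 1" using qo(2) m1 by simp
    have gX: "gcomp P X [] = X" using gcomp_ident_right[OF Xo(1)] X0 by simp
    have a1: "map (out P) ?Vr = take (arity P q - 1) (ins P (rot P q))"
      unfolding unit_list_eq length_map length_take mrl rq(2) by linarith
    have a2: "set ?Vr \<subseteq> opers P" using Hm(1) m1 by (auto simp: ulops)
    have a3: "map (out P) [] = drop (Suc (arity P q - 1)) (ins P (rot P q))"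
      unfolding unit_list_eq length_map length_drop rq(2) by simp
    have "gcomp P ?T (?Vr @ [] @ []) = gcomp P (rot P q) (?Vr @ [gcomp P X []] @ [])"
      by (rule gcomp_pcomp(1)[OF p cX a1 a2 a3]) simp
    then have e2: "cglue P H (?T, m) = cglue P ?H (rot P q, m @ [\<rho>])"
      unfolding m1 append_Cons cglue_eq using gX by (simp add: sub_def h(1,2) H\<rho> l1\<rho> del: fun_upd_apply)
    have sX: "sub P H (X, lX) = (X, [])" using gX X0 by (simp add: sub_def)
    have 2: "crelab P (cglue P ?H (q, \<rho> # m)) (cglue P ?H (rot P q, m @ [\<rho>]))"
    proof (rule crelab_cglue_rot[OF qo])
      show "ok ?H (insert \<rho> (set m))" using Hm(1) Xo X0 by (auto simp: ulops)
      show "snd (cglue P ?H (q, \<rho> # m)) \<noteq> []" using d(2) sX unfolding labs cglue_eq by (simp add: sub_def Q_def h(4) H\<rho> del: fun_upd_apply)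
    qed
    have "1 \<le> arity P (fst Q)" using d(2) Qo(2) unfolding labs sX by (cases "snd Q") auto
    then have "glue_root P (fst Q) X = glue_root P X (fst Q)" using X0 by (simp add: glue_root_def)
    then have e3: "cglue P ?H (q, \<rho> # m) = cglue P (\<lambda>l. sub P H (G l)) (x, ls)"
      unfolding R cglue_eq sX by (simp add: sub_def Q_def h(3,4) H\<rho> del: fun_upd_apply)
    show ?thesis using crelab_sym[OF 2] unfolding e2[symmetric] e3 e X0 gT by simp
  qed
qed

end

section \<open>The cyclic twisted arrow category\<close>

definition cU :: "'o ctree \<Rightarrow> nat \<Rightarrow> 'o \<times> nat list" where "cU f k = (cverts f ! k, clabels f ! k)"

lemma ctree_eqI:
  assumes "csource f = csource g" "\<And>k. k < n \<Longrightarrow> cU f k = cU g k"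
    "length (cverts f) = n" "length (cverts g) = n" "length (clabels f) = n" "length (clabels g) = n"
  shows "f = g"
proof -
  have "cverts f = cverts g" "clabels f = clabels g"
    by (rule nth_equalityI; use assms in \<open>simp add: cU_def\<close>)+
  then show ?thesis using assms(1) by (cases f, cases g) simp
qed

section \<open>Composition of cyclic trees\<close>

context cyclic_operad
begin

abbreviation "cn f \<equiv> Suc (arity P (csource f))"

lemma ctree_arrowI:
  assumes "csource f \<in> opers P" "set (cverts f) \<subseteq> opers P" "length (cverts f) = cn f" "length (clabels f) = cn f"
    "\<And>k. k < cn f \<Longrightarrow> length (clabels f ! k) = arity P (cverts f ! k)" "cleaves f \<noteq> []"
    "cleaves f \<in> permutations_of_set {..<length (cleaves f)}" "\<And>l. l \<in> set (clabels f) \<Longrightarrow> sorted l"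
  shows "ctree_arrow P f"
proof -
  have m: "map length (clabels f) = map (arity P) (cverts f)" by (rule nth_equalityI) (use assms(3-5) in simp_all)
  have "sum_list (map (arity P) (cverts f)) = length (cleaves f)" unfolding m[symmetric] cleaves_def length_concat ..
  then have "1 \<le> sum_list (map (arity P) (cverts f))" using assms(6) by (cases "cleaves f") auto
  then show ?thesis using assms m unfolding ctree_arrow_def by blast
qed

lemma cglue_cU:
  assumes "length (cverts f) = cn f" "length (clabels f) = cn f"
  shows "cglue P (cU f) (csource f, [0..<cn f]) = (glue_root P (gcomp P (csource f) (tl (cverts f))) (hd (cverts f)), cleaves f)"
proof -
  obtain v vs where v: "cverts f = v # vs" using assms(1) by (cases "cverts f") auto
  have "map (\<lambda>l. fst (cU f l)) [0..<cn f] = cverts f" "map (\<lambda>l. snd (cU f l)) [0..<cn f] = clabels f"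
    using map_nth[of "cverts f"] map_nth[of "clabels f"] assms unfolding cU_def by (simp_all del: upt_Suc)
  moreover have "[0..<cn f] = 0 # [1..<cn f]" by (simp add: upt_conv_Cons del: upt_Suc)
  ultimately show ?thesis unfolding cglue_def fst_conv snd_conv v by (simp add: cleaves_def del: upt_Suc)
qed

text \<open>Gluing the vertices to the legs of the source gives a raw operation labelled by
  \<open>cleaves f\<close>; the target is its normal form. This is the cyclic counterpart of the
  description of symmetric trees by labelled operations.\<close>

lemma ctree_arrowD:
  assumes f: "ctree_arrow P f"
  shows "csource f \<in> opers P" "ctarget P f \<in> opers P" "Suc (arity P (ctarget P f)) = length (cleaves f)"
    "length (cverts f) = cn f" "length (clabels f) = cn f" "ok (cU f) {..<cn f}"
    "cleaves f \<in> permutations_of_set {..<Suc (arity P (ctarget P f))}"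
    "snd (cglue P (cU f) (csource f, [0..<cn f])) = cleaves f"
    "crelab P (cglue P (cU f) (csource f, [0..<cn f])) (ctarget P f, [0..<Suc (arity P (ctarget P f))])"
    "cnf P (cglue P (cU f) (csource f, [0..<cn f])) = (ctarget P f, [0..<Suc (arity P (ctarget P f))])"
    "fst (cglue P (cU f) (csource f, [0..<cn f])) = glue_root P (gcomp P (csource f) (tl (cverts f))) (hd (cverts f))"
proof -
  let ?t = "ctarget P f" and ?n = "cn f"
  show p: "csource f \<in> opers P" and l: "length (cverts f) = ?n" using f by (simp_all add: ctree_arrow_def)
  have m: "map length (clabels f) = map (arity P) (cverts f)" using f by (simp add: ctree_arrow_def)
  show l': "length (clabels f) = ?n" using arg_cong[OF m, of length] l by simp
  have vo: "set (cverts f) \<subseteq> opers P" using f by (simp add: ctree_arrow_def)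
  show U: "ok (cU f) {..<?n}"
    unfolding ulops
  proof
    fix k assume k: "k \<in> {..<?n}"
    have "length (clabels f ! k) = arity P (cverts f ! k)" using arg_cong[OF m, of "\<lambda>l. l ! k"] k l l' by simp
    then show "fst (cU f k) \<in> opers P \<and> length (snd (cU f k)) = arity P (fst (cU f k))"
      using vo k l nth_mem[of k "cverts f"] by (auto simp: cU_def)
  qed
  note e = cglue_cU[OF l l']
  show s: "snd (cglue P (cU f) (csource f, [0..<?n])) = cleaves f" unfolding e by simp
  show fs: "fst (cglue P (cU f) (csource f, [0..<?n])) = glue_root P (gcomp P (csource f) (tl (cverts f))) (hd (cverts f))"
    unfolding e by simp
  have "length (cleaves f) = sum_list (map (arity P) (cverts f))" unfolding cleaves_def length_concat m ..
  moreover have "1 \<le> sum_list (map (arity P) (cverts f))" using f unfolding ctree_arrow_def by blast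
  ultimately have ne: "cleaves f \<noteq> []" by (metis list.size(3) not_one_le_zero)
  have U': "ok (cU f) (set [0..<?n])" using U unfolding set_upt lessThan_atLeast0 .
  define T where "T = fst (cglue P (cU f) (csource f, [0..<?n]))"
  have cg: "cglue P (cU f) (csource f, [0..<?n]) = (T, cleaves f)" using s by (simp add: T_def prod_eq_iff)
  have T: "T \<in> opers P" "length (cleaves f) = Suc (arity P T)"
    using cglue_opers[OF p _ U'] ne unfolding s T_def by simp_all
  have pm: "cleaves f \<in> permutations_of_set {..<Suc (arity P T)}" using f unfolding T(2)[symmetric] by (simp add: ctree_arrow_def)
  have t: "?t = cact P (cleaves f) T" unfolding ctarget_def T_def fs ..
  show to: "?t \<in> opers P" unfolding t by (rule cact_opers'[OF T(1) pm])
  have at: "arity P ?t = arity P T" unfolding t by (rule cact_arity'[OF T(1) pm])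
  show "Suc (arity P ?t) = length (cleaves f)" unfolding at T(2) ..
  show "cleaves f \<in> permutations_of_set {..<Suc (arity P ?t)}" using pm unfolding at .
  have "map ((!) [0..<Suc (arity P T)]) (cleaves f) = cleaves f"
  proof (rule map_idI)
    fix k assume "k \<in> set (cleaves f)"
    then show "[0..<Suc (arity P T)] ! k = k" unfolding perm_set[OF pm] by (simp del: upt_Suc)
  qed
  then have e: "cleaves f = map ((!) [0..<Suc (arity P T)]) (cleaves f)" by (rule sym)
  have lT: "length (cleaves f) = Suc (arity P T)" "length [0..<Suc (arity P T)] = Suc (arity P T)" by (rule T(2)) simp
  show "crelab P (cglue P (cU f) (csource f, [0..<?n])) (?t, [0..<Suc (arity P ?t)])"
    unfolding cg at crelab_def fst_conv snd_conv
    by (rule conjI[OF T(1)], rule conjI[OF lT(1)], rule conjI[OF lT(2)], rule bexI[OF _ pm]) (rule conjI[OF t e] conjI[OF e t])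
  show "cnf P (cglue P (cU f) (csource f, [0..<?n])) = (?t, [0..<Suc (arity P ?t)])"
    unfolding cg at cnf_def fst_conv snd_conv ranks_perm[OF pm] sort_perm[OF pm] t[symmetric] ..
qed

lemma ctree_arrow_labels:
  assumes f: "ctree_arrow P f" and k: "k < cn f"
  shows "set (snd (cU f k)) \<subseteq> {..<Suc (arity P (ctarget P f))}" "distinct (snd (cU f k))" "sorted (snd (cU f k))"
    "ulop (cU f k)"
proof -
  note D = ctree_arrowD[OF f]
  have s: "set (cleaves f) = {..<Suc (arity P (ctarget P f))}" "distinct (cleaves f)"
    using D(7) perm_set perm_distinct by blast+
  have kl: "k < length (clabels f)" using k D(5) by simp
  show "set (snd (cU f k)) \<subseteq> {..<Suc (arity P (ctarget P f))}"
    using set_subset_concat[OF kl] s(1) by (auto simp: cU_def cleaves_def)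
  show "distinct (snd (cU f k))" using distinct_concat_nth[OF _ kl] s(2) by (simp add: cU_def cleaves_def)
  show "sorted (snd (cU f k))" using f nth_mem[OF kl] by (simp add: ctree_arrow_def cU_def)
  show "ulop (cU f k)" using D(6) k unfolding ulops ulop by blast
qed

lemma nf_cU:
  assumes "ctree_arrow P f" "k < cn f"
  shows "nf P (cU f k) = cU f k"
  using ctree_arrow_labels(2-4)[OF assms] by (intro nf_sorted) (simp_all add: ulop)

lemma ctcomp_sel:
  assumes f: "ctree_arrow P f"
  shows "csource (ctcomp P g f) = csource f"
    "length (cverts (ctcomp P g f)) = cn f" "length (clabels (ctcomp P g f)) = cn f"
    "k < cn f \<Longrightarrow> cU (ctcomp P g f) k = nf P (sub P (cU g) (cU f k))"
  using ctree_arrowD(4,5)[OF f] by (simp_all add: ctcomp_def Let_def cU_def nf_def sub_def)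

lemma ctcomp_labels:
  assumes f: "ctree_arrow P f" and g: "ctree_arrow P g" and fg: "ctarget P f = csource g"
  defines "RL \<equiv> concat (map ((!) (clabels g)) (cleaves f))"
  shows "mset RL = mset (cleaves g)" "distinct RL"
    and "k < cn f \<Longrightarrow> distinct (snd (sub P (cU g) (cU f k)))"
    and "k < cn f \<Longrightarrow> set (snd (cU f k)) \<subseteq> {..<cn g}"
    and "k < cn f \<Longrightarrow> ok (cU g) (set (snd (cU f k)))"
    and "k < cn f \<Longrightarrow> relab P (sub P (cU g) (cU f k)) (cU (ctcomp P g f) k)"
    and "mset (cleaves (ctcomp P g f)) = mset (cleaves g)"
proof -
  note F = ctree_arrowD[OF f] and G = ctree_arrowD[OF g]
  have "mset (map ((!) (clabels g)) (cleaves f)) = mset (clabels g)"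
    by (rule mset_map_nth_perm) (use F(7) G(5) fg in simp)
  from mset_concat_cong[OF this] show m: "mset RL = mset (cleaves g)" by (simp add: RL_def cleaves_def)
  show d: "distinct RL" using mset_eq_imp_distinct_iff[OF m] perm_distinct[OF G(7)] by simp
  have sp: "RL = concat (map (\<lambda>ls. concat (map ((!) (clabels g)) ls)) (clabels f))"
    by (simp add: RL_def cleaves_def map_concat concat_concat_map o_def)
  have "mset (concat (map (\<lambda>ls. sort (concat (map ((!) (clabels g)) ls))) X)) = mset (concat (map (\<lambda>ls. concat (map ((!) (clabels g)) ls)) X))" for X
    by (induction X) auto
  then have "mset (cleaves (ctcomp P g f)) = mset RL" unfolding sp by (simp add: cleaves_def ctcomp_def Let_def)
  then show "mset (cleaves (ctcomp P g f)) = mset (cleaves g)" using m by simp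
  assume k: "k < cn f"
  show dk: "distinct (snd (sub P (cU g) (cU f k)))"
    using distinct_concat_nth[of "map (\<lambda>ls. concat (map ((!) (clabels g)) ls)) (clabels f)" k] d k F(5)
    unfolding sp by (simp add: sub_def cU_def)
  show s: "set (snd (cU f k)) \<subseteq> {..<cn g}" using ctree_arrow_labels(1)[OF f k] unfolding fg .
  show o: "ok (cU g) (set (snd (cU f k)))" by (rule lops_subset[OF G(6) s])
  have v: "ulop (cU f k)" by (rule ctree_arrow_labels(4)[OF f k])
  have "ulop (sub P (cU g) (cU f k))" by (rule lop_sub(1)[OF v o])
  then show "relab P (sub P (cU g) (cU f k)) (cU (ctcomp P g f) k)"
    unfolding ctcomp_sel(4)[OF f k] ulop by (intro relab_nf dk) simp_all
qed

lemma ctcomp_arrow: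
  assumes f: "ctree_arrow P f" and g: "ctree_arrow P g" and fg: "ctarget P f = csource g"
  shows "ctree_arrow P (ctcomp P g f)"
proof (rule ctree_arrowI)
  note F = ctree_arrowD[OF f] and G = ctree_arrowD[OF g] and S = ctcomp_sel[OF f] and L = ctcomp_labels[OF f g fg]
  let ?h = "ctcomp P g f"
  show "csource ?h \<in> opers P" "length (cverts ?h) = cn ?h" "length (clabels ?h) = cn ?h" using S(1-3) F(1) by simp_all
  have r: "cverts ?h ! k \<in> opers P \<and> length (clabels ?h ! k) = arity P (cverts ?h ! k)" if "k < cn f" for k
    using relab_out(1,4)[OF L(6)[OF that]] by (simp add: cU_def)
  then show "set (cverts ?h) \<subseteq> opers P" using S(2) by (auto simp: in_set_conv_nth)
  show "length (clabels ?h ! k) = arity P (cverts ?h ! k)" if "k < cn ?h" for k using r that S(1) by simp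
  show "cleaves ?h \<noteq> []" using mset_eq_length[OF L(7)] G(3) by auto
  show "cleaves ?h \<in> permutations_of_set {..<length (cleaves ?h)}"
    using G(7) unfolding G(3) perm_iff_mset mset_eq_length[OF L(7)] L(7) .
  show "sorted l" if "l \<in> set (clabels ?h)" for l using that by (auto simp: ctcomp_def Let_def)
qed

text \<open>The raw composites are compared in three moves: \<open>cglue_cglue\<close> reassociates,
  inner equivariance sorts the labels at each vertex, and \<open>crelab_cglue\<close> replaces the
  raw composite of \<open>f\<close> by the target of \<open>f\<close>. As the labels are distinct,
  the normal forms agree.\<close>

lemma ctcomp_target:
  assumes f: "ctree_arrow P f" and g: "ctree_arrow P g" and fg: "ctarget P f = csource g"
  shows "ctarget P (ctcomp P g f) = ctarget P g"
proof -
  note F = ctree_arrowD[OF f] and G = ctree_arrowD[OF g] and S = ctcomp_sel[OF f] and L = ctcomp_labels[OF f g fg]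
  let ?h = "ctcomp P g f" and ?v = "[0..<cn f]"
  note H = ctree_arrowD[OF ctcomp_arrow[OF f g fg]]
  let ?c = "cglue P (cU f) (csource f, ?v)"
  have U: "ok (cU f) (set ?v)" using F(6) unfolding set_upt lessThan_atLeast0 .
  have Ug: "ok (cU g) (set (snd ?c))" using G(6) unfolding F(8) perm_set[OF F(7)] fg .
  have lv: "length ?v = Suc (arity P (csource f))" by simp
  have snd_c: "snd (cglue P (cU g) ?c) = concat (map ((!) (clabels g)) (cleaves f))"
  proof -
    have "snd (cglue P (cU g) ?c) = concat (map (\<lambda>l. snd (cU g l)) (snd ?c))" by (simp only: cglue_def snd_conv)
    then show ?thesis unfolding F(8) by (simp only: cU_def snd_conv)
  qed
  have dc: "distinct (snd ?c)" "snd ?c \<noteq> []" unfolding F(8) using perm_distinct[OF F(7)] F(3) by auto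
  have d: "distinct (snd (cglue P (cU g) ?c))" unfolding snd_c by (rule L(2))
  have ne: "snd (cglue P (cU g) ?c) \<noteq> []" unfolding snd_c using mset_eq_length[OF L(1)] G(3) by (metis list.size(3) nat.distinct(1))
  have 1: "crelab P (cglue P (cU g) ?c) (cglue P (\<lambda>l. sub P (cU g) (cU f l)) (csource f, ?v))"
    by (rule cglue_cglue[OF F(1) lv U Ug dc d ne])
  have m1: "mset (snd (cglue P (cU g) ?c)) = mset (snd (cglue P (\<lambda>l. sub P (cU g) (cU f l)) (csource f, ?v)))"
    by (rule crelab_mset[OF 1])
  have kv: "k < cn f" if "k \<in> set ?v" for k using that by (simp del: upt_Suc)
  have sg: "ok (\<lambda>l. sub P (cU g) (cU f l)) (set ?v)"
    unfolding ulops
  proof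
    fix k assume "k \<in> set ?v"
    then have k: "k < cn f" by (rule kv)
    have "ulop (sub P (cU g) (cU f k))" by (rule lop_sub(1)[OF ctree_arrow_labels(4)[OF f k] L(5)[OF k]])
    then show "fst (sub P (cU g) (cU f k)) \<in> opers P \<and> length (snd (sub P (cU g) (cU f k))) = arity P (fst (sub P (cU g) (cU f k)))"
      by (simp only: ulop)
  qed
  have 2: "crelab P (cglue P (\<lambda>l. sub P (cU g) (cU f l)) (csource f, ?v)) (cglue P (cU ?h) (csource f, ?v))"
  proof (rule crelab_cglue_inner[OF F(1) lv sg])
    show "snd (cglue P (\<lambda>l. sub P (cU g) (cU f l)) (csource f, ?v)) \<noteq> []" using ne m1 by auto
    show "distinct (snd (cglue P (\<lambda>l. sub P (cU g) (cU f l)) (csource f, ?v)))" using d m1 mset_eq_imp_distinct_iff by blast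
    show "relab P (sub P (cU g) (cU f k)) (cU ?h k)" if "k \<in> set ?v" for k by (rule L(6)[OF kv[OF that]])
  qed
  have 3: "crelab P (cglue P (cU g) ?c) (cglue P (cU g) (ctarget P f, [0..<Suc (arity P (ctarget P f))]))"
    by (rule crelab_cglue[OF F(9) Ug ne d])
  have "cnf P (cglue P (cU ?h) (csource f, ?v)) = cnf P (cglue P (cU g) ?c)"
    using cnf_crelab[OF crelab_trans[OF 1 2] d] by simp
  also have "\<dots> = cnf P (cglue P (cU g) (csource g, [0..<cn g]))" using cnf_crelab[OF 3 d] unfolding fg .
  finally show ?thesis using H(10) G(10) S(1) by simp
qed

text \<open>All vertices of a cyclic tree are of one kind and are composed through their own leg 0,
  so the argument for upper vertices of symmetric trees covers the whole tree.\<close>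

lemma ctcomp_assoc:
  assumes f: "ctree_arrow P f" and g: "ctree_arrow P g" and h: "ctree_arrow P h"
    and fg: "ctarget P f = csource g" and gh: "ctarget P g = csource h"
  shows "ctcomp P h (ctcomp P g f) = ctcomp P (ctcomp P h g) f"
proof -
  have agf: "ctree_arrow P (ctcomp P g f)" by (rule ctcomp_arrow[OF f g fg])
  have tgf: "ctarget P (ctcomp P g f) = csource h" using ctcomp_target[OF f g fg] gh by simp
  note Sf = ctcomp_sel[OF f] and Sg = ctcomp_sel[OF g] and S1 = ctcomp_sel[OF agf]
  note L = ctcomp_labels[OF f g fg] and Lg = ctcomp_labels[OF g h gh] and L1 = ctcomp_labels[OF agf h tgf]
  show ?thesis
  proof (rule ctree_eqI[of _ _ "cn f"])
    show "csource (ctcomp P h (ctcomp P g f)) = csource (ctcomp P (ctcomp P h g) f)"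
      "length (cverts (ctcomp P h (ctcomp P g f))) = cn f" "length (cverts (ctcomp P (ctcomp P h g) f)) = cn f"
      "length (clabels (ctcomp P h (ctcomp P g f))) = cn f" "length (clabels (ctcomp P (ctcomp P h g) f)) = cn f"
      using Sf(1-3) S1(1-3) by simp_all
    fix k assume k: "k < cn f"
    have k': "k < cn (ctcomp P g f)" using k Sf(1) by simp
    have lt: "l < cn g" if "l \<in> set (snd (cU f k))" for l using L(4)[OF k] that by auto
    have "cU (ctcomp P h (ctcomp P g f)) k = nf P (sub P (cU h) (nf P (sub P (cU g) (cU f k))))"
      unfolding S1(4)[OF k'] Sf(4)[OF k] ..
    also have "\<dots> = nf P (sub P (\<lambda>l. nf P (sub P (cU h) (cU g l))) (cU f k))"
    proof (rule nf_sub_assoc[OF ctree_arrow_labels(4)[OF f k] L(5)[OF k]])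
      show "ok (cU h) (\<Union>l\<in>set (snd (cU f k)). set (snd (cU g l)))" using Lg(5) lt unfolding ulops by blast
      show "distinct (snd (sub P (cU g) (cU f k)))" by (rule L(3)[OF k])
      show "distinct (snd (sub P (cU h) (cU g l)))" if "l \<in> set (snd (cU f k))" for l by (rule Lg(3)[OF lt[OF that]])
      show "distinct (snd (sub P (cU h) (nf P (sub P (cU g) (cU f k)))))" using L1(3)[OF k'] unfolding Sf(4)[OF k] .
    qed
    also have "\<dots> = nf P (sub P (cU (ctcomp P h g)) (cU f k))"
      by (rule arg_cong[of _ _ "nf P"], rule sub_cong) (use Sg(4) lt in simp)
    also have "\<dots> = cU (ctcomp P (ctcomp P h g) f) k" by (rule Sf(4)[OF k, symmetric])
    finally show "cU (ctcomp P h (ctcomp P g f)) k = cU (ctcomp P (ctcomp P h g) f) k" .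
  qed
qed

lemma cU_cid: "k < Suc (arity P p) \<Longrightarrow> cU (cid P p) k = (uid, [k])"
  by (simp add: cU_def cid_def del: upt_Suc replicate_Suc)

lemma cid_arrow:
  assumes p: "p \<in> opers P"
  shows "ctree_arrow P (cid P p)" "ctarget P (cid P p) = p" "csource (cid P p) = p"
proof -
  show s: "csource (cid P p) = p" by (simp add: cid_def)
  have lv: "cleaves (cid P p) = [0..<Suc (arity P p)]" unfolding cleaves_def cid_def ctree.sel by (simp only: concat_map_singleton map_ident)
  show "ctree_arrow P (cid P p)"
  proof (rule ctree_arrowI)
    show "length (clabels (cid P p) ! k) = arity P (cverts (cid P p) ! k)" if "k < cn (cid P p)" for k
      using cU_cid[of k p] that uid unfolding s cU_def by simp
    show "cleaves (cid P p) \<in> permutations_of_set {..<length (cleaves (cid P p))}" unfolding lv length_upt minus_nat.diff_0 by (rule perm_id)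
    show "sorted l" if "l \<in> set (clabels (cid P p))" for l using that by (auto simp: cid_def simp del: upt_Suc)
    show "cleaves (cid P p) \<noteq> []" unfolding lv by simp
  qed (use p uid s in \<open>auto simp: cid_def\<close>)
  have "map (ident P) (ins P p) = replicate (arity P p) uid" by (rule nth_equalityI) simp_all
  then have g: "gcomp P p (replicate (arity P p) uid) = p" using gcomp_ident_right[OF p] by simp
  have "glue_root P p uid = p"
    using uid pcomp_ident_left[OF p] by (simp add: glue_root_def rot_ident)
  then show "ctarget P (cid P p) = p"
    unfolding ctarget_def lv using g cact_id[OF p] by (simp add: cid_def del: upt_Suc)
qed

lemma ctcomp_cid_right:
  assumes f: "ctree_arrow P f"
  shows "ctcomp P f (cid P (csource f)) = f"
proof -
  note F = ctree_arrowD[OF f]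
  note i = cid_arrow[OF F(1)]
  note S = ctcomp_sel[OF i(1), unfolded i(3)]
  show ?thesis
  proof (rule ctree_eqI[of _ _ "cn f"])
    fix k assume k: "k < cn f"
    have "sub P (cU f) (uid, [k]) = cU f k"
      by (rule sub_unit[of "\<lambda>_. ()"]) (use ctree_arrow_labels(4)[OF f k] in simp_all)
    then show "cU (ctcomp P f (cid P (csource f))) k = cU f k" unfolding S(4)[OF k] cU_cid[OF k] using nf_cU[OF f k] by simp
  qed (simp_all only: S(1-3) F(4,5))
qed

lemma ctcomp_cid_left:
  assumes f: "ctree_arrow P f"
  shows "ctcomp P (cid P (ctarget P f)) f = f"
proof -
  note F = ctree_arrowD[OF f] and S = ctcomp_sel[OF f]
  show ?thesis
  proof (rule ctree_eqI[of _ _ "cn f"])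
    fix k assume k: "k < cn f"
    have "sub P (cU (cid P (ctarget P f))) (cU f k) = cU f k"
    proof (rule sub_ident_right[OF ctree_arrow_labels(4)[OF f k]])
      fix l assume "l \<in> set (snd (cU f k))"
      then have "l < Suc (arity P (ctarget P f))" using ctree_arrow_labels(1)[OF f k] by blast
      then show "cU (cid P (ctarget P f)) l = (uid, [l])" by (rule cU_cid)
    qed
    then show "cU (ctcomp P (cid P (ctarget P f)) f) k = cU f k" unfolding S(4)[OF k] using nf_cU[OF f k] by simp
  qed (simp_all only: S(1-3) F(4,5))
qed

lemma category_cyclic_Tw: "category (cyclic_Tw P)"
proof -
  have 1: "ctree_arrow P (ctcomp P g f)" "csource (ctcomp P g f) = csource f" "ctarget P (ctcomp P g f) = ctarget P g"
    if "ctree_arrow P f" "ctree_arrow P g" "ctarget P f = csource g" for f g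
    by (rule ctcomp_arrow[OF that], rule ctcomp_sel(1)[OF that(1)], rule ctcomp_target[OF that])
  show ?thesis
    by (rule category.intro, unfold cyclic_Tw_def cat.simps mem_Collect_eq)
      ((rule ctcomp_assoc; assumption) | (rule 1; assumption) | (rule cid_arrow; assumption)
        | (rule ctree_arrowD(1,2) ctcomp_cid_left ctcomp_cid_right; assumption))+
qed

section \<open>Isomorphisms of cyclic trees\<close>

lemma cvertices_alt:
  assumes "ctree_arrow P f"
  shows "cvertices f = (\<lambda>k. fst (cU f k)) ` {..<cn f}"
  unfolding ctree_arrowD(4)[OF assms, symmetric] by (auto simp: cvertices_def cU_def in_set_conv_nth image_iff)

lemma cyclic_left_inverse:
  assumes f: "ctree_arrow P f" and g: "ctree_arrow P g" and fg: "ctarget P f = csource g"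
    and inv: "ctcomp P g f = cid P (csource f)" and k: "k < cn f"
  shows "snd (cU f k) \<noteq> []"
    and "(\<And>l. l < cn g \<Longrightarrow> snd (cU g l) \<noteq> []) \<Longrightarrow> \<exists>l<cn g. composable P (fst (cU f k)) [fst (cU g l)] \<and>
      gcomp P (fst (cU f k)) [fst (cU g l)] = ident P (out P (fst (cU f k)))"
proof -
  note L = ctcomp_labels[OF f g fg]
  have e: "nf P (sub P (cU g) (cU f k)) = (uid, [k])"
    using ctcomp_sel(4)[OF f k, where g = g] cU_cid[OF k] unfolding inv by simp
  have c: "() \<in> colours P" by (simp add: single_colour)
  note N = nf_sub_identD[OF ctree_arrow_labels(4)[OF f k] L(5)[OF k] c e]
  show "snd (cU f k) \<noteq> []" by (rule N(1))
  assume nz: "\<And>l. l < cn g \<Longrightarrow> snd (cU g l) \<noteq> []"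
  have ll: "l < cn g" if "l \<in> set (snd (cU f k))" for l
    using subsetD[OF L(4)[OF k] that] by (simp only: lessThan_iff)
  obtain l where l: "snd (cU f k) = [l]" "composable P (fst (cU f k)) [fst (cU g l)]"
    "gcomp P (fst (cU f k)) [fst (cU g l)] = uid"
    using N(2) nz ll by blast
  have "l < cn g" by (rule ll) (simp add: l(1))
  then show "\<exists>l<cn g. composable P (fst (cU f k)) [fst (cU g l)] \<and>
      gcomp P (fst (cU f k)) [fst (cU g l)] = ident P (out P (fst (cU f k)))"
    using l(2,3) by (intro exI[of _ l]) simp
qed

lemma cyclic_isos_invertible:
  assumes f: "f \<in> isos (cyclic_Tw P)" and v: "v \<in> cvertices f"
  shows "invertible P v"
proof -
  obtain g where g: "ctree_arrow P f" "ctree_arrow P g" "csource g = ctarget P f" "ctarget P g = csource f"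
    "ctcomp P g f = cid P (csource f)" "ctcomp P f g = cid P (csource g)"
    using f by (auto simp: isos_def cyclic_Tw_def)
  note a = cyclic_left_inverse[OF g(1,2) g(3)[symmetric] g(5)] and b = cyclic_left_inverse[OF g(2,1) g(4) g(6)]
  obtain k where k: "k < cn f" "v = fst (cU f k)" using v unfolding cvertices_alt[OF g(1)] by blast
  obtain l where l: "l < cn g" "composable P v [fst (cU g l)]" "gcomp P v [fst (cU g l)] = ident P (out P v)"
    using a(2)[OF k(1) b(1)] k(2) by blast
  obtain j where "composable P (fst (cU g l)) [fst (cU f j)]" "gcomp P (fst (cU g l)) [fst (cU f j)] = ident P (out P (fst (cU g l)))"
    using b(2)[OF l(1) a(1)] by blast
  with l show ?thesis using invertible_two_sided by blast
qed

lemma cyclic_isosI: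
  assumes "ctree_arrow P f" "\<forall>v\<in>cvertices f. invertible P v"
  shows "f \<in> isos (cyclic_Tw P)"
proof -
  interpret C: category "cyclic_Tw P" by (rule category_cyclic_Tw)
  let ?E = "{f. ctree_arrow P f \<and> (\<forall>v\<in>cvertices f. invertible P v)}"
  have "?E \<subseteq> isos (cyclic_Tw P)"
  proof (rule C.isos_if_left_inverses)
    show "?E \<subseteq> Arr (cyclic_Tw P)" by (auto simp: cyclic_Tw_def)
    fix f assume "f \<in> ?E"
    then have f: "ctree_arrow P f" and inv: "\<forall>v\<in>cvertices f. invertible P v" by auto
    note F = ctree_arrowD[OF f]
    let ?t = "ctarget P f"
    define n where "n = cn f"
    have F5: "length (cverts f) = n" "length (clabels f) = n" using F(4,5) by (simp_all add: n_def)
    have iU: "invertible P (cverts f ! k)" if "k < n" for k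
      using inv nth_mem[of k "cverts f"] that F5 by (simp add: cvertices_def)
    have U1: "\<exists>j. clabels f ! k = [j]" if k: "k < n" for k
    proof -
      have "ulop (cverts f ! k, clabels f ! k)" using ctree_arrow_labels(4)[OF f k[unfolded n_def]] by (simp only: cU_def)
      then have "length (clabels f ! k) = 1" using op_inv(4)[OF iU[OF k]] by (simp add: ulop)
      then show ?thesis by (cases "clabels f ! k") auto
    qed
    define s where "s = cleaves f"
    have "clabels f = map (\<lambda>k. [hd (clabels f ! k)]) [0..<n]"
      by (rule nth_equalityI) (use U1 F5 in fastforce)+
    then have s: "s = map (\<lambda>k. hd (clabels f ! k)) [0..<n]" unfolding s_def cleaves_def by (metis concat_map_singleton)
    have "length s = n" unfolding s by simp
    then have at: "Suc (arity P ?t) = n" using F(3) unfolding s_def by simp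
    have ps: "s \<in> permutations_of_set {..<n}" using F(7) unfolding at s_def .
    have fU: "cU f k = (cverts f ! k, [s ! k])" if "k < n" for k using U1[OF that] s that by (auto simp: cU_def)
    obtain t where t: "t \<in> permutations_of_set {..<n}" "\<And>k. k < n \<Longrightarrow> t ! (s ! k) = k" "\<And>k. k < n \<Longrightarrow> s ! (t ! k) = k"
      using perm_inverse[OF ps] by metis
    have tl: "t ! j < n" if "j < n" for j using that perm_set[OF t(1)] perm_length[OF t(1)] nth_mem[of j t] by auto
    \<comment> \<open>The vertices are unary, so their labels form a permutation \<open>s\<close> of
      the legs. At leg \<open>j\<close> of the target stands the inverse of vertex
      \<open>t ! j\<close>, where \<open>t\<close> is inverse to \<open>s\<close>.\<close>
    let ?g = "CTree ?t (map (\<lambda>j. op_inv P (cverts f ! (t ! j))) [0..<n]) (map (\<lambda>j. [t ! j]) [0..<n])"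
    have "cleaves ?g = map ((!) t) [0..<length t]" using perm_length[OF t(1)] by (simp add: cleaves_def concat_map_singleton)
    then have sg: "cleaves ?g = t" by (simp only: map_nth)
    have iUt: "invertible P (cverts f ! (t ! j))" if "j < n" for j by (rule iU[OF tl[OF that]])
    have ga: "ctree_arrow P ?g"
    proof (rule ctree_arrowI)
      show "csource ?g \<in> opers P" using F(2) by simp
      show "set (cverts ?g) \<subseteq> opers P" using op_inv(2)[OF iUt] by auto
      show "length (cverts ?g) = cn ?g" "length (clabels ?g) = cn ?g" using at by simp_all
      show "length (clabels ?g ! k) = arity P (cverts ?g ! k)" if "k < cn ?g" for k
        using that op_inv(3)[OF iUt] at by simp
      show "cleaves ?g \<noteq> []" unfolding sg using perm_length[OF t(1)] at by auto
      show "cleaves ?g \<in> permutations_of_set {..<length (cleaves ?g)}"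
        unfolding sg perm_length[OF t(1)] by (rule t(1))
      show "sorted l" if "l \<in> set (clabels ?g)" for l using that by auto
    qed
    have "ctcomp P ?g f = cid P (csource f)"
    proof (rule ctree_eqI[of _ _ n])
      show "csource (ctcomp P ?g f) = csource (cid P (csource f))" by (simp add: cid_def ctcomp_def Let_def)
      show "length (cverts (ctcomp P ?g f)) = n" "length (clabels (ctcomp P ?g f)) = n"
        unfolding n_def by (rule ctcomp_sel(2,3)[OF f])+
      show "length (cverts (cid P (csource f))) = n" "length (clabels (cid P (csource f))) = n"
        by (simp_all add: cid_def n_def)
      fix k assume k: "k < n"
      have k': "k < cn f" using k by (simp add: n_def)
      have sk: "s ! k < n" using k perm_set[OF ps] perm_length[OF ps] nth_mem[of k s] by auto
      have g1: "cU ?g (s ! k) = (op_inv P (cverts f ! k), [k])" using sk t(2)[OF k] by (simp add: cU_def)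
      have "sub P (cU ?g) (cU f k) = (gcomp P (cverts f ! k) [op_inv P (cverts f ! k)], [k])"
        unfolding sub_def fU[OF k] by (simp add: g1)
      also have "\<dots> = (uid, [k])" using op_inv(5)[OF iU[OF k]] by simp
      finally have e: "sub P (cU ?g) (cU f k) = (uid, [k])" .
      have "nf P (uid, [k]) = (uid, [k])" by (rule nf_sorted) (use uid in simp_all)
      then show "cU (ctcomp P ?g f) k = cU (cid P (csource f)) k"
        unfolding ctcomp_sel(4)[OF f k'] cU_cid[OF k'] e .
    qed
    moreover have "\<forall>v\<in>cvertices ?g. invertible P v" using op_inv(7)[OF iUt] by (auto simp: cvertices_def)
    ultimately show "\<exists>g\<in>?E. Dom (cyclic_Tw P) g = Cod (cyclic_Tw P) f \<and>
        Comp (cyclic_Tw P) g f = Id (cyclic_Tw P) (Dom (cyclic_Tw P) f)"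
      using ga by (intro bexI[of _ ?g]) (simp_all add: cyclic_Tw_def)
  qed
  then show ?thesis using assms by blast
qed

end

section \<open>The factorization in the cyclic case\<close>

locale graded_cyclic_operad = cyclic_operad P + graded_symmetric_operad P \<psi>
  for P :: "('o, 'x) cyc_operad_scheme" and \<psi> :: "'o \<Rightarrow> int" +
  assumes grading_cact: "p \<in> opers P \<Longrightarrow> s \<in> permutations_of_set {..arity P p} \<Longrightarrow> \<psi> (cact P s p) = \<psi> p"
begin

lemma grading_rot: "p \<in> opers P \<Longrightarrow> \<psi> (rot P p) = \<psi> p"
  unfolding rot_def by (rule grading_cact) (simp_all only: atMost_perm perm_rot)

lemma grading_glue_root:
  assumes "x \<in> opers P" "q \<in> opers P" "1 \<le> arity P q + arity P x"
  shows "\<psi> (glue_root P x q) = \<psi> x + \<psi> q"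
proof (cases "1 \<le> arity P q")
  case True
  have "pcomposable P (rot P q) (arity P q - 1) x"
    using rotn_opers[OF assms(2), of 1] assms(1) True unfolding pcomposable_unit by simp
  then show ?thesis using True grading_pcomp grading_rot[OF assms(2)] unfolding glue_root_def by simp
next
  case False
  have "pcomposable P (rot P x) (arity P x - 1) q"
    using rotn_opers[OF assms(1), of 1] assms(2,3) False unfolding pcomposable_unit by simp
  then show ?thesis using False grading_pcomp grading_rot[OF assms(1)] unfolding glue_root_def by simp
qed

lemma grading_crelab: "crelab P v w \<Longrightarrow> \<psi> (fst w) = \<psi> (fst v)"
  using grading_cact unfolding crelab_def atMost_perm by auto

lemma grading_ctarget:
  assumes f: "ctree_arrow P f"
  shows "\<psi> (ctarget P f) = \<psi> (csource f) + sum_list (map \<psi> (cverts f))"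
proof -
  note F = ctree_arrowD[OF f]
  obtain v vs where v: "cverts f = v # vs" using F(4) by (cases "cverts f") auto
  have o: "v \<in> opers P" "set vs \<subseteq> opers P" using f v by (auto simp: ctree_arrow_def)
  have c: "composable P (csource f) vs" using F(1,4) o v unfolding composable_unit by simp
  have "1 \<le> sum_list (map (arity P) (cverts f))" using f unfolding ctree_arrow_def by blast
  then have "1 \<le> arity P v + arity P (gcomp P (csource f) vs)" unfolding gcomp_arity[OF c] v by simp
  then have "\<psi> (glue_root P (gcomp P (csource f) vs) v) = \<psi> (gcomp P (csource f) vs) + \<psi> v"
    by (rule grading_glue_root[OF gcomp_opers[OF c] o(1)])
  moreover have "\<psi> (ctarget P f) = \<psi> (glue_root P (gcomp P (csource f) vs) v)"
    using grading_crelab[OF F(9)] F(11) v by simp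
  ultimately show ?thesis using grading_gcomp[OF c] v by simp
qed

abbreviation "cR \<equiv> R_eq_minus1 P \<psi> (cyclic_Tw P) cvertices ctrivial"

lemma cR_cases:
  assumes l: "l \<in> cR"
  shows "ctree_arrow P l"
    "k < cn l \<Longrightarrow> minus_vertex () (cU l k)"
    "concat (clabels l) = [0..<Suc (arity P (ctarget P l))]"
proof -
  show a: "ctree_arrow P l" using l by (simp add: R_eq_minus1_def cyclic_Tw_def)
  have v: "\<forall>q\<in>cvertices l. q \<in> ident P ` colours P \<or> \<psi> q = - 1" and t: "ctrivial l" using l by (simp_all add: R_eq_minus1_def)
  show "concat (clabels l) = [0..<Suc (arity P (ctarget P l))]"
    using t unfolding ctrivial_def ctree_arrowD(3)[OF a] unfolding cleaves_def .
  assume k: "k < cn l"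
  have "fst (cU l k) \<in> cvertices l" unfolding cvertices_alt[OF a] using k by blast
  then show "minus_vertex () (cU l k)"
    by (intro minus_vertexI[OF ctree_arrow_labels(4)[OF a k]]) (use v in simp_all)
qed

lemma ctcomp_cR:
  assumes l: "l \<in> cR" and g: "ctree_arrow P g" and lg: "ctarget P l = csource g" and k: "k < cn l"
  shows "cU (ctcomp P g l) k = (if snd (cU l k) = [] then cU l k else cU g (hd (snd (cU l k))))"
    and "\<forall>v\<in>cvertices g. 0 \<le> \<psi> v \<Longrightarrow>
      cverts l ! k = (if \<psi> (cverts (ctcomp P g l) ! k) = - 1 then cverts (ctcomp P g l) ! k else uid) \<and>
      length (clabels l ! k) = (if \<psi> (cverts (ctcomp P g l) ! k) = - 1 then 0 else 1)"
proof -
  note R = cR_cases[OF l]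
  note L = ctcomp_labels[OF R(1) g lg] and S = ctcomp_sel(4)[OF R(1) k, where g = g]
  have jl: "j < cn g" if "j \<in> set (snd (cU l k))" for j using subsetD[OF L(4)[OF k] that] by (simp only: lessThan_iff)
  have oc: "(\<lambda>_. ()) j = ()" if "j \<in> set (snd (cU l k))" for j :: nat by simp
  note N = R(2)[OF k] ctree_arrow_labels(4)[OF R(1) k] L(5)[OF k] oc nf_cU[OF g jl]
  show "cU (ctcomp P g l) k = (if snd (cU l k) = [] then cU l k else cU g (hd (snd (cU l k))))"
    unfolding S by (rule nf_sub_minus_vertex[OF N])
  assume nn: "\<forall>v\<in>cvertices g. 0 \<le> \<psi> v"
  have nG: "0 \<le> \<psi> (fst (cU g j))" if "j \<in> set (snd (cU l k))" for j
    using nn jl[OF that] unfolding cvertices_alt[OF g] by blast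
  note m = minus_vertex_nonneg_composite[OF N nG, folded S]
  show "cverts l ! k = (if \<psi> (cverts (ctcomp P g l) ! k) = - 1 then cverts (ctcomp P g l) ! k else uid) \<and>
      length (clabels l ! k) = (if \<psi> (cverts (ctcomp P g l) ! k) = - 1 then 0 else 1)"
    using m by (simp add: cU_def)
qed

lemma cyclic_factor:
  assumes f: "ctree_arrow P f"
  shows "\<exists>l\<in>cR. \<exists>r. ctree_arrow P r \<and> ctarget P l = csource r \<and> ctcomp P r l = f \<and>
      cvertices r \<subseteq> {v \<in> cvertices f. 0 \<le> \<psi> v}"
proof -
  note F = ctree_arrowD[OF f]
  let ?p = "csource f"
  define n where "n = cn f"
  define zs where "zs = zip (cverts f) (clabels f)"
  define Q where "Q = (\<lambda>z :: 'o \<times> nat list. \<psi> (fst z) \<noteq> - 1)"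
  let ?zs = "filter Q zs" and ?keep = "\<lambda>z. if Q z then uid else fst z"
  let ?l = "CTree ?p (map ?keep zs) (keep_labels Q 0 zs)"
  have F5: "length (cverts f) = n" "length (clabels f) = n" using F(4,5) by (simp_all add: n_def)
  have lz: "length zs = n" using F5 by (simp add: zs_def)
  have zk: "zs ! k = cU f k" if "k < n" for k using that F5 by (simp add: zs_def cU_def)
  have zo: "fst z \<in> opers P \<and> length (snd z) = arity P (fst z)" if z: "z \<in> set zs" for z
  proof -
    obtain k where k: "k < n" "z = cU f k" using z zk lz unfolding in_set_conv_nth by metis
    show ?thesis using ctree_arrow_labels(4)[OF f k(1)[unfolded n_def]] unfolding k(2) ulop .
  qed
  have zQ: "snd z = []" if "z \<in> set zs" "\<not> Q z" for z
    using zo[OF that(1)] grading_minus1[of "fst z"] that(2) by (simp add: Q_def)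
  have keep: "?keep z \<in> opers P" "arity P (?keep z) = (if Q z then 1 else 0)" if "z \<in> set zs" for z
    by (cases "Q z"; use zo[OF that] zQ[OF that] uid in auto)+
  have cf: "concat (map snd (filter Q ys)) = concat (map snd ys)" if "set ys \<subseteq> set zs" for ys
    using that
  proof (induction ys)
    case (Cons y ys)
    then show ?case using zQ[of y] by auto
  qed simp
  have zl: "map snd zs = clabels f" using F5 by (simp add: zs_def)
  have cr: "concat (map snd ?zs) = cleaves f" using cf[of zs] zl by (simp add: cleaves_def)
  \<comment> \<open>The intermediate object needs at least one leg, so some vertex has to survive.
    It does because \<open>f\<close> has a leaf and discarded vertices have none.\<close>
  have ne: "?zs \<noteq> []" using cr F(3) by auto
  have cc: "cleaves ?l = [0..<length ?zs]" by (simp add: concat_keep_labels cleaves_def)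
  have la: "ctree_arrow P ?l"
  proof (rule ctree_arrowI)
    show "csource ?l \<in> opers P" using F(1) by simp
    show "set (cverts ?l) \<subseteq> opers P" unfolding ctree.sel set_map image_subset_iff using keep(1) by blast
    show "length (cverts ?l) = cn ?l" "length (clabels ?l) = cn ?l" using lz by (simp_all add: n_def length_keep_labels)
    show "length (clabels ?l ! k) = arity P (cverts ?l ! k)" if "k < cn ?l" for k
    proof -
      have k: "k < length zs" using that lz by (simp add: n_def)
      have "arity P (cverts ?l ! k) = arity P (?keep (zs ! k))" using k by simp
      also have "\<dots> = (if Q (zs ! k) then 1 else 0)" by (rule keep(2)[OF nth_mem[OF k]])
      also have "\<dots> = length (clabels ?l ! k)" using nth_keep_labels[OF k, of Q 0] by (cases "Q (zs ! k)") auto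
      finally show ?thesis by (rule sym)
    qed
    show "cleaves ?l \<noteq> []" unfolding cc using ne by simp
    show "cleaves ?l \<in> permutations_of_set {..<length (cleaves ?l)}" unfolding cc length_upt minus_nat.diff_0 by (rule perm_id)
    show "sorted x" if x: "x \<in> set (clabels ?l)" for x
    proof -
      obtain k where "k < length zs" "x = keep_labels Q 0 zs ! k" using x by (auto simp: in_set_conv_nth length_keep_labels)
      then show ?thesis using nth_keep_labels[of k zs Q 0] by (auto split: if_splits)
    qed
  qed
  have "?keep z \<in> ident P ` colours P \<or> \<psi> (?keep z) = - 1" for z by (simp add: Q_def single_colour)
  then have "\<forall>q\<in>cvertices ?l. q \<in> ident P ` colours P \<or> \<psi> q = - 1" unfolding cvertices_def ctree.sel set_map by blast
  moreover have "ctrivial ?l" unfolding ctrivial_def cc by simp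
  ultimately have lR: "?l \<in> cR" using la by (simp add: R_eq_minus1_def cyclic_Tw_def)
  let ?t = "ctarget P ?l"
  note L = ctree_arrowD[OF la]
  have at: "Suc (arity P ?t) = length ?zs" unfolding L(3) cc by simp
  let ?r = "CTree ?t (map fst ?zs) (map snd ?zs)"
  have sr: "cleaves ?r = cleaves f" using cr by (simp add: cleaves_def)
  have ra: "ctree_arrow P ?r"
  proof (rule ctree_arrowI)
    show "csource ?r \<in> opers P" using L(2) by simp
    show "set (cverts ?r) \<subseteq> opers P" using zo by auto
    show "length (cverts ?r) = cn ?r" "length (clabels ?r) = cn ?r" unfolding ctree.sel at by simp_all
    show "length (clabels ?r ! k) = arity P (cverts ?r ! k)" if k: "k < cn ?r" for k
    proof -
      have k: "k < length ?zs" using k unfolding ctree.sel at .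
      then have "?zs ! k \<in> set zs" using nth_mem[OF k] by simp
      then show ?thesis using zo[of "?zs ! k"] k by simp
    qed
    show "cleaves ?r \<noteq> []" unfolding sr using F(3) by auto
    show "cleaves ?r \<in> permutations_of_set {..<length (cleaves ?r)}" unfolding sr using F(7) unfolding F(3) .
    show "sorted x" if "x \<in> set (clabels ?r)" for x
    proof -
      have "x \<in> set (map snd zs)" using that by auto
      then show ?thesis using f unfolding zl by (simp add: ctree_arrow_def)
    qed
  qed
  have lr: "ctarget P ?l = csource ?r" by simp
  note K = ctcomp_cR(1)[OF lR ra lr]
  note S = ctcomp_sel[OF la, where g = ?r]
  have "ctcomp P ?r ?l = f"
  proof (rule ctree_eqI[of _ _ n])
    show "csource (ctcomp P ?r ?l) = csource f" using S(1) by simp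
    show "length (cverts (ctcomp P ?r ?l)) = n" "length (clabels (ctcomp P ?r ?l)) = n" using S(2,3) by (simp_all add: n_def)
    show "length (cverts f) = n" "length (clabels f) = n" by (rule F5)+
    fix k assume k: "k < n"
    have Uk: "cU ?l k = (?keep (zs ! k), keep_labels Q 0 zs ! k)" using k lz by (simp add: cU_def)
    have kk: "k < cn ?l" using k by (simp add: n_def)
    have kz: "k < length zs" using k lz by simp
    show "cU (ctcomp P ?r ?l) k = cU f k"
    proof (cases "Q (zs ! k)")
      case True
      then obtain j where "j < length ?zs" "keep_labels Q 0 zs ! k = [j]" "?zs ! j = zs ! k"
        using nth_keep_labels[OF kz, of Q 0] by auto
      then show ?thesis unfolding K[OF kk] Uk using zk[OF k] by (simp add: cU_def)
    next
      case False
      then have "keep_labels Q 0 zs ! k = []" using nth_keep_labels[OF kz, of Q 0] by auto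
      moreover have "snd (zs ! k) = []" by (rule zQ[OF nth_mem[OF kz] False])
      ultimately show ?thesis unfolding K[OF kk] Uk using False unfolding zk[OF k] by (simp add: prod_eq_iff)
    qed
  qed
  moreover have "cvertices ?r \<subseteq> {v \<in> cvertices f. 0 \<le> \<psi> v}"
  proof
    fix v assume "v \<in> cvertices ?r"
    then obtain z where z: "z \<in> set zs" "Q z" "v = fst z" by (auto simp: cvertices_def)
    then have "0 \<le> \<psi> v" using zo[of z] grading_ge[of v] by (auto simp: Q_def)
    moreover have "v \<in> set (cverts f)" using z set_zip_leftD[of "fst z" "snd z" "cverts f" "clabels f"] by (simp add: zs_def)
    ultimately show "v \<in> {v \<in> cvertices f. 0 \<le> \<psi> v}" by (simp add: cvertices_def)
  qed
  ultimately show ?thesis using lR ra by (intro bexI[of _ ?l] exI[of _ ?r]) auto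
qed

lemma cyclic_graded_vertices:
  assumes H: "\<forall>p\<in>opers P. \<psi> p = 0 \<longrightarrow> invertible P p"
  shows "graded_vertices (cyclic_Tw P) \<psi> cverts cR"
proof (intro graded_vertices.intro category_cyclic_Tw graded_vertices_axioms.intro)
  fix f assume f: "f \<in> Arr (cyclic_Tw P)"
  then have fa: "ctree_arrow P f" by (simp add: cyclic_Tw_def)
  then have vo: "cvertices f \<subseteq> opers P" by (simp add: ctree_arrow_def cvertices_def)
  show "f \<in> isos (cyclic_Tw P) \<longleftrightarrow> (\<forall>v\<in>set (cverts f). \<psi> v = 0)"
    unfolding cvertices_def[symmetric]
    using cyclic_isos_invertible invertible_grading cyclic_isosI[OF fa] H vo by blast
  show "\<psi> (Cod (cyclic_Tw P) f) = \<psi> (Dom (cyclic_Tw P) f) + sum_list (map \<psi> (cverts f))"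
    using grading_ctarget[OF fa] by (simp add: cyclic_Tw_def)
  show "\<exists>l\<in>cR. \<exists>r\<in>Arr (cyclic_Tw P). Cod (cyclic_Tw P) l = Dom (cyclic_Tw P) r \<and> Comp (cyclic_Tw P) r l = f \<and>
      set (cverts r) \<subseteq> {v \<in> set (cverts f). 0 \<le> \<psi> v}"
    using cyclic_factor[OF fa] by (fastforce simp: cyclic_Tw_def cvertices_def)
next
  fix a assume "a \<in> Obj (cyclic_Tw P)"
  then show "- 1 \<le> \<psi> a" using grading_ge by (simp add: cyclic_Tw_def)
next
  fix f g v assume "f \<in> Arr (cyclic_Tw P)" "g \<in> Arr (cyclic_Tw P)" "Cod (cyclic_Tw P) f = Dom (cyclic_Tw P) g"
    and "v \<in> set (cverts (Comp (cyclic_Tw P) g f))"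
  then have a: "ctree_arrow P f" "ctree_arrow P g" "ctarget P f = csource g" and v: "v \<in> cvertices (ctcomp P g f)"
    by (simp_all add: cyclic_Tw_def cvertices_def)
  note C = ctcomp_labels[OF a] and S = ctcomp_sel[OF a(1), where g = g]
  obtain k where k: "k < cn f" "v = fst (cU (ctcomp P g f) k)"
    using v unfolding cvertices_alt[OF ctcomp_arrow[OF a]] S(1) by blast
  have "\<psi> v = \<psi> (fst (sub P (cU g) (cU f k)))" using grading_relab[OF C(6)[OF k(1)]] k(2) by simp
  then have "\<psi> v = sum_list (map \<psi> (fst (cU f k) # map (\<lambda>j. fst (cU g j)) (snd (cU f k))))"
    using grading_sub[OF ctree_arrow_labels(4)[OF a(1) k(1)] C(5)[OF k(1)]] by (simp add: o_def)
  moreover have "set (fst (cU f k) # map (\<lambda>j. fst (cU g j)) (snd (cU f k))) \<subseteq> cvertices f \<union> cvertices g"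
    using C(4)[OF k(1)] k(1) unfolding cvertices_alt[OF a(1)] cvertices_alt[OF a(2)] by auto
  ultimately show "\<exists>us. set us \<subseteq> set (cverts f) \<union> set (cverts g) \<and> \<psi> v = sum_list (map \<psi> us)"
    unfolding cvertices_def by blast
next
  fix l assume l: "l \<in> cR"
  then show "l \<in> Arr (cyclic_Tw P)" by (simp add: R_eq_minus1_def)
  fix v assume "v \<in> set (cverts l)"
  then show "\<psi> v \<le> 0" using l grading_ident by (auto simp: R_eq_minus1_def cvertices_def)
next
  fix l g h
  assume l: "l \<in> cR" and "g \<in> Arr (cyclic_Tw P)" "h \<in> Arr (cyclic_Tw P)"
    "Dom (cyclic_Tw P) g = Cod (cyclic_Tw P) l" "Dom (cyclic_Tw P) h = Cod (cyclic_Tw P) l"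
    "Comp (cyclic_Tw P) g l = Comp (cyclic_Tw P) h l"
  then have gh: "ctree_arrow P g" "ctree_arrow P h" "ctarget P l = csource g" "ctarget P l = csource h"
    and eq: "ctcomp P g l = ctcomp P h l" by (simp_all add: cyclic_Tw_def)
  note R = cR_cases[OF l] and F = ctree_arrowD[OF cR_cases(1)[OF l]]
  note G = ctree_arrowD[OF gh(1)] and Hh = ctree_arrowD[OF gh(2)]
  note K = ctcomp_cR(1)[OF l gh(1,3)] and K' = ctcomp_cR(1)[OF l gh(2,4)]
  show "g = h"
  proof (rule ctree_eqI[of _ _ "Suc (arity P (ctarget P l))"])
    show "csource g = csource h" using gh by simp
    show "length (cverts g) = Suc (arity P (ctarget P l))" "length (clabels g) = Suc (arity P (ctarget P l))"
      "length (cverts h) = Suc (arity P (ctarget P l))" "length (clabels h) = Suc (arity P (ctarget P l))"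
      using G(4,5) Hh(4,5) gh(3,4) by simp_all
    fix j assume "j < Suc (arity P (ctarget P l))"
    then have "j \<in> set (concat (clabels l))" unfolding R(3) by (simp del: upt_Suc)
    then obtain x where x: "x \<in> set (clabels l)" "j \<in> set x" by auto
    then obtain k where "k < length (clabels l)" "clabels l ! k = x" by (auto simp: in_set_conv_nth)
    then have k: "k < cn l" "j \<in> set (snd (cU l k))" using F(5) x(2) by (simp_all add: cU_def)
    then have "snd (cU l k) = [j]" using R(2)[OF k(1)] by (auto simp: minus_vertex_def)
    then show "cU g j = cU h j" using K[OF k(1)] K'[OF k(1)] eq by simp
  qed
next
  fix l l' g h
  assume l: "l \<in> cR" and l': "l' \<in> cR" and "g \<in> Arr (cyclic_Tw P)" "h \<in> Arr (cyclic_Tw P)"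
    "Dom (cyclic_Tw P) g = Cod (cyclic_Tw P) l" "Dom (cyclic_Tw P) h = Cod (cyclic_Tw P) l'"
    "Comp (cyclic_Tw P) g l = Comp (cyclic_Tw P) h l'"
    and nn: "\<forall>v\<in>set (cverts g) \<union> set (cverts h). 0 \<le> \<psi> v"
  then have gh: "ctree_arrow P g" "ctree_arrow P h" "ctarget P l = csource g" "ctarget P l' = csource h"
    and eq: "ctcomp P g l = ctcomp P h l'" by (simp_all add: cyclic_Tw_def)
  note R = cR_cases[OF l] and R' = cR_cases[OF l']
  note F = ctree_arrowD[OF R(1)] and F' = ctree_arrowD[OF R'(1)]
  have p: "csource l = csource l'"
    using ctcomp_sel(1)[OF R(1), where g = g] ctcomp_sel(1)[OF R'(1), where g = h] eq by simp
  have nng: "\<forall>v\<in>cvertices g. 0 \<le> \<psi> v" "\<forall>v\<in>cvertices h. 0 \<le> \<psi> v" using nn by (auto simp: cvertices_def)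
  have K: "cverts l ! k = cverts l' ! k \<and> length (clabels l ! k) = length (clabels l' ! k)" if "k < cn l" for k
    using ctcomp_cR(2)[OF l gh(1,3) that nng(1)] ctcomp_cR(2)[OF l' gh(2,4) that[unfolded p] nng(2)] eq by simp
  have u: "cverts l = cverts l'" by (rule nth_equalityI) (use K F(4) F'(4) p in simp_all)
  have ll: "map length (clabels l) = map length (clabels l')"
    by (rule nth_equalityI) (use K F(5) F'(5) p in simp_all)
  have "length (concat (clabels l)) = length (concat (clabels l'))" unfolding length_concat ll ..
  then have "concat (clabels l) = concat (clabels l')" unfolding R(3) R'(3) by (simp del: upt_Suc)
  then have "clabels l = clabels l'" using ll by (rule concat_inj)
  then show "l = l'" using u p by (cases l, cases l') simp
qed

theorem cyclic_reedy_iff: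
  "generalized_reedy (cyclic_Tw P) {-1..} \<psi> (R_minus P \<psi> (cyclic_Tw P) cvertices ctrivial)
     (R_plus \<psi> (cyclic_Tw P) cvertices)
   \<longleftrightarrow> (\<forall>p\<in>opers P. \<psi> p = 0 \<longrightarrow> arity P p = 1) \<and> groupoid (grade0_cat P \<psi>)"
  unfolding groupoid_iff_invertible
proof
  assume H: "\<forall>p\<in>opers P. \<psi> p = 0 \<longrightarrow> invertible P p"
  interpret graded_vertices "cyclic_Tw P" \<psi> cverts cR by (rule cyclic_graded_vertices[OF H])
  show "generalized_reedy (cyclic_Tw P) {-1..} \<psi> (R_minus P \<psi> (cyclic_Tw P) cvertices ctrivial)
     (R_plus \<psi> (cyclic_Tw P) cvertices)"
    using reedy by (simp add: R_minus_def R_plus_def R_ge_0_def cvertices_def)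
next
  assume R: "generalized_reedy (cyclic_Tw P) {-1..} \<psi> (R_minus P \<psi> (cyclic_Tw P) cvertices ctrivial)
     (R_plus \<psi> (cyclic_Tw P) cvertices)"
  show "\<forall>p\<in>opers P. \<psi> p = 0 \<longrightarrow> invertible P p"
  proof (intro ballI impI)
    fix p assume p: "p \<in> opers P" "\<psi> p = 0"
    \<comment> \<open>The operation \<open>p\<close> is glued to the input of an identity. The
      identity vertex at the other leg provides the leaf numbered 0, so the tree has a leaf even if
      \<open>p\<close> is nullary.\<close>
    let ?f = "CTree uid [uid, p] [[0], [1..<Suc (arity P p)]]"
    have lv: "cleaves ?f = [0..<Suc (arity P p)]" unfolding cleaves_def by (simp add: upt_conv_Cons del: upt_Suc)
    have f: "ctree_arrow P ?f"
      using p uid perm_id[of "Suc (arity P p)"] unfolding ctree_arrow_def lv by (simp del: upt_Suc)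
    have "glue_root P p uid = p" using uid pcomp_ident_left[OF p(1)] by (simp add: glue_root_def rot_ident)
    moreover have "gcomp P uid [p] = p" using gcomp_ident_left[OF p(1)] by simp
    ultimately have t: "ctarget P ?f = p" using cact_id[OF p(1)] unfolding ctarget_def lv by (simp del: upt_Suc)
    have c: "() \<in> colours P" by (simp add: single_colour)
    have "?f \<in> isos (cyclic_Tw P)"
    proof (rule reedy_pos_iso[OF R[unfolded R_plus_def]])
      show "R_ge_0 \<psi> (cyclic_Tw P) cvertices \<subseteq> Arr (cyclic_Tw P)" by (auto simp: R_ge_0_def)
      show "?f \<in> R_ge_0 \<psi> (cyclic_Tw P) cvertices"
        using f p grading_ident[OF c] by (simp add: R_ge_0_def cyclic_Tw_def cvertices_def del: upt_Suc)
      show "\<not> \<psi> (Dom (cyclic_Tw P) ?f) < \<psi> (Cod (cyclic_Tw P) ?f)"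
        using t p grading_ident[OF c] by (simp add: cyclic_Tw_def del: upt_Suc)
    qed
    then show "invertible P p" by (rule cyclic_isos_invertible) (simp add: cvertices_def)
  qed
qed

end

theorem theorem2p54:
  fixes P :: "('c, 'o) operad" and \<psi> :: "'o \<Rightarrow> int"
    and S :: "('d, 's) sym_operad" and \<phi> :: "'s \<Rightarrow> int"
    and K :: "'k cyc_operad" and \<chi> :: "'k \<Rightarrow> int"
  shows
    "(planar_operad P \<and> planar_grading P \<psi> \<and> nice P \<psi> \<longrightarrow>
       (generalized_reedy (planar_Tw P) {-1..} \<psi>
          (R_minus P \<psi> (planar_Tw P) pvertices (\<lambda>_. True))
          (R_plus \<psi> (planar_Tw P) pvertices)
        \<longleftrightarrow> (\<forall>p\<in>opers P. \<psi> p = 0 \<longrightarrow> arity P p = 1) \<and> groupoid (grade0_cat P \<psi>)))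
     \<and> (symmetric_operad S \<and> symmetric_grading S \<phi> \<and> nice S \<phi> \<longrightarrow>
       (generalized_reedy (symmetric_Tw S) {-1..} \<phi>
          (R_minus S \<phi> (symmetric_Tw S) svertices strivial)
          (R_plus \<phi> (symmetric_Tw S) svertices)
        \<longleftrightarrow> (\<forall>p\<in>opers S. \<phi> p = 0 \<longrightarrow> arity S p = 1) \<and> groupoid (grade0_cat S \<phi>)))
     \<and> (cyclic_operad K \<and> cyclic_grading K \<chi> \<and> nice K \<chi> \<longrightarrow>
       (generalized_reedy (cyclic_Tw K) {-1..} \<chi>
          (R_minus K \<chi> (cyclic_Tw K) cvertices ctrivial)
          (R_plus \<chi> (cyclic_Tw K) cvertices)
        \<longleftrightarrow> (\<forall>p\<in>opers K. \<chi> p = 0 \<longrightarrow> arity K p = 1) \<and> groupoid (grade0_cat K \<chi>)))"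
proof (intro conjI impI)
  assume "planar_operad P \<and> planar_grading P \<psi> \<and> nice P \<psi>"
  then interpret graded_operad P \<psi> by (simp add: graded_operad_def graded_operad_axioms_def)
  show "generalized_reedy (planar_Tw P) {-1..} \<psi> (R_minus P \<psi> (planar_Tw P) pvertices (\<lambda>_. True))
      (R_plus \<psi> (planar_Tw P) pvertices)
    \<longleftrightarrow> (\<forall>p\<in>opers P. \<psi> p = 0 \<longrightarrow> arity P p = 1) \<and> groupoid (grade0_cat P \<psi>)"
    by (rule planar_reedy_iff)
next
  assume A: "symmetric_operad S \<and> symmetric_grading S \<phi> \<and> nice S \<phi>"
  then interpret symmetric_operad S by simp
  interpret graded_symmetric_operad S \<phi>
    by unfold_locales (use A in \<open>simp_all add: symmetric_grading_def\<close>)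
  show "generalized_reedy (symmetric_Tw S) {-1..} \<phi> (R_minus S \<phi> (symmetric_Tw S) svertices strivial)
      (R_plus \<phi> (symmetric_Tw S) svertices)
    \<longleftrightarrow> (\<forall>p\<in>opers S. \<phi> p = 0 \<longrightarrow> arity S p = 1) \<and> groupoid (grade0_cat S \<phi>)"
    by (rule symmetric_reedy_iff)
next
  assume A: "cyclic_operad K \<and> cyclic_grading K \<chi> \<and> nice K \<chi>"
  then interpret cyclic_operad K by simp
  have g: "\<chi> (cact K s p) = \<chi> p" if "p \<in> opers K" "s \<in> permutations_of_set {..arity K p}" for s p
    using A that by (simp add: cyclic_grading_def)
  interpret graded_cyclic_operad K \<chi>
  proof unfold_locales
    show "planar_grading K \<chi>" "nice K \<chi>" using A by (simp_all add: cyclic_grading_def)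
    fix p s assume p: "p \<in> opers K"
    show "\<chi> (act K s p) = \<chi> p" if s: "s \<in> permutations_of_set {..<arity K p}"
    proof -
      \<comment> \<open>Invariance under permutations of inputs is the case of leg permutations that
        fix leg 0.\<close>
      have "0 # map Suc s \<in> permutations_of_set {..arity K p}"
        unfolding atMost_perm lessThan_Suc_eq_insert_0
        by (rule permutations_of_setI) (use perm_set[OF s] perm_distinct[OF s] in \<open>simp_all add: distinct_map\<close>)
      from g[OF p this] show ?thesis unfolding cact_extends[OF p s] .
    qed
    show "\<chi> (cact K s p) = \<chi> p" if "s \<in> permutations_of_set {..arity K p}" by (rule g[OF p that])
  qed
  show "generalized_reedy (cyclic_Tw K) {-1..} \<chi> (R_minus K \<chi> (cyclic_Tw K) cvertices ctrivial)
      (R_plus \<chi> (cyclic_Tw K) cvertices)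
    \<longleftrightarrow> (\<forall>p\<in>opers K. \<chi> p = 0 \<longrightarrow> arity K p = 1) \<and> groupoid (grade0_cat K \<chi>)"
    by (rule cyclic_reedy_iff)
qed

end
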